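(* Let $n\in\mathbb{N}$, let $M'$ be a manifold and let $f:M'\to R_n^2M'$ be an admissible rough velocity field. Let $M$ be a properly embedded submanifold of $M'$ with $\phi:M\to M'$ being the embedding. Then the following statements are equivalent: (1) $(f\circ\phi)(M)\subseteq\mathrm{Im}(R_n^2\phi)$. (2) For every interval $[S,T]\subseteq\mathbb{R}$, every $n$-dimensional branched rough path $X$ on $[S,T]$ with regularity $p\in[1,3)$ and control function $\omega$, and every integral curve $Y:[S,T]\to M'$ of $f$ driven by $X$ such that $Y(S)\in\phi(M)$, we have $Y(t)\in\phi(M)$ for every $t\in[S,T]$.
   Context: Smooth means $C^\infty$; manifolds are smooth and finite-dimensional; superscripts $i$ denote coordinates. Properly embedded means that $\phi$ is a smooth embedding which is a proper map (so $\phi(M)$ is closed in $M'$). For $I\subseteq\mathbb{R}$, $\Delta I:=\{(s,t)\in I^2: s\le t\}$. A control function on $[S,T]$ is a continuous function $\omega:\Delta[S,T]\to[0,\infty)$ with $\omega(s,s)=0$ for all $s$ and $\omega(s,t)\ge\omega(s,u)+\omega(u,t)$ for all $S\le s\le u\le t\le T$. $\mathcal{F}_n^2$ is the set of non-empty forests of rooted trees with at most two vertices, with vertices labeled by $\{1,\dots,n\}$. Its elements are: the one-vertex trees, written $\alpha$; the forests made of two one-vertex trees, written $\alpha\cdot\beta=\beta\cdot\alpha$ (unordered, $\alpha=\beta$ allowed); and the two-vertex trees, written $\alpha|\beta$ (top vertex $\alpha$, bottom vertex $\beta$). The symmetry factor is $\sigma(\alpha)=1$, $\sigma(\alpha|\beta)=1$,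 $\sigma(\alpha\cdot\beta)=1$ if $\alpha\ne\beta$, and $\sigma(\alpha\cdot\alpha)=2$. For $p\in[1,3)$, an $n$-dimensional branched rough path on $[S,T]$ with regularity $p$ and control $\omega$ is a tuple $X=(X^\tau)_{\tau\in\mathcal{F}_n^2}$ of functions $X^\tau:\Delta[S,T]\to\mathbb{R}$ such that for all $\alpha,\beta$ and all $S\le s\le u\le t\le T$: $X^\alpha(s,t)=X^\alpha(s,u)+X^\alpha(u,t)$; $X^{\alpha\cdot\beta}(s,t)=X^\alpha(s,t)X^\beta(s,t)$; $X^{\alpha|\beta}(s,t)=X^{\alpha|\beta}(s,u)+X^{\alpha|\beta}(u,t)+X^\alpha(s,u)X^\beta(u,t)$; and such that for some $C\in(0,\infty)$, $|X^\alpha(s,t)|\le C\omega(s,t)^{1/p}$, $|X^{\alpha\cdot\beta}(s,t)|\le C\omega(s,t)^{2/p}$, $|X^{\alpha|\beta}(s,t)|\le C\omega(s,t)^{2/p}$ for all $\alpha,\beta$ and $(s,t)\in\Delta[S,T]$. Rough velocity bundle. $F_{mn}^2$ is the real vector space of tuples $(f^i_\tau)$, $i\in\{1,\dots,m\}$, $\tau\in\mathcal{F}_n^2$. $G_m^2$ is the Lie group of invertible $2$-jets of smooth maps $\mathbb{R}^m\to\mathbb{R}^m$ with source and target $0$; a jet $a$ is written $(a^i_j,a^i_{jk})$ with $a^i_{jk}=a^i_{kj}$ (first and second partial derivatives at $0$). It acts on $F_{mn}^2$ from the left by $af=g$, $g^i_\alpha=\sum_j a^i_jf^j_\alpha$,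 $g^i_{\alpha\cdot\beta}=\sum_j a^i_jf^j_{\alpha\cdot\beta}+\sum_{j,k}a^i_{jk}f^j_\alpha f^k_\beta$, $g^i_{\alpha|\beta}=\sum_j a^i_jf^j_{\alpha|\beta}$. For an $m$-dimensional manifold $M$, let $P^2M$ be the second-order frame bundle ($2$-jets $j^2_0\psi$ at $0$ of local diffeomorphisms $\psi:\mathbb{R}^m\to M$), a principal $G_m^2$-bundle; $R_n^2M$ is the associated bundle with fiber $F_{mn}^2$, i.e. the set of classes $[(j_0^2\psi,f)]$ under $(j^2_0\psi,f)\sim(j^2_0(\psi\circ a),a^{-1}f)$, with projection $\pi[(j_0^2\psi,f)]=\psi(0)$. A chart $(U,x)$ on $M$ induces coordinates $(x^i,f^i_\tau)$ on $\pi^{-1}(U)$: the class $[(j_0^2\psi,f)]$ has base coordinates $x(\psi(0))$ and fiber coordinates $af$, where $a\in G_m^2$ consists of the first and second derivatives of $x\circ\psi$ at $0$. Under a change of charts from $(U,x)$ to $(V,y)$ the fiber coordinates at $p$ change by the action of the jet with $a^i_j=\frac{\partial y^i}{\partial x^j}(p)$, $a^i_{jk}=\frac{\partial^2y^i}{\partial x^j\partial x^k}(p)$. A smooth map $\phi:M\to M'$ induces a bundle map $R_n^2\phi:R_n^2M\to R_n^2M'$ over $\phi$: for a chart $(U,x)$ around $p\in M$ and a chart $(V,y)$ around $\phi(p)$, with $\phi^i=y^i\circ\phi$, the point over $p$ with fiber coordinates $(f^i_\tau)$ is mapped to the point over $\phi(p)$ with fiber coordinates $g^i_\alpha=\sum_j\frac{\partial\phi^i}{\partial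 x^j}(p)f^j_\alpha$, $g^i_{\alpha\cdot\beta}=\sum_j\frac{\partial\phi^i}{\partial x^j}(p)f^j_{\alpha\cdot\beta}+\sum_{j,k}\frac{\partial^2\phi^i}{\partial x^j\partial x^k}(p)f^j_\alpha f^k_\beta$, $g^i_{\alpha|\beta}=\sum_j\frac{\partial\phi^i}{\partial x^j}(p)f^j_{\alpha|\beta}$ (this is independent of the charts). A rough velocity field on a manifold $N$ is a smooth section $f:N\to R_n^2N$; in a chart $(U,x)$ it is represented by smooth functions $f^i_\tau:U\to\mathbb{R}$. It is admissible if for every $p\in N$ there is a chart $(U,x)$ around $p$ in which $\sum_j\frac{\partial f^i_\beta}{\partial x^j}(p)f^j_\alpha(p)=f^i_{\alpha\cdot\beta}(p)+f^i_{\alpha|\beta}(p)$ for all $i,\alpha,\beta$ (this condition does not depend on the chart). A function $Y:[S,T]\to N$ is an integral curve of $f$ driven by $X$ if it is continuous and if for every compact interval $I\subseteq[S,T]$ and every chart $(U,x)$ with $Y(I)\subseteq U$ there exists $C\in(0,\infty)$ such that $\left|Y^i(t)-Y^i(s)-\sum_{\tau\in\mathcal{F}_n^2}\frac{1}{\sigma(\tau)}f^i_\tau(Y(s))X^\tau(s,t)\right|\le C\omega(s,t)^{3/p}$ for every $i$ and $(s,t)\in\Delta I$, where $Y^i=x^i\circ Y$ and $(f^i_\tau)$ represents $f$ in the chart induced by $(U,x)$. *)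

theory Defs
  imports "HOL-Analysis.Analysis" "HOL-Library.Uprod"
begin

text \<open>The coordinate space of dimension \<open>m\<close> is the library's \<^term>\<open>Euclidean_space m\<close>, i.e. the
  functions \<open>nat \<Rightarrow> real\<close> vanishing at all indices \<open>\<ge> m\<close>; so dimension is a natural number, and
  dimension \<open>0\<close> is allowed. Coordinate indices are \<open>0, \<dots>, m - 1\<close>.\<close>

section \<open>Smooth functions on open subsets of the coordinate space\<close>

abbreviation origin :: "nat \<Rightarrow> real" where
  "origin \<equiv> (\<lambda>_. 0)"

definition partial_deriv :: "nat \<Rightarrow> ((nat \<Rightarrow> real) \<Rightarrow> real) \<Rightarrow> (nat \<Rightarrow> real) \<Rightarrow> real" where
  "partial_deriv j g u = deriv (\<lambda>t. g (u(j := t))) (u j)"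

primrec C_k_on :: "nat \<Rightarrow> nat \<Rightarrow> (nat \<Rightarrow> real) set \<Rightarrow> ((nat \<Rightarrow> real) \<Rightarrow> real) \<Rightarrow> bool" where
  "C_k_on 0 m W g \<longleftrightarrow> continuous_map (subtopology (Euclidean_space m) W) euclideanreal g"
| "C_k_on (Suc k) m W g \<longleftrightarrow>
     continuous_map (subtopology (Euclidean_space m) W) euclideanreal g \<and>
     (\<forall>j<m. (\<forall>u\<in>W. (\<lambda>t. g (u(j := t))) differentiable (at (u j))) \<and>
             C_k_on k m W (partial_deriv j g))"

definition smooth_on :: "nat \<Rightarrow> (nat \<Rightarrow> real) set \<Rightarrow> ((nat \<Rightarrow> real) \<Rightarrow> real) \<Rightarrow> bool" where
  "smooth_on m W g \<longleftrightarrow> openin (Euclidean_space m) W \<and> (\<forall>k. C_k_on k m W g)"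

definition same_2jet ::
    "nat \<Rightarrow> nat \<Rightarrow> ((nat \<Rightarrow> real) \<Rightarrow> nat \<Rightarrow> real) \<Rightarrow> ((nat \<Rightarrow> real) \<Rightarrow> nat \<Rightarrow> real) \<Rightarrow> (nat \<Rightarrow> real) \<Rightarrow> bool" where
  "same_2jet m m' g h u \<longleftrightarrow> g u = h u \<and>
     (\<forall>i<m'. \<forall>j<m. partial_deriv j (\<lambda>v. g v i) u = partial_deriv j (\<lambda>v. h v i) u \<and>
        (\<forall>k<m. partial_deriv j (partial_deriv k (\<lambda>v. g v i)) u =
                partial_deriv j (partial_deriv k (\<lambda>v. h v i)) u))"


section \<open>Smooth manifolds\<close>

type_synonym 'a chart = "'a set \<times> ('a \<Rightarrow> nat \<Rightarrow> real)"

text \<open>The set \<open>charts M\<close> is the maximal atlas. The values of a coordinate map outside its domain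
  are irrelevant.\<close>

record 'a manifold =
  mtop :: "'a topology"
  mdim :: nat
  charts :: "'a chart set"

definition coordinate_chart :: "'a topology \<Rightarrow> nat \<Rightarrow> 'a chart \<Rightarrow> bool" where
  "coordinate_chart T m = (\<lambda>(U, x). openin T U \<and> openin (Euclidean_space m) (x ` U) \<and>
     homeomorphic_map (subtopology T U) (subtopology (Euclidean_space m) (x ` U)) x)"

definition compatible_charts :: "nat \<Rightarrow> 'a chart \<Rightarrow> 'a chart \<Rightarrow> bool" where
  "compatible_charts m = (\<lambda>(U, x) (V, y). \<forall>i<m.
     smooth_on m (x ` (U \<inter> V)) (\<lambda>u. y (inv_into U x u) i) \<and>
     smooth_on m (y ` (U \<inter> V)) (\<lambda>u. x (inv_into V y u) i))"

definition smooth_manifold :: "'a manifold \<Rightarrow> bool" where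
  "smooth_manifold M \<longleftrightarrow>
     Hausdorff_space (mtop M) \<and> second_countable (mtop M) \<and>
     \<Union> (fst ` charts M) = topspace (mtop M) \<and>
     (\<forall>c\<in>charts M. coordinate_chart (mtop M) (mdim M) c) \<and>
     (\<forall>c\<in>charts M. \<forall>d\<in>charts M. compatible_charts (mdim M) c d) \<and>
     (\<forall>c. coordinate_chart (mtop M) (mdim M) c \<and>
          (\<forall>d\<in>charts M. compatible_charts (mdim M) c d) \<longrightarrow> c \<in> charts M)"

definition smooth_map :: "'a manifold \<Rightarrow> 'b manifold \<Rightarrow> ('a \<Rightarrow> 'b) \<Rightarrow> bool" where
  "smooth_map M M' \<phi> \<longleftrightarrow> continuous_map (mtop M) (mtop M') \<phi> \<and>
     (\<forall>(U, x)\<in>charts M. \<forall>(V, y)\<in>charts M'. \<forall>i<mdim M'.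
        smooth_on (mdim M) (x ` {p \<in> U. \<phi> p \<in> V}) (\<lambda>u. y (\<phi> (inv_into U x u)) i))"

definition immersion :: "'a manifold \<Rightarrow> 'b manifold \<Rightarrow> ('a \<Rightarrow> 'b) \<Rightarrow> bool" where
  "immersion M M' \<phi> \<longleftrightarrow> smooth_map M M' \<phi> \<and>
     (\<forall>(U, x)\<in>charts M. \<forall>(V, y)\<in>charts M'. \<forall>p\<in>U. \<phi> p \<in> V \<longrightarrow>
        (\<forall>v. (\<forall>i<mdim M'. (\<Sum>j<mdim M. partial_deriv j (\<lambda>u. y (\<phi> (inv_into U x u)) i) (x p) * v j) = 0)
             \<longrightarrow> (\<forall>j<mdim M. v j = 0)))"

definition properly_embedded :: "'a manifold \<Rightarrow> 'b manifold \<Rightarrow> ('a \<Rightarrow> 'b) \<Rightarrow> bool" where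
  "properly_embedded M M' \<phi> \<longleftrightarrow>
     immersion M M' \<phi> \<and> embedding_map (mtop M) (mtop M') \<phi> \<and> proper_map (mtop M) (mtop M') \<phi>"


section \<open>Labelled forests with at most two vertices\<close>

text \<open>\<open>Vertex \<alpha>\<close> is \<open>\<alpha>\<close>, \<open>Two (Upair \<alpha> \<beta>)\<close> is the unordered \<open>\<alpha> \<cdot> \<beta>\<close>, and \<open>Ladder \<alpha> \<beta>\<close> is \<open>\<alpha>|\<beta>\<close>
  (top vertex \<open>\<alpha>\<close>, bottom vertex \<open>\<beta>\<close>).\<close>

datatype forest = Vertex nat | Two "nat uprod" | Ladder nat nat

definition forests :: "nat \<Rightarrow> forest set" where
  "forests n = Vertex ` {1..n} \<union> {Two (Upair \<alpha> \<beta>) |\<alpha> \<beta>. \<alpha> \<in> {1..n} \<and> \<beta> \<in> {1..n}}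
                 \<union> {Ladder \<alpha> \<beta> |\<alpha> \<beta>. \<alpha> \<in> {1..n} \<and> \<beta> \<in> {1..n}}"

definition symmetry_factor :: "forest \<Rightarrow> real" where
  "symmetry_factor \<tau> = (if \<exists>\<alpha>. \<tau> = Two (Upair \<alpha> \<alpha>) then 2 else 1)"


section \<open>Branched rough paths\<close>

definition control_function :: "real \<Rightarrow> real \<Rightarrow> (real \<Rightarrow> real \<Rightarrow> real) \<Rightarrow> bool" where
  "control_function S T \<omega> \<longleftrightarrow>
     continuous_on {(s, t). S \<le> s \<and> s \<le> t \<and> t \<le> T} (\<lambda>(s, t). \<omega> s t) \<and>
     (\<forall>s t. S \<le> s \<and> s \<le> t \<and> t \<le> T \<longrightarrow> 0 \<le> \<omega> s t) \<and>
     (\<forall>s\<in>{S..T}. \<omega> s s = 0) \<and>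
     (\<forall>s u t. S \<le> s \<and> s \<le> u \<and> u \<le> t \<and> t \<le> T \<longrightarrow> \<omega> s u + \<omega> u t \<le> \<omega> s t)"

definition branched_rough_path ::
    "nat \<Rightarrow> real \<Rightarrow> real \<Rightarrow> real \<Rightarrow> (real \<Rightarrow> real \<Rightarrow> real) \<Rightarrow> (forest \<Rightarrow> real \<Rightarrow> real \<Rightarrow> real) \<Rightarrow> bool" where
  "branched_rough_path n S T p \<omega> X \<longleftrightarrow>
     (\<forall>\<alpha>\<in>{1..n}. \<forall>\<beta>\<in>{1..n}. \<forall>s u t. S \<le> s \<and> s \<le> u \<and> u \<le> t \<and> t \<le> T \<longrightarrow>
        X (Vertex \<alpha>) s t = X (Vertex \<alpha>) s u + X (Vertex \<alpha>) u t \<and>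
        X (Two (Upair \<alpha> \<beta>)) s t = X (Vertex \<alpha>) s t * X (Vertex \<beta>) s t \<and>
        X (Ladder \<alpha> \<beta>) s t =
          X (Ladder \<alpha> \<beta>) s u + X (Ladder \<alpha> \<beta>) u t + X (Vertex \<alpha>) s u * X (Vertex \<beta>) u t) \<and>
     (\<exists>C>0. \<forall>\<alpha>\<in>{1..n}. \<forall>\<beta>\<in>{1..n}. \<forall>s t. S \<le> s \<and> s \<le> t \<and> t \<le> T \<longrightarrow>
        \<bar>X (Vertex \<alpha>) s t\<bar> \<le> C * \<omega> s t powr (1 / p) \<and>
        \<bar>X (Two (Upair \<alpha> \<beta>)) s t\<bar> \<le> C * \<omega> s t powr (2 / p) \<and>
        \<bar>X (Ladder \<alpha> \<beta>) s t\<bar> \<le> C * \<omega> s t powr (2 / p))"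


section \<open>The rough velocity bundle\<close>

text \<open>Tuples \<open>(f\<^sup>i\<^sub>\<tau>)\<close> are functions that vanish outside the index range.\<close>

type_synonym fiber = "nat \<Rightarrow> forest \<Rightarrow> real"

definition fiber_space :: "nat \<Rightarrow> nat \<Rightarrow> fiber set" where
  "fiber_space m n = {f. \<forall>i \<tau>. \<not> (i < m \<and> \<tau> \<in> forests n) \<longrightarrow> f i \<tau> = 0}"

text \<open>The formula by which the 2-jet at \<open>u\<close> of a map \<open>h\<close> from the \<open>m\<close>- to the \<open>m'\<close>-dimensional
  coordinate space sends \<open>f\<close> to \<open>g\<close>. It serves for the action of jets in the structure group, for
  the induced coordinates, and for the bundle map. It is a relation because \<open>Two\<close> takes an
  unordered pair; when \<open>h\<close> is smooth, the second derivatives commute and \<open>g\<close> is a function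
  of \<open>f\<close>.\<close>

definition jet_push ::
    "nat \<Rightarrow> nat \<Rightarrow> nat \<Rightarrow> ((nat \<Rightarrow> real) \<Rightarrow> nat \<Rightarrow> real) \<Rightarrow> (nat \<Rightarrow> real) \<Rightarrow> fiber \<Rightarrow> fiber \<Rightarrow> bool" where
  "jet_push m m' n h u f g \<longleftrightarrow> g \<in> fiber_space m' n \<and>
     (\<forall>i<m'. \<forall>\<alpha>\<in>{1..n}. \<forall>\<beta>\<in>{1..n}.
        g i (Vertex \<alpha>) = (\<Sum>j<m. partial_deriv j (\<lambda>v. h v i) u * f j (Vertex \<alpha>)) \<and>
        g i (Two (Upair \<alpha> \<beta>)) =
          (\<Sum>j<m. partial_deriv j (\<lambda>v. h v i) u * f j (Two (Upair \<alpha> \<beta>))) +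
          (\<Sum>j<m. \<Sum>k<m. partial_deriv j (partial_deriv k (\<lambda>v. h v i)) u *
                            f j (Vertex \<alpha>) * f k (Vertex \<beta>)) \<and>
        g i (Ladder \<alpha> \<beta>) = (\<Sum>j<m. partial_deriv j (\<lambda>v. h v i) u * f j (Ladder \<alpha> \<beta>)))"

text \<open>Representatives of the elements of the jet group: smooth self-maps of the coordinate space
  that fix the origin and whose 2-jet there is invertible.\<close>

definition smooth_origin_map :: "nat \<Rightarrow> ((nat \<Rightarrow> real) \<Rightarrow> nat \<Rightarrow> real) \<Rightarrow> bool" where
  "smooth_origin_map m a \<longleftrightarrow>
     a ` topspace (Euclidean_space m) \<subseteq> topspace (Euclidean_space m) \<and> a origin = origin \<and>
     (\<forall>i<m. smooth_on m (topspace (Euclidean_space m)) (\<lambda>u. a u i))"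

definition invertible_jet :: "nat \<Rightarrow> ((nat \<Rightarrow> real) \<Rightarrow> nat \<Rightarrow> real) \<Rightarrow> bool" where
  "invertible_jet m a \<longleftrightarrow> smooth_origin_map m a \<and>
     (\<exists>b. smooth_origin_map m b \<and> same_2jet m m (a \<circ> b) id origin \<and> same_2jet m m (b \<circ> a) id origin)"

text \<open>Local diffeomorphisms from a neighbourhood of the origin to \<open>M\<close>. Only the germ of \<open>\<psi>\<close> at
  the origin matters.\<close>

definition local_frame :: "'a manifold \<Rightarrow> ((nat \<Rightarrow> real) \<Rightarrow> 'a) \<Rightarrow> bool" where
  "local_frame M \<psi> \<longleftrightarrow> (\<exists>W. origin \<in> W \<and> openin (Euclidean_space (mdim M)) W \<and>
     openin (mtop M) (\<psi> ` W) \<and>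
     homeomorphic_map (subtopology (Euclidean_space (mdim M)) W) (subtopology (mtop M) (\<psi> ` W)) \<psi> \<and>
     (\<forall>(U, x)\<in>charts M. \<forall>i<mdim M.
        smooth_on (mdim M) {u \<in> W. \<psi> u \<in> U} (\<lambda>u. x (\<psi> u) i) \<and>
        smooth_on (mdim M) (x ` (U \<inter> \<psi> ` W)) (\<lambda>v. inv_into W \<psi> (inv_into U x v) i)))"

type_synonym 'a jet = "((nat \<Rightarrow> real) \<Rightarrow> 'a) set"

definition jet2 :: "'a manifold \<Rightarrow> ((nat \<Rightarrow> real) \<Rightarrow> 'a) \<Rightarrow> 'a jet" where
  "jet2 M \<psi> = {\<psi>'. local_frame M \<psi>' \<and> \<psi>' origin = \<psi> origin \<and>
     (\<forall>(U, x)\<in>charts M. \<psi> origin \<in> U \<longrightarrow> same_2jet (mdim M) (mdim M) (x \<circ> \<psi>') (x \<circ> \<psi>) origin)}"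

definition frame_bundle2 :: "'a manifold \<Rightarrow> 'a jet set" where
  "frame_bundle2 M = {jet2 M \<psi> |\<psi>. local_frame M \<psi>}"

text \<open>The pairs \<open>(j \<psi>, f)\<close> and \<open>(j (\<psi> \<circ> a), a\<^sup>-\<^sup>1 f)\<close> are identified; writing \<open>f'\<close> for \<open>a\<^sup>-\<^sup>1 f\<close>,
  the condition on the second components is \<open>f = a f'\<close>.\<close>

definition bundle_rel :: "'a manifold \<Rightarrow> nat \<Rightarrow> (('a jet \<times> fiber) \<times> ('a jet \<times> fiber)) set" where
  "bundle_rel M n = {((J, f), (J', f')).
     J \<in> frame_bundle2 M \<and> J' \<in> frame_bundle2 M \<and>
     f \<in> fiber_space (mdim M) n \<and> f' \<in> fiber_space (mdim M) n \<and>
     (\<exists>\<psi> a. local_frame M \<psi> \<and> J = jet2 M \<psi> \<and> invertible_jet (mdim M) a \<and> J' = jet2 M (\<psi> \<circ> a) \<and>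
            jet_push (mdim M) (mdim M) n a origin f' f)}"

type_synonym 'a bundle_point = "('a jet \<times> fiber) set"

definition rough_bundle :: "nat \<Rightarrow> 'a manifold \<Rightarrow> 'a bundle_point set" where
  "rough_bundle n M = (frame_bundle2 M \<times> fiber_space (mdim M) n) // bundle_rel M n"

definition base_point :: "'a bundle_point \<Rightarrow> 'a" where
  "base_point \<xi> = (THE p. \<exists>(J, f)\<in>\<xi>. \<exists>\<psi>\<in>J. p = \<psi> origin)"

text \<open>The fiber coordinates induced by a chart; meaningful when the base point lies in its domain.\<close>

definition fiber_coords :: "nat \<Rightarrow> 'a manifold \<Rightarrow> 'a chart \<Rightarrow> 'a bundle_point \<Rightarrow> fiber" where
  "fiber_coords n M = (\<lambda>(U, x) \<xi>.
     THE g. \<exists>(J, f)\<in>\<xi>. \<exists>\<psi>\<in>J. jet_push (mdim M) (mdim M) n (x \<circ> \<psi>) origin f g)"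

definition bundle_map ::
    "nat \<Rightarrow> 'a manifold \<Rightarrow> 'b manifold \<Rightarrow> ('a \<Rightarrow> 'b) \<Rightarrow> 'a bundle_point \<Rightarrow> 'b bundle_point" where
  "bundle_map n M M' \<phi> \<xi> = (THE \<eta>. \<eta> \<in> rough_bundle n M' \<and> base_point \<eta> = \<phi> (base_point \<xi>) \<and>
     (\<forall>(U, x)\<in>charts M. \<forall>(V, y)\<in>charts M'. base_point \<xi> \<in> U \<and> \<phi> (base_point \<xi>) \<in> V \<longrightarrow>
        jet_push (mdim M) (mdim M') n (\<lambda>u. y (\<phi> (inv_into U x u))) (x (base_point \<xi>))
          (fiber_coords n M (U, x) \<xi>) (fiber_coords n M' (V, y) \<eta>)))"


section \<open>Rough velocity fields and their integral curves\<close>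

definition rough_velocity_field :: "nat \<Rightarrow> 'a manifold \<Rightarrow> ('a \<Rightarrow> 'a bundle_point) \<Rightarrow> bool" where
  "rough_velocity_field n M f \<longleftrightarrow>
     (\<forall>p\<in>topspace (mtop M). f p \<in> rough_bundle n M \<and> base_point (f p) = p) \<and>
     (\<forall>(U, x)\<in>charts M. \<forall>i<mdim M. \<forall>\<tau>\<in>forests n.
        smooth_on (mdim M) (x ` U) (\<lambda>u. fiber_coords n M (U, x) (f (inv_into U x u)) i \<tau>))"

definition admissible :: "nat \<Rightarrow> 'a manifold \<Rightarrow> ('a \<Rightarrow> 'a bundle_point) \<Rightarrow> bool" where
  "admissible n M f \<longleftrightarrow> (\<forall>p\<in>topspace (mtop M). \<exists>(U, x)\<in>charts M. p \<in> U \<and>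
     (\<forall>i<mdim M. \<forall>\<alpha>\<in>{1..n}. \<forall>\<beta>\<in>{1..n}.
        (\<Sum>j<mdim M.
           partial_deriv j (\<lambda>u. fiber_coords n M (U, x) (f (inv_into U x u)) i (Vertex \<beta>)) (x p) *
           fiber_coords n M (U, x) (f p) j (Vertex \<alpha>)) =
        fiber_coords n M (U, x) (f p) i (Two (Upair \<alpha> \<beta>)) +
        fiber_coords n M (U, x) (f p) i (Ladder \<alpha> \<beta>)))"

definition integral_curve ::
    "nat \<Rightarrow> 'a manifold \<Rightarrow> ('a \<Rightarrow> 'a bundle_point) \<Rightarrow> real \<Rightarrow> real \<Rightarrow> real \<Rightarrow> (real \<Rightarrow> real \<Rightarrow> real) \<Rightarrow>
     (forest \<Rightarrow> real \<Rightarrow> real \<Rightarrow> real) \<Rightarrow> (real \<Rightarrow> 'a) \<Rightarrow> bool" where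
  "integral_curve n M f S T p \<omega> X Y \<longleftrightarrow>
     continuous_map (top_of_set {S..T}) (mtop M) Y \<and>
     (\<forall>a b. S \<le> a \<and> a \<le> b \<and> b \<le> T \<longrightarrow>
       (\<forall>(U, x)\<in>charts M. Y ` {a..b} \<subseteq> U \<longrightarrow>
         (\<exists>C>0. \<forall>i<mdim M. \<forall>s t. a \<le> s \<and> s \<le> t \<and> t \<le> b \<longrightarrow>
            \<bar>x (Y t) i - x (Y s) i -
              (\<Sum>\<tau>\<in>forests n. 1 / symmetry_factor \<tau> * fiber_coords n M (U, x) (f (Y s)) i \<tau> * X \<tau> s t)\<bar>
            \<le> C * \<omega> s t powr (3 / p))))"

end

(* Around a point of the submanifold one may choose charts of M and M' in which the embedding is a
   coordinate inclusion, so that (1) says that the normal coordinates of f vanish on the slice.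

   For (1) ==> (2), let z be the normal part of an integral curve in such a chart. The defect in additivity
   of its Taylor remainder is bounded by the control to the power 3/p > 1 times the size of z, because
   admissibility cancels the terms of second order. Splitting an interval at a point where the control is
   halved therefore bounds the remainder without partitions, and on a short interval z is
   bounded by half of its own supremum, so it vanishes.

   For (2) ==> (1), each tree has a smooth driver with regularity 2 and control t - s for which f has an integral
   curve leaving the given point in the direction of the coordinate of f at that tree. This gives tangency
   for the trees, and admissibility expresses the remaining coordinates by derivatives along the slice. *)
theory Submission
  imports Defs "HOL-Homology.Invariance_of_Domain"
begin

section \<open>Calculus on the coordinate space\<close>

text \<open>For (1) ==> (2) there is no uniqueness theorem for the rough equation by which the curve
  could be compared with one inside the submanifold. Homogeneity takes its place: for a function
  that vanishes on the slice, values, increments and Taylor remainders all carry a factor of the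
  normal coordinates or of their increment. Every estimate for z is therefore linear in two
  constants, one for the size of z and one for its remainder; with the second kept at a fixed
  multiple of the first, the pair improves by a fixed factor below 1, and iteration drives it to 0.
  Properness makes the image closed, which turns this local statement into one on all of [S, T].
  Slice charts come from invariance of domain and an explicit shear: the function whose graph is the
  submanifold is subtracted from the non-tangential coordinates. Points of the bundle are
  equivalence classes and their coordinates are definite descriptions, so much of the work is to
  show that coordinates are well defined, change by the jet action and determine the class. Symmetry
  of second derivatives is what gives the value at an unordered pair a meaning.\<close>

abbreviation coord_space :: "nat \<Rightarrow> (nat \<Rightarrow> real) set" where
  "coord_space m \<equiv> topspace (Euclidean_space m)"

text \<open>Boxes take the place of balls because replacing coordinates of one point by those of
  another, one at a time, never leaves a box.\<close>

definition cube :: "nat \<Rightarrow> (nat \<Rightarrow> real) \<Rightarrow> real \<Rightarrow> (nat \<Rightarrow> real) set" where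
  "cube m u r = {v \<in> coord_space m. \<forall>i<m. \<bar>v i - u i\<bar> < r}"

section \<open>Open sets and continuity in terms of cubes\<close>

lemma mem_coord_space: "u \<in> coord_space m \<longleftrightarrow> (\<forall>i\<ge>m. u i = 0)"
  by (simp add: topspace_Euclidean_space)

lemma Euclidean_space_eq: "Euclidean_space m = top_of_set {x. \<forall>i\<ge>m. x i = 0}"
  by (simp add: Euclidean_space_def euclidean_product_topology)

lemma center_in_cube: "u \<in> coord_space m \<Longrightarrow> r > 0 \<Longrightarrow> u \<in> cube m u r"
  by (simp add: cube_def)

lemma cube_subset: "cube m u r \<subseteq> coord_space m"
  by (auto simp: cube_def)

lemma cube_mono: "r \<le> r' \<Longrightarrow> cube m u r \<subseteq> cube m u r'"
  by (force simp: cube_def)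

lemma openin_cube: "openin (Euclidean_space m) (cube m u r)"
proof -
  have "open {v::nat\<Rightarrow>real. \<bar>v i - u i\<bar> < r}" for i
    by (intro open_Collect_less continuous_intros) auto
  then have "open (\<Inter>i<m. {v::nat\<Rightarrow>real. \<bar>v i - u i\<bar> < r})"
    by (intro open_INT) auto
  moreover have "cube m u r = coord_space m \<inter> (\<Inter>i<m. {v::nat\<Rightarrow>real. \<bar>v i - u i\<bar> < r})"
    by (auto simp: cube_def)
  ultimately show ?thesis
    by (simp add: Euclidean_space_eq openin_open_Int)
qed

text \<open>Only the coordinates below \<open>m\<close> limit the radius. From \<open>m\<close> on
  all points of the space vanish, so a factor of a basic open set that contains the entry of the
  centre contains the entry of every other point.\<close>

lemma openin_Euclidean_space_iff:
  "openin (Euclidean_space m) W \<longleftrightarrow> W \<subseteq> coord_space m \<and> (\<forall>u\<in>W. \<exists>r>0. cube m u r \<subseteq> W)"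
proof safe
  fix u assume W: "openin (Euclidean_space m) W" and u: "u \<in> W"
  obtain Q where Q: "openin (product_topology (\<lambda>i. euclideanreal) UNIV) Q" "W = Q \<inter> {x. \<forall>i\<ge>m. x i = 0}"
    using W by (auto simp: Euclidean_space_def openin_subtopology)
  have "u \<in> Q" using Q u by auto
  from product_topology_open_contains_basis[OF Q(1) \<open>u \<in> Q\<close>]
  obtain X where X: "u \<in> PiE UNIV X" "\<forall>i. openin euclideanreal (X i)" "PiE UNIV X \<subseteq> Q"
    by (elim exE conjE) (rule that)
  have "\<exists>e>0. \<forall>y. \<bar>y - u i\<bar> < e \<longrightarrow> y \<in> X i" for i
  proof -
    have "open (X i)" "u i \<in> X i" using X by auto
    then show ?thesis by (auto simp: open_dist dist_real_def)
  qed
  then obtain e where e: "\<And>i. e i > 0" "\<And>i y. \<bar>y - u i\<bar> < e i \<Longrightarrow> y \<in> X i"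
    by metis
  \<comment> \<open>The inserted \<open>1\<close> keeps the set non-empty when
    \<open>m = 0\<close>.\<close>
  define r where "r = Min (insert 1 (e ` {..<m}))"
  have r: "r > 0" "\<And>i. i < m \<Longrightarrow> r \<le> e i"
    using e(1) by (auto simp: r_def)
  have "v \<in> W" if "v \<in> cube m u r" for v
  proof -
    have "v i \<in> X i" for i
    proof (cases "i < m")
      case True
      then show ?thesis using that r(2)[OF True] by (intro e(2)) (auto simp: cube_def)
    next
      case False
      then have "v i = 0" "u i = 0" using that Q u by (auto simp: cube_def mem_coord_space)
      then show ?thesis using e by simp
    qed
    then show ?thesis using X Q that by (auto simp: cube_def mem_coord_space)
  qed
  then show "\<exists>r>0. cube m u r \<subseteq> W" using r by blast
next
  fix u assume "openin (Euclidean_space m) W" "u \<in> W" then show "u \<in> coord_space m"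
    using openin_subset by blast
next
  assume W: "W \<subseteq> coord_space m" and ex: "\<forall>u\<in>W. \<exists>r>0. cube m u r \<subseteq> W"
  show "openin (Euclidean_space m) W"
    by (subst openin_subopen) (metis W center_in_cube ex openin_cube subsetD)
qed

lemma continuous_map_coords_iff:
  assumes "W \<subseteq> coord_space m"
  shows "continuous_map (subtopology (Euclidean_space m) W) euclideanreal g \<longleftrightarrow> continuous_on W g"
  using assms by (simp add: Euclidean_space_eq subtopology_subtopology Int_absorb1)

lemma openin_imp_cube:
  assumes "openin (Euclidean_space m) W" "u \<in> W"
  obtains r where "r > 0" "cube m u r \<subseteq> W"
  using assms openin_Euclidean_space_iff by blast

lemma continuous_on_cubeE:
  assumes "openin (Euclidean_space m) W" "continuous_on W g" "u \<in> W" "e > (0::real)"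
  obtains r where "r > 0" "cube m u r \<subseteq> W" "\<forall>v\<in>cube m u r. \<bar>g v - g u\<bar> < e"
proof -
  have W: "W \<subseteq> coord_space m" using assms(1) openin_subset by blast
  have "openin (Euclidean_space m) (W \<inter> g -` ball (g u) e)"
    using continuous_openin_preimage_gen[OF assms(2) open_ball] assms(1) W
    by (simp add: Euclidean_space_eq) (meson openin_trans)
  moreover have "u \<in> W \<inter> g -` ball (g u) e" using assms by auto
  ultimately obtain r where "r > 0" "cube m u r \<subseteq> W \<inter> g -` ball (g u) e"
    by (rule openin_imp_cube)
  then show ?thesis by (intro that[of r]) (auto simp: dist_real_def abs_minus_commute)
qed

lemma continuous_on_bounded_cube:
  assumes "openin (Euclidean_space m) W" "continuous_on W g" "u \<in> W"
  obtains r C where "r > 0" "cube m u r \<subseteq> W" "\<forall>v\<in>cube m u r. \<bar>g v :: real\<bar> \<le> C"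
proof -
  obtain r where r: "r > 0" "cube m u r \<subseteq> W" "\<forall>v\<in>cube m u r. \<bar>g v - g u\<bar> < 1"
    using continuous_on_cubeE[OF assms zero_less_one] by blast
  show ?thesis
  proof (rule that[OF r(1,2)])
    show "\<forall>v\<in>cube m u r. \<bar>g v\<bar> \<le> \<bar>g u\<bar> + 1"
    proof
      fix v assume "v \<in> cube m u r"
      with r(3) have "\<bar>g v - g u\<bar> < 1" by blast
      then show "\<bar>g v\<bar> \<le> \<bar>g u\<bar> + 1" by linarith
    qed
  qed
qed

text \<open>Partial derivatives are derivatives along \<open>u(j := t)\<close>, a line that may
  leave the open set. Close to \<open>u j\<close> it does not, so facts known only on the set can be
  used under \<open>deriv\<close>.\<close>

lemma eventually_upd_in:
  assumes "openin (Euclidean_space m) W" "u \<in> W" "j < m"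
  shows "\<forall>\<^sub>F t in nhds (u j). u(j := t) \<in> W"
proof -
  obtain r where r: "r > 0" "cube m u r \<subseteq> W" using assms(1,2) by (rule openin_imp_cube)
  have "u \<in> coord_space m" using assms openin_subset by blast
  then have "u(j := t) \<in> W" if "dist t (u j) < r" for t
    using that r assms(3) by (intro subsetD[OF r(2)]) (auto simp: cube_def mem_coord_space dist_real_def)
  then show ?thesis using r(1) by (auto simp: eventually_nhds_metric)
qed

section \<open>Partial derivatives and closure properties of functions of class C^k\<close>

lemma partial_deriv_eqI:
  "((\<lambda>t. g (u(j := t))) has_field_derivative D) (at (u j)) \<Longrightarrow> partial_deriv j g u = D"
  by (simp add: partial_deriv_def DERIV_imp_deriv)

lemma partial_deriv_cong:
  assumes "openin (Euclidean_space m) W" "u \<in> W" "j < m" "\<And>v. v \<in> W \<Longrightarrow> g v = h v"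
  shows "partial_deriv j g u = partial_deriv j h u"
  unfolding partial_deriv_def
  by (rule deriv_cong_ev) (auto intro: eventually_mono[OF eventually_upd_in[OF assms(1-3)]] assms(4))

lemma C_k_on_0_iff: "W \<subseteq> coord_space m \<Longrightarrow> C_k_on 0 m W g \<longleftrightarrow> continuous_on W g"
  by (simp add: continuous_map_coords_iff)

lemma C_k_on_Suc_iff:
  assumes "W \<subseteq> coord_space m"
  shows "C_k_on (Suc k) m W g \<longleftrightarrow> continuous_on W g \<and>
     (\<forall>j<m. (\<forall>u\<in>W. (\<lambda>t. g (u(j := t))) differentiable (at (u j))) \<and> C_k_on k m W (partial_deriv j g))"
  using continuous_map_coords_iff[OF assms] by simp

lemma C_k_on_continuous:
  assumes "C_k_on k m W g" "W \<subseteq> coord_space m"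
  shows "continuous_on W g"
  using assms continuous_map_coords_iff[OF assms(2)] by (cases k) auto

lemma C_k_on_Suc_D: "C_k_on (Suc k) m W g \<Longrightarrow> C_k_on k m W g"
  by (induction k arbitrary: g) auto

lemma C_k_on_cong:
  assumes "openin (Euclidean_space m) W" "\<And>v. v \<in> W \<Longrightarrow> g v = h v" "C_k_on k m W g"
  shows "C_k_on k m W h"
proof -
  have W: "W \<subseteq> coord_space m" using assms(1) openin_subset by blast
  show ?thesis using assms(2,3)
  proof (induction k arbitrary: g h)
    case 0
    have "continuous_on W g" using 0(2) C_k_on_0_iff[OF W] by blast
    then have "continuous_on W h" using 0(1) continuous_on_cong[OF refl, of W g h] by blast
    then show ?case using C_k_on_0_iff[OF W] by blast
  next
    case (Suc k)
    have "(\<lambda>t. h (u(j := t))) differentiable (at (u j))" if "j < m" "u \<in> W" for j u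
    proof -
      have "(\<lambda>t. g (u(j := t))) differentiable (at (u j))" using Suc.prems(2) that by auto
      then obtain D where D: "((\<lambda>t. g (u(j := t))) has_field_derivative D) (at (u j))"
        unfolding real_differentiable_def by blast
      have ev: "\<forall>\<^sub>F t in nhds (u j). g (u(j := t)) = h (u(j := t))"
        by (rule eventually_mono[OF eventually_upd_in[OF assms(1) that(2,1)]]) (rule Suc.prems(1))
      have "((\<lambda>t. h (u(j := t))) has_field_derivative D) (at (u j))"
        using D DERIV_cong_ev[OF refl ev refl] by blast
      then show ?thesis unfolding real_differentiable_def by blast
    qed
    moreover have "C_k_on k m W (partial_deriv j h)" if "j < m" for j
    proof (rule Suc.IH)
      show "partial_deriv j g v = partial_deriv j h v" if "v \<in> W" for v
        by (rule partial_deriv_cong[OF assms(1) that \<open>j < m\<close> Suc.prems(1)])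
      show "C_k_on k m W (partial_deriv j g)" using Suc.prems(2) that by simp
    qed
    moreover have "continuous_on W g" using Suc.prems C_k_on_Suc_iff[OF W] by blast
    then have "continuous_on W h" using Suc.prems(1) continuous_on_cong[OF refl, of W g h] by blast
    ultimately show ?case using C_k_on_Suc_iff[OF W] by blast
  qed
qed

lemma C_k_on_subset:
  assumes "C_k_on k m W g" "W' \<subseteq> W" "W \<subseteq> coord_space m"
  shows "C_k_on k m W' g"
  using assms(1)
proof (induction k arbitrary: g)
  case 0
  then show ?case using assms continuous_map_coords_iff[of W m g] continuous_map_coords_iff[of W' m g]
    by (auto intro: continuous_on_subset)
next
  case (Suc k)
  then show ?case using assms C_k_on_Suc_iff[of W m k g] C_k_on_Suc_iff[of W' m k g]
    by (auto intro: continuous_on_subset)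
qed

lemma C_k_on_DERIV:
  assumes "C_k_on (Suc k) m W g" "u(j := s) \<in> W" "j < m"
  shows "((\<lambda>t. g (u(j := t))) has_field_derivative partial_deriv j g (u(j := s))) (at s)"
proof -
  have "(\<lambda>t. g ((u(j := s))(j := t))) differentiable (at ((u(j := s)) j))"
    using assms unfolding C_k_on.simps by blast
  then show ?thesis by (auto simp: partial_deriv_def DERIV_deriv_iff_real_differentiable)
qed

lemma C_k_on_DERIV':
  assumes "C_k_on (Suc k) m W g" "u \<in> W" "j < m"
  shows "((\<lambda>t. g (u(j := t))) has_field_derivative partial_deriv j g u) (at (u j))"
  using C_k_on_DERIV[of k m W g u j "u j"] assms by simp

text \<open>The derivatives are supplied as explicit functions \<open>d\<close>. The closure proofs
  can then name a formula and apply the induction hypothesis to it, instead of reasoning about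
  \<open>deriv\<close>.\<close>

lemma C_k_on_SucI:
  assumes "openin (Euclidean_space m) W" "continuous_on W g"
    and "\<And>u j. u \<in> W \<Longrightarrow> j < m \<Longrightarrow> ((\<lambda>t. g (u(j := t))) has_field_derivative d j u) (at (u j))"
    and "\<And>j. j < m \<Longrightarrow> C_k_on k m W (d j)"
  shows "C_k_on (Suc k) m W g"
proof -
  have W: "W \<subseteq> coord_space m" using assms(1) openin_subset by blast
  have "C_k_on k m W (partial_deriv j g)" if "j < m" for j
    using assms(3,4) that by (intro C_k_on_cong[OF assms(1) _ assms(4)]) (auto intro: partial_deriv_eqI[symmetric])
  moreover have "(\<lambda>t. g (u(j := t))) differentiable (at (u j))" if "u \<in> W" "j < m" for u j
    unfolding real_differentiable_def using assms(3)[OF that] by blast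
  ultimately show ?thesis unfolding C_k_on_Suc_iff[OF W] using assms(2) by blast
qed

lemma C_k_on_const:
  assumes "openin (Euclidean_space m) W"
  shows "C_k_on k m W (\<lambda>_. c)"
proof (induction k arbitrary: c)
  case 0
  then show ?case by simp
next
  case (Suc k)
  show ?case by (rule C_k_on_SucI[OF assms, where d = "\<lambda>_ _. 0"]) (use Suc in auto)
qed

lemma C_k_on_coord:
  assumes "openin (Euclidean_space m) W"
  shows "C_k_on k m W (\<lambda>u. u i)"
proof -
  have cont: "continuous_on W (\<lambda>u. u i)"
    by (rule continuous_on_product_then_coordinatewise[of W "\<lambda>u. u", OF continuous_on_id])
  show ?thesis
  proof (cases k)
    case 0
    show ?thesis unfolding 0 C_k_on_0_iff[OF openin_subset[OF assms]] by (rule cont)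
  next
    case (Suc l)
    show ?thesis unfolding Suc
    proof (rule C_k_on_SucI[OF assms cont, where d = "\<lambda>j _. if j = i then 1 else 0"])
      show "((\<lambda>t. (u(j := t)) i) has_real_derivative (if j = i then 1 else 0)) (at (u j))" for u j
        by (cases "j = i") (simp_all add: DERIV_ident)
    qed (rule C_k_on_const[OF assms])
  qed
qed

lemma C_k_on_add:
  assumes W: "openin (Euclidean_space m) W" and "C_k_on k m W g" "C_k_on k m W h"
  shows "C_k_on k m W (\<lambda>u. g u + h u)"
  using assms(2,3)
proof (induction k arbitrary: g h)
  case 0
  then show ?case using C_k_on_0_iff[OF openin_subset[OF W]] by (simp add: continuous_on_add)
next
  case (Suc k)
  note cont = Suc.prems[THEN C_k_on_continuous, OF openin_subset[OF W]]
  show ?case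
  proof (rule C_k_on_SucI[OF W, where d = "\<lambda>j u. partial_deriv j g u + partial_deriv j h u"])
    show "continuous_on W (\<lambda>u. g u + h u)" using cont by (rule continuous_on_add)
    show "((\<lambda>t. g (u(j := t)) + h (u(j := t))) has_real_derivative partial_deriv j g u + partial_deriv j h u) (at (u j))"
      if "u \<in> W" "j < m" for u j
      by (intro DERIV_add Suc.prems[THEN C_k_on_DERIV'] that)
    show "C_k_on k m W (\<lambda>u. partial_deriv j g u + partial_deriv j h u)" if "j < m" for j
      using Suc.prems that by (intro Suc.IH) auto
  qed
qed

text \<open>The induction generalizes both factors, since the product rule pairs a derivative with
  an undifferentiated factor; the latter is lowered from class \<open>Suc k\<close> to class
  \<open>k\<close>.\<close>

lemma C_k_on_mult:
  assumes W: "openin (Euclidean_space m) W" and "C_k_on k m W g" "C_k_on k m W h"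
  shows "C_k_on k m W (\<lambda>u. g u * h u)"
  using assms(2,3)
proof (induction k arbitrary: g h)
  case 0
  then show ?case using C_k_on_0_iff[OF openin_subset[OF W]] by (simp add: continuous_on_mult)
next
  case (Suc k)
  note cont = Suc.prems[THEN C_k_on_continuous, OF openin_subset[OF W]]
  show ?case
  proof (rule C_k_on_SucI[OF W, where d = "\<lambda>j u. partial_deriv j g u * h u + partial_deriv j h u * g u"])
    show "continuous_on W (\<lambda>u. g u * h u)" using cont by (rule continuous_on_mult)
    show "((\<lambda>t. g (u(j := t)) * h (u(j := t))) has_real_derivative
        partial_deriv j g u * h u + partial_deriv j h u * g u) (at (u j))" if "u \<in> W" "j < m" for u j
    proof -
      have "((\<lambda>t. g (u(j := t)) * h (u(j := t))) has_real_derivative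
          partial_deriv j g u * h (u(j := u j)) + partial_deriv j h u * g (u(j := u j))) (at (u j))"
        by (rule DERIV_mult[OF Suc.prems[THEN C_k_on_DERIV', OF that]])
      then show ?thesis by simp
    qed
    show "C_k_on k m W (\<lambda>u. partial_deriv j g u * h u + partial_deriv j h u * g u)" if "j < m" for j
    proof (intro C_k_on_add[OF W] Suc.IH)
      show "C_k_on k m W (partial_deriv j g)" "C_k_on k m W (partial_deriv j h)" using Suc.prems that by simp_all
      show "C_k_on k m W g" "C_k_on k m W h" by (fact Suc.prems[THEN C_k_on_Suc_D])+
    qed
  qed
qed

lemma C_k_on_sum:
  assumes W: "openin (Euclidean_space m) W" and "\<And>a. a \<in> A \<Longrightarrow> C_k_on k m W (g a)"
  shows "C_k_on k m W (\<lambda>u. \<Sum>a\<in>A. g a u)"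
  using assms(2)
  by (induction A rule: infinite_finite_induct) (auto intro!: C_k_on_add[OF W] C_k_on_const[OF W])

lemma C_k_on_uminus:
  assumes W: "openin (Euclidean_space m) W" and "C_k_on k m W g"
  shows "C_k_on k m W (\<lambda>u. - g u)"
  using C_k_on_mult[OF W C_k_on_const[OF W, of k "-1"] assms(2)] by simp

lemma C_k_on_diff:
  assumes W: "openin (Euclidean_space m) W" and "C_k_on k m W g" "C_k_on k m W h"
  shows "C_k_on k m W (\<lambda>u. g u - h u)"
  using C_k_on_add[OF W assms(2) C_k_on_uminus[OF W assms(3)]] by simp

text \<open>The derivative of the reciprocal is a polynomial in the reciprocal and a derivative of
  \<open>g\<close>, so the induction hypothesis for the very same function gives its
  regularity.\<close>

lemma C_k_on_inverse:
  assumes W: "openin (Euclidean_space m) W" and "C_k_on k m W g" and nz: "\<And>u. u \<in> W \<Longrightarrow> g u \<noteq> 0"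
  shows "C_k_on k m W (\<lambda>u. inverse (g u))"
  using assms(2)
proof (induction k)
  case 0
  then show ?case using C_k_on_0_iff[OF openin_subset[OF W]] nz by (simp add: continuous_on_inverse)
next
  case (Suc k)
  note cont = Suc.prems[THEN C_k_on_continuous, OF openin_subset[OF W]]
  note IH = Suc.IH[OF C_k_on_Suc_D[OF Suc.prems]]
  show ?case
  proof (rule C_k_on_SucI[OF W, where d = "\<lambda>j u. - (partial_deriv j g u * (inverse (g u) * inverse (g u)))"])
    show "continuous_on W (\<lambda>u. inverse (g u))" using cont nz by (intro continuous_on_inverse) auto
    show "((\<lambda>t. inverse (g (u(j := t)))) has_real_derivative
        - (partial_deriv j g u * (inverse (g u) * inverse (g u)))) (at (u j))" if "u \<in> W" "j < m" for u j
    proof -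
      have "((\<lambda>t. inverse (g (u(j := t)))) has_real_derivative
          - (inverse (g (u(j := u j))) * partial_deriv j g u * inverse (g (u(j := u j))))) (at (u j))"
        using nz[OF that(1)] by (intro DERIV_inverse' Suc.prems[THEN C_k_on_DERIV', OF that]) simp
      then show ?thesis by (simp add: mult_ac)
    qed
    show "C_k_on k m W (\<lambda>u. - (partial_deriv j g u * (inverse (g u) * inverse (g u))))" if "j < m" for j
    proof (intro C_k_on_uminus C_k_on_mult W IH)
      show "C_k_on k m W (partial_deriv j g)" using Suc.prems that by simp
    qed
  qed
qed

section \<open>Mean values and the chain rule\<close>

lemma mean_value_closed_segment:
  fixes f :: "real \<Rightarrow> real"
  assumes "\<And>t. t \<in> closed_segment a b \<Longrightarrow> (f has_real_derivative f' t) (at t)"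
  obtains s where "s \<in> closed_segment a b" "f b - f a = f' s * (b - a)"
proof -
  \<comment> \<open>A coordinate may move up, down or not at all, hence the unordered
    segment.\<close>
  consider "a < b" | "a = b" | "b < a" by linarith
  then show ?thesis
  proof cases
    case 1
    then obtain z where "a < z" "z < b" "f b - f a = (b - a) * f' z"
      using MVT2[of a b f f'] assms by (auto simp: closed_segment_eq_real_ivl)
    then show ?thesis using 1 that[of z] by (auto simp: closed_segment_eq_real_ivl mult.commute)
  next
    case 2
    then show ?thesis using that[of a] by auto
  next
    case 3
    then obtain z where "b < z" "z < a" "f a - f b = (a - b) * f' z"
      using MVT2[of b a f f'] assms by (auto simp: closed_segment_eq_real_ivl)
    then show ?thesis using 3 that[of z] by (auto simp: closed_segment_eq_real_ivl algebra_simps)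
  qed
qed

text \<open>The coordinates are changed one at a time, so only one-dimensional mean values are needed;
  in return, every partial derivative is evaluated at a point of its own.\<close>

lemma mean_value_cube:
  assumes C: "C_k_on (Suc l) m W g" and sub: "cube m c r \<subseteq> W" and u: "u \<in> cube m c r" and v: "v \<in> cube m c r"
  obtains \<xi> where "\<forall>k<m. \<xi> k \<in> cube m c r" "\<forall>k i. \<bar>\<xi> k i - u i\<bar> \<le> \<bar>v i - u i\<bar>"
    "g v - g u = (\<Sum>k<m. partial_deriv k g (\<xi> k) * (v k - u k))"
proof -
  \<comment> \<open>\<open>w k\<close> has the entries of \<open>v\<close> below \<open>k\<close>
    and those of \<open>u\<close> from \<open>k\<close> on. Consecutive points differ in coordinate
    \<open>k\<close> alone, so the total increment telescopes into one-dimensional ones.\<close>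
  define w where "w k i = (if i < k then v i else u i)" for k i
  have "\<exists>s. s \<in> closed_segment (u k) (v k) \<and>
      g (w (Suc k)) - g (w k) = partial_deriv k g ((w k)(k := s)) * (v k - u k)" if k: "k < m" for k
  proof -
    have in_cube: "(w k)(k := t) \<in> cube m c r" if "t \<in> closed_segment (u k) (v k)" for t
    proof -
      have "\<bar>u k - c k\<bar> < r" "\<bar>v k - c k\<bar> < r" using u v k by (auto simp: cube_def)
      then have "\<bar>t - c k\<bar> < r" using that by (auto simp: closed_segment_eq_real_ivl split: if_splits)
      then show ?thesis using u v k by (auto simp: cube_def w_def mem_coord_space)
    qed
    obtain s where s: "s \<in> closed_segment (u k) (v k)"
      "g ((w k)(k := v k)) - g ((w k)(k := u k)) = partial_deriv k g ((w k)(k := s)) * (v k - u k)"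
    proof (rule mean_value_closed_segment)
      show "((\<lambda>t. g ((w k)(k := t))) has_real_derivative partial_deriv k g ((w k)(k := t))) (at t)"
        if "t \<in> closed_segment (u k) (v k)" for t
        using C in_cube[OF that] sub k by (intro C_k_on_DERIV[where W = W]) auto
    qed
    moreover have "(w k)(k := v k) = w (Suc k)" "(w k)(k := u k) = w k" by (auto simp: w_def)
    ultimately show ?thesis by auto
  qed
  then obtain s where s: "\<And>k. k < m \<Longrightarrow> s k \<in> closed_segment (u k) (v k)"
     "\<And>k. k < m \<Longrightarrow> g (w (Suc k)) - g (w k) = partial_deriv k g ((w k)(k := s k)) * (v k - u k)" by metis
  \<comment> \<open>From \<open>m\<close> on the value \<open>u\<close> makes the distance bound
    hold for every index, without a side condition on \<open>k\<close>.\<close>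
  define \<xi> where "\<xi> k = (if k < m then (w k)(k := s k) else u)" for k
  have "w 0 = u" "w m = v" using u v by (auto simp: w_def cube_def mem_coord_space)
  then have "g v - g u = (\<Sum>k<m. g (w (Suc k)) - g (w k))" using sum_lessThan_telescope[of "\<lambda>k. g (w k)" m] by simp
  also have "\<dots> = (\<Sum>k<m. partial_deriv k g (\<xi> k) * (v k - u k))"
    using s by (intro sum.cong) (auto simp: \<xi>_def)
  finally have "g v - g u = (\<Sum>k<m. partial_deriv k g (\<xi> k) * (v k - u k))" .
  moreover have "\<xi> k \<in> cube m c r" if "k < m" for k
  proof -
    have "\<bar>u k - c k\<bar> < r" "\<bar>v k - c k\<bar> < r" using u v that by (auto simp: cube_def)
    then have "\<bar>s k - c k\<bar> < r" using s(1)[OF that] by (auto simp: closed_segment_eq_real_ivl split: if_splits)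
    then show ?thesis using u v that by (auto simp: \<xi>_def cube_def w_def mem_coord_space)
  qed
  moreover have "\<bar>\<xi> k i - u i\<bar> \<le> \<bar>v i - u i\<bar>" for k i
    using s(1)[of k] by (auto simp: \<xi>_def w_def closed_segment_eq_real_ivl split: if_splits)
  ultimately show ?thesis using that[of \<xi>] by blast
qed

lemma eventually_coords_near:
  fixes m :: nat
  assumes "\<And>i. i < m \<Longrightarrow> ((\<lambda>t. \<gamma> t i) \<longlongrightarrow> (c i :: real)) F" "r > 0"
  shows "\<forall>\<^sub>F t in F. \<forall>i<m. \<bar>\<gamma> t i - c i\<bar> < r"
proof -
  have "\<forall>\<^sub>F t in F. \<forall>i\<in>{..<m}. dist (\<gamma> t i) (c i) < r"
    by (intro eventually_ball_finite ballI) (use tendstoD[OF assms] in auto)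
  then show ?thesis by eventually_elim (auto simp: dist_real_def)
qed

text \<open>Mean value points come from a choice function without any continuity in
  \<open>t\<close>. Being coordinatewise at least as close to \<open>c\<close> as the curve is, they
  are still forced to converge to \<open>c\<close>.\<close>

lemma tendsto_intermediate_point:
  assumes W: "openin (Euclidean_space m) W" and "c \<in> W" and g: "continuous_on W g"
    and \<gamma>: "\<And>i. i < m \<Longrightarrow> ((\<lambda>t. \<gamma> t i) \<longlongrightarrow> c i) F"
    and \<xi>: "\<forall>\<^sub>F t in F. \<xi> t \<in> coord_space m \<and> (\<forall>i<m. \<bar>\<xi> t i - c i\<bar> \<le> \<bar>\<gamma> t i - c i\<bar>)"
  shows "((\<lambda>t. g (\<xi> t) :: real) \<longlongrightarrow> g c) F"
proof (rule tendstoI)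
  fix e :: real assume "0 < e"
  with W g \<open>c \<in> W\<close> obtain r where r: "r > 0" "cube m c r \<subseteq> W" "\<forall>v\<in>cube m c r. \<bar>g v - g c\<bar> < e"
    using continuous_on_cubeE by blast
  have "\<forall>\<^sub>F t in F. \<forall>i<m. \<bar>\<gamma> t i - c i\<bar> < r"
    using \<gamma> r(1) by (rule eventually_coords_near)
  with \<xi> show "\<forall>\<^sub>F t in F. dist (g (\<xi> t)) (g c) < e"
  proof eventually_elim
    case (elim t)
    have "\<xi> t \<in> cube m c r"
      unfolding cube_def mem_Collect_eq using elim le_less_trans by blast
    then show ?case using r(3) by (simp add: dist_real_def)
  qed
qed

text \<open>Divide the mean value expansion between \<open>\<gamma> s\<close> and
  \<open>\<gamma> t\<close> by \<open>t - s\<close>: the coefficients converge by continuity of the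
  partial derivatives, the quotients by hypothesis. The derivative is taken within a set, so that
  end points of intervals are covered.\<close>

lemma has_derivative_along_curve:
  assumes W: "openin (Euclidean_space m) W" and g: "C_k_on (Suc l) m W g"
    and in_W: "\<gamma> s \<in> W" "\<forall>\<^sub>F t in at s within S. \<gamma> t \<in> W"
    and \<gamma>: "\<And>k. k < m \<Longrightarrow> ((\<lambda>t. \<gamma> t k) has_real_derivative \<gamma>' k) (at s within S)"
  shows "((\<lambda>t. g (\<gamma> t)) has_real_derivative (\<Sum>k<m. partial_deriv k g (\<gamma> s) * \<gamma>' k)) (at s within S)"
proof -
  define c where "c = \<gamma> s"
  obtain r where r: "r > 0" "cube m c r \<subseteq> W" using openin_imp_cube[OF W in_W(1)] c_def by auto
  have cW: "c \<in> W" "c \<in> coord_space m" using in_W openin_subset[OF W] by (auto simp: c_def)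
  have lim: "((\<lambda>t. \<gamma> t k) \<longlongrightarrow> c k) (at s within S)" if "k < m" for k
    using \<gamma>[OF that] by (auto simp: c_def dest!: DERIV_continuous simp: continuous_within)
  have "\<forall>\<^sub>F t in at s within S. \<forall>i<m. \<bar>\<gamma> t i - c i\<bar> < r"
    using lim r(1) by (rule eventually_coords_near)
  with in_W(2) have in_cube: "\<forall>\<^sub>F t in at s within S. \<gamma> t \<in> cube m c r"
    by eventually_elim (use openin_subset[OF W] in \<open>auto simp: cube_def\<close>)
  \<comment> \<open>The predicate is vacuous while the curve is outside the cube, so that a single
    choice works for all \<open>t\<close>.\<close>
  define P where "P t \<xi> \<longleftrightarrow> (\<gamma> t \<in> cube m c r \<longrightarrow> (\<forall>k<m. \<xi> k \<in> cube m c r) \<and>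
    (\<forall>k i. \<bar>\<xi> k i - c i\<bar> \<le> \<bar>\<gamma> t i - c i\<bar>) \<and>
    g (\<gamma> t) - g c = (\<Sum>k<m. partial_deriv k g (\<xi> k) * (\<gamma> t k - c k)))" for t \<xi>
  have "\<forall>t. \<exists>\<xi>. P t \<xi>"
  proof
    fix t
    show "\<exists>\<xi>. P t \<xi>"
    proof (cases "\<gamma> t \<in> cube m c r")
      case True
      obtain \<xi> where "\<forall>k<m. \<xi> k \<in> cube m c r" "\<forall>k i. \<bar>\<xi> k i - c i\<bar> \<le> \<bar>\<gamma> t i - c i\<bar>"
        "g (\<gamma> t) - g c = (\<Sum>k<m. partial_deriv k g (\<xi> k) * (\<gamma> t k - c k))"
        by (rule mean_value_cube[OF g r(2) center_in_cube[OF cW(2) r(1)] True])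
      then have "P t \<xi>" unfolding P_def by blast
      then show ?thesis by blast
    qed (simp add: P_def)
  qed
  then obtain \<xi> where "\<forall>t. P t (\<xi> t)" using choice[of P] by blast
  then have \<xi>: "\<And>t k. \<gamma> t \<in> cube m c r \<Longrightarrow> k < m \<Longrightarrow> \<xi> t k \<in> cube m c r"
    "\<And>t k i. \<gamma> t \<in> cube m c r \<Longrightarrow> \<bar>\<xi> t k i - c i\<bar> \<le> \<bar>\<gamma> t i - c i\<bar>"
    "\<And>t. \<gamma> t \<in> cube m c r \<Longrightarrow> g (\<gamma> t) - g c = (\<Sum>k<m. partial_deriv k g (\<xi> t k) * (\<gamma> t k - c k))"
    unfolding P_def by blast+
  have "((\<lambda>t. partial_deriv k g (\<xi> t k)) \<longlongrightarrow> partial_deriv k g c) (at s within S)" if "k < m" for k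
  proof (rule tendsto_intermediate_point[OF W cW(1) _ lim])
    show "continuous_on W (partial_deriv k g)"
      using g that by (auto intro: C_k_on_continuous[OF _ openin_subset[OF W]])
    show "\<forall>\<^sub>F t in at s within S. \<xi> t k \<in> coord_space m \<and> (\<forall>i<m. \<bar>\<xi> t k i - c i\<bar> \<le> \<bar>\<gamma> t i - c i\<bar>)"
      using in_cube by eventually_elim (use \<xi>(1,2) that cube_subset in blast)
  qed
  then have "((\<lambda>t. \<Sum>k<m. partial_deriv k g (\<xi> t k) * ((\<gamma> t k - c k) / (t - s))) \<longlongrightarrow>
      (\<Sum>k<m. partial_deriv k g c * \<gamma>' k)) (at s within S)"
    using \<gamma> by (intro tendsto_sum tendsto_mult) (auto simp: has_field_derivative_iff c_def)
  moreover have "\<forall>\<^sub>F t in at s within S. (g (\<gamma> t) - g c) / (t - s) =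
      (\<Sum>k<m. partial_deriv k g (\<xi> t k) * ((\<gamma> t k - c k) / (t - s)))"
    using in_cube by eventually_elim (simp add: \<xi>(3) sum_divide_distrib)
  ultimately show ?thesis
    by (simp add: has_field_derivative_iff c_def[symmetric] tendsto_cong)
qed

lemma has_partial_deriv_comp:
  assumes W: "openin (Euclidean_space m) W" and W': "openin (Euclidean_space m') W'"
    and g: "C_k_on (Suc l) m' W' g" and h: "\<And>a. a < m' \<Longrightarrow> C_k_on (Suc l) m W (\<lambda>u. h u a)"
    and hW: "\<And>u. u \<in> W \<Longrightarrow> h u \<in> W'" and u: "u \<in> W" and j: "j < m"
  shows "((\<lambda>t. g (h (u(j := t)))) has_real_derivative
    (\<Sum>a<m'. partial_deriv a g (h u) * partial_deriv j (\<lambda>v. h v a) u)) (at (u j))"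
proof -
  have "((\<lambda>t. g (h (u(j := t)))) has_real_derivative
    (\<Sum>a<m'. partial_deriv a g (h (u(j := u j))) * partial_deriv j (\<lambda>v. h v a) u)) (at (u j))"
  proof (rule has_derivative_along_curve[OF W' g])
    show "h (u(j := u j)) \<in> W'" using hW u by simp
    show "\<forall>\<^sub>F t in at (u j). h (u(j := t)) \<in> W'"
      using eventually_at_filter[of "\<lambda>t. h (u(j := t)) \<in> W'" "u j" UNIV] eventually_upd_in[OF W u j] hW
      by (auto elim: eventually_mono)
    show "((\<lambda>t. h (u(j := t)) a) has_real_derivative partial_deriv j (\<lambda>v. h v a) u) (at (u j))" if "a < m'" for a
      by (rule C_k_on_DERIV'[OF h[OF that] u j])
  qed
  then show ?thesis by simp
qed

text \<open>Induction on \<open>k\<close> with the outer function generalized: the chain rule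
  produces partial derivatives of \<open>g\<close> composed with the same \<open>h\<close>, to which
  the hypothesis applies.\<close>

lemma C_k_on_comp:
  assumes W: "openin (Euclidean_space m) W" and W': "openin (Euclidean_space m') W'"
    and "C_k_on k m' W' g" and "\<And>a. a < m' \<Longrightarrow> C_k_on k m W (\<lambda>u. h u a)"
    and hW: "\<And>u. u \<in> W \<Longrightarrow> h u \<in> W'"
  shows "C_k_on k m W (\<lambda>u. g (h u))"
proof -
  have cont: "continuous_on W (\<lambda>u. g (h u))" if "continuous_on W' g" "\<And>a. a < m' \<Longrightarrow> continuous_on W (\<lambda>u. h u a)" for g
  proof (rule continuous_on_compose2[OF that(1)])
    \<comment> \<open>Coordinates from \<open>m'\<close> on are constantly zero because the values
      of \<open>h\<close> lie in the coordinate space.\<close>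
    have "continuous_on W (\<lambda>u. h u a)" for a
    proof (cases "a < m'")
      case False
      then have "\<And>u. u \<in> W \<Longrightarrow> h u a = 0" using hW openin_subset[OF W'] by (auto simp: mem_coord_space subset_iff)
      then show ?thesis by (simp cong: continuous_on_cong)
    qed (use that in auto)
    then show "continuous_on W h" by (rule continuous_on_coordinatewise_then_product)
  qed (use hW in auto)
  show ?thesis using assms(3,4)
  proof (induction k arbitrary: g)
    case 0
    have "continuous_on W' g" using 0(1) by (rule C_k_on_continuous[OF _ openin_subset[OF W']])
    moreover have "continuous_on W (\<lambda>u. h u a)" if "a < m'" for a
      using 0(2)[OF that] by (rule C_k_on_continuous[OF _ openin_subset[OF W]])
    ultimately have "continuous_on W (\<lambda>u. g (h u))" by (rule cont)
    then show ?case using C_k_on_0_iff[OF openin_subset[OF W]] by blast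
  next
    case (Suc k)
    show ?case
    proof (rule C_k_on_SucI[OF W, where d = "\<lambda>j u. \<Sum>a<m'. partial_deriv a g (h u) * partial_deriv j (\<lambda>v. h v a) u"])
      show "continuous_on W (\<lambda>u. g (h u))"
      proof (rule cont)
        show "continuous_on W' g" using Suc.prems(1) by (rule C_k_on_continuous[OF _ openin_subset[OF W']])
        show "continuous_on W (\<lambda>u. h u a)" if "a < m'" for a
          using Suc.prems(2)[OF that] by (rule C_k_on_continuous[OF _ openin_subset[OF W]])
      qed
      show "((\<lambda>t. g (h (u(j := t)))) has_real_derivative
        (\<Sum>a<m'. partial_deriv a g (h u) * partial_deriv j (\<lambda>v. h v a) u)) (at (u j))" if "u \<in> W" "j < m" for u j
        by (rule has_partial_deriv_comp[OF W W' Suc.prems hW that])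
      show "C_k_on k m W (\<lambda>u. \<Sum>a<m'. partial_deriv a g (h u) * partial_deriv j (\<lambda>v. h v a) u)" if "j < m" for j
      proof (intro C_k_on_sum[OF W] C_k_on_mult[OF W])
        fix a assume "a \<in> {..<m'}"
        then have a: "a < m'" by simp
        show "C_k_on k m W (partial_deriv j (\<lambda>v. h v a))" using Suc.prems(2)[OF a] that by simp
        show "C_k_on k m W (\<lambda>u. partial_deriv a g (h u))"
        proof (rule Suc.IH)
          show "C_k_on k m' W' (partial_deriv a g)" using Suc.prems(1) a by simp
          show "C_k_on k m W (\<lambda>u. h u b)" if "b < m'" for b
            using Suc.prems(2)[OF that] by (rule C_k_on_Suc_D)
        qed
      qed
    qed
  qed
qed

lemma partial_deriv_comp:
  assumes W: "openin (Euclidean_space m) W" and W': "openin (Euclidean_space m') W'"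
    and g: "C_k_on (Suc l) m' W' g" and h: "\<And>a. a < m' \<Longrightarrow> C_k_on (Suc l) m W (\<lambda>u. h u a)"
    and hW: "\<And>u. u \<in> W \<Longrightarrow> h u \<in> W'" and u: "u \<in> W" and j: "j < m"
  shows "partial_deriv j (\<lambda>v. g (h v)) u = (\<Sum>a<m'. partial_deriv a g (h u) * partial_deriv j (\<lambda>v. h v a) u)"
  by (rule partial_deriv_eqI[OF has_partial_deriv_comp[OF W W' g h hW u j]])

section \<open>Smooth functions\<close>

lemma smooth_on_C_k: "smooth_on m W g \<Longrightarrow> C_k_on k m W g"
  by (simp add: smooth_on_def)

lemma smooth_on_open: "smooth_on m W g \<Longrightarrow> openin (Euclidean_space m) W"
  by (simp add: smooth_on_def)

lemma smooth_on_continuous: "smooth_on m W g \<Longrightarrow> continuous_on W g"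
  using C_k_on_continuous[OF smooth_on_C_k[of m W g 0]] openin_subset[OF smooth_on_open] by blast

lemma smooth_on_partial_deriv:
  assumes "smooth_on m W g" "j < m"
  shows "smooth_on m W (partial_deriv j g)"
  unfolding smooth_on_def
proof (intro conjI allI)
  show "openin (Euclidean_space m) W" using assms(1) by (rule smooth_on_open)
  show "C_k_on k m W (partial_deriv j g)" for k
    using smooth_on_C_k[OF assms(1), of "Suc k"] assms(2) by simp
qed

lemma smooth_on_cong:
  assumes "smooth_on m W g" "\<And>v. v \<in> W \<Longrightarrow> g v = h v"
  shows "smooth_on m W h"
  using assms C_k_on_cong[OF smooth_on_open[OF assms(1)], of g h] unfolding smooth_on_def by blast

lemma smooth_on_subset:
  assumes "smooth_on m W g" "W' \<subseteq> W" "openin (Euclidean_space m) W'"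
  shows "smooth_on m W' g"
  using assms C_k_on_subset[OF _ assms(2) openin_subset[OF smooth_on_open[OF assms(1)]], of _ g]
  unfolding smooth_on_def by blast

lemma smooth_on_coord: "openin (Euclidean_space m) W \<Longrightarrow> smooth_on m W (\<lambda>u. u i)"
  by (simp add: smooth_on_def C_k_on_coord)

lemma smooth_on_const: "openin (Euclidean_space m) W \<Longrightarrow> smooth_on m W (\<lambda>_. c)"
  by (simp add: smooth_on_def C_k_on_const)

lemma smooth_on_add: "smooth_on m W g \<Longrightarrow> smooth_on m W h \<Longrightarrow> smooth_on m W (\<lambda>u. g u + h u)"
  by (simp add: smooth_on_def C_k_on_add)

lemma smooth_on_diff: "smooth_on m W g \<Longrightarrow> smooth_on m W h \<Longrightarrow> smooth_on m W (\<lambda>u. g u - h u)"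
  by (simp add: smooth_on_def C_k_on_diff)

lemma smooth_on_mult: "smooth_on m W g \<Longrightarrow> smooth_on m W h \<Longrightarrow> smooth_on m W (\<lambda>u. g u * h u)"
  by (simp add: smooth_on_def C_k_on_mult)

lemma smooth_on_sum:
  "openin (Euclidean_space m) W \<Longrightarrow> (\<And>a. a \<in> A \<Longrightarrow> smooth_on m W (g a)) \<Longrightarrow> smooth_on m W (\<lambda>u. \<Sum>a\<in>A. g a u)"
  by (simp add: smooth_on_def C_k_on_sum)

lemma smooth_on_comp:
  assumes "smooth_on m' W' g" "openin (Euclidean_space m) W"
    and "\<And>a. a < m' \<Longrightarrow> smooth_on m W (\<lambda>u. h u a)" "\<And>u. u \<in> W \<Longrightarrow> h u \<in> W'"
  shows "smooth_on m W (\<lambda>u. g (h u))"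
  unfolding smooth_on_def
proof (intro conjI allI)
  show "C_k_on k m W (\<lambda>u. g (h u))" for k
    by (rule C_k_on_comp[OF assms(2) smooth_on_open[OF assms(1)] smooth_on_C_k[OF assms(1)] smooth_on_C_k[OF assms(3)] assms(4)])
qed (rule assms(2))

lemma partial_deriv_comp_smooth:
  assumes "smooth_on m' W' g" "openin (Euclidean_space m) W"
    and "\<And>a. a < m' \<Longrightarrow> smooth_on m W (\<lambda>u. h u a)" "\<And>u. u \<in> W \<Longrightarrow> h u \<in> W'" "u \<in> W" "j < m"
  shows "partial_deriv j (\<lambda>v. g (h v)) u = (\<Sum>a<m'. partial_deriv a g (h u) * partial_deriv j (\<lambda>v. h v a) u)"
  by (rule partial_deriv_comp[OF assms(2) smooth_on_open[OF assms(1)] smooth_on_C_k[OF assms(1)] smooth_on_C_k[OF assms(3)] assms(4-6)])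

lemma smooth_on_DERIV:
  assumes "smooth_on m W g" "u(j := s) \<in> W" "j < m"
  shows "((\<lambda>t. g (u(j := t))) has_field_derivative partial_deriv j g (u(j := s))) (at s)"
  by (rule C_k_on_DERIV[OF smooth_on_C_k[OF assms(1), of 1, unfolded One_nat_def] assms(2,3)])

lemma smooth_on_DERIV':
  assumes "smooth_on m W g" "u \<in> W" "j < m"
  shows "((\<lambda>t. g (u(j := t))) has_field_derivative partial_deriv j g u) (at (u j))"
  by (rule C_k_on_DERIV'[OF smooth_on_C_k[OF assms(1), of 1, unfolded One_nat_def] assms(2,3)])

lemma partial_deriv_add:
  assumes "smooth_on m W g" "smooth_on m W h" "u \<in> W" "j < m"
  shows "partial_deriv j (\<lambda>v. g v + h v) u = partial_deriv j g u + partial_deriv j h u"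
  by (intro partial_deriv_eqI DERIV_add smooth_on_DERIV'[OF _ assms(3,4)] assms)

lemma partial_deriv_mult:
  assumes "smooth_on m W g" "smooth_on m W h" "u \<in> W" "j < m"
  shows "partial_deriv j (\<lambda>v. g v * h v) u = partial_deriv j g u * h u + partial_deriv j h u * g u"
proof -
  have "((\<lambda>t. g (u(j := t)) * h (u(j := t))) has_real_derivative
      partial_deriv j g u * h (u(j := u j)) + partial_deriv j h u * g (u(j := u j))) (at (u j))"
    by (intro DERIV_mult smooth_on_DERIV'[OF _ assms(3,4)] assms)
  then show ?thesis by (intro partial_deriv_eqI) simp
qed

lemma partial_deriv_sum:
  assumes "\<And>a. a \<in> A \<Longrightarrow> smooth_on m W (g a)" "u \<in> W" "j < m"
  shows "partial_deriv j (\<lambda>v. \<Sum>a\<in>A. g a v) u = (\<Sum>a\<in>A. partial_deriv j (g a) u)"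
  by (intro partial_deriv_eqI DERIV_sum smooth_on_DERIV'[OF _ assms(2,3)] assms)

lemma partial_deriv_const [simp]: "partial_deriv j (\<lambda>_. c) u = 0"
  by (simp add: partial_deriv_def)

lemma partial_deriv_coord: "partial_deriv j (\<lambda>v. v i) u = (if j = i then 1 else 0)"
proof (rule partial_deriv_eqI)
  show "((\<lambda>t. (u(j := t)) i) has_real_derivative (if j = i then 1 else 0)) (at (u j))"
    by (cases "j = i") (simp_all add: DERIV_ident)
qed

lemma smooth_on_along_curve:
  assumes "smooth_on m W g" "\<gamma> s \<in> W" "\<forall>\<^sub>F t in at s within S. \<gamma> t \<in> W"
    and "\<And>k. k < m \<Longrightarrow> ((\<lambda>t. \<gamma> t k) has_real_derivative \<gamma>' k) (at s within S)"
  shows "((\<lambda>t. g (\<gamma> t)) has_real_derivative (\<Sum>k<m. partial_deriv k g (\<gamma> s) * \<gamma>' k)) (at s within S)"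
  by (rule has_derivative_along_curve[OF smooth_on_open[OF assms(1)] smooth_on_C_k[OF assms(1), of 1, unfolded One_nat_def] assms(2-4)])

lemma mean_value_cube_smooth:
  assumes g: "smooth_on m W g" and sub: "cube m c r \<subseteq> W" and u: "u \<in> cube m c r" and v: "v \<in> cube m c r"
  obtains \<xi> where "\<forall>k<m. \<xi> k \<in> cube m c r" "\<forall>k i. \<bar>\<xi> k i - u i\<bar> \<le> \<bar>v i - u i\<bar>"
    "g v - g u = (\<Sum>k<m. partial_deriv k g (\<xi> k) * (v k - u k))"
  using mean_value_cube[OF smooth_on_C_k[OF g, of 1, unfolded One_nat_def] sub u v] by blast

text \<open>The second difference over a square is the increment, in coordinate \<open>j\<close>, of
  an increment in coordinate \<open>k\<close>; one mean value for each coordinate turns it into a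
  mixed derivative. The difference itself does not distinguish \<open>j\<close> from
  \<open>k\<close>, whence the symmetry of second derivatives.\<close>

lemma mixed_difference_eq_partial_deriv:
  assumes g: "smooth_on m W g" and sub: "cube m u r \<subseteq> W" and jk: "j < m" "k < m" "j \<noteq> k"
    and h: "0 < h" "h < r" and u: "u \<in> coord_space m"
  obtains \<xi> where "\<xi> \<in> cube m u r" "\<forall>i. \<bar>\<xi> i - u i\<bar> \<le> h"
    "g (u(j := u j + h, k := u k + h)) - g (u(j := u j + h)) - g (u(k := u k + h)) + g u
      = h * h * partial_deriv k (partial_deriv j g) \<xi>"
proof -
  have inW: "u(j := a, k := b) \<in> cube m u r" if "u j \<le> a" "a \<le> u j + h" "u k \<le> b" "b \<le> u k + h" for a b
    using that h u jk by (auto simp: cube_def mem_coord_space)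
  have unchanged: "(u(k := c))(j := u j) = u(k := c)" for c using jk by auto
  have twist: "(u(k := c))(j := a) = (u(j := a))(k := c)" for a c using jk by auto
  define \<phi> where "\<phi> a = g ((u(k := u k + h))(j := a)) - g ((u(k := u k))(j := a))" for a
  have "DERIV \<phi> a :> partial_deriv j g ((u(k := u k + h))(j := a)) - partial_deriv j g ((u(k := u k))(j := a))"
    if "u j \<le> a" "a \<le> u j + h" for a
  proof -
    have "u(j := a, k := u k + h) \<in> W" "u(j := a, k := u k) \<in> W"
      using inW[OF that, of "u k + h"] inW[OF that, of "u k"] sub h by auto
    then have "(u(k := u k + h))(j := a) \<in> W" "(u(k := u k))(j := a) \<in> W"
      unfolding fun_upd_twist[OF jk(3)] by simp_all
    then show ?thesis
      unfolding \<phi>_def by (intro DERIV_diff smooth_on_DERIV[OF g] jk(1))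
  qed
  from MVT2[of "u j" "u j + h" \<phi>, OF _ this] h
  obtain a where a: "u j < a" "a < u j + h"
    "\<phi> (u j + h) - \<phi> (u j) = h * (partial_deriv j g ((u(k := u k + h))(j := a)) - partial_deriv j g ((u(k := u k))(j := a)))"
    by auto
  have "DERIV (\<lambda>b. partial_deriv j g ((u(j := a))(k := b))) b :> partial_deriv k (partial_deriv j g) ((u(j := a))(k := b))"
    if "u k \<le> b" "b \<le> u k + h" for b
    using inW[OF _ _ that, of a] a sub jk
    by (intro smooth_on_DERIV[OF smooth_on_partial_deriv[OF g jk(1)]]) auto
  from MVT2[of "u k" "u k + h" "\<lambda>b. partial_deriv j g ((u(j := a))(k := b))", OF _ this] h
  obtain b where b: "u k < b" "b < u k + h"
    "partial_deriv j g ((u(j := a))(k := u k + h)) - partial_deriv j g ((u(j := a))(k := u k))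
      = h * partial_deriv k (partial_deriv j g) ((u(j := a))(k := b))"
    by auto
  show ?thesis
  proof (rule that)
    show "u(j := a, k := b) \<in> cube m u r" using inW a b by auto
    show "\<forall>i. \<bar>(u(j := a, k := b)) i - u i\<bar> \<le> h" using a b h by auto
    have "g (u(j := u j + h, k := u k + h)) - g (u(j := u j + h)) - g (u(k := u k + h)) + g u = \<phi> (u j + h) - \<phi> (u j)"
      by (simp add: \<phi>_def unchanged fun_upd_twist[OF jk(3)])
    also have "\<dots> = h * h * partial_deriv k (partial_deriv j g) (u(j := a, k := b))"
      by (simp only: a(3)[unfolded twist] b(3) mult.assoc)
    finally show "g (u(j := u j + h, k := u k + h)) - g (u(j := u j + h)) - g (u(k := u k + h)) + g u
      = h * h * partial_deriv k (partial_deriv j g) (u(j := a, k := b))" .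
  qed
qed

text \<open>Each mixed derivative, at some point of a small cube, equals the same second difference
  divided by the square of the step. Continuity carries the equality to \<open>u\<close> up to any
  error \<open>e\<close>.\<close>

lemma partial_deriv_commute:
  assumes g: "smooth_on m W g" and u: "u \<in> W" and jk: "j < m" "k < m"
  shows "partial_deriv j (partial_deriv k g) u = partial_deriv k (partial_deriv j g) u"
proof (cases "j = k")
  case False
  have W: "openin (Euclidean_space m) W" using g by (rule smooth_on_open)
  have uE: "u \<in> coord_space m" using u openin_subset[OF W] by blast
  \<comment> \<open>The shape \<open>0 + e\<close> is the one that \<open>field_le_epsilon\<close>
    expects.\<close>
  have bound: "\<bar>partial_deriv j (partial_deriv k g) u - partial_deriv k (partial_deriv j g) u\<bar> \<le> 0 + e" if e: "e > 0" for e
  proof -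
    have cont: "continuous_on W (partial_deriv j (partial_deriv k g))" "continuous_on W (partial_deriv k (partial_deriv j g))"
      by (rule smooth_on_continuous, rule smooth_on_partial_deriv, rule smooth_on_partial_deriv[OF g]; fact jk)+
    obtain r1 where r1: "r1 > 0" "cube m u r1 \<subseteq> W"
      "\<forall>v\<in>cube m u r1. \<bar>partial_deriv j (partial_deriv k g) v - partial_deriv j (partial_deriv k g) u\<bar> < e/2"
      by (rule continuous_on_cubeE[OF W cont(1) u half_gt_zero[OF e]])
    obtain r2 where r2: "r2 > 0" "cube m u r2 \<subseteq> W"
      "\<forall>v\<in>cube m u r2. \<bar>partial_deriv k (partial_deriv j g) v - partial_deriv k (partial_deriv j g) u\<bar> < e/2"
      by (rule continuous_on_cubeE[OF W cont(2) u half_gt_zero[OF e]])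
    define r where "r = min r1 r2"
    have rr: "r > 0" "cube m u r \<subseteq> W" "cube m u r \<subseteq> cube m u r1" "cube m u r \<subseteq> cube m u r2"
      using r1 r2 cube_mono[of r r1 m u] cube_mono[of r r2 m u] by (auto simp: r_def)
    have r2pos: "0 < r/2" "r/2 < r" using rr(1) by auto
    obtain \<xi> where \<xi>: "\<xi> \<in> cube m u r" "g (u(j := u j + r/2, k := u k + r/2)) - g (u(j := u j + r/2)) - g (u(k := u k + r/2)) + g u
      = r/2 * (r/2) * partial_deriv k (partial_deriv j g) \<xi>"
      by (rule mixed_difference_eq_partial_deriv[OF g rr(2) jk False r2pos uE])
    obtain \<eta> where \<eta>: "\<eta> \<in> cube m u r" "g (u(k := u k + r/2, j := u j + r/2)) - g (u(k := u k + r/2)) - g (u(j := u j + r/2)) + g u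
      = r/2 * (r/2) * partial_deriv j (partial_deriv k g) \<eta>"
      by (rule mixed_difference_eq_partial_deriv[OF g rr(2) jk(2,1) False[symmetric] r2pos uE])
    have "u(j := u j + r/2, k := u k + r/2) = u(k := u k + r/2, j := u j + r/2)"
      using False by (rule fun_upd_twist)
    then have "r/2 * (r/2) * partial_deriv k (partial_deriv j g) \<xi> = r/2 * (r/2) * partial_deriv j (partial_deriv k g) \<eta>"
      unfolding \<xi>(2)[symmetric] \<eta>(2)[symmetric] by simp
    then have "partial_deriv k (partial_deriv j g) \<xi> = partial_deriv j (partial_deriv k g) \<eta>"
      using rr(1) by simp
    moreover have "\<xi> \<in> cube m u r2" "\<eta> \<in> cube m u r1" using \<xi> \<eta> rr by auto
    ultimately show ?thesis using bspec[OF r1(3), of \<eta>] bspec[OF r2(3), of \<xi>] by linarith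
  qed
  have "\<bar>partial_deriv j (partial_deriv k g) u - partial_deriv k (partial_deriv j g) u\<bar> \<le> 0"
    by (rule field_le_epsilon) (rule bound)
  then show ?thesis by simp
qed simp

text \<open>The condition on the image says that the entries from \<open>m'\<close> on vanish, which
  smoothness of the first \<open>m'\<close> entries does not see. Together they give continuity into
  the product space.\<close>

definition smooth_vec :: "nat \<Rightarrow> nat \<Rightarrow> (nat \<Rightarrow> real) set \<Rightarrow> ((nat \<Rightarrow> real) \<Rightarrow> nat \<Rightarrow> real) \<Rightarrow> bool" where
  "smooth_vec m m' W h \<longleftrightarrow> openin (Euclidean_space m) W \<and> h ` W \<subseteq> coord_space m' \<and>
     (\<forall>i<m'. smooth_on m W (\<lambda>u. h u i))"

lemma smooth_vec_open: "smooth_vec m m' W h \<Longrightarrow> openin (Euclidean_space m) W"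
  by (simp add: smooth_vec_def)

lemma smooth_vec_coord: "smooth_vec m m' W h \<Longrightarrow> i < m' \<Longrightarrow> smooth_on m W (\<lambda>u. h u i)"
  by (simp add: smooth_vec_def)

lemma smooth_vec_in_coord_space: "smooth_vec m m' W h \<Longrightarrow> u \<in> W \<Longrightarrow> h u \<in> coord_space m'"
  by (auto simp: smooth_vec_def)

lemma smooth_vec_subset:
  assumes "smooth_vec m m' W h" "W' \<subseteq> W" "openin (Euclidean_space m) W'"
  shows "smooth_vec m m' W' h"
  using assms smooth_on_subset[OF smooth_vec_coord[OF assms(1)] assms(2,3)]
  unfolding smooth_vec_def by blast

lemma smooth_vec_id: "openin (Euclidean_space m) W \<Longrightarrow> smooth_vec m m W (\<lambda>u. u)"
  using openin_subset by (fastforce simp: smooth_vec_def smooth_on_coord)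

lemma smooth_on_comp_vec:
  assumes "smooth_on m' W' g" "smooth_vec m m' W h" "\<And>u. u \<in> W \<Longrightarrow> h u \<in> W'"
  shows "smooth_on m W (\<lambda>u. g (h u))"
  by (rule smooth_on_comp[OF assms(1) smooth_vec_open[OF assms(2)] smooth_vec_coord[OF assms(2)] assms(3)])

lemma smooth_vec_comp:
  assumes "smooth_vec m' m'' W' k" "smooth_vec m m' W h" "\<And>u. u \<in> W \<Longrightarrow> h u \<in> W'"
  shows "smooth_vec m m'' W (\<lambda>u. k (h u))"
  unfolding smooth_vec_def
proof (intro conjI allI impI)
  show "openin (Euclidean_space m) W" using assms(2) by (rule smooth_vec_open)
  show "(\<lambda>u. k (h u)) ` W \<subseteq> coord_space m''" using assms(1,3) unfolding smooth_vec_def by blast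
  show "smooth_on m W (\<lambda>u. k (h u) i)" if "i < m''" for i
    by (rule smooth_on_comp_vec[OF smooth_vec_coord[OF assms(1) that] assms(2,3)])
qed

lemma smooth_vec_continuous:
  assumes "smooth_vec m m' W h"
  shows "continuous_on W h"
proof (rule continuous_on_coordinatewise_then_product)
  fix i
  show "continuous_on W (\<lambda>u. h u i)"
  proof (cases "i < m'")
    case True
    then show ?thesis using smooth_vec_coord[OF assms] smooth_on_continuous by blast
  next
    case False
    then have "\<And>u. u \<in> W \<Longrightarrow> h u i = 0"
      using smooth_vec_in_coord_space[OF assms] by (auto simp: mem_coord_space)
    then show ?thesis using continuous_on_cong[OF refl, of W "\<lambda>u. h u i" "\<lambda>_. 0"] continuous_on_const by blast
  qed
qed

lemma smooth_vec_preimage_open: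
  assumes h: "smooth_vec m m' W h" and W': "openin (Euclidean_space m') W'"
  shows "openin (Euclidean_space m) {u \<in> W. h u \<in> W'}"
proof -
  have "h \<in> W \<rightarrow> {x. \<forall>i\<ge>m'. x i = 0}"
    using smooth_vec_in_coord_space[OF h] by (auto simp: mem_coord_space)
  then have "openin (top_of_set W) (W \<inter> h -` W')"
    using continuous_openin_preimage[OF smooth_vec_continuous[OF h]] W' unfolding Euclidean_space_eq by blast
  moreover have "W \<inter> h -` W' = {u \<in> W. h u \<in> W'}" by auto
  ultimately have "openin (top_of_set W) {u \<in> W. h u \<in> W'}" by simp
  from openin_trans[OF this smooth_vec_open[OF h, unfolded Euclidean_space_eq]]
  show ?thesis unfolding Euclidean_space_eq .
qed

text \<open>The inverse is an argument, so its smoothness is proved where the map is constructed and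
  is available to every user of it.\<close>

definition coord_diffeo :: "nat \<Rightarrow> (nat \<Rightarrow> real) set \<Rightarrow> (nat \<Rightarrow> real) set \<Rightarrow>
    ((nat \<Rightarrow> real) \<Rightarrow> nat \<Rightarrow> real) \<Rightarrow> ((nat \<Rightarrow> real) \<Rightarrow> nat \<Rightarrow> real) \<Rightarrow> bool" where
  "coord_diffeo m W W' \<Theta> \<Psi> \<longleftrightarrow> smooth_vec m m W \<Theta> \<and> smooth_vec m m W' \<Psi> \<and>
     (\<forall>u\<in>W. \<Theta> u \<in> W' \<and> \<Psi> (\<Theta> u) = u) \<and> (\<forall>v\<in>W'. \<Psi> v \<in> W \<and> \<Theta> (\<Psi> v) = v)"

text \<open>Replacing one coordinate by a function with non-vanishing partial derivative in that
  coordinate. Openness of the image is invariance of domain; differentiability of the inverse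
  follows from the mean value theorem, and its smoothness by bootstrapping.\<close>

lemma coordinate_replacement:
  assumes g: "smooth_on m W g" and u0: "u0 \<in> W" and i: "i < m" and nz: "partial_deriv i g u0 \<noteq> 0"
  obtains W1 W2 \<Psi> where "W1 \<subseteq> W" "u0 \<in> W1" "coord_diffeo m W1 W2 (\<lambda>u. u(i := g u)) \<Psi>"
proof -
  define D where "D = partial_deriv i g"
  define \<Theta> where "\<Theta> u = u(i := g u)" for u :: "nat \<Rightarrow> real"
  have W: "openin (Euclidean_space m) W" using g by (rule smooth_on_open)
  have u0E: "u0 \<in> coord_space m" using u0 openin_subset[OF W] by blast
  have contD: "continuous_on W D" unfolding D_def by (rule smooth_on_continuous[OF smooth_on_partial_deriv[OF g i]])
  have pos: "\<bar>D u0\<bar> > 0" using nz D_def by simp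
  \<comment> \<open>Closer to \<open>D u0\<close> than \<open>\<bar>D u0\<bar>\<close> means
    non-zero; this holds on the whole cube and hence at all mean value points below.\<close>
  obtain r where r: "r > 0" "cube m u0 r \<subseteq> W" "\<forall>v\<in>cube m u0 r. \<bar>D v - D u0\<bar> < \<bar>D u0\<bar>"
    by (rule continuous_on_cubeE[OF W contD u0 pos])
  define W1 where "W1 = cube m u0 r"
  have Dnz: "D v \<noteq> 0" if "v \<in> W1" for v using bspec[OF r(3), of v] that unfolding W1_def by auto
  have W1: "openin (Euclidean_space m) W1" unfolding W1_def by (rule openin_cube)
  have W1W: "W1 \<subseteq> W" using r W1_def by simp
  have W1E: "W1 \<subseteq> coord_space m" using openin_subset[OF W1] .
  have gW1: "smooth_on m W1 g" by (rule smooth_on_subset[OF g W1W W1])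
  have \<Theta>_smooth: "smooth_vec m m W1 \<Theta>"
    unfolding smooth_vec_def
  proof (intro conjI allI impI W1)
    show "\<Theta> ` W1 \<subseteq> coord_space m" using W1E i by (auto simp: \<Theta>_def mem_coord_space subset_iff)
    show "smooth_on m W1 (\<lambda>u. \<Theta> u k)" if "k < m" for k
      using gW1 smooth_on_coord[OF W1, of k] by (cases "k = i") (simp_all add: \<Theta>_def)
  qed
  \<comment> \<open>Points with the same image agree off coordinate \<open>i\<close>, so the mean
    value expansion of \<open>g v - g u = 0\<close> has only its term at \<open>i\<close>, with a
    non-zero coefficient.\<close>
  have inj: "inj_on \<Theta> W1"
  proof (rule inj_onI)
    fix u v assume u: "u \<in> W1" and v: "v \<in> W1" and eq: "\<Theta> u = \<Theta> v"
    have off: "u k = v k" if "k \<noteq> i" for k using fun_cong[OF eq, of k] that by (simp add: \<Theta>_def)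
    have "g u = g v" using fun_cong[OF eq, of i] by (simp add: \<Theta>_def)
    obtain \<xi> where \<xi>: "\<forall>k<m. \<xi> k \<in> cube m u0 r" "\<forall>k i. \<bar>\<xi> k i - u i\<bar> \<le> \<bar>v i - u i\<bar>"
      "g v - g u = (\<Sum>k<m. partial_deriv k g (\<xi> k) * (v k - u k))"
      by (rule mean_value_cube_smooth[OF g r(2) u[unfolded W1_def] v[unfolded W1_def]])
    have "(\<Sum>k<m. partial_deriv k g (\<xi> k) * (v k - u k)) = (\<Sum>k<m. if k = i then D (\<xi> i) * (v i - u i) else 0)"
      by (rule sum.cong) (auto simp: off D_def)
    then have "D (\<xi> i) * (v i - u i) = 0" using \<xi>(3) \<open>g u = g v\<close> i by simp
    moreover have "D (\<xi> i) \<noteq> 0" using \<xi>(1) i Dnz W1_def by blast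
    ultimately have "v i = u i" by simp
    then show "u = v" using off by (metis ext)
  qed
  have cmap: "continuous_map (subtopology (Euclidean_space m) W1) (Euclidean_space m) \<Theta>"
    unfolding cm_Euclidean_space_iff_continuous_on
    using smooth_vec_continuous[OF \<Theta>_smooth] smooth_vec_in_coord_space[OF \<Theta>_smooth] W1E
    by (auto simp: Int_absorb1)
  define W2 where "W2 = \<Theta> ` W1"
  have W2: "openin (Euclidean_space m) W2"
    unfolding W2_def by (rule invariance_of_domain_Euclidean_space[OF W1 cmap inj])
  have W2E: "W2 \<subseteq> coord_space m" using openin_subset[OF W2] .
  have "embedding_map (subtopology (Euclidean_space m) W1) (Euclidean_space m) \<Theta>"
    by (rule invariance_of_domain_Euclidean_space_embedding_map[OF W1 cmap inj])
  then have "homeomorphic_map (subtopology (Euclidean_space m) W1) (subtopology (Euclidean_space m) W2) \<Theta>"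
    using W1E by (simp add: embedding_map_def W2_def Int_absorb1)
  then obtain \<Psi> where "homeomorphic_maps (subtopology (Euclidean_space m) W1) (subtopology (Euclidean_space m) W2) \<Theta> \<Psi>"
    unfolding homeomorphic_map_maps by blast
  then have \<Psi>: "continuous_map (subtopology (Euclidean_space m) W2) (subtopology (Euclidean_space m) W1) \<Psi>"
    "\<forall>u\<in>W1. \<Psi> (\<Theta> u) = u" "\<forall>v\<in>W2. \<Theta> (\<Psi> v) = v"
    using W1E W2E by (auto simp: homeomorphic_maps_def Int_absorb1)
  have \<Psi>W1: "\<Psi> v \<in> W1" if "v \<in> W2" for v using that \<Psi>(2) by (auto simp: W2_def)
  have "continuous_map (subtopology (Euclidean_space m) W2) (Euclidean_space m) \<Psi>"
    using \<Psi>(1) continuous_map_in_subtopology by blast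
  then have "continuous_on W2 \<Psi>" unfolding cm_Euclidean_space_iff_continuous_on using W2E by (simp add: Int_absorb1)
  then have cont\<Psi>: "continuous_on W2 (\<lambda>v. \<Psi> v k)" for k by (rule continuous_on_product_then_coordinatewise)
  have off: "\<Psi> v k = v k" if "v \<in> W2" "k \<noteq> i" for v k
    using fun_cong[OF bspec[OF \<Psi>(3) that(1)], of k] that(2) by (simp add: \<Theta>_def)
  have at_i: "g (\<Psi> v) = v i" if "v \<in> W2" for v
    using fun_cong[OF bspec[OF \<Psi>(3) that], of i] by (simp add: \<Theta>_def)
  \<comment> \<open>Implicit differentiation of \<open>g (\<Psi> v) = v i\<close>: the right side
    has derivative 1 or 0 according to whether \<open>j = i\<close>, and off \<open>i\<close> the
    entries of \<open>\<Psi> v\<close> are those of \<open>v\<close>.\<close>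
  define d where "d j v = (if j = i then 1 else - partial_deriv j g (\<Psi> v)) * inverse (D (\<Psi> v))" for j v
  have deriv: "((\<lambda>s. \<Psi> (v(j := s)) i) has_real_derivative d j v) (at (v j))" if v: "v \<in> W2" and j: "j < m" for v j
  proof -
    define u where "u = \<Psi> v"
    have u: "u \<in> W1" unfolding u_def by (rule \<Psi>W1[OF v])
    have ev: "\<forall>\<^sub>F s in at (v j). v(j := s) \<in> W2"
      using eventually_upd_in[OF W2 v j] by (simp add: eventually_at_filter eventually_mono)
    define P where "P s \<xi> \<longleftrightarrow> (v(j := s) \<in> W2 \<longrightarrow> (\<forall>k<m. \<xi> k \<in> cube m u0 r) \<and>
       (\<forall>k i. \<bar>\<xi> k i - u i\<bar> \<le> \<bar>\<Psi> (v(j := s)) i - u i\<bar>) \<and>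
       g (\<Psi> (v(j := s))) - g u = (\<Sum>k<m. partial_deriv k g (\<xi> k) * (\<Psi> (v(j := s)) k - u k)))" for s \<xi>
    have "\<forall>s. \<exists>\<xi>. P s \<xi>"
    proof
      fix s
      show "\<exists>\<xi>. P s \<xi>"
      proof (cases "v(j := s) \<in> W2")
        case True
        obtain \<xi> where "\<forall>k<m. \<xi> k \<in> cube m u0 r" "\<forall>k i. \<bar>\<xi> k i - u i\<bar> \<le> \<bar>\<Psi> (v(j := s)) i - u i\<bar>"
          "g (\<Psi> (v(j := s))) - g u = (\<Sum>k<m. partial_deriv k g (\<xi> k) * (\<Psi> (v(j := s)) k - u k))"
          by (rule mean_value_cube_smooth[OF g r(2) u[unfolded W1_def] \<Psi>W1[OF True, unfolded W1_def]])
        then have "P s \<xi>" unfolding P_def by blast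
        then show ?thesis by blast
      qed (simp add: P_def)
    qed
    then obtain \<xi> where "\<forall>s. P s (\<xi> s)" using choice[of P] by blast
    then have \<xi>: "\<forall>s. v(j := s) \<in> W2 \<longrightarrow> (\<forall>k<m. \<xi> s k \<in> cube m u0 r)"
      "\<forall>s. v(j := s) \<in> W2 \<longrightarrow> (\<forall>k i. \<bar>\<xi> s k i - u i\<bar> \<le> \<bar>\<Psi> (v(j := s)) i - u i\<bar>)"
      "\<forall>s. v(j := s) \<in> W2 \<longrightarrow> g (\<Psi> (v(j := s))) - g u = (\<Sum>k<m. partial_deriv k g (\<xi> s k) * (\<Psi> (v(j := s)) k - u k))"
      unfolding P_def by blast+
    have lim\<Psi>: "((\<lambda>s. \<Psi> (v(j := s)) k) \<longlongrightarrow> u k) (at (v j))" for k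
      unfolding u_def
    proof (rule tendsto_intermediate_point[OF W2 v cont\<Psi>])
      show "((\<lambda>s. (v(j := s)) k) \<longlongrightarrow> v k) (at (v j))" for k
        by (cases "k = j") (auto intro: tendsto_ident_at)
      show "\<forall>\<^sub>F s in at (v j). v(j := s) \<in> coord_space m \<and> (\<forall>i<m. \<bar>(v(j := s)) i - v i\<bar> \<le> \<bar>(v(j := s)) i - v i\<bar>)"
        using ev by eventually_elim (use W2E in auto)
    qed
    have lim: "((\<lambda>s. partial_deriv k g (\<xi> s k)) \<longlongrightarrow> partial_deriv k g u) (at (v j))" if "k < m" for k
    proof (rule tendsto_intermediate_point[OF W _ _ lim\<Psi>])
      show "u \<in> W" using u W1W by blast
      show "continuous_on W (partial_deriv k g)" by (rule smooth_on_continuous[OF smooth_on_partial_deriv[OF g that]])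
      show "\<forall>\<^sub>F s in at (v j). \<xi> s k \<in> coord_space m \<and> (\<forall>i<m. \<bar>\<xi> s k i - u i\<bar> \<le> \<bar>\<Psi> (v(j := s)) i - u i\<bar>)"
        using ev by eventually_elim (use \<xi>(1,2) that W1E[unfolded W1_def] in blast)
    qed
    \<comment> \<open>In the mean value expansion of \<open>g\<close> along \<open>\<Psi>\<close>
      only the terms at \<open>i\<close> and \<open>j\<close> survive; solving for the one at
      \<open>i\<close> gives the difference quotient before the limit.\<close>
    have quot: "(\<Psi> (v(j := s)) i - u i) / (s - v j) =
        (if j = i then 1 else - partial_deriv j g (\<xi> s j)) * inverse (D (\<xi> s i))"
      if s: "v(j := s) \<in> W2" and ne: "s \<noteq> v j" for s
    proof -
      let ?u = "\<Psi> (v(j := s))"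
      have ku: "?u k - u k = (if k = j then s - v j else 0)" if "k \<noteq> i" for k
        using off[OF s that] off[OF v that] by (simp add: u_def)
      have "(\<Sum>k<m. partial_deriv k g (\<xi> s k) * (?u k - u k)) =
         (\<Sum>k<m. (if k = i then D (\<xi> s i) * (?u i - u i) else 0) +
                (if k = j then (if j = i then 0 else partial_deriv j g (\<xi> s j) * (s - v j)) else 0))"
        by (rule sum.cong) (auto simp: ku D_def)
      also have "\<dots> = D (\<xi> s i) * (?u i - u i) + (if j = i then 0 else partial_deriv j g (\<xi> s j) * (s - v j))"
        using i j by (simp add: sum.distrib)
      finally have "D (\<xi> s i) * (?u i - u i) + (if j = i then 0 else partial_deriv j g (\<xi> s j) * (s - v j)) = g ?u - g u"
        using \<xi>(3) s by simp
      also have "\<dots> = (if j = i then s - v j else 0)"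
        using at_i[OF s] at_i[OF v] by (simp add: u_def)
      finally have eq: "D (\<xi> s i) * (?u i - u i) = (if j = i then 1 else - partial_deriv j g (\<xi> s j)) * (s - v j)"
        by (auto split: if_splits)
      have "D (\<xi> s i) \<noteq> 0" using \<xi>(1) s i Dnz W1_def by blast
      then have "?u i - u i = (if j = i then 1 else - partial_deriv j g (\<xi> s j)) * (s - v j) * inverse (D (\<xi> s i))"
        using eq by (metis mult.commute mult.assoc mult.left_neutral right_inverse)
      then show ?thesis using ne by simp
    qed
    have "((\<lambda>s. (if j = i then 1 else - partial_deriv j g (\<xi> s j)) * inverse (D (\<xi> s i))) \<longlongrightarrow> d j v) (at (v j))"
      unfolding d_def u_def[symmetric]
    proof (intro tendsto_mult tendsto_inverse)
      show "((\<lambda>s. D (\<xi> s i)) \<longlongrightarrow> D u) (at (v j))" unfolding D_def by (rule lim[OF i])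
      show "D u \<noteq> 0" using u by (rule Dnz)
      show "((\<lambda>s. if j = i then 1 else - partial_deriv j g (\<xi> s j)) \<longlongrightarrow> (if j = i then 1 else - partial_deriv j g u)) (at (v j))"
        using tendsto_minus[OF lim[OF j]] by simp
    qed
    moreover have quot_ev: "\<forall>\<^sub>F s in at (v j). (\<Psi> (v(j := s)) i - u i) / (s - v j) =
        (if j = i then 1 else - partial_deriv j g (\<xi> s j)) * inverse (D (\<xi> s i))"
      using ev eventually_neq_at_within by eventually_elim (rule quot)
    ultimately have "((\<lambda>s. (\<Psi> (v(j := s)) i - u i) / (s - v j)) \<longlongrightarrow> d j v) (at (v j))"
      by (simp only: tendsto_cong[OF quot_ev])
    then show ?thesis by (simp add: has_field_derivative_iff u_def)
  qed
  \<comment> \<open>The formula \<open>d\<close> contains \<open>\<Psi>\<close> only inside smooth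
    functions, so class \<open>k\<close> of \<open>\<Psi>\<close> yields class \<open>k\<close> of
    its derivatives and thereby class \<open>Suc k\<close> of \<open>\<Psi>\<close>.\<close>
  have Ck: "C_k_on k m W2 (\<lambda>v. \<Psi> v a)" if "a < m" for k a
    using that
  proof (induction k arbitrary: a)
    case 0
    show ?case unfolding C_k_on_0_iff[OF W2E] by (rule cont\<Psi>)
  next
    case (Suc k)
    show ?case
    proof (cases "a = i")
      case False
      show ?thesis by (rule C_k_on_cong[OF W2 _ C_k_on_coord[OF W2, of _ a]]) (use off False in simp)
    next
      case True
      have comp: "C_k_on k m W2 (\<lambda>v. h (\<Psi> v))" if "smooth_on m W1 h" for h
        by (rule C_k_on_comp[OF W2 W1 smooth_on_C_k[OF that] Suc.IH \<Psi>W1])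
      have "C_k_on (Suc k) m W2 (\<lambda>v. \<Psi> v i)"
      proof (rule C_k_on_SucI[OF W2 cont\<Psi> deriv])
        show "C_k_on k m W2 (d j)" if "j < m" for j
          unfolding d_def
        proof (intro C_k_on_mult[OF W2] C_k_on_inverse[OF W2])
          show "C_k_on k m W2 (\<lambda>v. D (\<Psi> v))"
            unfolding D_def by (rule comp[OF smooth_on_partial_deriv[OF gW1 i]])
          show "D (\<Psi> v) \<noteq> 0" if "v \<in> W2" for v by (rule Dnz[OF \<Psi>W1[OF that]])
          show "C_k_on k m W2 (\<lambda>v. if j = i then 1 else - partial_deriv j g (\<Psi> v))"
            using C_k_on_const[OF W2] C_k_on_uminus[OF W2 comp[OF smooth_on_partial_deriv[OF gW1 that]]]
            by (cases "j = i") simp_all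
        qed
      qed
      then show ?thesis using True by simp
    qed
  qed
  have "smooth_vec m m W2 \<Psi>"
    unfolding smooth_vec_def smooth_on_def using W2 Ck \<Psi>W1 W1E by blast
  then have "coord_diffeo m W1 W2 \<Theta> \<Psi>"
    unfolding coord_diffeo_def using \<Theta>_smooth \<Psi>(2,3) \<Psi>W1 W2_def by blast
  moreover have "\<Theta> = (\<lambda>u. u(i := g u))" by (simp add: \<Theta>_def fun_eq_iff)
  moreover have "u0 \<in> W1" unfolding W1_def by (rule center_in_cube[OF u0E r(1)])
  ultimately show ?thesis using that W1W by metis
qed

section \<open>Second-order jets and the transformation of fibers\<close>

text \<open>The first-order chain rule holds on all of the open set \<open>W\<close>, not just at
  \<open>u\<close>, and may therefore be differentiated once more by the product rule.\<close>

lemma partial_deriv2_comp: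
  assumes g: "smooth_on m' W' g" and h: "smooth_vec m m' W h" and hW: "\<And>u. u \<in> W \<Longrightarrow> h u \<in> W'"
    and u: "u \<in> W" and j: "j < m" and q: "q < m"
  shows "partial_deriv j (partial_deriv q (\<lambda>v. g (h v))) u =
    (\<Sum>a<m'. \<Sum>b<m'. partial_deriv a (partial_deriv b g) (h u) * partial_deriv j (\<lambda>v. h v a) u * partial_deriv q (\<lambda>v. h v b) u) +
    (\<Sum>b<m'. partial_deriv b g (h u) * partial_deriv j (partial_deriv q (\<lambda>v. h v b)) u)"
proof -
  have W: "openin (Euclidean_space m) W" using h by (rule smooth_vec_open)
  have sm1: "smooth_on m W (\<lambda>v. partial_deriv b g (h v))" if "b < m'" for b
    by (rule smooth_on_comp_vec[OF smooth_on_partial_deriv[OF g that] h hW])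
  have sm2: "smooth_on m W (partial_deriv q (\<lambda>v. h v b))" if "b < m'" for b
    by (rule smooth_on_partial_deriv[OF smooth_vec_coord[OF h that] q])
  have "partial_deriv j (partial_deriv q (\<lambda>v. g (h v))) u =
      partial_deriv j (\<lambda>v. \<Sum>b<m'. partial_deriv b g (h v) * partial_deriv q (\<lambda>v. h v b) v) u"
    by (rule partial_deriv_cong[OF W u j])
      (rule partial_deriv_comp_smooth[OF g W smooth_vec_coord[OF h] hW _ q])
  also have "\<dots> = (\<Sum>b<m'. partial_deriv j (\<lambda>v. partial_deriv b g (h v) * partial_deriv q (\<lambda>v. h v b) v) u)"
    by (rule partial_deriv_sum[OF _ u j]) (simp add: smooth_on_mult sm1 sm2)
  also have "\<dots> = (\<Sum>b<m'. (\<Sum>a<m'. partial_deriv a (partial_deriv b g) (h u) * partial_deriv j (\<lambda>v. h v a) u) * partial_deriv q (\<lambda>v. h v b) u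
      + partial_deriv b g (h u) * partial_deriv j (partial_deriv q (\<lambda>v. h v b)) u)"
  proof (rule sum.cong[OF refl])
    fix b assume "b \<in> {..<m'}"
    then have b: "b < m'" by simp
    have "partial_deriv j (\<lambda>v. partial_deriv b g (h v)) u = (\<Sum>a<m'. partial_deriv a (partial_deriv b g) (h u) * partial_deriv j (\<lambda>v. h v a) u)"
      by (rule partial_deriv_comp_smooth[OF smooth_on_partial_deriv[OF g b] W smooth_vec_coord[OF h] hW u j])
    then show "partial_deriv j (\<lambda>v. partial_deriv b g (h v) * partial_deriv q (\<lambda>v. h v b) v) u =
        (\<Sum>a<m'. partial_deriv a (partial_deriv b g) (h u) * partial_deriv j (\<lambda>v. h v a) u) * partial_deriv q (\<lambda>v. h v b) u
      + partial_deriv b g (h u) * partial_deriv j (partial_deriv q (\<lambda>v. h v b)) u"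
      using partial_deriv_mult[OF sm1[OF b] sm2[OF b] u j] by simp
  qed
  also have "\<dots> = (\<Sum>b<m'. \<Sum>a<m'. partial_deriv a (partial_deriv b g) (h u) * partial_deriv j (\<lambda>v. h v a) u * partial_deriv q (\<lambda>v. h v b) u) +
    (\<Sum>b<m'. partial_deriv b g (h u) * partial_deriv j (partial_deriv q (\<lambda>v. h v b)) u)"
    by (simp add: sum.distrib sum_distrib_right)
  also have "\<dots> = (\<Sum>a<m'. \<Sum>b<m'. partial_deriv a (partial_deriv b g) (h u) * partial_deriv j (\<lambda>v. h v a) u * partial_deriv q (\<lambda>v. h v b) u) +
    (\<Sum>b<m'. partial_deriv b g (h u) * partial_deriv j (partial_deriv q (\<lambda>v. h v b)) u)"
    by (rule arg_cong2[where f = "(+)", OF sum.swap refl])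
  finally show ?thesis .
qed

text \<open>This and the next two rearrangements collect the three kinds of terms in the composition
  law of 2-jets: differential after differential, differential after Hessian, and Hessian after two
  differentials.\<close>

lemma sum_mult_sum_swap:
  fixes A :: "nat \<Rightarrow> real"
  shows "(\<Sum>a<m'. A a * (\<Sum>j<m. P a j * f j)) = (\<Sum>j<m. (\<Sum>a<m'. A a * P a j) * f j)"
proof -
  have "(\<Sum>a<m'. A a * (\<Sum>j<m. P a j * f j)) = (\<Sum>a<m'. \<Sum>j<m. A a * P a j * f j)"
    by (simp add: sum_distrib_left mult.assoc)
  also have "\<dots> = (\<Sum>j<m. \<Sum>a<m'. A a * P a j * f j)" by (rule sum.swap)
  finally show ?thesis by (simp add: sum_distrib_right)
qed

lemma sum_mult_sum2_swap:
  fixes A :: "nat \<Rightarrow> real"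
  shows "(\<Sum>a<m'. A a * (\<Sum>j<m. \<Sum>q<m. Q a j q * x j * y q)) = (\<Sum>j<m. \<Sum>q<m. (\<Sum>a<m'. A a * Q a j q) * x j * y q)"
proof -
  have "(\<Sum>a<m'. A a * (\<Sum>j<m. \<Sum>q<m. Q a j q * x j * y q)) = (\<Sum>a<m'. \<Sum>j<m. \<Sum>q<m. A a * Q a j q * x j * y q)"
    by (simp add: sum_distrib_left mult.assoc)
  also have "\<dots> = (\<Sum>j<m. \<Sum>a<m'. \<Sum>q<m. A a * Q a j q * x j * y q)" by (rule sum.swap)
  also have "\<dots> = (\<Sum>j<m. \<Sum>q<m. \<Sum>a<m'. A a * Q a j q * x j * y q)" by (intro sum.cong refl sum.swap)
  finally show ?thesis by (simp add: sum_distrib_right)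
qed

lemma sum2_mult_sums_swap:
  fixes B :: "nat \<Rightarrow> nat \<Rightarrow> real"
  shows "(\<Sum>a<m'. \<Sum>b<m'. B a b * (\<Sum>j<m. P a j * x j) * (\<Sum>q<m. P b q * y q)) =
    (\<Sum>j<m. \<Sum>q<m. (\<Sum>a<m'. \<Sum>b<m'. B a b * P a j * P b q) * x j * y q)"
proof -
  have "(\<Sum>a<m'. \<Sum>b<m'. B a b * (\<Sum>j<m. P a j * x j) * (\<Sum>q<m. P b q * y q)) =
    (\<Sum>a<m'. \<Sum>b<m'. \<Sum>j<m. \<Sum>q<m. B a b * P a j * P b q * x j * y q)"
  proof (intro sum.cong refl)
    fix a b
    have "B a b * (\<Sum>j<m. P a j * x j) * (\<Sum>q<m. P b q * y q) = B a b * (\<Sum>j<m. \<Sum>q<m. P a j * x j * (P b q * y q))"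
      by (simp only: mult.assoc sum_product)
    also have "\<dots> = (\<Sum>j<m. \<Sum>q<m. B a b * P a j * P b q * x j * y q)"
      unfolding sum_distrib_left by (intro sum.cong refl) (simp add: mult_ac)
    finally show "B a b * (\<Sum>j<m. P a j * x j) * (\<Sum>q<m. P b q * y q) = (\<Sum>j<m. \<Sum>q<m. B a b * P a j * P b q * x j * y q)" .
  qed
  also have "\<dots> = (\<Sum>a<m'. \<Sum>j<m. \<Sum>b<m'. \<Sum>q<m. B a b * P a j * P b q * x j * y q)"
    by (rule sum.cong[OF refl], rule sum.swap)
  also have "\<dots> = (\<Sum>j<m. \<Sum>a<m'. \<Sum>b<m'. \<Sum>q<m. B a b * P a j * P b q * x j * y q)"
    by (rule sum.swap)
  also have "\<dots> = (\<Sum>j<m. \<Sum>a<m'. \<Sum>q<m. \<Sum>b<m'. B a b * P a j * P b q * x j * y q)"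
    by (rule sum.cong[OF refl], rule sum.cong[OF refl], rule sum.swap)
  also have "\<dots> = (\<Sum>j<m. \<Sum>q<m. \<Sum>a<m'. \<Sum>b<m'. B a b * P a j * P b q * x j * y q)"
    by (rule sum.cong[OF refl], rule sum.swap)
  finally show ?thesis by (simp add: sum_distrib_right)
qed

section \<open>Forests as a finite index set\<close>

lemma Vertex_in_forests [simp]: "Vertex \<alpha> \<in> forests n \<longleftrightarrow> \<alpha> \<in> {1..n}"
  by (auto simp: forests_def)

lemma Two_in_forests [simp]: "Two (Upair \<alpha> \<beta>) \<in> forests n \<longleftrightarrow> \<alpha> \<in> {1..n} \<and> \<beta> \<in> {1..n}"
  by (auto simp: forests_def Upair_inject)

lemma Ladder_in_forests [simp]: "Ladder \<alpha> \<beta> \<in> forests n \<longleftrightarrow> \<alpha> \<in> {1..n} \<and> \<beta> \<in> {1..n}"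
  by (auto simp: forests_def)

lemma finite_forests: "finite (forests n)"
proof -
  have "forests n \<subseteq> Vertex ` {1..n} \<union> (\<lambda>(\<alpha>, \<beta>). Two (Upair \<alpha> \<beta>)) ` ({1..n} \<times> {1..n}) \<union> (\<lambda>(\<alpha>, \<beta>). Ladder \<alpha> \<beta>) ` ({1..n} \<times> {1..n})"
    unfolding forests_def by auto
  then show ?thesis by (rule finite_subset) simp
qed

lemma forests_cases:
  assumes "\<tau> \<in> forests n"
  obtains (Vertex) \<alpha> where "\<tau> = Vertex \<alpha>" "\<alpha> \<in> {1..n}"
    | (Two) \<alpha> \<beta> where "\<tau> = Two (Upair \<alpha> \<beta>)" "\<alpha> \<in> {1..n}" "\<beta> \<in> {1..n}"
    | (Ladder) \<alpha> \<beta> where "\<tau> = Ladder \<alpha> \<beta>" "\<alpha> \<in> {1..n}" "\<beta> \<in> {1..n}"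
  using assms unfolding forests_def by blast

section \<open>The jet action: uniqueness, locality, composition, existence and inverses\<close>

lemma jet_push_Vertex:
  assumes "jet_push m m' n h u f g" "i < m'" "\<alpha> \<in> {1..n}"
  shows "g i (Vertex \<alpha>) = (\<Sum>j<m. partial_deriv j (\<lambda>v. h v i) u * f j (Vertex \<alpha>))"
  using assms unfolding jet_push_def by blast

lemma jet_push_Ladder:
  assumes "jet_push m m' n h u f g" "i < m'" "\<alpha> \<in> {1..n}" "\<beta> \<in> {1..n}"
  shows "g i (Ladder \<alpha> \<beta>) = (\<Sum>j<m. partial_deriv j (\<lambda>v. h v i) u * f j (Ladder \<alpha> \<beta>))"
  using assms unfolding jet_push_def by blast

lemma jet_push_Two:
  assumes "jet_push m m' n h u f g" "i < m'" "\<alpha> \<in> {1..n}" "\<beta> \<in> {1..n}"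
  shows "g i (Two (Upair \<alpha> \<beta>)) =
          (\<Sum>j<m. partial_deriv j (\<lambda>v. h v i) u * f j (Two (Upair \<alpha> \<beta>))) +
          (\<Sum>j<m. \<Sum>k<m. partial_deriv j (partial_deriv k (\<lambda>v. h v i)) u *
                            f j (Vertex \<alpha>) * f k (Vertex \<beta>))"
  using assms unfolding jet_push_def by blast

lemma jet_push_fiber_space: "jet_push m m' n h u f g \<Longrightarrow> g \<in> fiber_space m' n"
  by (simp add: jet_push_def)

lemma fiber_space_eqI:
  assumes "f \<in> fiber_space m n" "g \<in> fiber_space m n"
    and "\<And>i \<tau>. i < m \<Longrightarrow> \<tau> \<in> forests n \<Longrightarrow> f i \<tau> = g i \<tau>"
  shows "f = g"
proof (intro ext)
  fix i \<tau>
  show "f i \<tau> = g i \<tau>"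
    using assms unfolding fiber_space_def mem_Collect_eq by metis
qed

lemma jet_push_unique:
  assumes "jet_push m m' n h u f g" "jet_push m m' n h u f g'"
  shows "g = g'"
proof (rule fiber_space_eqI)
  show "g i \<tau> = g' i \<tau>" if "i < m'" "\<tau> \<in> forests n" for i \<tau>
    using that(2)
    by (cases rule: forests_cases)
      (simp_all add: jet_push_Vertex[OF assms(1) that(1)] jet_push_Vertex[OF assms(2) that(1)]
       jet_push_Ladder[OF assms(1) that(1)] jet_push_Ladder[OF assms(2) that(1)]
       jet_push_Two[OF assms(1) that(1)] jet_push_Two[OF assms(2) that(1)])
qed (use assms jet_push_fiber_space in blast)+

lemma jet_push_cong:
  assumes J: "jet_push m m' n h u f g"
    and e1: "\<And>i j. i < m' \<Longrightarrow> j < m \<Longrightarrow> partial_deriv j (\<lambda>v. h v i) u = partial_deriv j (\<lambda>v. h' v i) u"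
    and e2: "\<And>i j k. i < m' \<Longrightarrow> j < m \<Longrightarrow> k < m \<Longrightarrow>
      partial_deriv j (partial_deriv k (\<lambda>v. h v i)) u = partial_deriv j (partial_deriv k (\<lambda>v. h' v i)) u"
  shows "jet_push m m' n h' u f g"
proof -
  have s1: "(\<Sum>j<m. partial_deriv j (\<lambda>v. h v i) u * x j) = (\<Sum>j<m. partial_deriv j (\<lambda>v. h' v i) u * x j)"
    if "i < m'" for i x by (rule sum.cong) (simp_all add: e1[OF that])
  have s2: "(\<Sum>j<m. \<Sum>k<m. partial_deriv j (partial_deriv k (\<lambda>v. h v i)) u * x j * y k) =
     (\<Sum>j<m. \<Sum>k<m. partial_deriv j (partial_deriv k (\<lambda>v. h' v i)) u * x j * y k)"
    if "i < m'" for i x y by (intro sum.cong) (simp_all add: e2[OF that])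
  show ?thesis
    unfolding jet_push_def
    using jet_push_fiber_space[OF J] jet_push_Vertex[OF J] jet_push_Ladder[OF J] jet_push_Two[OF J] s1 s2
    by simp
qed

lemma same_2jet_jet_push:
  assumes "same_2jet m m' h h' u" "jet_push m m' n h u f g"
  shows "jet_push m m' n h' u f g"
  using assms(1) by (intro jet_push_cong[OF assms(2)]) (simp_all add: same_2jet_def)

lemma same_2jet_sym: "same_2jet m m' h h' u \<Longrightarrow> same_2jet m m' h' h u"
  by (simp add: same_2jet_def)

lemma same_2jet_trans: "same_2jet m m' h h' u \<Longrightarrow> same_2jet m m' h' h'' u \<Longrightarrow> same_2jet m m' h h'' u"
  by (simp add: same_2jet_def)

lemma partial_deriv2_cong:
  assumes W: "openin (Euclidean_space m) W" and u: "u \<in> W" and j: "j < m" and k: "k < m"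
    and eq: "\<And>v. v \<in> W \<Longrightarrow> g v = h v"
  shows "partial_deriv j (partial_deriv k g) u = partial_deriv j (partial_deriv k h) u"
  by (rule partial_deriv_cong[OF W u j]) (rule partial_deriv_cong[OF W _ k eq])

lemma same_2jet_local:
  assumes W: "openin (Euclidean_space m) W" and u: "u \<in> W" and eq: "\<And>v. v \<in> W \<Longrightarrow> h v = h' v"
  shows "same_2jet m m' h h' u"
  unfolding same_2jet_def
  using eq[OF u] partial_deriv_cong[OF W u, of _ "\<lambda>v. h v i" "\<lambda>v. h' v i" for i]
    partial_deriv2_cong[OF W u, of _ _ "\<lambda>v. h v i" "\<lambda>v. h' v i" for i] eq by simp

lemma jet_push_local:
  assumes "openin (Euclidean_space m) W" "u \<in> W" "\<And>v. v \<in> W \<Longrightarrow> h v = h' v" "jet_push m m' n h u f g"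
  shows "jet_push m m' n h' u f g"
  by (rule same_2jet_jet_push[OF same_2jet_local[OF assms(1-3)] assms(4)])

text \<open>Functoriality of the action. Pushing twice produces two quadratic contributions, the
  Hessian of \<open>k\<close> on pushed vertices and the differential of \<open>k\<close> on the
  Hessian of \<open>h\<close>; by the second-order chain rule their sum is the Hessian of the
  composite.\<close>

lemma jet_push_comp:
  assumes h: "smooth_vec m m' W h" and k: "smooth_vec m' m'' W' k" and u: "u \<in> W" "h u \<in> W'"
    and f: "jet_push m m' n h u f g" and g: "jet_push m' m'' n k (h u) g l"
  shows "jet_push m m'' n (\<lambda>v. k (h v)) u f l"
proof -
  define W0 where "W0 = {u \<in> W. h u \<in> W'}"
  have W0: "openin (Euclidean_space m) W0"
    unfolding W0_def by (rule smooth_vec_preimage_open[OF h smooth_vec_open[OF k]])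
  have h0: "smooth_vec m m' W0 h" by (rule smooth_vec_subset[OF h _ W0]) (auto simp: W0_def)
  have hW': "\<And>u. u \<in> W0 \<Longrightarrow> h u \<in> W'" by (simp add: W0_def)
  have u0: "u \<in> W0" using u by (simp add: W0_def)
  note d1 = partial_deriv_comp_smooth[OF smooth_vec_coord[OF k] W0 smooth_vec_coord[OF h0] hW' u0]
  note d2 = partial_deriv2_comp[OF smooth_vec_coord[OF k] h0 hW' u0]
  show ?thesis
    unfolding jet_push_def
  proof (intro conjI allI impI ballI)
    show "l \<in> fiber_space m'' n" using g by (rule jet_push_fiber_space)
    fix i \<alpha> \<beta> assume i: "i < m''" and \<alpha>: "\<alpha> \<in> {1..n}" and \<beta>: "\<beta> \<in> {1..n}"
    show "l i (Vertex \<alpha>) = (\<Sum>j<m. partial_deriv j (\<lambda>v. k (h v) i) u * f j (Vertex \<alpha>))"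
      by (simp add: jet_push_Vertex[OF g i \<alpha>] jet_push_Vertex[OF f _ \<alpha>] d1[OF i] sum_mult_sum_swap)
    show "l i (Ladder \<alpha> \<beta>) = (\<Sum>j<m. partial_deriv j (\<lambda>v. k (h v) i) u * f j (Ladder \<alpha> \<beta>))"
      by (simp add: jet_push_Ladder[OF g i \<alpha> \<beta>] jet_push_Ladder[OF f _ \<alpha> \<beta>] d1[OF i] sum_mult_sum_swap)
    show "l i (Two (Upair \<alpha> \<beta>)) =
          (\<Sum>j<m. partial_deriv j (\<lambda>v. k (h v) i) u * f j (Two (Upair \<alpha> \<beta>))) +
          (\<Sum>j<m. \<Sum>q<m. partial_deriv j (partial_deriv q (\<lambda>v. k (h v) i)) u *
                            f j (Vertex \<alpha>) * f q (Vertex \<beta>))"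
    proof -
      let ?k = "\<lambda>v. k v i"
      have "(\<Sum>a<m'. partial_deriv a ?k (h u) * g a (Two (Upair \<alpha> \<beta>))) =
          (\<Sum>a<m'. partial_deriv a ?k (h u) * (\<Sum>j<m. partial_deriv j (\<lambda>v. h v a) u * f j (Two (Upair \<alpha> \<beta>)))) +
          (\<Sum>a<m'. partial_deriv a ?k (h u) * (\<Sum>j<m. \<Sum>q<m. partial_deriv j (partial_deriv q (\<lambda>v. h v a)) u *
                            f j (Vertex \<alpha>) * f q (Vertex \<beta>)))"
        unfolding sum.distrib[symmetric] by (intro sum.cong refl) (simp add: jet_push_Two[OF f _ \<alpha> \<beta>] distrib_left)
      also have "\<dots> = (\<Sum>j<m. partial_deriv j (\<lambda>v. k (h v) i) u * f j (Two (Upair \<alpha> \<beta>))) +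
          (\<Sum>j<m. \<Sum>q<m. (\<Sum>a<m'. partial_deriv a ?k (h u) * partial_deriv j (partial_deriv q (\<lambda>v. h v a)) u) *
                            f j (Vertex \<alpha>) * f q (Vertex \<beta>))"
        unfolding sum_mult_sum_swap sum_mult_sum2_swap by (simp add: d1[OF i])
      finally have 1: "(\<Sum>a<m'. partial_deriv a ?k (h u) * g a (Two (Upair \<alpha> \<beta>))) = \<dots>" .
      have "(\<Sum>a<m'. \<Sum>b<m'. partial_deriv a (partial_deriv b ?k) (h u) * g a (Vertex \<alpha>) * g b (Vertex \<beta>)) =
          (\<Sum>a<m'. \<Sum>b<m'. partial_deriv a (partial_deriv b ?k) (h u) *
             (\<Sum>j<m. partial_deriv j (\<lambda>v. h v a) u * f j (Vertex \<alpha>)) * (\<Sum>q<m. partial_deriv q (\<lambda>v. h v b) u * f q (Vertex \<beta>)))"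
        by (intro sum.cong refl) (simp add: jet_push_Vertex[OF f _ \<alpha>] jet_push_Vertex[OF f _ \<beta>])
      also have "\<dots> = (\<Sum>j<m. \<Sum>q<m. (\<Sum>a<m'. \<Sum>b<m'. partial_deriv a (partial_deriv b ?k) (h u) *
             partial_deriv j (\<lambda>v. h v a) u * partial_deriv q (\<lambda>v. h v b) u) * f j (Vertex \<alpha>) * f q (Vertex \<beta>))"
        by (rule sum2_mult_sums_swap)
      finally have 2: "(\<Sum>a<m'. \<Sum>b<m'. partial_deriv a (partial_deriv b ?k) (h u) * g a (Vertex \<alpha>) * g b (Vertex \<beta>)) = \<dots>" .
      \<comment> \<open>The second-order chain rule splits the Hessian term of the composite into
        the quadratic sums that occur in \<open>1\<close> and \<open>2\<close>.\<close>
      have 3: "(\<Sum>j<m. \<Sum>q<m. partial_deriv j (partial_deriv q (\<lambda>v. k (h v) i)) u * f j (Vertex \<alpha>) * f q (Vertex \<beta>)) =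
          (\<Sum>j<m. \<Sum>q<m. (\<Sum>a<m'. \<Sum>b<m'. partial_deriv a (partial_deriv b ?k) (h u) *
             partial_deriv j (\<lambda>v. h v a) u * partial_deriv q (\<lambda>v. h v b) u) * f j (Vertex \<alpha>) * f q (Vertex \<beta>)) +
          (\<Sum>j<m. \<Sum>q<m. (\<Sum>a<m'. partial_deriv a ?k (h u) * partial_deriv j (partial_deriv q (\<lambda>v. h v a)) u) *
                            f j (Vertex \<alpha>) * f q (Vertex \<beta>))"
        unfolding sum.distrib[symmetric] by (intro sum.cong refl) (simp add: d2[OF i] distrib_right)
      show ?thesis unfolding jet_push_Two[OF g i \<alpha> \<beta>] 1 2 3 by simp
    qed
  qed
qed

text \<open>The one obstruction is that the value at an unordered pair is prescribed for both orders
  of its labels. The quadratic parts agree because second derivatives commute.\<close>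

lemma jet_push_exists:
  assumes h: "smooth_vec m m' W h" and u: "u \<in> W"
  obtains g where "jet_push m m' n h u f g"
proof -
  define L where "L i \<tau> = (\<Sum>j<m. partial_deriv j (\<lambda>v. h v i) u * f j \<tau>)" for i \<tau>
  define Q where "Q i \<alpha> \<beta> = (\<Sum>j<m. \<Sum>k<m. partial_deriv j (partial_deriv k (\<lambda>v. h v i)) u * f j (Vertex \<alpha>) * f k (Vertex \<beta>))" for i \<alpha> \<beta>
  have sym: "Q i \<alpha> \<beta> = Q i \<beta> \<alpha>" if i: "i < m'" for i \<alpha> \<beta>
  proof -
    have "Q i \<alpha> \<beta> = (\<Sum>k<m. \<Sum>j<m. partial_deriv j (partial_deriv k (\<lambda>v. h v i)) u * f j (Vertex \<alpha>) * f k (Vertex \<beta>))"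
      unfolding Q_def by (rule sum.swap)
    also have "\<dots> = Q i \<beta> \<alpha>"
      unfolding Q_def
      by (intro sum.cong refl) (simp add: partial_deriv_commute[OF smooth_vec_coord[OF h i] u] mult_ac)
    finally show ?thesis .
  qed
  \<comment> \<open>The description reads the quadratic part off any ordering of the pair
    \<open>P\<close>; symmetry makes it well defined.\<close>
  define g where "g i \<tau> = (if i < m' \<and> \<tau> \<in> forests n then L i \<tau> +
     (case \<tau> of Two P \<Rightarrow> (THE c. \<exists>\<alpha> \<beta>. P = Upair \<alpha> \<beta> \<and> c = Q i \<alpha> \<beta>) | _ \<Rightarrow> 0) else 0)" for i \<tau>
  have the: "(THE c. \<exists>\<alpha>' \<beta>'. Upair \<alpha> \<beta> = Upair \<alpha>' \<beta>' \<and> c = Q i \<alpha>' \<beta>') = Q i \<alpha> \<beta>" if "i < m'" for i \<alpha> \<beta>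
    by (rule the_equality) (use sym[OF that] in \<open>auto simp: Upair_inject\<close>)
  have "jet_push m m' n h u f g"
    unfolding jet_push_def using the by (auto simp: g_def fiber_space_def L_def[symmetric] Q_def[symmetric])
  then show ?thesis by (rule that)
qed

lemma jet_push_id:
  assumes "f \<in> fiber_space m n"
  shows "jet_push m m n (\<lambda>v. v) u f f"
proof -
  have "partial_deriv k (\<lambda>v. v i) = (\<lambda>_. if k = i then 1 else 0)" for i k by (rule ext) (rule partial_deriv_coord)
  then show ?thesis using assms by (simp add: jet_push_def if_distrib[of "\<lambda>x. x * _"] cong: if_cong)
qed

text \<open>Some \<open>f'\<close> is the push of \<open>g\<close> under \<open>k\<close>. Then
  \<open>f'\<close> is also the push of \<open>f\<close> under the composite, which is the identity
  near \<open>u\<close>, so uniqueness gives \<open>f' = f\<close>.\<close>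

lemma jet_push_inverse:
  assumes h: "smooth_vec m m W h" and k: "smooth_vec m m W' k" and u: "u \<in> W" "h u \<in> W'"
    and inv: "\<And>v. v \<in> W \<Longrightarrow> k (h v) = v" and f: "f \<in> fiber_space m n" and J: "jet_push m m n h u f g"
  shows "jet_push m m n k (h u) g f"
proof -
  obtain f' where f': "jet_push m m n k (h u) g f'" by (rule jet_push_exists[OF k u(2)])
  have "jet_push m m n (\<lambda>v. k (h v)) u f f'" by (rule jet_push_comp[OF h k u J f'])
  then have "jet_push m m n (\<lambda>v. v) u f f'"
    using jet_push_local[OF smooth_vec_open[OF h] u(1), of "\<lambda>v. k (h v)" "\<lambda>v. v"] inv by blast
  then have "f' = f" using jet_push_unique jet_push_id[OF f] by blast
  then show ?thesis using f' by simp
qed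

section \<open>Global polynomial representatives of 2-jets\<close>

lemma partial_deriv_linear_form:
  assumes "l < m" "u \<in> coord_space m"
  shows "partial_deriv l (\<lambda>v. \<Sum>j<m. A j * v j) u = A l"
proof -
  have E: "openin (Euclidean_space m) (coord_space m)" by simp
  have "partial_deriv l (\<lambda>v. \<Sum>j<m. A j * v j) u = (\<Sum>j<m. partial_deriv l (\<lambda>v. A j * v j) u)"
    by (rule partial_deriv_sum[OF _ assms(2,1)]) (intro smooth_on_mult smooth_on_const smooth_on_coord E)
  also have "\<dots> = (\<Sum>j<m. if l = j then A j else 0)"
    by (intro sum.cong refl)
      (simp add: partial_deriv_mult[OF smooth_on_const[OF E] smooth_on_coord[OF E] assms(2,1)] partial_deriv_coord)
  finally show ?thesis using assms(1) by simp
qed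

lemma smooth_on_linear_form:
  assumes "openin (Euclidean_space m) W"
  shows "smooth_on m W (\<lambda>v. \<Sum>j<m. A j * v j)"
  by (intro smooth_on_sum smooth_on_mult smooth_on_const smooth_on_coord assms)

lemma partial_deriv_quadratic_form:
  assumes "l < m" "u \<in> coord_space m"
  shows "partial_deriv l (\<lambda>v. \<Sum>j<m. v j * (\<Sum>k<m. B j k * v k)) u = (\<Sum>k<m. (B l k + B k l) * u k)"
proof -
  have E: "openin (Euclidean_space m) (coord_space m)" by simp
  have "partial_deriv l (\<lambda>v. \<Sum>j<m. v j * (\<Sum>k<m. B j k * v k)) u = (\<Sum>j<m. partial_deriv l (\<lambda>v. v j * (\<Sum>k<m. B j k * v k)) u)"
    by (rule partial_deriv_sum[OF _ assms(2,1)]) (intro smooth_on_mult smooth_on_coord smooth_on_linear_form E)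
  also have "\<dots> = (\<Sum>j<m. (if l = j then (\<Sum>k<m. B l k * u k) else 0) + B j l * u j)"
    by (intro sum.cong refl)
      (simp add: partial_deriv_mult[OF smooth_on_coord[OF E] smooth_on_linear_form[OF E] assms(2,1)] partial_deriv_coord
        partial_deriv_linear_form[OF assms])
  finally show ?thesis using assms(1) by (simp add: sum.distrib distrib_right)
qed

text \<open>Elements of the structure group are represented by maps that are smooth on the whole
  coordinate space, whereas the transition between two frames exists only near the origin. The
  second-order Taylor polynomial of the transition is global and has the same 2-jet.\<close>

lemma quadratic_jet_representative:
  assumes c: "smooth_vec m m W c" and 0: "origin \<in> W" "c origin = origin"
  obtains a where "smooth_origin_map m a" "same_2jet m m a c origin"
proof -
  have E: "openin (Euclidean_space m) (coord_space m)" by simp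
  have 0: "origin \<in> coord_space m" by (simp add: mem_coord_space)
  define A where "A i j = partial_deriv j (\<lambda>v. c v i) origin" for i j
  \<comment> \<open>Half the Hessian, because differentiating the quadratic form twice meets every
    coefficient of the symmetric \<open>B\<close> twice.\<close>
  define B where "B i j k = partial_deriv j (partial_deriv k (\<lambda>v. c v i)) origin / 2" for i j k
  have Bsym: "B i j k = B i k j" if "i < m" "j < m" "k < m" for i j k
    unfolding B_def using partial_deriv_commute[OF smooth_vec_coord[OF c that(1)] assms(2) that(2,3)] by simp
  define a where "a u i = (if i < m then (\<Sum>j<m. A i j * u j) + (\<Sum>j<m. u j * (\<Sum>k<m. B i j k * u k)) else 0)" for u i
  have sm_quad: "smooth_on m (coord_space m) (\<lambda>u. \<Sum>j<m. u j * (\<Sum>k<m. B i j k * u k))" for i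
    by (intro smooth_on_sum smooth_on_mult smooth_on_coord smooth_on_linear_form E)
  have sm: "smooth_on m (coord_space m) (\<lambda>u. a u i)" if "i < m" for i
    using smooth_on_add[OF smooth_on_linear_form[OF E, of "A i"] sm_quad[of i]] that by (simp add: a_def)
  have d1: "partial_deriv l (\<lambda>u. a u i) u = A i l + (\<Sum>k<m. (B i l k + B i k l) * u k)"
    if "i < m" "l < m" "u \<in> coord_space m" for i l u
    using partial_deriv_add[OF smooth_on_linear_form[OF E, of "A i"] sm_quad[of i] that(3,2)]
    by (simp add: a_def that partial_deriv_linear_form partial_deriv_quadratic_form)
  have d2: "partial_deriv p (partial_deriv l (\<lambda>u. a u i)) origin = B i l p + B i p l"
    if i: "i < m" and l: "l < m" and p: "p < m" for i l p
  proof -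
    have "partial_deriv p (partial_deriv l (\<lambda>u. a u i)) origin =
        partial_deriv p (\<lambda>u. A i l + (\<Sum>k<m. (B i l k + B i k l) * u k)) origin"
      by (rule partial_deriv_cong[OF E 0 p]) (rule d1[OF i l])
    also have "\<dots> = B i l p + B i p l"
      by (simp add: partial_deriv_add[OF smooth_on_const[OF E] smooth_on_linear_form[OF E] 0 p] partial_deriv_linear_form[OF p 0])
    finally show ?thesis .
  qed
  have "a origin = origin" by (auto simp: a_def)
  then have "smooth_origin_map m a"
    unfolding smooth_origin_map_def using sm by (auto simp: a_def mem_coord_space)
  moreover have "same_2jet m m a c origin"
    unfolding same_2jet_def
  proof (intro conjI allI impI)
    show "a origin = c origin" using \<open>a origin = origin\<close> assms(3) by simp
    fix i j assume i: "i < m" and j: "j < m"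
    show "partial_deriv j (\<lambda>v. a v i) origin = partial_deriv j (\<lambda>v. c v i) origin"
      using d1[OF i j 0] by (simp add: A_def)
    fix k assume k: "k < m"
    show "partial_deriv j (partial_deriv k (\<lambda>v. a v i)) origin = partial_deriv j (partial_deriv k (\<lambda>v. c v i)) origin"
      using d2[OF i k j] Bsym[OF i k j] by (simp add: B_def)
  qed
  ultimately show ?thesis by (rule that)
qed

text \<open>The two chain rules express the 2-jet of a composite through the 2-jets of its factors
  alone. They are proved for arbitrary maps and then instantiated for both composites.\<close>

lemma same_2jet_comp:
  assumes h: "smooth_vec m m' W h" "smooth_vec m m' V h'" and k: "smooth_vec m' m'' W' k" "smooth_vec m' m'' V' k'"
    and u: "u \<in> W" "u \<in> V" "h u \<in> W'" "h u \<in> V'"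
    and jh: "same_2jet m m' h h' u" and jk: "same_2jet m' m'' k k' (h u)"
  shows "same_2jet m m'' (\<lambda>v. k (h v)) (\<lambda>v. k' (h' v)) u"
proof -
  have d: "partial_deriv j (\<lambda>v. k (h v) i) u = (\<Sum>a<m'. partial_deriv a (\<lambda>v. k v i) (h u) * partial_deriv j (\<lambda>v. h v a) u)"
    "partial_deriv j (partial_deriv q (\<lambda>v. k (h v) i)) u =
    (\<Sum>a<m'. \<Sum>b<m'. partial_deriv a (partial_deriv b (\<lambda>v. k v i)) (h u) * partial_deriv j (\<lambda>v. h v a) u * partial_deriv q (\<lambda>v. h v b) u) +
    (\<Sum>b<m'. partial_deriv b (\<lambda>v. k v i) (h u) * partial_deriv j (partial_deriv q (\<lambda>v. h v b)) u)"
    if h: "smooth_vec m m' W h" and k: "smooth_vec m' m'' W' k" and u: "u \<in> W" "h u \<in> W'"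
      and i: "i < m''" and j: "j < m" and q: "q < m"
    for h k W W' i j q
  proof -
    define W0 where "W0 = {u \<in> W. h u \<in> W'}"
    have W0: "openin (Euclidean_space m) W0"
      unfolding W0_def by (rule smooth_vec_preimage_open[OF h smooth_vec_open[OF k]])
    have h0: "smooth_vec m m' W0 h" by (rule smooth_vec_subset[OF h _ W0]) (auto simp: W0_def)
    have hW': "\<And>u. u \<in> W0 \<Longrightarrow> h u \<in> W'" by (simp add: W0_def)
    have u0: "u \<in> W0" using u by (simp add: W0_def)
    show "partial_deriv j (\<lambda>v. k (h v) i) u = (\<Sum>a<m'. partial_deriv a (\<lambda>v. k v i) (h u) * partial_deriv j (\<lambda>v. h v a) u)"
      by (rule partial_deriv_comp_smooth[OF smooth_vec_coord[OF k i] W0 smooth_vec_coord[OF h0] hW' u0 j])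
    show "partial_deriv j (partial_deriv q (\<lambda>v. k (h v) i)) u =
      (\<Sum>a<m'. \<Sum>b<m'. partial_deriv a (partial_deriv b (\<lambda>v. k v i)) (h u) * partial_deriv j (\<lambda>v. h v a) u * partial_deriv q (\<lambda>v. h v b) u) +
      (\<Sum>b<m'. partial_deriv b (\<lambda>v. k v i) (h u) * partial_deriv j (partial_deriv q (\<lambda>v. h v b)) u)"
      by (rule partial_deriv2_comp[OF smooth_vec_coord[OF k i] h0 hW' u0 j q])
  qed
  have hu: "h u = h' u" using jh by (simp add: same_2jet_def)
  note D = d[OF h(1) k(1) u(1,3)]
  note D' = d[OF h(2) k(2) u(2) u(4)[unfolded hu]]
  show ?thesis
    unfolding same_2jet_def
  proof (intro conjI allI impI)
    show "k (h u) = k' (h' u)" using jh jk by (simp add: same_2jet_def)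
    fix i j assume i: "i < m''" and j: "j < m"
    show "partial_deriv j (\<lambda>v. k (h v) i) u = partial_deriv j (\<lambda>v. k' (h' v) i) u"
      unfolding D(1)[OF i j j] D'(1)[OF i j j] hu[symmetric]
      using jh jk i j by (intro sum.cong) (simp_all add: same_2jet_def)
    fix q assume q: "q < m"
    show "partial_deriv j (partial_deriv q (\<lambda>v. k (h v) i)) u = partial_deriv j (partial_deriv q (\<lambda>v. k' (h' v) i)) u"
      unfolding D(2)[OF i j q] D'(2)[OF i j q] hu[symmetric]
      using jh jk i j q by (intro arg_cong2[of _ _ _ _ "(+)"] sum.cong) (simp_all add: same_2jet_def)
  qed
qed

section \<open>Charts\<close>

lemma smooth_vec_continuous_map:
  assumes "smooth_vec m m' W h"
  shows "continuous_map (subtopology (Euclidean_space m) W) (Euclidean_space m') h"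
  unfolding cm_Euclidean_space_iff_continuous_on
  using smooth_vec_continuous[OF assms] smooth_vec_in_coord_space[OF assms] openin_subset[OF smooth_vec_open[OF assms]]
  by (auto simp: Int_absorb1)

lemma chart_coordinate_chart:
  assumes "smooth_manifold M" "(U, x) \<in> charts M"
  shows "openin (mtop M) U" "openin (Euclidean_space (mdim M)) (x ` U)"
    "homeomorphic_map (subtopology (mtop M) U) (subtopology (Euclidean_space (mdim M)) (x ` U)) x"
proof -
  have "coordinate_chart (mtop M) (mdim M) (U, x)" using assms unfolding smooth_manifold_def by blast
  then show "openin (mtop M) U" "openin (Euclidean_space (mdim M)) (x ` U)"
    "homeomorphic_map (subtopology (mtop M) U) (subtopology (Euclidean_space (mdim M)) (x ` U)) x"
    by (simp_all add: coordinate_chart_def)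
qed

lemma chart_inj_on:
  assumes "smooth_manifold M" "(U, x) \<in> charts M"
  shows "inj_on x U"
  using homeomorphic_imp_injective_map[OF chart_coordinate_chart(3)[OF assms]] openin_subset[OF chart_coordinate_chart(1)[OF assms]]
  by (simp add: Int_absorb1)

lemma chart_inv_into:
  assumes "smooth_manifold M" "(U, x) \<in> charts M" "r \<in> U"
  shows "inv_into U x (x r) = r"
  using inv_into_f_f[OF chart_inj_on[OF assms(1,2)] assms(3)] .

lemma chart_subset_topspace:
  assumes "smooth_manifold M" "(U, x) \<in> charts M"
  shows "U \<subseteq> topspace (mtop M)"
  using openin_subset[OF chart_coordinate_chart(1)[OF assms]] .

lemma chart_in_coord_space:
  assumes "smooth_manifold M" "(U, x) \<in> charts M" "r \<in> U"
  shows "x r \<in> coord_space (mdim M)"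
  using openin_subset[OF chart_coordinate_chart(2)[OF assms(1,2)]] assms(3) by blast

lemma chart_exists:
  assumes "smooth_manifold M" "p \<in> topspace (mtop M)"
  obtains U x where "(U, x) \<in> charts M" "p \<in> U"
proof -
  have "p \<in> \<Union> (fst ` charts M)" using assms unfolding smooth_manifold_def by blast
  then show ?thesis using that by force
qed

lemma chart_continuous_map:
  assumes "smooth_manifold M" "(U, x) \<in> charts M"
  shows "continuous_map (subtopology (mtop M) U) (Euclidean_space (mdim M)) x"
  using homeomorphic_imp_continuous_map[OF chart_coordinate_chart(3)[OF assms]] continuous_map_in_subtopology by blast

text \<open>The homeomorphism property supplies some continuous inverse; on the image of the chart
  it coincides with \<open>inv_into\<close>, the form in which all notions of smoothness are
  phrased.\<close>

lemma chart_inverse_continuous_map: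
  assumes "smooth_manifold M" "(U, x) \<in> charts M"
  shows "continuous_map (subtopology (Euclidean_space (mdim M)) (x ` U)) (mtop M) (inv_into U x)"
proof -
  note c = chart_coordinate_chart[OF assms]
  obtain g where g: "homeomorphic_maps (subtopology (mtop M) U) (subtopology (Euclidean_space (mdim M)) (x ` U)) x g"
    using c(3) unfolding homeomorphic_map_maps by blast
  have top: "topspace (subtopology (mtop M) U) = U" "topspace (subtopology (Euclidean_space (mdim M)) (x ` U)) = x ` U"
    using openin_subset[OF c(1)] openin_subset[OF c(2)] by (simp_all add: Int_absorb1)
  have "continuous_map (subtopology (Euclidean_space (mdim M)) (x ` U)) (mtop M) g"
    using g continuous_map_in_subtopology unfolding homeomorphic_maps_def by blast
  moreover have "g u = inv_into U x u" if "u \<in> x ` U" for u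
    using that g chart_inv_into[OF assms] unfolding homeomorphic_maps_def top by auto
  ultimately show ?thesis by (rule continuous_map_eq) (simp add: top(2))
qed

lemma chart_preimage_open:
  assumes "smooth_manifold M" "(U, x) \<in> charts M" "openin (Euclidean_space (mdim M)) W"
  shows "openin (mtop M) {r \<in> U. x r \<in> W}"
proof -
  have "openin (subtopology (mtop M) U) {r \<in> topspace (subtopology (mtop M) U). x r \<in> W}"
    by (rule openin_continuous_map_preimage[OF chart_continuous_map[OF assms(1,2)] assms(3)])
  moreover have "{r \<in> topspace (subtopology (mtop M) U). x r \<in> W} = {r \<in> U. x r \<in> W}"
    using chart_subset_topspace[OF assms(1,2)] by auto
  ultimately have "openin (subtopology (mtop M) U) {r \<in> U. x r \<in> W}" by simp
  then show ?thesis using openin_trans_full[OF _ chart_coordinate_chart(1)[OF assms(1,2)]] by blast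
qed

lemma chart_image_open:
  assumes "smooth_manifold M" "(U, x) \<in> charts M" "openin (mtop M) O'"
  shows "openin (Euclidean_space (mdim M)) (x ` (U \<inter> O'))"
proof -
  note c = chart_coordinate_chart[OF assms(1,2)]
  have "openin (subtopology (mtop M) U) (U \<inter> O')"
    using assms(3) by (metis Int_commute openin_subtopology)
  then have "openin (subtopology (Euclidean_space (mdim M)) (x ` U)) (x ` (U \<inter> O'))"
    using homeomorphic_imp_open_map[OF c(3)] unfolding open_map_def by blast
  then show ?thesis using openin_trans_full[OF _ c(2)] by blast
qed

lemma chart_transition:
  assumes "smooth_manifold M" "(U, x) \<in> charts M" "(V, y) \<in> charts M"
  shows "smooth_vec (mdim M) (mdim M) (x ` (U \<inter> V)) (\<lambda>u. y (inv_into U x u))"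
  unfolding smooth_vec_def
proof (intro conjI allI impI)
  show "openin (Euclidean_space (mdim M)) (x ` (U \<inter> V))"
    by (rule chart_image_open[OF assms(1,2) chart_coordinate_chart(1)[OF assms(1,3)]])
  show "(\<lambda>u. y (inv_into U x u)) ` x ` (U \<inter> V) \<subseteq> coord_space (mdim M)"
    using chart_inv_into[OF assms(1,2)] chart_in_coord_space[OF assms(1,3)] by auto
  fix i assume i: "i < mdim M"
  have "compatible_charts (mdim M) (U, x) (V, y)" using assms unfolding smooth_manifold_def by blast
  then show "smooth_on (mdim M) (x ` (U \<inter> V)) (\<lambda>u. y (inv_into U x u) i)"
    using i by (simp add: compatible_charts_def)
qed

lemma smooth_map_coords:
  assumes "smooth_manifold M" "smooth_manifold M'" "smooth_map M M' \<phi>" "(U, x) \<in> charts M" "(V, y) \<in> charts M'"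
  shows "smooth_vec (mdim M) (mdim M') (x ` {p \<in> U. \<phi> p \<in> V}) (\<lambda>u. y (\<phi> (inv_into U x u)))"
  unfolding smooth_vec_def
proof (intro conjI allI impI)
  have "smooth_on (mdim M) (x ` {p \<in> U. \<phi> p \<in> V}) (\<lambda>u. y (\<phi> (inv_into U x u)) i)" if "i < mdim M'" for i
    using assms(3-5) that unfolding smooth_map_def by blast
  then show "\<And>i. i < mdim M' \<Longrightarrow> smooth_on (mdim M) (x ` {p \<in> U. \<phi> p \<in> V}) (\<lambda>u. y (\<phi> (inv_into U x u)) i)" .
  have cont: "continuous_map (mtop M) (mtop M') \<phi>" using assms(3) by (simp add: smooth_map_def)
  have "{p \<in> U. \<phi> p \<in> V} = U \<inter> {p \<in> topspace (mtop M). \<phi> p \<in> V}"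
    using chart_subset_topspace[OF assms(1,4)] by auto
  then show "openin (Euclidean_space (mdim M)) (x ` {p \<in> U. \<phi> p \<in> V})"
    using chart_image_open[OF assms(1,4) openin_continuous_map_preimage[OF cont chart_coordinate_chart(1)[OF assms(2,5)]]] by simp
  show "(\<lambda>u. y (\<phi> (inv_into U x u))) ` x ` {p \<in> U. \<phi> p \<in> V} \<subseteq> coord_space (mdim M')"
    using chart_inv_into[OF assms(1,4)] chart_in_coord_space[OF assms(2,5)] by auto
qed

text \<open>Smoothness of \<open>\<Theta>\<close> and of \<open>\<Psi>\<close> makes the new
  coordinates compatible with every chart, so they belong to the maximal atlas. With the identity in
  place of \<open>\<Theta>\<close> this restricts a chart to an open part.\<close>

lemma chart_diffeo:
  assumes M: "smooth_manifold M" and c: "(U, x) \<in> charts M"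
    and D: "coord_diffeo (mdim M) W1 W2 \<Theta> \<Psi>" and sub: "W1 \<subseteq> x ` U"
  shows "({r \<in> U. x r \<in> W1}, \<lambda>r. \<Theta> (x r)) \<in> charts M"
proof -
  let ?m = "mdim M"
  define U' where "U' = {r \<in> U. x r \<in> W1}"
  define z where "z r = \<Theta> (x r)" for r
  have \<Theta>: "smooth_vec ?m ?m W1 \<Theta>" and \<Psi>: "smooth_vec ?m ?m W2 \<Psi>"
    and \<Theta>\<Psi>: "\<And>u. u \<in> W1 \<Longrightarrow> \<Theta> u \<in> W2 \<and> \<Psi> (\<Theta> u) = u" "\<And>v. v \<in> W2 \<Longrightarrow> \<Psi> v \<in> W1 \<and> \<Theta> (\<Psi> v) = v"
    using D unfolding coord_diffeo_def by blast+
  note W1 = smooth_vec_open[OF \<Theta>] and W2 = smooth_vec_open[OF \<Psi>]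
  note xinv = chart_inv_into[OF M c]
  have xinv': "inv_into U x u \<in> U'" "x (inv_into U x u) = u" if "u \<in> W1" for u
  proof -
    have "u \<in> x ` U" using sub that by blast
    then show "x (inv_into U x u) = u" "inv_into U x u \<in> U'"
      using that inv_into_into[of u x U] f_inv_into_f[of u x U] by (auto simp: U'_def)
  qed
  have U': "openin (mtop M) U'" unfolding U'_def by (rule chart_preimage_open[OF M c W1])
  have U'U: "U' \<subseteq> U" by (auto simp: U'_def)
  have top: "topspace (subtopology (mtop M) U') = U'" "topspace (subtopology (Euclidean_space ?m) W2) = W2"
    using openin_subset[OF U'] openin_subset[OF W2] by (simp_all add: Int_absorb1)
  have zU': "z ` U' = W2"
  proof
    show "z ` U' \<subseteq> W2" using \<Theta>\<Psi>(1) by (auto simp: z_def U'_def)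
    show "W2 \<subseteq> z ` U'"
    proof
      fix v assume v: "v \<in> W2"
      then have "z (inv_into U x (\<Psi> v)) = v" "inv_into U x (\<Psi> v) \<in> U'" using \<Theta>\<Psi>(2)[OF v] xinv' by (auto simp: z_def)
      then show "v \<in> z ` U'" by (metis imageI)
    qed
  qed
  have cont1: "continuous_map (subtopology (mtop M) U') (subtopology (Euclidean_space ?m) W2) z"
    unfolding continuous_map_in_subtopology
  proof
    have "continuous_map (subtopology (mtop M) U') (Euclidean_space ?m) x"
      using continuous_map_from_subtopology_mono[OF chart_continuous_map[OF M c] U'U] .
    then have "continuous_map (subtopology (mtop M) U') (subtopology (Euclidean_space ?m) W1) x"
      unfolding continuous_map_in_subtopology by (auto simp: U'_def)
    from continuous_map_compose[OF this smooth_vec_continuous_map[OF \<Theta>]]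
    show "continuous_map (subtopology (mtop M) U') (Euclidean_space ?m) z"
      by (simp add: z_def[abs_def] comp_def)
    show "z \<in> topspace (subtopology (mtop M) U') \<rightarrow> W2" unfolding top using zU' by blast
  qed
  have cont2: "continuous_map (subtopology (Euclidean_space ?m) W2) (subtopology (mtop M) U') (\<lambda>v. inv_into U x (\<Psi> v))"
    unfolding continuous_map_in_subtopology
  proof
    have "continuous_map (subtopology (Euclidean_space ?m) W2) (subtopology (Euclidean_space ?m) (x ` U)) \<Psi>"
      unfolding continuous_map_in_subtopology top using smooth_vec_continuous_map[OF \<Psi>] \<Theta>\<Psi>(2) sub by blast
    from continuous_map_compose[OF this chart_inverse_continuous_map[OF M c]]
    show "continuous_map (subtopology (Euclidean_space ?m) W2) (mtop M) (\<lambda>v. inv_into U x (\<Psi> v))"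
      by (simp add: comp_def)
    show "(\<lambda>v. inv_into U x (\<Psi> v)) \<in> topspace (subtopology (Euclidean_space ?m) W2) \<rightarrow> U'"
      unfolding top using \<Theta>\<Psi>(2) xinv' by blast
  qed
  have zinv: "inv_into U x (\<Psi> (z r)) = r" if "r \<in> U'" for r
    using that \<Theta>\<Psi>(1)[of "x r"] xinv[of r] by (auto simp: z_def U'_def)
  have injz: "inj_on z U'" by (rule inj_on_inverseI[of _ "\<lambda>v. inv_into U x (\<Psi> v)"]) (rule zinv)
  have zinv': "z (inv_into U x (\<Psi> v)) = v" if "v \<in> W2" for v
    using \<Theta>\<Psi>(2)[OF that] xinv' by (simp add: z_def)
  have inv_z: "inv_into U' z v = inv_into U x (\<Psi> v)" if "v \<in> W2" for v
    by (rule inv_into_f_eq[OF injz _ zinv'[OF that]]) (use \<Theta>\<Psi>(2)[OF that] xinv' in blast)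
  have "homeomorphic_maps (subtopology (mtop M) U') (subtopology (Euclidean_space ?m) W2) z (\<lambda>v. inv_into U x (\<Psi> v))"
    unfolding homeomorphic_maps_def top using cont1 cont2 zinv zinv' by blast
  then have "homeomorphic_map (subtopology (mtop M) U') (subtopology (Euclidean_space ?m) W2) z"
    unfolding homeomorphic_map_maps by blast
  then have cc: "coordinate_chart (mtop M) ?m (U', z)"
    unfolding coordinate_chart_def using U' W2 zU' by simp
  have compat: "compatible_charts ?m (U', z) (V, y)" if d: "(V, y) \<in> charts M" for V y
    unfolding compatible_charts_def case_prod_conv
  proof (intro allI impI conjI)
    fix i assume i: "i < ?m"
    note t1 = chart_transition[OF M c d] and t2 = chart_transition[OF M d c]
    \<comment> \<open>Rewritten as a preimage under \<open>\<Psi>\<close>, the image is seen to be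
      open, and it is the set on which the old transition may be composed with
      \<open>\<Psi>\<close>.\<close>
    have im1: "z ` (U' \<inter> V) = {v \<in> W2. \<Psi> v \<in> x ` (U \<inter> V)}"
    proof (rule subset_antisym; rule subsetI)
      fix v assume "v \<in> z ` (U' \<inter> V)"
      then obtain r where "r \<in> U'" "r \<in> V" "v = z r" by blast
      then show "v \<in> {v \<in> W2. \<Psi> v \<in> x ` (U \<inter> V)}" using \<Theta>\<Psi>(1)[of "x r"] by (auto simp: z_def U'_def)
    next
      fix v assume v: "v \<in> {v \<in> W2. \<Psi> v \<in> x ` (U \<inter> V)}"
      then obtain r where r: "r \<in> U" "r \<in> V" "\<Psi> v = x r" by blast
      then have "z r = v" "r \<in> U'" using v \<Theta>\<Psi>(2)[of v] by (auto simp: z_def U'_def)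
      then show "v \<in> z ` (U' \<inter> V)" using r by blast
    qed
    have o1: "openin (Euclidean_space ?m) (z ` (U' \<inter> V))"
      unfolding im1 by (rule smooth_vec_preimage_open[OF \<Psi> smooth_vec_open[OF t1]])
    have "smooth_on ?m (z ` (U' \<inter> V)) (\<lambda>v. y (inv_into U x (\<Psi> v)) i)"
      by (rule smooth_on_comp_vec[OF smooth_vec_coord[OF t1 i] smooth_vec_subset[OF \<Psi> _ o1]]) (auto simp: im1)
    then show "smooth_on ?m (z ` (U' \<inter> V)) (\<lambda>u. y (inv_into U' z u) i)"
      by (rule smooth_on_cong) (simp add: im1 inv_z)
    have im2: "y ` (U' \<inter> V) = {v \<in> y ` (V \<inter> U). x (inv_into V y v) \<in> W1}"
      using chart_inv_into[OF M d] by (auto simp: U'_def)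
    have o2: "openin (Euclidean_space ?m) (y ` (U' \<inter> V))"
      unfolding im2 by (rule smooth_vec_preimage_open[OF t2 W1])
    show "smooth_on ?m (y ` (U' \<inter> V)) (\<lambda>u. z (inv_into V y u) i)"
      unfolding z_def
      by (rule smooth_on_comp_vec[OF smooth_vec_coord[OF \<Theta> i] smooth_vec_subset[OF t2 _ o2]]) (auto simp: im2)
  qed
  have "\<forall>d\<in>charts M. compatible_charts ?m (U', z) d" using compat by auto
  then have "(U', z) \<in> charts M" using M cc unfolding smooth_manifold_def by blast
  then show ?thesis by (simp add: U'_def z_def[abs_def])
qed

section \<open>The rough velocity bundle\<close>

text \<open>Read backwards, a chart whose image contains the origin is a frame. Bundle points with
  prescribed coordinates are built from such frames.\<close>

lemma local_frame_chart:
  assumes M: "smooth_manifold M" and c: "(U, x) \<in> charts M" and 0: "origin \<in> x ` U"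
  shows "local_frame M (inv_into U x)"
proof -
  let ?m = "mdim M" and ?\<psi> = "inv_into U x"
  note cc = chart_coordinate_chart[OF M c] and xinv = chart_inv_into[OF M c]
  have im: "?\<psi> ` x ` U = U" using xinv by (force simp: image_image)
  have inj: "inj_on ?\<psi> (x ` U)" by (rule inj_on_inv_into) simp
  have inv: "inv_into (x ` U) ?\<psi> r = x r" if "r \<in> U" for r
    by (rule inv_into_f_eq[OF inj]) (use that xinv in auto)
  have top: "topspace (subtopology (mtop M) U) = U" "topspace (subtopology (Euclidean_space ?m) (x ` U)) = x ` U"
    using openin_subset[OF cc(1)] openin_subset[OF cc(2)] by (simp_all add: Int_absorb1)
  have "continuous_map (subtopology (Euclidean_space ?m) (x ` U)) (subtopology (mtop M) U) ?\<psi>"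
    unfolding continuous_map_in_subtopology top using chart_inverse_continuous_map[OF M c] im by blast
  then have "homeomorphic_maps (subtopology (Euclidean_space ?m) (x ` U)) (subtopology (mtop M) U) ?\<psi> x"
    unfolding homeomorphic_maps_def top
    using homeomorphic_imp_continuous_map[OF cc(3)] xinv f_inv_into_f[of _ x U] by blast
  then have hom: "homeomorphic_map (subtopology (Euclidean_space ?m) (x ` U)) (subtopology (mtop M) U) ?\<psi>"
    unfolding homeomorphic_map_maps by blast
  have sm: "smooth_on ?m {u \<in> x ` U. ?\<psi> u \<in> V} (\<lambda>u. y (?\<psi> u) i)"
    "smooth_on ?m (y ` (V \<inter> U)) (\<lambda>v. inv_into (x ` U) ?\<psi> (inv_into V y v) i)"
    if d: "(V, y) \<in> charts M" and i: "i < ?m" for V y i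
  proof -
    have "{u \<in> x ` U. ?\<psi> u \<in> V} = x ` (U \<inter> V)" using xinv by auto
    then show "smooth_on ?m {u \<in> x ` U. ?\<psi> u \<in> V} (\<lambda>u. y (?\<psi> u) i)"
      using smooth_vec_coord[OF chart_transition[OF M c d] i] by simp
    show "smooth_on ?m (y ` (V \<inter> U)) (\<lambda>v. inv_into (x ` U) ?\<psi> (inv_into V y v) i)"
      by (rule smooth_on_cong[OF smooth_vec_coord[OF chart_transition[OF M d c] i]])
        (use inv chart_inv_into[OF M d] in auto)
  qed
  show ?thesis
    unfolding local_frame_def
    by (rule exI[of _ "x ` U"], unfold im) (use 0 cc hom sm in blast)
qed

text \<open>Turns the definition of a frame into a statement about diffeomorphisms of the coordinate
  space. One neighbourhood \<open>W\<close> of the origin serves all charts, so that the same germ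
  can be compared in several of them.\<close>

lemma local_frame_diffeo:
  assumes "local_frame M \<psi>" and M: "smooth_manifold M"
  obtains W where "origin \<in> W" "openin (Euclidean_space (mdim M)) W" "inj_on \<psi> W" "\<psi> ` W \<subseteq> topspace (mtop M)"
    "\<forall>U x. (U, x) \<in> charts M \<longrightarrow> coord_diffeo (mdim M) {u \<in> W. \<psi> u \<in> U} (x ` (U \<inter> \<psi> ` W))
       (\<lambda>u. x (\<psi> u)) (\<lambda>v. inv_into W \<psi> (inv_into U x v))"
proof -
  let ?m = "mdim M"
  obtain W where W: "origin \<in> W" "openin (Euclidean_space ?m) W" "openin (mtop M) (\<psi> ` W)"
    "homeomorphic_map (subtopology (Euclidean_space ?m) W) (subtopology (mtop M) (\<psi> ` W)) \<psi>"
    and sm: "\<forall>(U, x)\<in>charts M. \<forall>i<?m. smooth_on ?m {u \<in> W. \<psi> u \<in> U} (\<lambda>u. x (\<psi> u) i) \<and>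
        smooth_on ?m (x ` (U \<inter> \<psi> ` W)) (\<lambda>v. inv_into W \<psi> (inv_into U x v) i)"
    using assms(1) unfolding local_frame_def by blast
  have inj: "inj_on \<psi> W"
    using homeomorphic_imp_injective_map[OF W(4)] openin_subset[OF W(2)] by (simp add: Int_absorb1)
  have diffeo: "coord_diffeo ?m {u \<in> W. \<psi> u \<in> U} (x ` (U \<inter> \<psi> ` W)) (\<lambda>u. x (\<psi> u)) (\<lambda>v. inv_into W \<psi> (inv_into U x v))"
    if c: "(U, x) \<in> charts M" for U x
  proof -
    have "continuous_map (subtopology (Euclidean_space ?m) W) (mtop M) \<psi>"
      using homeomorphic_imp_continuous_map[OF W(4)] continuous_map_in_subtopology by blast
    from openin_continuous_map_preimage[OF this chart_coordinate_chart(1)[OF M c]]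
    have "openin (subtopology (Euclidean_space ?m) W) {u \<in> W. \<psi> u \<in> U}"
      using openin_subset[OF W(2)] by (simp add: Int_absorb1)
    then have o1: "openin (Euclidean_space ?m) {u \<in> W. \<psi> u \<in> U}" using openin_trans_full W(2) by blast
    have o2: "openin (Euclidean_space ?m) (x ` (U \<inter> \<psi> ` W))" by (rule chart_image_open[OF M c W(3)])
    note xinv = chart_inv_into[OF M c]
    have "smooth_vec ?m ?m {u \<in> W. \<psi> u \<in> U} (\<lambda>u. x (\<psi> u))"
      unfolding smooth_vec_def using sm c o1 chart_in_coord_space[OF M c] by blast
    moreover have "smooth_vec ?m ?m (x ` (U \<inter> \<psi> ` W)) (\<lambda>v. inv_into W \<psi> (inv_into U x v))"
      unfolding smooth_vec_def
    proof (intro conjI o2)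
      show "(\<lambda>v. inv_into W \<psi> (inv_into U x v)) ` x ` (U \<inter> \<psi> ` W) \<subseteq> coord_space ?m"
        using openin_subset[OF W(2)] xinv inv_into_into[of _ \<psi> W] by fastforce
      show "\<forall>i<?m. smooth_on ?m (x ` (U \<inter> \<psi> ` W)) (\<lambda>v. inv_into W \<psi> (inv_into U x v) i)" using sm c by blast
    qed
    ultimately show ?thesis
      unfolding coord_diffeo_def using xinv inv_into_f_f[OF inj] by force
  qed
  show ?thesis by (rule that[OF W(1,2) inj openin_subset[OF W(3)]]) (use diffeo in blast)
qed

section \<open>Jets of frames and the equivalence relation of the associated bundle\<close>

lemma jet2_self: "local_frame M \<psi> \<Longrightarrow> \<psi> \<in> jet2 M \<psi>"
  by (auto simp: jet2_def same_2jet_def)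

lemma jet2_subset:
  assumes "\<psi> origin = \<psi>' origin"
    and "\<And>U x. (U, x) \<in> charts M \<Longrightarrow> \<psi> origin \<in> U \<Longrightarrow> same_2jet (mdim M) (mdim M) (x \<circ> \<psi>) (x \<circ> \<psi>') origin"
  shows "jet2 M \<psi> \<subseteq> jet2 M \<psi>'"
proof
  fix \<eta> assume \<eta>: "\<eta> \<in> jet2 M \<psi>"
  have "same_2jet (mdim M) (mdim M) (x \<circ> \<eta>) (x \<circ> \<psi>') origin" if c: "(U, x) \<in> charts M" "\<psi>' origin \<in> U" for U x
  proof (rule same_2jet_trans)
    have U: "\<psi> origin \<in> U" using c(2) assms(1) by simp
    show "same_2jet (mdim M) (mdim M) (x \<circ> \<psi>) (x \<circ> \<psi>') origin" by (rule assms(2)[OF c(1) U])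
    show "same_2jet (mdim M) (mdim M) (x \<circ> \<eta>) (x \<circ> \<psi>) origin" using \<eta> c(1) U unfolding jet2_def by blast
  qed
  moreover have "local_frame M \<eta>" "\<eta> origin = \<psi>' origin" using \<eta> assms(1) unfolding jet2_def by auto
  ultimately show "\<eta> \<in> jet2 M \<psi>'" unfolding jet2_def by blast
qed

lemma jet2_eqI:
  assumes "\<psi> origin = \<psi>' origin"
    and "\<And>U x. (U, x) \<in> charts M \<Longrightarrow> \<psi> origin \<in> U \<Longrightarrow> same_2jet (mdim M) (mdim M) (x \<circ> \<psi>) (x \<circ> \<psi>') origin"
  shows "jet2 M \<psi> = jet2 M \<psi>'"
proof
  show "jet2 M \<psi> \<subseteq> jet2 M \<psi>'" by (rule jet2_subset[OF assms])
  show "jet2 M \<psi>' \<subseteq> jet2 M \<psi>"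
    by (rule jet2_subset[OF assms(1)[symmetric] same_2jet_sym[OF assms(2)]]) (simp_all add: assms(1))
qed

lemma jet2_origin: "\<psi>' \<in> jet2 M \<psi> \<Longrightarrow> \<psi>' origin = \<psi> origin"
  by (simp add: jet2_def)

lemma jet2_same_2jet:
  assumes "\<psi>' \<in> jet2 M \<psi>" "(U, x) \<in> charts M" "\<psi> origin \<in> U"
  shows "same_2jet (mdim M) (mdim M) (\<lambda>u. x (\<psi>' u)) (\<lambda>u. x (\<psi> u)) origin"
  using assms unfolding jet2_def comp_def by blast

lemma smooth_origin_map_smooth_vec:
  "smooth_origin_map m a \<Longrightarrow> smooth_vec m m (coord_space m) a"
  by (simp add: smooth_origin_map_def smooth_vec_def)

text \<open>Related pairs have the same coordinates. Since \<open>f\<close> is the push of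
  \<open>f'\<close> under \<open>a\<close>, pushing \<open>f'\<close> under the frame composed with
  \<open>a\<close> is pushing \<open>f\<close> under the frame; and members of a jet may be
  exchanged because a push depends on the 2-jet alone.\<close>

lemma bundle_rel_coords:
  assumes M: "smooth_manifold M" and rel: "((J, f), (J', f')) \<in> bundle_rel M n"
    and \<psi>: "\<psi> \<in> J" "\<psi>' \<in> J'"
  shows "\<psi>' origin = \<psi> origin"
    and "\<And>U x g. (U, x) \<in> charts M \<Longrightarrow> \<psi> origin \<in> U \<Longrightarrow> jet_push (mdim M) (mdim M) n (\<lambda>u. x (\<psi> u)) origin f g \<Longrightarrow>
      jet_push (mdim M) (mdim M) n (\<lambda>u. x (\<psi>' u)) origin f' g"
proof -
  let ?m = "mdim M"
  obtain \<psi>0 a where \<psi>0: "local_frame M \<psi>0" "J = jet2 M \<psi>0" "invertible_jet ?m a" "J' = jet2 M (\<psi>0 \<circ> a)"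
    "jet_push ?m ?m n a origin f' f"
    using rel unfolding bundle_rel_def by blast
  have a: "smooth_origin_map ?m a" "a origin = origin" using \<psi>0(3) by (simp_all add: invertible_jet_def smooth_origin_map_def)
  have o: "\<psi> origin = \<psi>0 origin" "\<psi>' origin = \<psi>0 origin" using \<psi> \<psi>0 a(2) by (auto dest: jet2_origin)
  then show "\<psi>' origin = \<psi> origin" by simp
  fix U x g assume c: "(U, x) \<in> charts M" and U: "\<psi> origin \<in> U" and J: "jet_push ?m ?m n (\<lambda>u. x (\<psi> u)) origin f g"
  obtain W where W: "origin \<in> W" "openin (Euclidean_space ?m) W" "inj_on \<psi>0 W" "\<psi>0 ` W \<subseteq> topspace (mtop M)"
    and DW: "\<forall>U x. (U, x) \<in> charts M \<longrightarrow> coord_diffeo ?m {u \<in> W. \<psi>0 u \<in> U} (x ` (U \<inter> \<psi>0 ` W))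
       (\<lambda>u. x (\<psi>0 u)) (\<lambda>v. inv_into W \<psi>0 (inv_into U x v))"
    by (rule local_frame_diffeo[OF \<psi>0(1) M])
  have "coord_diffeo ?m {u \<in> W. \<psi>0 u \<in> U} (x ` (U \<inter> \<psi>0 ` W)) (\<lambda>u. x (\<psi>0 u)) (\<lambda>v. inv_into W \<psi>0 (inv_into U x v))"
    using DW c by blast
  then have sm: "smooth_vec ?m ?m {u \<in> W. \<psi>0 u \<in> U} (\<lambda>u. x (\<psi>0 u))" unfolding coord_diffeo_def by blast
  have "jet_push ?m ?m n (\<lambda>u. x (\<psi>0 u)) origin f g"
    using same_2jet_jet_push[OF jet2_same_2jet[OF _ c] J] \<psi>(1) \<psi>0(2) U o by simp
  then have "jet_push ?m ?m n (\<lambda>u. x (\<psi>0 (a u))) origin f' g"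
    using jet_push_comp[OF smooth_origin_map_smooth_vec[OF a(1)] sm _ _ \<psi>0(5)] a(2) W(1) U o by (simp add: mem_coord_space)
  moreover have "same_2jet ?m ?m (\<lambda>u. x (\<psi>' u)) (\<lambda>u. x (\<psi>0 (a u))) origin"
    using jet2_same_2jet[OF \<psi>(2)[unfolded \<psi>0(4)] c] a(2) U o by simp
  ultimately show "jet_push ?m ?m n (\<lambda>u. x (\<psi>' u)) origin f' g"
    using same_2jet_jet_push same_2jet_sym by blast
qed

text \<open>Conversely, equal coordinates in one chart imply relatedness. The change of frame is the
  germ of \<open>\<psi>'\<close> followed by the inverse of \<open>\<psi>\<close>, computed through
  the chart; its 2-jet is invertible and carries \<open>f'\<close> to \<open>f\<close>, since both
  are the pull-back of the same \<open>g\<close>.\<close>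

lemma bundle_relI:
  assumes M: "smooth_manifold M" and \<psi>: "local_frame M \<psi>" and \<psi>': "local_frame M \<psi>'"
    and o: "\<psi>' origin = \<psi> origin" and c: "(U, x) \<in> charts M" "\<psi> origin \<in> U"
    and f: "f \<in> fiber_space (mdim M) n" "f' \<in> fiber_space (mdim M) n"
    and J: "jet_push (mdim M) (mdim M) n (\<lambda>u. x (\<psi> u)) origin f g"
    and J': "jet_push (mdim M) (mdim M) n (\<lambda>u. x (\<psi>' u)) origin f' g"
  shows "((jet2 M \<psi>, f), (jet2 M \<psi>', f')) \<in> bundle_rel M n"
proof -
  let ?m = "mdim M"
  obtain W where W: "origin \<in> W" "openin (Euclidean_space ?m) W" "inj_on \<psi> W" "\<psi> ` W \<subseteq> topspace (mtop M)"
    and DW: "\<forall>U x. (U, x) \<in> charts M \<longrightarrow> coord_diffeo ?m {u \<in> W. \<psi> u \<in> U} (x ` (U \<inter> \<psi> ` W))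
       (\<lambda>u. x (\<psi> u)) (\<lambda>v. inv_into W \<psi> (inv_into U x v))"
    by (rule local_frame_diffeo[OF \<psi> M])
  obtain W' where W': "origin \<in> W'" "openin (Euclidean_space ?m) W'" "inj_on \<psi>' W'" "\<psi>' ` W' \<subseteq> topspace (mtop M)"
    and DW': "\<forall>U x. (U, x) \<in> charts M \<longrightarrow> coord_diffeo ?m {u \<in> W'. \<psi>' u \<in> U} (x ` (U \<inter> \<psi>' ` W'))
       (\<lambda>u. x (\<psi>' u)) (\<lambda>v. inv_into W' \<psi>' (inv_into U x v))"
    by (rule local_frame_diffeo[OF \<psi>' M])
  define h where "h u = x (\<psi> u)" for u
  define h' where "h' u = x (\<psi>' u)" for u
  define k where "k v = inv_into W \<psi> (inv_into U x v)" for v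
  define k' where "k' v = inv_into W' \<psi>' (inv_into U x v)" for v
  define A where "A = {u \<in> W. \<psi> u \<in> U}"
  define A' where "A' = {u \<in> W'. \<psi>' u \<in> U}"
  define B where "B = x ` (U \<inter> \<psi> ` W)"
  define B' where "B' = x ` (U \<inter> \<psi>' ` W')"
  have "coord_diffeo ?m A B h k" using DW c(1) unfolding A_def B_def h_def[abs_def] k_def[abs_def] by blast
  then have h: "smooth_vec ?m ?m A h" and k: "smooth_vec ?m ?m B k"
    and hk: "\<And>u. u \<in> A \<Longrightarrow> h u \<in> B \<and> k (h u) = u" "\<And>v. v \<in> B \<Longrightarrow> k v \<in> A \<and> h (k v) = v"
    unfolding coord_diffeo_def by blast+
  have "coord_diffeo ?m A' B' h' k'" using DW' c(1) unfolding A'_def B'_def h'_def[abs_def] k'_def[abs_def] by blast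
  then have h': "smooth_vec ?m ?m A' h'" and k': "smooth_vec ?m ?m B' k'"
    and hk': "\<And>u. u \<in> A' \<Longrightarrow> h' u \<in> B' \<and> k' (h' u) = u" "\<And>v. v \<in> B' \<Longrightarrow> k' v \<in> A' \<and> h' (k' v) = v"
    unfolding coord_diffeo_def by blast+
  have 0: "origin \<in> A" "origin \<in> A'" using W W' c(2) o by (simp_all add: A_def A'_def)
  have h0: "h' origin = h origin" by (simp add: h_def h'_def o)
  \<comment> \<open>Neighbourhoods of the origin on which the two transitions between the frames are
    defined.\<close>
  define C where "C = {u \<in> A'. h' u \<in> B}"
  define C' where "C' = {u \<in> A. h u \<in> B'}"
  have C: "openin (Euclidean_space ?m) C" unfolding C_def by (rule smooth_vec_preimage_open[OF h' smooth_vec_open[OF k]])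
  have C': "openin (Euclidean_space ?m) C'" unfolding C'_def by (rule smooth_vec_preimage_open[OF h smooth_vec_open[OF k']])
  have h'C: "smooth_vec ?m ?m C h'" by (rule smooth_vec_subset[OF h' _ C]) (auto simp: C_def)
  have hC': "smooth_vec ?m ?m C' h" by (rule smooth_vec_subset[OF h _ C']) (auto simp: C'_def)
  have c_smooth: "smooth_vec ?m ?m C (\<lambda>u. k (h' u))" by (rule smooth_vec_comp[OF k h'C]) (simp add: C_def)
  have c'_smooth: "smooth_vec ?m ?m C' (\<lambda>u. k' (h u))" by (rule smooth_vec_comp[OF k' hC']) (simp add: C'_def)
  have 0: "origin \<in> C" "origin \<in> C'" "origin \<in> A" "origin \<in> A'"
    using 0 hk(1)[OF 0(1)] hk'(1)[OF 0(2)] h0 by (simp_all add: C_def C'_def)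
  have c0: "k (h' origin) = origin" "k' (h origin) = origin" using hk(1)[OF 0(3)] hk'(1)[OF 0(4)] h0 by simp_all
  \<comment> \<open>Globally defined representatives of the two transition germs; as these germs are
    inverse to each other, so are the representatives up to second order.\<close>
  obtain a where a: "smooth_origin_map ?m a" "same_2jet ?m ?m a (\<lambda>u. k (h' u)) origin"
    by (rule quadratic_jet_representative[OF c_smooth 0(1) c0(1)])
  obtain b where b: "smooth_origin_map ?m b" "same_2jet ?m ?m b (\<lambda>u. k' (h u)) origin"
    by (rule quadratic_jet_representative[OF c'_smooth 0(2) c0(2)])
  have oE: "origin \<in> coord_space ?m" by (simp add: mem_coord_space)
  have a0: "a origin = origin" "b origin = origin" using a(1) b(1) by (simp_all add: smooth_origin_map_def)
  note va = smooth_origin_map_smooth_vec[OF a(1)] and vb = smooth_origin_map_smooth_vec[OF b(1)]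
  have ab: "same_2jet ?m ?m (a \<circ> b) id origin"
  proof (rule same_2jet_trans)
    show "same_2jet ?m ?m (a \<circ> b) (\<lambda>u. k (h' (k' (h u)))) origin"
      unfolding comp_def
      using same_2jet_comp[OF vb c'_smooth va c_smooth oE 0(2) _ _ b(2)] a(2) 0 a0 oE by simp
    show "same_2jet ?m ?m (\<lambda>u. k (h' (k' (h u)))) id origin"
    proof (rule same_2jet_local[OF C' 0(2)])
      fix v assume "v \<in> C'"
      then have "h' (k' (h v)) = h v" "k (h v) = v" using hk hk' by (auto simp: C'_def)
      then show "k (h' (k' (h v))) = id v" by simp
    qed
  qed
  have ba: "same_2jet ?m ?m (b \<circ> a) id origin"
  proof (rule same_2jet_trans)
    show "same_2jet ?m ?m (b \<circ> a) (\<lambda>u. k' (h (k (h' u)))) origin"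
      unfolding comp_def
      using same_2jet_comp[OF va c_smooth vb c'_smooth oE 0(1) _ _ a(2)] b(2) 0 a0 oE by simp
    show "same_2jet ?m ?m (\<lambda>u. k' (h (k (h' u)))) id origin"
    proof (rule same_2jet_local[OF C 0(1)])
      fix v assume "v \<in> C"
      then have "h (k (h' v)) = h' v" "k' (h' v) = v" using hk hk' by (auto simp: C_def)
      then show "k' (h (k (h' v))) = id v" by simp
    qed
  qed
  have inv: "invertible_jet ?m a" unfolding invertible_jet_def using a(1) b(1) ab ba by blast
  \<comment> \<open>In every chart \<open>y\<close>, the frame \<open>\<psi>'\<close> equals
    \<open>\<psi>\<close> after the transition near the origin, and \<open>a\<close> has the 2-jet
    of this transition.\<close>
  have J2: "jet2 M \<psi>' = jet2 M (\<psi> \<circ> a)"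
  proof (rule jet2_eqI)
    show "\<psi>' origin = (\<psi> \<circ> a) origin" using o a0 by simp
    fix V y assume d: "(V, y) \<in> charts M" and V: "\<psi>' origin \<in> V"
    define A2 where "A2 = {u \<in> W. \<psi> u \<in> V}"
    have "coord_diffeo ?m A2 (y ` (V \<inter> \<psi> ` W)) (\<lambda>u. y (\<psi> u)) (\<lambda>v. inv_into W \<psi> (inv_into V y v))"
      using DW d unfolding A2_def by blast
    then have y\<psi>: "smooth_vec ?m ?m A2 (\<lambda>u. y (\<psi> u))" unfolding coord_diffeo_def by blast
    have 02: "origin \<in> A2" using W(1) V o by (simp add: A2_def)
    have "same_2jet ?m ?m (\<lambda>u. y (\<psi> (a u))) (\<lambda>u. y (\<psi> (k (h' u)))) origin"
      using same_2jet_comp[OF va c_smooth y\<psi> y\<psi> oE 0(1) _ _ a(2)] 02 a0 by (simp add: same_2jet_def)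
    moreover have "same_2jet ?m ?m (\<lambda>u. y (\<psi>' u)) (\<lambda>u. y (\<psi> (k (h' u)))) origin"
    proof (rule same_2jet_local[OF C 0(1)])
      fix v assume v: "v \<in> C"
      then have v': "\<psi>' v \<in> U" "x (\<psi>' v) \<in> B" by (auto simp: C_def A'_def h'_def)
      then obtain w where w: "w \<in> W" "\<psi> w \<in> U" "x (\<psi>' v) = x (\<psi> w)" by (auto simp: B_def)
      then have "\<psi>' v = \<psi> w" using inj_onD[OF chart_inj_on[OF M c(1)]] v' by blast
      then have "k (h' v) = w"
        unfolding k_def h'_def using chart_inv_into[OF M c(1) w(2)] inv_into_f_f[OF W(3) w(1)] by simp
      then show "y (\<psi>' v) = y (\<psi> (k (h' v)))" using \<open>\<psi>' v = \<psi> w\<close> by simp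
    qed
    ultimately show "same_2jet ?m ?m (y \<circ> \<psi>') (y \<circ> (\<psi> \<circ> a)) origin"
      unfolding comp_def using same_2jet_trans same_2jet_sym by blast
  qed
  have "jet_push ?m ?m n k (h origin) g f"
    using jet_push_inverse[OF h k 0(3) _ _ f(1) J[folded h_def]] hk(1) 0(3) by blast
  then have "jet_push ?m ?m n (\<lambda>u. k (h' u)) origin f' f"
    using jet_push_comp[OF h' k 0(4) _ J'[folded h'_def]] h0 hk(1)[OF 0(3)] by simp
  then have Ja: "jet_push ?m ?m n a origin f' f"
    using same_2jet_jet_push[OF same_2jet_sym[OF a(2)]] by blast
  have "jet2 M \<psi> \<in> frame_bundle2 M" "jet2 M \<psi>' \<in> frame_bundle2 M"
    using \<psi> \<psi>' unfolding frame_bundle2_def by blast+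
  then show ?thesis
    unfolding bundle_rel_def using f \<psi> inv J2 Ja by blast
qed

text \<open>Evaluates both definite descriptions on a class. Uniqueness is the invariance along
  \<open>bundle_rel\<close>; existence needs the pair to lie in its own class, which is
  \<open>bundle_relI\<close> with equal frames.\<close>

lemma class_coords:
  assumes M: "smooth_manifold M" and \<psi>: "local_frame M \<psi>" and f: "f \<in> fiber_space (mdim M) n"
  shows "base_point (bundle_rel M n `` {(jet2 M \<psi>, f)}) = \<psi> origin"
    and "\<psi> origin \<in> topspace (mtop M)"
    and "\<And>U x. (U, x) \<in> charts M \<Longrightarrow> \<psi> origin \<in> U \<Longrightarrow>
      jet_push (mdim M) (mdim M) n (\<lambda>u. x (\<psi> u)) origin f (fiber_coords n M (U, x) (bundle_rel M n `` {(jet2 M \<psi>, f)}))"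
proof -
  let ?m = "mdim M"
  define \<xi> where "\<xi> = bundle_rel M n `` {(jet2 M \<psi>, f)}"
  obtain W where W: "origin \<in> W" "openin (Euclidean_space ?m) W" "inj_on \<psi> W" "\<psi> ` W \<subseteq> topspace (mtop M)"
    and DW: "\<forall>U x. (U, x) \<in> charts M \<longrightarrow> coord_diffeo ?m {u \<in> W. \<psi> u \<in> U} (x ` (U \<inter> \<psi> ` W))
       (\<lambda>u. x (\<psi> u)) (\<lambda>v. inv_into W \<psi> (inv_into U x v))"
    by (rule local_frame_diffeo[OF \<psi> M])
  show oM: "\<psi> origin \<in> topspace (mtop M)" using W by blast
  have ex: "\<exists>g. jet_push ?m ?m n (\<lambda>u. x (\<psi> u)) origin f g" if c: "(U, x) \<in> charts M" "\<psi> origin \<in> U" for U x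
  proof -
    have "coord_diffeo ?m {u \<in> W. \<psi> u \<in> U} (x ` (U \<inter> \<psi> ` W)) (\<lambda>u. x (\<psi> u)) (\<lambda>v. inv_into W \<psi> (inv_into U x v))"
      using DW c by blast
    then have sm: "smooth_vec ?m ?m {u \<in> W. \<psi> u \<in> U} (\<lambda>u. x (\<psi> u))" unfolding coord_diffeo_def by blast
    have "origin \<in> {u \<in> W. \<psi> u \<in> U}" using W(1) c(2) by simp
    from jet_push_exists[OF sm this] show ?thesis by blast
  qed
  have self: "(jet2 M \<psi>, f) \<in> \<xi>"
  proof -
    obtain U x where c: "(U, x) \<in> charts M" "\<psi> origin \<in> U" by (rule chart_exists[OF M oM])
    obtain g where g: "jet_push ?m ?m n (\<lambda>u. x (\<psi> u)) origin f g" using ex[OF c] by blast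
    show ?thesis unfolding \<xi>_def using bundle_relI[OF M \<psi> \<psi> refl c f f g g] by simp
  qed
  have rel: "((jet2 M \<psi>, f), (J', f')) \<in> bundle_rel M n" if "(J', f') \<in> \<xi>" for J' f' using that by (simp add: \<xi>_def)
  show "base_point (bundle_rel M n `` {(jet2 M \<psi>, f)}) = \<psi> origin"
    unfolding base_point_def \<xi>_def[symmetric]
  proof (rule the_equality)
    show "\<exists>(J, f)\<in>\<xi>. \<exists>\<psi>'\<in>J. \<psi> origin = \<psi>' origin" using self jet2_self[OF \<psi>] by blast
    show "p = \<psi> origin" if ex: "\<exists>(J, f)\<in>\<xi>. \<exists>\<psi>'\<in>J. p = \<psi>' origin" for p
    proof -
      obtain J' f' \<psi>' where "(J', f') \<in> \<xi>" "\<psi>' \<in> J'" "p = \<psi>' origin" using ex by blast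
      then show ?thesis using bundle_rel_coords(1)[OF M rel jet2_self[OF \<psi>]] by simp
    qed
  qed
  fix U x assume c: "(U, x) \<in> charts M" "\<psi> origin \<in> U"
  obtain g where g: "jet_push ?m ?m n (\<lambda>u. x (\<psi> u)) origin f g" using ex[OF c] by blast
  have "fiber_coords n M (U, x) \<xi> = g"
    unfolding fiber_coords_def case_prod_conv comp_def
  proof (rule the_equality)
    show "\<exists>(J, f)\<in>\<xi>. \<exists>\<psi>\<in>J. jet_push ?m ?m n (\<lambda>u. x (\<psi> u)) origin f g" using self jet2_self[OF \<psi>] g by blast
    show "g' = g" if ex: "\<exists>(J, f)\<in>\<xi>. \<exists>\<psi>\<in>J. jet_push ?m ?m n (\<lambda>u. x (\<psi> u)) origin f g'" for g'
    proof -
      obtain J' f' \<psi>' where 1: "(J', f') \<in> \<xi>" "\<psi>' \<in> J'" "jet_push ?m ?m n (\<lambda>u. x (\<psi>' u)) origin f' g'" using ex by blast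
      have "jet_push ?m ?m n (\<lambda>u. x (\<psi>' u)) origin f' g"
        by (rule bundle_rel_coords(2)[OF M rel[OF 1(1)] jet2_self[OF \<psi>] 1(2) c g])
      then show ?thesis using 1(3) jet_push_unique by blast
    qed
  qed
  then show "jet_push ?m ?m n (\<lambda>u. x (\<psi> u)) origin f (fiber_coords n M (U, x) (bundle_rel M n `` {(jet2 M \<psi>, f)}))"
    using g by (simp add: \<xi>_def)
qed

section \<open>Bundle points in coordinates\<close>

lemma rough_bundleE:
  assumes "\<xi> \<in> rough_bundle n M"
  obtains \<psi> f where "local_frame M \<psi>" "f \<in> fiber_space (mdim M) n" "\<xi> = bundle_rel M n `` {(jet2 M \<psi>, f)}"
  using assms unfolding rough_bundle_def frame_bundle2_def quotient_def by blast

lemma rough_bundleI: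
  assumes "local_frame M \<psi>" "f \<in> fiber_space (mdim M) n"
  shows "bundle_rel M n `` {(jet2 M \<psi>, f)} \<in> rough_bundle n M"
  using assms unfolding rough_bundle_def frame_bundle2_def quotient_def by blast

lemma base_point_in_topspace:
  assumes "smooth_manifold M" "\<xi> \<in> rough_bundle n M"
  shows "base_point \<xi> \<in> topspace (mtop M)"
proof -
  obtain \<psi> f where "local_frame M \<psi>" "f \<in> fiber_space (mdim M) n" "\<xi> = bundle_rel M n `` {(jet2 M \<psi>, f)}"
    by (rule rough_bundleE[OF assms(2)])
  then show ?thesis using class_coords(1,2)[OF assms(1)] by simp
qed

text \<open>Coordinates replace symmetry and transitivity of the relation: every member of the first
  class has coordinates \<open>g\<close>, and equality of coordinates relates it to the second
  pair.\<close>

lemma bundle_rel_class_subset: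
  assumes M: "smooth_manifold M" and \<psi>: "local_frame M \<psi>" and \<psi>': "local_frame M \<psi>'"
    and f: "f \<in> fiber_space (mdim M) n" "f' \<in> fiber_space (mdim M) n"
    and o: "\<psi>' origin = \<psi> origin" and c: "(U, x) \<in> charts M" "\<psi> origin \<in> U"
    and J: "jet_push (mdim M) (mdim M) n (\<lambda>u. x (\<psi> u)) origin f g"
    and J': "jet_push (mdim M) (mdim M) n (\<lambda>u. x (\<psi>' u)) origin f' g"
  shows "bundle_rel M n `` {(jet2 M \<psi>, f)} \<subseteq> bundle_rel M n `` {(jet2 M \<psi>', f')}"
proof
  fix z assume z: "z \<in> bundle_rel M n `` {(jet2 M \<psi>, f)}"
  obtain J2 f2 where z2: "z = (J2, f2)" by (cases z)
  have rel: "((jet2 M \<psi>, f), (J2, f2)) \<in> bundle_rel M n" using z z2 by simp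
  then have "J2 \<in> frame_bundle2 M" and f2: "f2 \<in> fiber_space (mdim M) n" unfolding bundle_rel_def by blast+
  then obtain \<eta> where \<eta>: "local_frame M \<eta>" "J2 = jet2 M \<eta>" unfolding frame_bundle2_def by blast
  have \<eta>J: "\<eta> \<in> J2" using jet2_self \<eta> by blast
  have o2: "\<eta> origin = \<psi>' origin" using bundle_rel_coords(1)[OF M rel jet2_self[OF \<psi>] \<eta>J] o by simp
  have "jet_push (mdim M) (mdim M) n (\<lambda>u. x (\<eta> u)) origin f2 g"
    by (rule bundle_rel_coords(2)[OF M rel jet2_self[OF \<psi>] \<eta>J c J])
  from bundle_relI[OF M \<psi>' \<eta>(1) o2 c(1) _ f(2) f2 J' this] c(2) o
  show "z \<in> bundle_rel M n `` {(jet2 M \<psi>', f')}" by (simp add: z2 \<eta>(2))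
qed

lemma rough_bundle_eqI:
  assumes M: "smooth_manifold M" and \<xi>: "\<xi> \<in> rough_bundle n M" and \<eta>: "\<eta> \<in> rough_bundle n M"
    and b: "base_point \<xi> = base_point \<eta>" and c: "(U, x) \<in> charts M" "base_point \<xi> \<in> U"
    and eq: "fiber_coords n M (U, x) \<xi> = fiber_coords n M (U, x) \<eta>"
  shows "\<xi> = \<eta>"
proof -
  obtain \<psi> f where 1: "local_frame M \<psi>" "f \<in> fiber_space (mdim M) n" "\<xi> = bundle_rel M n `` {(jet2 M \<psi>, f)}"
    by (rule rough_bundleE[OF \<xi>])
  obtain \<psi>' f' where 2: "local_frame M \<psi>'" "f' \<in> fiber_space (mdim M) n" "\<eta> = bundle_rel M n `` {(jet2 M \<psi>', f')}"
    by (rule rough_bundleE[OF \<eta>])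
  have o: "base_point \<xi> = \<psi> origin" "base_point \<eta> = \<psi>' origin"
    using class_coords(1)[OF M 1(1,2)] class_coords(1)[OF M 2(1,2)] 1(3) 2(3) by simp_all
  have U: "\<psi> origin \<in> U" "\<psi>' origin \<in> U" using c o b by simp_all
  note J = class_coords(3)[OF M 1(1,2) c(1) U(1), folded 1(3)]
  note J' = class_coords(3)[OF M 2(1,2) c(1) U(2), folded 2(3), folded eq]
  have o': "\<psi>' origin = \<psi> origin" using o b by simp
  show ?thesis
    unfolding 1(3) 2(3)
  proof
    show "bundle_rel M n `` {(jet2 M \<psi>, f)} \<subseteq> bundle_rel M n `` {(jet2 M \<psi>', f')}"
      by (rule bundle_rel_class_subset[OF M 1(1) 2(1) 1(2) 2(2) o' c(1) U(1) J J'])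
    show "bundle_rel M n `` {(jet2 M \<psi>', f')} \<subseteq> bundle_rel M n `` {(jet2 M \<psi>, f)}"
      by (rule bundle_rel_class_subset[OF M 2(1) 1(1) 2(2) 1(2) o'[symmetric] c(1) U(2) J' J])
  qed
qed

text \<open>Used to move a given point of a chart to the origin, where frames are based.\<close>

lemma translation_diffeo:
  assumes W: "openin (Euclidean_space m) W" and p: "p \<in> coord_space m"
  obtains W2 where "coord_diffeo m W W2 (\<lambda>u i. u i - p i) (\<lambda>v i. v i + p i)"
proof -
  have sm: "smooth_vec m m W (\<lambda>u i. u i - p i)" if "openin (Euclidean_space m) W" "p \<in> coord_space m" for W p
    unfolding smooth_vec_def
  proof (intro conjI allI impI that)
    show "(\<lambda>u i. u i - p i) ` W \<subseteq> coord_space m"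
      using openin_subset[OF that(1)] that(2) by (fastforce simp: mem_coord_space)
    show "smooth_on m W (\<lambda>u. u i - p i)" if "i < m" for i
      using \<open>openin (Euclidean_space m) W\<close> by (intro smooth_on_diff smooth_on_coord smooth_on_const)
  qed
  define W2 where "W2 = {v \<in> coord_space m. (\<lambda>i. v i + p i) \<in> W}"
  have p': "(\<lambda>i. - p i) \<in> coord_space m" using p by (simp add: mem_coord_space)
  have sm2: "smooth_vec m m (coord_space m) (\<lambda>v i. v i + p i)" using sm[OF openin_topspace p'] by simp
  have W2: "openin (Euclidean_space m) W2" unfolding W2_def by (rule smooth_vec_preimage_open[OF sm2 W])
  have "coord_diffeo m W W2 (\<lambda>u i. u i - p i) (\<lambda>v i. v i + p i)"
    unfolding coord_diffeo_def
  proof (intro conjI ballI)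
    show "smooth_vec m m W (\<lambda>u i. u i - p i)" by (rule sm[OF W p])
    show "smooth_vec m m W2 (\<lambda>v i. v i + p i)" by (rule smooth_vec_subset[OF sm2 _ W2]) (auto simp: W2_def)
    show "(\<lambda>i. u i - p i) \<in> W2" if "u \<in> W" for u
      using that smooth_vec_in_coord_space[OF sm[OF W p]] by (simp add: W2_def)
    show "(\<lambda>i. v i + p i) \<in> W" if "v \<in> W2" for v using that by (simp add: W2_def)
  qed simp_all
  then show ?thesis by (rule that)
qed

text \<open>Translate the chart so that \<open>p\<close> is mapped to the origin and take its
  inverse as the frame. The tuple to be paired with this frame is \<open>g\<close> pushed into the
  translated chart, and pushing it back returns \<open>g\<close>.\<close>

lemma rough_bundle_exists:
  assumes M: "smooth_manifold M" and c: "(U, x) \<in> charts M" and p: "p \<in> U" and g: "g \<in> fiber_space (mdim M) n"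
  obtains \<xi> where "\<xi> \<in> rough_bundle n M" "base_point \<xi> = p" "fiber_coords n M (U, x) \<xi> = g"
proof -
  let ?m = "mdim M"
  note cU = chart_coordinate_chart(2)[OF M c]
  obtain W2 where D: "coord_diffeo ?m (x ` U) W2 (\<lambda>u i. u i - x p i) (\<lambda>v i. v i + x p i)"
    by (rule translation_diffeo[OF cU chart_in_coord_space[OF M c p]])
  have c': "({r \<in> U. x r \<in> x ` U}, \<lambda>r i. x r i - x p i) \<in> charts M"
    by (rule chart_diffeo[OF M c D subset_refl])
  have "{r \<in> U. x r \<in> x ` U} = U" by blast
  define x' where "x' r i = x r i - x p i" for r i
  have c': "(U, x') \<in> charts M" using c' \<open>{r \<in> U. x r \<in> x ` U} = U\<close> by (simp add: x'_def[abs_def])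
  have x'p: "x' p = origin" by (simp add: x'_def fun_eq_iff)
  then have o: "origin \<in> x' ` U" using p by (metis imageI)
  define \<psi> where "\<psi> = inv_into U x'"
  have \<psi>: "local_frame M \<psi>" unfolding \<psi>_def by (rule local_frame_chart[OF M c' o])
  have \<psi>0: "\<psi> origin = p" unfolding \<psi>_def x'p[symmetric] by (rule chart_inv_into[OF M c' p])
  have sm1: "smooth_vec ?m ?m (x ` U) (\<lambda>u. x' (inv_into U x u))" using chart_transition[OF M c c'] by simp
  have sm2: "smooth_vec ?m ?m (x' ` U) (\<lambda>u. x (\<psi> u))" unfolding \<psi>_def using chart_transition[OF M c' c] by simp
  have xp: "x p \<in> x ` U" using p by blast
  obtain f where f: "jet_push ?m ?m n (\<lambda>u. x' (inv_into U x u)) (x p) g f" by (rule jet_push_exists[OF sm1 xp])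
  have inv: "x (\<psi> (x' (inv_into U x u))) = u" if "u \<in> x ` U" for u
    using that chart_inv_into[OF M c'] chart_inv_into[OF M c] by (auto simp: \<psi>_def)
  have xp0: "x' (inv_into U x (x p)) = origin" using chart_inv_into[OF M c p] x'p by simp
  have J: "jet_push ?m ?m n (\<lambda>u. x (\<psi> u)) origin f g"
    using jet_push_inverse[OF sm1 sm2 xp _ inv g f] o unfolding xp0 by blast
  have f': "f \<in> fiber_space ?m n" using f by (rule jet_push_fiber_space)
  show ?thesis
  proof (rule that)
    show "bundle_rel M n `` {(jet2 M \<psi>, f)} \<in> rough_bundle n M" by (rule rough_bundleI[OF \<psi> f'])
    show "base_point (bundle_rel M n `` {(jet2 M \<psi>, f)}) = p" using class_coords(1)[OF M \<psi> f'] \<psi>0 by simp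
    show "fiber_coords n M (U, x) (bundle_rel M n `` {(jet2 M \<psi>, f)}) = g"
      using class_coords(3)[OF M \<psi> f' c] \<psi>0 p J jet_push_unique by blast
  qed
qed

lemma fiber_coords_in_fiber_space:
  assumes M: "smooth_manifold M" and \<xi>: "\<xi> \<in> rough_bundle n M" and c: "(U, x) \<in> charts M" "base_point \<xi> \<in> U"
  shows "fiber_coords n M (U, x) \<xi> \<in> fiber_space (mdim M) n"
proof -
  obtain \<psi> f where 1: "local_frame M \<psi>" "f \<in> fiber_space (mdim M) n" "\<xi> = bundle_rel M n `` {(jet2 M \<psi>, f)}"
    by (rule rough_bundleE[OF \<xi>])
  then show ?thesis using class_coords(1,3)[OF M 1(1,2)] c jet_push_fiber_space by metis
qed

text \<open>Both coordinate tuples are pushes of one \<open>f\<close>, under \<open>x\<close> and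
  under \<open>y\<close> after the same frame. Near the origin the second map is the transition
  after the first, so composition and uniqueness give the claim.\<close>

lemma fiber_coords_transition:
  assumes M: "smooth_manifold M" and \<xi>: "\<xi> \<in> rough_bundle n M"
    and c: "(U, x) \<in> charts M" "base_point \<xi> \<in> U" and d: "(V, y) \<in> charts M" "base_point \<xi> \<in> V"
  shows "jet_push (mdim M) (mdim M) n (\<lambda>u. y (inv_into U x u)) (x (base_point \<xi>))
      (fiber_coords n M (U, x) \<xi>) (fiber_coords n M (V, y) \<xi>)"
proof -
  let ?m = "mdim M"
  obtain \<psi> f where 1: "local_frame M \<psi>" "f \<in> fiber_space ?m n" "\<xi> = bundle_rel M n `` {(jet2 M \<psi>, f)}"
    by (rule rough_bundleE[OF \<xi>])
  have b: "base_point \<xi> = \<psi> origin" using class_coords(1)[OF M 1(1,2)] 1(3) by simp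
  have J: "jet_push ?m ?m n (\<lambda>u. x (\<psi> u)) origin f (fiber_coords n M (U, x) \<xi>)"
    using class_coords(3)[OF M 1(1,2) c(1)] c(2) b 1(3) by simp
  have J': "jet_push ?m ?m n (\<lambda>u. y (\<psi> u)) origin f (fiber_coords n M (V, y) \<xi>)"
    using class_coords(3)[OF M 1(1,2) d(1)] d(2) b 1(3) by simp
  have xb: "x (base_point \<xi>) \<in> x ` (U \<inter> V)" using c d by blast
  note t = chart_transition[OF M c(1) d(1)]
  obtain l where l: "jet_push ?m ?m n (\<lambda>u. y (inv_into U x u)) (x (base_point \<xi>)) (fiber_coords n M (U, x) \<xi>) l"
    by (rule jet_push_exists[OF t xb])
  obtain W where W: "origin \<in> W" "openin (Euclidean_space ?m) W" "inj_on \<psi> W" "\<psi> ` W \<subseteq> topspace (mtop M)"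
    and DW: "\<forall>U x. (U, x) \<in> charts M \<longrightarrow> coord_diffeo ?m {u \<in> W. \<psi> u \<in> U} (x ` (U \<inter> \<psi> ` W))
       (\<lambda>u. x (\<psi> u)) (\<lambda>v. inv_into W \<psi> (inv_into U x v))"
    by (rule local_frame_diffeo[OF 1(1) M])
  have "coord_diffeo ?m {u \<in> W. \<psi> u \<in> U} (x ` (U \<inter> \<psi> ` W)) (\<lambda>u. x (\<psi> u)) (\<lambda>v. inv_into W \<psi> (inv_into U x v))"
    using DW c by blast
  then have sm: "smooth_vec ?m ?m {u \<in> W. \<psi> u \<in> U} (\<lambda>u. x (\<psi> u))" unfolding coord_diffeo_def by blast
  have o: "origin \<in> {u \<in> W. \<psi> u \<in> U}" using W(1) c(2) b by simp
  have "jet_push ?m ?m n (\<lambda>u. y (inv_into U x (x (\<psi> u)))) origin f l"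
    using jet_push_comp[OF sm t o _ J] xb l b by simp
  then have "jet_push ?m ?m n (\<lambda>u. y (\<psi> u)) origin f l"
    by (rule jet_push_local[OF smooth_vec_open[OF sm] o, rotated]) (simp add: chart_inv_into[OF M c(1)])
  then have "l = fiber_coords n M (V, y) \<xi>" using J' jet_push_unique by blast
  then show ?thesis using l by simp
qed

text \<open>Conjugate the coordinate expression by the transition maps of source and target. The
  threefold composite agrees with the expression in the new charts near the point, and its jet acts
  as the composite of the three actions.\<close>

lemma jet_push_other_charts:
  assumes M: "smooth_manifold M" and M': "smooth_manifold M'" and \<phi>: "smooth_map M M' \<phi>"
    and \<xi>: "\<xi> \<in> rough_bundle n M" and \<eta>: "\<eta> \<in> rough_bundle n M'" and b: "base_point \<eta> = \<phi> (base_point \<xi>)"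
    and c: "(U, x) \<in> charts M" "base_point \<xi> \<in> U" and d: "(V, y) \<in> charts M'" "\<phi> (base_point \<xi>) \<in> V"
    and c2: "(U2, x2) \<in> charts M" "base_point \<xi> \<in> U2" and d2: "(V2, y2) \<in> charts M'" "\<phi> (base_point \<xi>) \<in> V2"
    and J: "jet_push (mdim M) (mdim M') n (\<lambda>u. y (\<phi> (inv_into U x u))) (x (base_point \<xi>))
      (fiber_coords n M (U, x) \<xi>) (fiber_coords n M' (V, y) \<eta>)"
  shows "jet_push (mdim M) (mdim M') n (\<lambda>u. y2 (\<phi> (inv_into U2 x2 u))) (x2 (base_point \<xi>))
      (fiber_coords n M (U2, x2) \<xi>) (fiber_coords n M' (V2, y2) \<eta>)"
proof -
  let ?p = "base_point \<xi>"
  note t = chart_transition[OF M c2(1) c(1)] and t' = chart_transition[OF M' d(1) d2(1)]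
    and s = smooth_map_coords[OF M M' \<phi> c(1) d(1)] and s2 = smooth_map_coords[OF M M' \<phi> c2(1) d2(1)]
    and inv = chart_inv_into[OF M c(1)] and inv2 = chart_inv_into[OF M c2(1)] and inv' = chart_inv_into[OF M' d(1)]
  \<comment> \<open>The part of the new chart, in its coordinates, on which the old coordinate
    expression makes sense.\<close>
  define A where "A = {u \<in> x2 ` (U2 \<inter> U). x (inv_into U2 x2 u) \<in> x ` {p \<in> U. \<phi> p \<in> V}}"
  have A: "openin (Euclidean_space (mdim M)) A"
    unfolding A_def by (rule smooth_vec_preimage_open[OF t smooth_vec_open[OF s]])
  have tA: "smooth_vec (mdim M) (mdim M) A (\<lambda>u. x (inv_into U2 x2 u))"
    by (rule smooth_vec_subset[OF t _ A]) (auto simp: A_def)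
  have sA: "smooth_vec (mdim M) (mdim M') A (\<lambda>u. y (\<phi> (inv_into U x (x (inv_into U2 x2 u)))))"
    by (rule smooth_vec_comp[OF s tA]) (simp add: A_def)
  have pA: "x2 ?p \<in> A" using c c2 d inv2 by (auto simp: A_def)
  have "jet_push (mdim M) (mdim M) n (\<lambda>u. x (inv_into U2 x2 u)) (x2 ?p) (fiber_coords n M (U2, x2) \<xi>) (fiber_coords n M (U, x) \<xi>)"
    by (rule fiber_coords_transition[OF M \<xi> c2 c])
  then have 1: "jet_push (mdim M) (mdim M') n (\<lambda>u. y (\<phi> (inv_into U x (x (inv_into U2 x2 u))))) (x2 ?p)
      (fiber_coords n M (U2, x2) \<xi>) (fiber_coords n M' (V, y) \<eta>)"
    using jet_push_comp[OF tA s pA] J c(2) d(2) inv2[OF c2(2)] by auto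
  have 2: "jet_push (mdim M') (mdim M') n (\<lambda>u. y2 (inv_into V y u)) (y (\<phi> ?p)) (fiber_coords n M' (V, y) \<eta>) (fiber_coords n M' (V2, y2) \<eta>)"
    using fiber_coords_transition[OF M' \<eta> d(1) _ d2(1)] b d(2) d2(2) by simp
  define A2 where "A2 = A \<inter> x2 ` {p \<in> U2. \<phi> p \<in> V2}"
  have A2: "openin (Euclidean_space (mdim M)) A2"
    unfolding A2_def by (rule openin_Int[OF A smooth_vec_open[OF s2]])
  have pA2: "x2 ?p \<in> A2" using pA c2 d2 by (auto simp: A2_def)
  have 3: "jet_push (mdim M) (mdim M') n (\<lambda>u. y2 (inv_into V y (y (\<phi> (inv_into U x (x (inv_into U2 x2 u))))))) (x2 ?p)
      (fiber_coords n M (U2, x2) \<xi>) (fiber_coords n M' (V2, y2) \<eta>)"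
    using jet_push_comp[OF sA t' pA _ 1] 2 d d2 inv[OF c(2)] inv2[OF c2(2)] by auto
  show ?thesis
  proof (rule jet_push_local[OF A2 pA2 _ 3])
    fix v assume "v \<in> A2"
    then have v: "v \<in> x2 ` (U2 \<inter> U)" "x (inv_into U2 x2 v) \<in> x ` {p \<in> U. \<phi> p \<in> V}" by (simp_all add: A2_def A_def)
    then obtain r where r: "r \<in> U2" "r \<in> U" "v = x2 r" by blast
    then have "x r \<in> x ` {p \<in> U. \<phi> p \<in> V}" using v(2) inv2 by simp
    then have "\<phi> r \<in> V" using inv[OF r(2)] inv by auto
    then show "y2 (inv_into V y (y (\<phi> (inv_into U x (x (inv_into U2 x2 v)))))) = y2 (\<phi> (inv_into U2 x2 v))"
      using r inv inv2 inv' by simp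
  qed
qed

text \<open>The description quantifies over all pairs of charts. One pair suffices to recognize the
  value: chart independence gives the others, and coordinates in one chart determine the
  point.\<close>

lemma bundle_map_eqI:
  assumes M: "smooth_manifold M" and M': "smooth_manifold M'" and \<phi>: "smooth_map M M' \<phi>"
    and \<xi>: "\<xi> \<in> rough_bundle n M" and \<eta>: "\<eta> \<in> rough_bundle n M'" and b: "base_point \<eta> = \<phi> (base_point \<xi>)"
    and c: "(U, x) \<in> charts M" "base_point \<xi> \<in> U" and d: "(V, y) \<in> charts M'" "\<phi> (base_point \<xi>) \<in> V"
    and J: "jet_push (mdim M) (mdim M') n (\<lambda>u. y (\<phi> (inv_into U x u))) (x (base_point \<xi>))
      (fiber_coords n M (U, x) \<xi>) (fiber_coords n M' (V, y) \<eta>)"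
  shows "bundle_map n M M' \<phi> \<xi> = \<eta>"
  unfolding bundle_map_def
proof (rule the_equality)
  show "\<eta> \<in> rough_bundle n M' \<and> base_point \<eta> = \<phi> (base_point \<xi>) \<and>
     (\<forall>(U, x)\<in>charts M. \<forall>(V, y)\<in>charts M'. base_point \<xi> \<in> U \<and> \<phi> (base_point \<xi>) \<in> V \<longrightarrow>
        jet_push (mdim M) (mdim M') n (\<lambda>u. y (\<phi> (inv_into U x u))) (x (base_point \<xi>))
          (fiber_coords n M (U, x) \<xi>) (fiber_coords n M' (V, y) \<eta>))"
    using \<eta> b jet_push_other_charts[OF M M' \<phi> \<xi> \<eta> b c d _ _ _ _ J] by auto
  fix \<eta>' assume \<eta>': "\<eta>' \<in> rough_bundle n M' \<and> base_point \<eta>' = \<phi> (base_point \<xi>) \<and>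
     (\<forall>(U, x)\<in>charts M. \<forall>(V, y)\<in>charts M'. base_point \<xi> \<in> U \<and> \<phi> (base_point \<xi>) \<in> V \<longrightarrow>
        jet_push (mdim M) (mdim M') n (\<lambda>u. y (\<phi> (inv_into U x u))) (x (base_point \<xi>))
          (fiber_coords n M (U, x) \<xi>) (fiber_coords n M' (V, y) \<eta>'))"
  then have "jet_push (mdim M) (mdim M') n (\<lambda>u. y (\<phi> (inv_into U x u))) (x (base_point \<xi>))
          (fiber_coords n M (U, x) \<xi>) (fiber_coords n M' (V, y) \<eta>')" using c d by blast
  then have "fiber_coords n M' (V, y) \<eta>' = fiber_coords n M' (V, y) \<eta>" using J jet_push_unique by blast
  then show "\<eta>' = \<eta>" using rough_bundle_eqI[OF M' _ \<eta> _ d(1)] \<eta>' b d(2) by simp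
qed

text \<open>The value exists: push the coordinates in one pair of charts and realize the result as a
  point over \<open>\<phi> (base_point \<xi>)\<close>. From here on the description need not be
  unfolded.\<close>

lemma bundle_map_coords:
  assumes M: "smooth_manifold M" and M': "smooth_manifold M'" and \<phi>: "smooth_map M M' \<phi>"
    and \<xi>: "\<xi> \<in> rough_bundle n M" and c: "(U, x) \<in> charts M" "base_point \<xi> \<in> U" and d: "(V, y) \<in> charts M'" "\<phi> (base_point \<xi>) \<in> V"
  shows "base_point (bundle_map n M M' \<phi> \<xi>) = \<phi> (base_point \<xi>)"
    and "jet_push (mdim M) (mdim M') n (\<lambda>u. y (\<phi> (inv_into U x u))) (x (base_point \<xi>))
      (fiber_coords n M (U, x) \<xi>) (fiber_coords n M' (V, y) (bundle_map n M M' \<phi> \<xi>))"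
proof -
  have p: "x (base_point \<xi>) \<in> x ` {p \<in> U. \<phi> p \<in> V}" using c d by blast
  obtain g where g: "jet_push (mdim M) (mdim M') n (\<lambda>u. y (\<phi> (inv_into U x u))) (x (base_point \<xi>)) (fiber_coords n M (U, x) \<xi>) g"
    by (rule jet_push_exists[OF smooth_map_coords[OF M M' \<phi> c(1) d(1)] p])
  obtain \<eta> where \<eta>: "\<eta> \<in> rough_bundle n M'" "base_point \<eta> = \<phi> (base_point \<xi>)" "fiber_coords n M' (V, y) \<eta> = g"
    by (rule rough_bundle_exists[OF M' d jet_push_fiber_space[OF g]])
  have "bundle_map n M M' \<phi> \<xi> = \<eta>"
    by (rule bundle_map_eqI[OF M M' \<phi> \<xi> \<eta>(1,2) c d]) (use g \<eta>(3) in simp)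
  then show "base_point (bundle_map n M M' \<phi> \<xi>) = \<phi> (base_point \<xi>)"
    "jet_push (mdim M) (mdim M') n (\<lambda>u. y (\<phi> (inv_into U x u))) (x (base_point \<xi>))
      (fiber_coords n M (U, x) \<xi>) (fiber_coords n M' (V, y) (bundle_map n M M' \<phi> \<xi>))"
    using \<eta> g by simp_all
qed

section \<open>Slice charts\<close>

lemma coord_diffeo_id: "openin (Euclidean_space m) W \<Longrightarrow> coord_diffeo m W W (\<lambda>u. u) (\<lambda>u. u)"
  by (simp add: coord_diffeo_def smooth_vec_id)

text \<open>Coordinates of \<open>M\<close> are exchanged one at a time for components of the embedding; since the
  embedding is an immersion, some component always has a non-zero derivative in the direction of the
  coordinate to be exchanged.\<close>

lemma coordinates_from_immersion:
  assumes M: "smooth_manifold M" and M': "smooth_manifold M'" and imm: "immersion M M' \<phi>"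
    and p: "p \<in> topspace (mtop M)" and d: "(V, y) \<in> charts M'" "\<phi> p \<in> V"
  shows "k \<le> mdim M \<Longrightarrow> \<exists>U x \<iota>. (U, x) \<in> charts M \<and> p \<in> U \<and> (\<forall>r\<in>U. \<phi> r \<in> V) \<and>
    (\<forall>j<k. \<iota> j < mdim M' \<and> (\<forall>r\<in>U. x r j = y (\<phi> r) (\<iota> j)))"
proof (induction k)
  case 0
  have sm: "smooth_map M M' \<phi>" using imm by (simp add: immersion_def)
  obtain U x where c: "(U, x) \<in> charts M" "p \<in> U" by (rule chart_exists[OF M p])
  define W where "W = x ` {r \<in> U. \<phi> r \<in> V}"
  have W: "openin (Euclidean_space (mdim M)) W"
    unfolding W_def by (rule smooth_vec_open[OF smooth_map_coords[OF M M' sm c(1) d(1)]])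
  \<comment> \<open>Shrinking the chart to the points mapped into \<open>V\<close> is a change of
    coordinates by the identity.\<close>
  have "W \<subseteq> x ` U" by (auto simp: W_def)
  from chart_diffeo[OF M c(1) coord_diffeo_id[OF W] this]
  have "({r \<in> U. x r \<in> W}, x) \<in> charts M" by simp
  moreover have "x r \<in> W \<longleftrightarrow> \<phi> r \<in> V" if "r \<in> U" for r
    unfolding W_def using inj_on_image_mem_iff[OF chart_inj_on[OF M c(1)] that, of "{r \<in> U. \<phi> r \<in> V}"] that by simp
  then have "{r \<in> U. x r \<in> W} = {r \<in> U. \<phi> r \<in> V}" by blast
  ultimately show ?case using c(2) d(2) by (intro exI[of _ "{r \<in> U. \<phi> r \<in> V}"] exI[of _ x]) simp
next
  case (Suc k)
  have sm: "smooth_map M M' \<phi>" using imm by (simp add: immersion_def)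
  obtain U x \<iota> where c: "(U, x) \<in> charts M" "p \<in> U" and UV: "\<forall>r\<in>U. \<phi> r \<in> V"
    and \<iota>: "\<forall>j<k. \<iota> j < mdim M' \<and> (\<forall>r\<in>U. x r j = y (\<phi> r) (\<iota> j))"
    using Suc by auto
  have k: "k < mdim M" using Suc.prems by simp
  define h where "h u = y (\<phi> (inv_into U x u))" for u
  have UV': "{r \<in> U. \<phi> r \<in> V} = U" using UV by blast
  have h: "smooth_vec (mdim M) (mdim M') (x ` U) h"
    using smooth_map_coords[OF M M' sm c(1) d(1)] unfolding UV' by (simp add: h_def[abs_def])
  \<comment> \<open>Otherwise the \<open>k\<close>-th basis vector would lie in the kernel of the
    differential.\<close>
  have "\<exists>i<mdim M'. partial_deriv k (\<lambda>u. h u i) (x p) \<noteq> 0"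
  proof (rule ccontr)
    assume "\<not> ?thesis"
    then have zero: "\<forall>i<mdim M'. partial_deriv k (\<lambda>u. h u i) (x p) = 0" by blast
    define v where "v j = (if j = k then 1 else 0 :: real)" for j
    have "\<forall>i<mdim M'. (\<Sum>j<mdim M. partial_deriv j (\<lambda>u. y (\<phi> (inv_into U x u)) i) (x p) * v j) = 0"
      using zero k by (simp add: v_def h_def if_distrib[of "\<lambda>x. _ * x"] cong: if_cong)
    then have "\<forall>j<mdim M. v j = 0" using imm c d unfolding immersion_def by blast
    then show False using k by (auto simp: v_def)
  qed
  then obtain i where i: "i < mdim M'" "partial_deriv k (\<lambda>u. h u i) (x p) \<noteq> 0" by blast
  have xp: "x p \<in> x ` U" using c(2) by blast
  obtain W1 W2 \<Psi> where W: "W1 \<subseteq> x ` U" "x p \<in> W1" "coord_diffeo (mdim M) W1 W2 (\<lambda>u. u(k := h u i)) \<Psi>"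
    by (rule coordinate_replacement[OF smooth_vec_coord[OF h i(1)] xp k i(2)])
  define U' where "U' = {r \<in> U. x r \<in> W1}"
  define x' where "x' r = (x r)(k := h (x r) i)" for r
  have "(U', x') \<in> charts M"
    using chart_diffeo[OF M c(1) W(3,1)] by (simp add: U'_def x'_def[abs_def])
  moreover have "p \<in> U'" using c(2) W(2) by (simp add: U'_def)
  moreover have "\<forall>r\<in>U'. \<phi> r \<in> V" using UV by (simp add: U'_def)
  \<comment> \<open>The coordinates exchanged earlier survive, because this replacement changes
    coordinate \<open>k\<close> alone.\<close>
  moreover have "\<forall>j<Suc k. (\<iota>(k := i)) j < mdim M' \<and> (\<forall>r\<in>U'. x' r j = y (\<phi> r) ((\<iota>(k := i)) j))"
  proof (intro allI impI)
    fix j assume j: "j < Suc k"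
    have "h (x r) i = y (\<phi> r) i" if "r \<in> U" for r using chart_inv_into[OF M c(1) that] by (simp add: h_def)
    then show "(\<iota>(k := i)) j < mdim M' \<and> (\<forall>r\<in>U'. x' r j = y (\<phi> r) ((\<iota>(k := i)) j))"
      using \<iota> i(1) j by (cases "j = k") (auto simp: U'_def x'_def)
  qed
  ultimately show ?case by blast
qed

text \<open>The indices in the range of \<open>\<iota>\<close> are the tangential coordinates of the
  target chart and the remaining ones the normal coordinates. The last clause keeps other sheets of
  the submanifold out of \<open>V\<close>.\<close>

definition slice_pair :: "'a manifold \<Rightarrow> 'b manifold \<Rightarrow> ('a \<Rightarrow> 'b) \<Rightarrow> 'a chart \<Rightarrow> 'b chart \<Rightarrow> (nat \<Rightarrow> nat) \<Rightarrow> bool" where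
  "slice_pair M M' \<phi> = (\<lambda>(U, x) (V, z) \<iota>. (U, x) \<in> charts M \<and> (V, z) \<in> charts M' \<and>
     inj_on \<iota> {..<mdim M} \<and> \<iota> ` {..<mdim M} \<subseteq> {..<mdim M'} \<and>
     (\<forall>r\<in>U. \<phi> r \<in> V \<longrightarrow> (\<forall>j<mdim M. z (\<phi> r) (\<iota> j) = x r j)) \<and>
     (\<forall>q\<in>V. q \<in> \<phi> ` U \<longleftrightarrow> (\<forall>i\<in>{..<mdim M'} - \<iota> ` {..<mdim M}. z q i = 0)) \<and>
     V \<inter> \<phi> ` topspace (mtop M) \<subseteq> \<phi> ` U)"

text \<open>Once the coordinates of \<open>M\<close> are components of the embedding, its image is a
  graph over those components. Subtracting the graph function from the other components flattens the
  image by a map whose inverse is explicit. The embedding property permits shrinking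
  \<open>V\<close> until no other part of the image meets it.\<close>

lemma slice_pair_exists:
  assumes M: "smooth_manifold M" and M': "smooth_manifold M'" and emb: "properly_embedded M M' \<phi>"
    and p: "p \<in> topspace (mtop M)"
  obtains U x V z \<iota> where "slice_pair M M' \<phi> (U, x) (V, z) \<iota>" "p \<in> U" "\<phi> p \<in> V"
proof -
  let ?m = "mdim M" and ?m' = "mdim M'"
  have imm: "immersion M M' \<phi>" and em: "embedding_map (mtop M) (mtop M') \<phi>" using emb by (simp_all add: properly_embedded_def)
  have sm: "smooth_map M M' \<phi>" using imm by (simp add: immersion_def)
  have \<phi>p: "\<phi> p \<in> topspace (mtop M')" using sm p continuous_map_image_subset_topspace unfolding smooth_map_def by blast
  obtain V y where d: "(V, y) \<in> charts M'" "\<phi> p \<in> V" by (rule chart_exists[OF M' \<phi>p])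
  obtain U x \<iota> where c: "(U, x) \<in> charts M" "p \<in> U" and UV: "\<forall>r\<in>U. \<phi> r \<in> V"
    and \<iota>: "\<forall>j<?m. \<iota> j < ?m' \<and> (\<forall>r\<in>U. x r j = y (\<phi> r) (\<iota> j))"
    using coordinates_from_immersion[OF M M' imm p d order_refl] by blast
  have xU: "openin (Euclidean_space ?m) (x ` U)" by (rule chart_coordinate_chart(2)[OF M c(1)])
  have xp: "x p \<in> x ` U" using c(2) by blast
  define I where "I = \<iota> ` {..<?m}"
  have I: "I \<subseteq> {..<?m'}" using \<iota> by (auto simp: I_def)
  \<comment> \<open>Two coordinates equal to the same component would agree on the open image of the
    chart, where one of them can be moved alone.\<close>
  have inj: "inj_on \<iota> {..<?m}"
  proof (rule inj_onI, rule ccontr)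
    fix j j' assume j: "j \<in> {..<?m}" "j' \<in> {..<?m}" "\<iota> j = \<iota> j'" "j \<noteq> j'"
    have eq: "u j = u j'" if "u \<in> x ` U" for u using that \<iota> j by auto
    obtain e where e: "e > 0" "cube ?m (x p) e \<subseteq> x ` U" by (rule openin_imp_cube[OF xU xp])
    have "(x p)(j := x p j + e / 2) \<in> cube ?m (x p) e"
      using j(1) e(1) chart_in_coord_space[OF M c] by (auto simp: cube_def mem_coord_space)
    then have "((x p)(j := x p j + e / 2)) j = ((x p)(j := x p j + e / 2)) j'" using eq e(2) by blast
    then show False using eq[OF xp] e(1) j(4) by simp
  qed
  define \<gamma> where "\<gamma> u = y (\<phi> (inv_into U x u))" for u
  have UV': "{r \<in> U. \<phi> r \<in> V} = U" using UV by blast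
  have \<gamma>: "smooth_vec ?m ?m' (x ` U) \<gamma>"
    using smooth_map_coords[OF M M' sm c(1) d(1)] unfolding UV' by (simp add: \<gamma>_def[abs_def])
  have \<gamma>x: "\<gamma> (x r) = y (\<phi> r)" if "r \<in> U" for r using chart_inv_into[OF M c(1) that] by (simp add: \<gamma>_def)
  \<comment> \<open>Projection to the tangential components, a left inverse of the embedding in
    coordinates.\<close>
  define \<pi> where "\<pi> v j = (if j < ?m then v (\<iota> j) else 0)" for v :: "nat \<Rightarrow> real" and j
  have \<pi>: "smooth_vec ?m' ?m (coord_space ?m') \<pi>"
    unfolding smooth_vec_def by (auto simp: \<pi>_def mem_coord_space smooth_on_coord)
  have \<pi>y: "\<pi> (y (\<phi> r)) = x r" if "r \<in> U" for r
  proof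
    fix j show "\<pi> (y (\<phi> r)) j = x r j"
      using \<iota> that chart_in_coord_space[OF M c(1) that] by (auto simp: \<pi>_def mem_coord_space)
  qed
  have "homeomorphic_map (mtop M) (subtopology (mtop M') (\<phi> ` topspace (mtop M))) \<phi>"
    using em by (simp add: embedding_map_def)
  then have "openin (subtopology (mtop M') (\<phi> ` topspace (mtop M))) (\<phi> ` U)"
    using homeomorphic_imp_open_map chart_coordinate_chart(1)[OF M c(1)] unfolding open_map_def by blast
  \<comment> \<open>\<open>\<phi>\<close> is open onto its image, so inside \<open>Q\<close> the
    submanifold consists of nothing but the image of \<open>U\<close>.\<close>
  then obtain Q where Q: "openin (mtop M') Q" "\<phi> ` U = Q \<inter> \<phi> ` topspace (mtop M)"
    unfolding openin_subtopology by blast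
  define A where "A = {v \<in> coord_space ?m'. \<pi> v \<in> x ` U}"
  have A: "openin (Euclidean_space ?m') A" unfolding A_def by (rule smooth_vec_preimage_open[OF \<pi> xU])
  have \<pi>A: "smooth_vec ?m' ?m A \<pi>" by (rule smooth_vec_subset[OF \<pi> _ A]) (auto simp: A_def)
  have \<gamma>\<pi>: "smooth_vec ?m' ?m' A (\<lambda>v. \<gamma> (\<pi> v))" by (rule smooth_vec_comp[OF \<gamma> \<pi>A]) (simp add: A_def)
  \<comment> \<open>The parameter \<open>c\<close> treats the shear and its inverse together:
    \<open>-1\<close> subtracts the graph function and \<open>1\<close> adds it back.\<close>
  have shear: "smooth_vec ?m' ?m' A (\<lambda>v i. if i \<in> I then v i else v i + c * \<gamma> (\<pi> v) i)" for c
    unfolding smooth_vec_def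
  proof (intro conjI allI impI A)
    show "(\<lambda>v i. if i \<in> I then v i else v i + c * \<gamma> (\<pi> v) i) ` A \<subseteq> coord_space ?m'"
      using openin_subset[OF A] smooth_vec_in_coord_space[OF \<gamma>\<pi>] I by (auto simp: mem_coord_space subset_iff)
    show "smooth_on ?m' A (\<lambda>v. if i \<in> I then v i else v i + c * \<gamma> (\<pi> v) i)" if "i < ?m'" for i
      using smooth_on_coord[OF A, of i]
        smooth_on_add[OF smooth_on_coord[OF A, of i] smooth_on_mult[OF smooth_on_const[OF A, of c] smooth_vec_coord[OF \<gamma>\<pi> that]]]
      by (cases "i \<in> I") simp_all
  qed
  define \<Theta> where "\<Theta> v i = (if i \<in> I then v i else v i + (-1) * \<gamma> (\<pi> v) i)" for v i
  define \<Psi> where "\<Psi> v i = (if i \<in> I then v i else v i + 1 * \<gamma> (\<pi> v) i)" for v i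
  have \<Theta>: "smooth_vec ?m' ?m' A \<Theta>" and \<Psi>: "smooth_vec ?m' ?m' A \<Psi>"
    using shear[of "-1"] shear[of 1] by (simp_all add: \<Theta>_def[abs_def] \<Psi>_def[abs_def])
  \<comment> \<open>Tangential components are untouched, so the shear and its inverse read off the
    same value of the graph function and cancel.\<close>
  have \<pi>\<Theta>: "\<pi> (\<Theta> v) = \<pi> v" "\<pi> (\<Psi> v) = \<pi> v" for v by (auto simp: \<pi>_def \<Theta>_def \<Psi>_def I_def fun_eq_iff)
  have \<Theta>\<Psi>: "\<Psi> (\<Theta> v) = v" "\<Theta> (\<Psi> v) = v" for v
    by (rule ext, simp add: \<Psi>_def[of "\<Theta> v"] \<pi>\<Theta> \<Theta>_def, rule ext, simp add: \<Theta>_def[of "\<Psi> v"] \<pi>\<Theta> \<Psi>_def)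
  define W1 where "W1 = A \<inter> y ` (V \<inter> Q)"
  have W1: "openin (Euclidean_space ?m') W1" unfolding W1_def by (rule openin_Int[OF A chart_image_open[OF M' d(1) Q(1)]])
  have W1A: "W1 \<subseteq> A" by (simp add: W1_def)
  define W2 where "W2 = {v \<in> A. \<Psi> v \<in> W1}"
  have W2: "openin (Euclidean_space ?m') W2" unfolding W2_def by (rule smooth_vec_preimage_open[OF \<Psi> W1])
  have W2A: "W2 \<subseteq> A" by (auto simp: W2_def)
  have "\<Theta> v \<in> W2" if "v \<in> W1" for v
    using that W1A smooth_vec_in_coord_space[OF \<Theta>, of v] \<Theta>\<Psi> \<pi>\<Theta> by (auto simp: W2_def A_def)
  then have D: "coord_diffeo ?m' W1 W2 \<Theta> \<Psi>"
    unfolding coord_diffeo_def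
    using smooth_vec_subset[OF \<Theta> W1A W1] smooth_vec_subset[OF \<Psi> W2A W2] \<Theta>\<Psi> by (auto simp: W2_def)
  have W1V: "W1 \<subseteq> y ` V" by (auto simp: W1_def)
  define V' where "V' = {q \<in> V. y q \<in> W1}"
  define z where "z q = \<Theta> (y q)" for q
  have d': "(V', z) \<in> charts M'" using chart_diffeo[OF M' d(1) D W1V] by (simp add: V'_def z_def[abs_def])
  have injy: "inj_on y V" by (rule chart_inj_on[OF M' d(1)])
  have V'Q: "q \<in> Q" if "q \<in> V'" for q
    using that inj_onD[OF injy] by (auto simp: V'_def W1_def)
  have \<phi>pV': "\<phi> p \<in> V'"
  proof -
    have "\<phi> p \<in> Q" using Q(2) c(2) by blast
    moreover have "y (\<phi> p) \<in> A" unfolding A_def using \<pi>y[OF c(2)] c(2) chart_in_coord_space[OF M' d] by simp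
    ultimately show ?thesis using d(2) by (simp add: V'_def W1_def)
  qed
  have on_U: "z (\<phi> r) i = (if i \<in> I then y (\<phi> r) i else 0)" if "r \<in> U" for r i
    by (simp add: z_def \<Theta>_def \<pi>y[OF that] \<gamma>x[OF that])
  have "slice_pair M M' \<phi> (U, x) (V', z) \<iota>"
    unfolding slice_pair_def case_prod_conv I_def[symmetric]
  proof (intro conjI ballI c(1) d' inj I allI impI)
    show "z (\<phi> r) (\<iota> j) = x r j" if "r \<in> U" "j < ?m" for r j
      using on_U[OF that(1), of "\<iota> j"] \<iota> that by (simp add: I_def)
    show "V' \<inter> \<phi> ` topspace (mtop M) \<subseteq> \<phi> ` U" using V'Q Q(2) by blast
    show "q \<in> \<phi> ` U \<longleftrightarrow> (\<forall>i\<in>{..<?m'} - I. z q i = 0)" if q: "q \<in> V'" for q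
    proof
      assume "q \<in> \<phi> ` U"
      then show "\<forall>i\<in>{..<?m'} - I. z q i = 0" using on_U by auto
    next
      assume zero: "\<forall>i\<in>{..<?m'} - I. z q i = 0"
      have qV: "q \<in> V" and "y q \<in> A" using q by (auto simp: V'_def W1_def)
      \<comment> \<open>The tangential components of \<open>q\<close> single out \<open>r\<close>;
        the vanishing normal coordinates say that the other components are those of the graph over
        it.\<close>
      then obtain r where r: "r \<in> U" "\<pi> (y q) = x r" by (auto simp: A_def)
      have "y q i = y (\<phi> r) i" for i
      proof -
        consider "i \<in> I" | "i \<in> {..<?m'} - I" | "i \<ge> ?m'" by force
        then show ?thesis
        proof cases
          case 1
          then obtain j where j: "j < ?m" "i = \<iota> j" by (auto simp: I_def)
          then have "y q i = \<pi> (y q) j" by (simp add: \<pi>_def)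
          also have "\<dots> = y (\<phi> r) i" using r \<iota> j by simp
          finally show ?thesis .
        next
          case 2
          then have "y q i - \<gamma> (x r) i = 0" using bspec[OF zero 2] r(2) by (simp add: z_def \<Theta>_def)
          then show ?thesis using \<gamma>x[OF r(1)] by simp
        next
          case 3
          then show ?thesis
            using chart_in_coord_space[OF M' d(1) qV] chart_in_coord_space[OF M' d(1), of "\<phi> r"] UV r(1)
            by (simp add: mem_coord_space)
        qed
      qed
      then have "y q = y (\<phi> r)" by (rule ext)
      then have "q = \<phi> r" using inj_onD[OF injy] qV UV r(1) by blast
      then show "q \<in> \<phi> ` U" using r(1) by blast
    qed
  qed
  then show ?thesis by (rule that[OF _ c(2) \<phi>pV'])
qed

text \<open>In slice coordinates the embedding is a coordinate inclusion: its differential copies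
  entries and its second derivatives vanish. The facts are given under the sums in which
  \<open>jet_push\<close> contains them.\<close>

lemma slice_jet:
  assumes h: "smooth_vec m m' W h" and u: "u \<in> W"
    and h1: "\<forall>v\<in>W. \<forall>j<m. h v (\<iota> j) = v j"
    and h0: "\<forall>v\<in>W. \<forall>i<m'. i \<notin> \<iota> ` {..<m} \<longrightarrow> h v i = 0"
  shows "a < m \<Longrightarrow> (\<Sum>j<m. partial_deriv j (\<lambda>v. h v (\<iota> a)) u * g j) = g a"
    and "i < m' \<Longrightarrow> i \<notin> \<iota> ` {..<m} \<Longrightarrow> (\<Sum>j<m. partial_deriv j (\<lambda>v. h v i) u * g j) = 0"
    and "i < m' \<Longrightarrow> (\<Sum>j<m. \<Sum>k<m. partial_deriv j (partial_deriv k (\<lambda>v. h v i)) u * g j * g' k) = 0"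
proof -
  note W = smooth_vec_open[OF h]
  have "partial_deriv j (\<lambda>v. h v (\<iota> a)) u = (if j = a then 1 else 0)" if "a < m" "j < m" for a j
    using partial_deriv_cong[OF W u that(2), of "\<lambda>v. h v (\<iota> a)" "\<lambda>v. v a"] h1 that(1) by (simp add: partial_deriv_coord)
  then show "(\<Sum>j<m. partial_deriv j (\<lambda>v. h v (\<iota> a)) u * g j) = g a" if "a < m"
    using that by (simp add: if_distrib[of "\<lambda>x. x * _"] cong: if_cong)
  have "partial_deriv j (\<lambda>v. h v i) u = 0" if "i < m'" "i \<notin> \<iota> ` {..<m}" "j < m" for i j
    using partial_deriv_cong[OF W u that(3), of "\<lambda>v. h v i" "\<lambda>_. 0"] h0 that by simp
  then show "(\<Sum>j<m. partial_deriv j (\<lambda>v. h v i) u * g j) = 0" if "i < m'" "i \<notin> \<iota> ` {..<m}"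
    using that by simp
  have coord: "partial_deriv k (\<lambda>v. v i) = (\<lambda>_. if k = i then 1 else 0)" for i k by (rule ext) (rule partial_deriv_coord)
  have const: "partial_deriv k (\<lambda>_. 0) = (\<lambda>_. 0)" for k by (rule ext) simp
  have "partial_deriv j (partial_deriv k (\<lambda>v. h v i)) u = 0" if i: "i < m'" and jk: "j < m" "k < m" for i j k
  proof (cases "i \<in> \<iota> ` {..<m}")
    case True
    then obtain a where "a < m" "i = \<iota> a" by blast
    then show ?thesis
      using partial_deriv2_cong[OF W u jk, of "\<lambda>v. h v i" "\<lambda>v. v a"] h1 by (simp add: coord)
  next
    case False
    then show ?thesis
      using partial_deriv2_cong[OF W u jk, of "\<lambda>v. h v i" "\<lambda>_. 0"] h0 i by (simp add: const)
  qed
  then show "(\<Sum>j<m. \<Sum>k<m. partial_deriv j (partial_deriv k (\<lambda>v. h v i)) u * g j * g' k) = 0" if "i < m'"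
    using that by simp
qed

text \<open>Without second derivatives the bundle map copies tuples forest by forest, also at
  products. Its image over a point therefore consists of the tuples without normal entries, the
  tangential entries being the preimage.\<close>

lemma slice_pair_tangent_iff:
  assumes M: "smooth_manifold M" and M': "smooth_manifold M'" and emb: "properly_embedded M M' \<phi>"
    and f: "rough_velocity_field n M' f" and S: "slice_pair M M' \<phi> (U, x) (V, z) \<iota>" and r: "r \<in> U" "\<phi> r \<in> V"
  shows "f (\<phi> r) \<in> bundle_map n M M' \<phi> ` rough_bundle n M \<longleftrightarrow>
    (\<forall>i\<in>{..<mdim M'} - \<iota> ` {..<mdim M}. \<forall>\<tau>\<in>forests n. fiber_coords n M' (V, z) (f (\<phi> r)) i \<tau> = 0)"
proof -
  let ?m = "mdim M" and ?m' = "mdim M'"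
  have imm: "immersion M M' \<phi>" and em: "embedding_map (mtop M) (mtop M') \<phi>" using emb by (simp_all add: properly_embedded_def)
  have sm: "smooth_map M M' \<phi>" using imm by (simp add: immersion_def)
  have inj\<phi>: "inj_on \<phi> (topspace (mtop M))"
    using em homeomorphic_imp_injective_map unfolding embedding_map_def by blast
  have c: "(U, x) \<in> charts M" and d: "(V, z) \<in> charts M'" and inj: "inj_on \<iota> {..<?m}" and \<iota>: "\<iota> ` {..<?m} \<subseteq> {..<?m'}"
    and z1: "\<forall>r\<in>U. \<phi> r \<in> V \<longrightarrow> (\<forall>j<?m. z (\<phi> r) (\<iota> j) = x r j)"
    and z0: "\<forall>q\<in>V. q \<in> \<phi> ` U \<longleftrightarrow> (\<forall>i\<in>{..<?m'} - \<iota> ` {..<?m}. z q i = 0)"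
    using S unfolding slice_pair_def case_prod_conv by blast+
  define h where "h u = z (\<phi> (inv_into U x u))" for u
  define W where "W = x ` {p \<in> U. \<phi> p \<in> V}"
  have h: "smooth_vec ?m ?m' W h" using smooth_map_coords[OF M M' sm c d] by (simp add: W_def h_def[abs_def])
  have u: "x r \<in> W" using r by (simp add: W_def)
  have hx: "h (x r) = z (\<phi> r)" if "r \<in> U" for r using chart_inv_into[OF M c that] by (simp add: h_def)
  have h1: "\<forall>v\<in>W. \<forall>j<?m. h v (\<iota> j) = v j"
    using z1 hx by (simp add: W_def)
  have h0: "\<forall>v\<in>W. \<forall>i<?m'. i \<notin> \<iota> ` {..<?m} \<longrightarrow> h v i = 0"
  proof
    fix v assume "v \<in> W"
    then obtain r where r: "r \<in> U" "\<phi> r \<in> V" "v = x r" unfolding W_def by blast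
    then have "\<forall>i\<in>{..<?m'} - \<iota> ` {..<?m}. z (\<phi> r) i = 0" using z0 by blast
    then show "\<forall>i<?m'. i \<notin> \<iota> ` {..<?m} \<longrightarrow> h v i = 0" using hx r by simp
  qed
  note jet = slice_jet[OF h u h1 h0]
  have rM: "r \<in> topspace (mtop M)" "\<phi> r \<in> topspace (mtop M')"
    using r chart_subset_topspace[OF M c] chart_subset_topspace[OF M' d] by auto
  have fr: "f (\<phi> r) \<in> rough_bundle n M'" "base_point (f (\<phi> r)) = \<phi> r" using f rM by (simp_all add: rough_velocity_field_def)
  define F where "F = fiber_coords n M' (V, z) (f (\<phi> r))"
  have "f (\<phi> r) \<in> bundle_map n M M' \<phi> ` rough_bundle n M \<longleftrightarrow> (\<forall>i\<in>{..<?m'} - \<iota> ` {..<?m}. \<forall>\<tau>\<in>forests n. F i \<tau> = 0)"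
  proof
    assume "f (\<phi> r) \<in> bundle_map n M M' \<phi> ` rough_bundle n M"
    then obtain \<xi> where \<xi>: "\<xi> \<in> rough_bundle n M" "f (\<phi> r) = bundle_map n M M' \<phi> \<xi>" by blast
    obtain U0 x0 where c0: "(U0, x0) \<in> charts M" "base_point \<xi> \<in> U0" by (rule chart_exists[OF M base_point_in_topspace[OF M \<xi>(1)]])
    have "\<phi> (base_point \<xi>) \<in> topspace (mtop M')"
      using sm base_point_in_topspace[OF M \<xi>(1)] continuous_map_image_subset_topspace unfolding smooth_map_def by blast
    then obtain V0 z0 where d0: "(V0, z0) \<in> charts M'" "\<phi> (base_point \<xi>) \<in> V0" by (rule chart_exists[OF M'])
    have "\<phi> (base_point \<xi>) = \<phi> r" using bundle_map_coords(1)[OF M M' sm \<xi>(1) c0 d0] fr \<xi>(2) by simp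
    \<comment> \<open>Injectivity of the embedding places the preimage over \<open>r\<close> itself,
      where the slice coordinates are available.\<close>
    then have b: "base_point \<xi> = r" using inj_onD[OF inj\<phi>] base_point_in_topspace[OF M \<xi>(1)] rM by blast
    have J: "jet_push ?m ?m' n h (x r) (fiber_coords n M (U, x) \<xi>) F"
      using bundle_map_coords(2)[OF M M' sm \<xi>(1) c _ d] b r \<xi>(2) by (simp add: h_def[abs_def] F_def)
    show "\<forall>i\<in>{..<?m'} - \<iota> ` {..<?m}. \<forall>\<tau>\<in>forests n. F i \<tau> = 0"
    proof (intro ballI)
      fix i \<tau> assume "i \<in> {..<?m'} - \<iota> ` {..<?m}" and \<tau>: "\<tau> \<in> forests n"
      then have i: "i < ?m'" "i \<notin> \<iota> ` {..<?m}" by auto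
      from \<tau> show "F i \<tau> = 0"
        by (cases rule: forests_cases)
          (simp_all add: jet_push_Vertex[OF J i(1)] jet_push_Two[OF J i(1)] jet_push_Ladder[OF J i(1)] jet(2)[OF i] jet(3)[OF i(1)])
    qed
  next
    assume zero: "\<forall>i\<in>{..<?m'} - \<iota> ` {..<?m}. \<forall>\<tau>\<in>forests n. F i \<tau> = 0"
    define g where "g j \<tau> = (if j < ?m \<and> \<tau> \<in> forests n then F (\<iota> j) \<tau> else 0)" for j \<tau>
    have g: "g \<in> fiber_space ?m n" by (auto simp: g_def fiber_space_def)
    obtain \<xi> where \<xi>: "\<xi> \<in> rough_bundle n M" "base_point \<xi> = r" "fiber_coords n M (U, x) \<xi> = g"
      by (rule rough_bundle_exists[OF M c r(1) g])
    have sum_eq: "F i \<tau> = (\<Sum>j<?m. partial_deriv j (\<lambda>v. h v i) (x r) * g j \<tau>)" if "i < ?m'" "\<tau> \<in> forests n" for i \<tau>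
    proof (cases "i \<in> \<iota> ` {..<?m}")
      case True
      then obtain a where "a < ?m" "i = \<iota> a" by blast
      then show ?thesis using jet(1)[of a "\<lambda>j. g j \<tau>"] that by (simp add: g_def)
    next
      case False
      then show ?thesis using jet(2)[OF that(1)] zero that by simp
    qed
    have "F \<in> fiber_space ?m' n" unfolding F_def using fiber_coords_in_fiber_space[OF M' fr(1) d] fr r by simp
    then have "jet_push ?m ?m' n h (x r) g F"
      unfolding jet_push_def using sum_eq jet(3) by simp
    then have "bundle_map n M M' \<phi> \<xi> = f (\<phi> r)"
      using bundle_map_eqI[OF M M' sm \<xi>(1) fr(1) _ c _ d] \<xi> fr r by (simp add: h_def[abs_def] F_def)
    then show "f (\<phi> r) \<in> bundle_map n M M' \<phi> ` rough_bundle n M" using \<xi>(1) by (metis imageI)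
  qed
  then show ?thesis by (simp add: F_def)
qed

section \<open>Rough velocity fields in charts\<close>

lemma field_coords_smooth:
  assumes "rough_velocity_field n M f" "(U, x) \<in> charts M" "i < mdim M" "\<tau> \<in> forests n"
  shows "smooth_on (mdim M) (x ` U) (\<lambda>u. fiber_coords n M (U, x) (f (inv_into U x u)) i \<tau>)"
  using assms unfolding rough_velocity_field_def by blast

lemma field_coords_transition:
  assumes M: "smooth_manifold M" and f: "rough_velocity_field n M f"
    and c: "(U, x) \<in> charts M" and d: "(V, y) \<in> charts M" and r: "r \<in> U" "r \<in> V"
  shows "jet_push (mdim M) (mdim M) n (\<lambda>u. y (inv_into U x u)) (x r)
      (fiber_coords n M (U, x) (f r)) (fiber_coords n M (V, y) (f r))"
proof -
  have "r \<in> topspace (mtop M)" using r chart_subset_topspace[OF M c] by blast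
  then have "f r \<in> rough_bundle n M" "base_point (f r) = r" using f by (simp_all add: rough_velocity_field_def)
  then show ?thesis using fiber_coords_transition[OF M _ c _ d] r by metis
qed

text \<open>Differentiating the transformation rule of the vertex components along the field creates
  a Hessian term. It is exactly the quadratic term in the rule for products, so the two sides of the
  condition transform alike.\<close>

lemma admissible_in_chart:
  assumes M: "smooth_manifold M" and f: "rough_velocity_field n M f" and adm: "admissible n M f"
    and d: "(V, y) \<in> charts M" and q: "q \<in> V" and i: "i < mdim M" and \<alpha>: "\<alpha> \<in> {1..n}" and \<beta>: "\<beta> \<in> {1..n}"
  shows "(\<Sum>j<mdim M.
           partial_deriv j (\<lambda>u. fiber_coords n M (V, y) (f (inv_into V y u)) i (Vertex \<beta>)) (y q) *
           fiber_coords n M (V, y) (f q) j (Vertex \<alpha>)) =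
        fiber_coords n M (V, y) (f q) i (Two (Upair \<alpha> \<beta>)) + fiber_coords n M (V, y) (f q) i (Ladder \<alpha> \<beta>)"
proof -
  let ?m = "mdim M"
  have "q \<in> topspace (mtop M)" using q chart_subset_topspace[OF M d] by blast
  with adm obtain U x where c: "(U, x) \<in> charts M" "q \<in> U" and
    adm: "\<forall>i<mdim M. \<forall>\<alpha>\<in>{1..n}. \<forall>\<beta>\<in>{1..n}.
        (\<Sum>j<mdim M.
           partial_deriv j (\<lambda>u. fiber_coords n M (U, x) (f (inv_into U x u)) i (Vertex \<beta>)) (x q) *
           fiber_coords n M (U, x) (f q) j (Vertex \<alpha>)) =
        fiber_coords n M (U, x) (f q) i (Two (Upair \<alpha> \<beta>)) +
        fiber_coords n M (U, x) (f q) i (Ladder \<alpha> \<beta>)"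
    unfolding admissible_def by blast
  define F where "F i \<tau> u = fiber_coords n M (U, x) (f (inv_into U x u)) i \<tau>" for i \<tau> u
  define G where "G i \<tau> u = fiber_coords n M (V, y) (f (inv_into V y u)) i \<tau>" for i \<tau> u
  define \<theta> where "\<theta> u = y (inv_into U x u)" for u
  define W where "W = x ` (U \<inter> V)"
  have \<theta>: "smooth_vec ?m ?m W \<theta>" using chart_transition[OF M c(1) d] by (simp add: W_def \<theta>_def[abs_def])
  note W = smooth_vec_open[OF \<theta>]
  have WU: "W \<subseteq> x ` U" by (auto simp: W_def)
  have F: "smooth_on ?m W (F a \<tau>)" if "a < ?m" "\<tau> \<in> forests n" for a \<tau>
    unfolding F_def[abs_def] by (rule smooth_on_subset[OF field_coords_smooth[OF f c(1) that] WU W])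
  have G: "smooth_on ?m (y ` V) (G a \<tau>)" if "a < ?m" "\<tau> \<in> forests n" for a \<tau>
    unfolding G_def[abs_def] by (rule field_coords_smooth[OF f d that])
  have J: "jet_push ?m ?m n \<theta> u (\<lambda>a \<tau>. F a \<tau> u) (\<lambda>a \<tau>. G a \<tau> (\<theta> u))" if u: "u \<in> W" for u
  proof -
    obtain r where r: "r \<in> U" "r \<in> V" "u = x r" using u unfolding W_def by blast
    then show ?thesis
      using field_coords_transition[OF M f c(1) d r(1,2)] chart_inv_into[OF M c(1) r(1)] chart_inv_into[OF M d r(2)]
      by (simp add: F_def G_def \<theta>_def[abs_def])
  qed
  have \<theta>V: "\<theta> u \<in> y ` V" if "u \<in> W" for u using that chart_inv_into[OF M c(1)] by (auto simp: W_def \<theta>_def)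
  define u where "u = x q"
  have u: "u \<in> W" using c(2) q by (simp add: u_def W_def)
  have \<theta>u: "\<theta> u = y q" using chart_inv_into[OF M c] by (simp add: \<theta>_def u_def)
  have V\<beta>: "Vertex \<beta> \<in> forests n" using \<beta> by simp
  \<comment> \<open>The vertex rule is differentiated in direction \<open>b\<close>: its left side
    by the chain rule, its right side by the product rule.\<close>
  have deriv: "(\<Sum>j<?m. partial_deriv j (G i (Vertex \<beta>)) (\<theta> u) * partial_deriv b (\<lambda>v. \<theta> v j) u) =
     (\<Sum>a<?m. partial_deriv b (partial_deriv a (\<lambda>v. \<theta> v i)) u * F a (Vertex \<beta>) u) +
     (\<Sum>a<?m. partial_deriv a (\<lambda>v. \<theta> v i) u * partial_deriv b (F a (Vertex \<beta>)) u)" if b: "b < ?m" for b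
  proof -
    have "(\<Sum>j<?m. partial_deriv j (G i (Vertex \<beta>)) (\<theta> u) * partial_deriv b (\<lambda>v. \<theta> v j) u) =
        partial_deriv b (\<lambda>v. G i (Vertex \<beta>) (\<theta> v)) u"
      by (rule partial_deriv_comp_smooth[OF G[OF i V\<beta>] W smooth_vec_coord[OF \<theta>] \<theta>V u b, symmetric])
    also have "\<dots> = partial_deriv b (\<lambda>v. \<Sum>a<?m. partial_deriv a (\<lambda>v. \<theta> v i) v * F a (Vertex \<beta>) v) u"
      by (rule partial_deriv_cong[OF W u b]) (rule jet_push_Vertex[OF J i \<beta>])
    also have "\<dots> = (\<Sum>a<?m. partial_deriv b (\<lambda>v. partial_deriv a (\<lambda>v. \<theta> v i) v * F a (Vertex \<beta>) v) u)"
      by (rule partial_deriv_sum[OF _ u b])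
        (simp add: smooth_on_mult[OF smooth_on_partial_deriv[OF smooth_vec_coord[OF \<theta> i]] F] V\<beta> del: Vertex_in_forests)
    also have "\<dots> = (\<Sum>a<?m. partial_deriv b (partial_deriv a (\<lambda>v. \<theta> v i)) u * F a (Vertex \<beta>) u +
        partial_deriv a (\<lambda>v. \<theta> v i) u * partial_deriv b (F a (Vertex \<beta>)) u)"
    proof (rule sum.cong[OF refl])
      fix a assume "a \<in> {..<?m}"
      then have a: "a < ?m" by simp
      show "partial_deriv b (\<lambda>v. partial_deriv a (\<lambda>v. \<theta> v i) v * F a (Vertex \<beta>) v) u =
        partial_deriv b (partial_deriv a (\<lambda>v. \<theta> v i)) u * F a (Vertex \<beta>) u +
        partial_deriv a (\<lambda>v. \<theta> v i) u * partial_deriv b (F a (Vertex \<beta>)) u"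
        using partial_deriv_mult[OF smooth_on_partial_deriv[OF smooth_vec_coord[OF \<theta> i] a] F[OF a V\<beta>] u b] by simp
    qed
    finally show ?thesis by (simp add: sum.distrib)
  qed
  have "(\<Sum>j<?m. partial_deriv j (G i (Vertex \<beta>)) (\<theta> u) * G j (Vertex \<alpha>) (\<theta> u)) =
      (\<Sum>j<?m. partial_deriv j (G i (Vertex \<beta>)) (\<theta> u) * (\<Sum>b<?m. partial_deriv b (\<lambda>v. \<theta> v j) u * F b (Vertex \<alpha>) u))"
    by (intro sum.cong refl) (simp add: jet_push_Vertex[OF J[OF u] _ \<alpha>])
  also have "\<dots> = (\<Sum>b<?m. (\<Sum>j<?m. partial_deriv j (G i (Vertex \<beta>)) (\<theta> u) * partial_deriv b (\<lambda>v. \<theta> v j) u) * F b (Vertex \<alpha>) u)"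
    by (rule sum_mult_sum_swap)
  also have "\<dots> = (\<Sum>b<?m. (\<Sum>a<?m. partial_deriv b (partial_deriv a (\<lambda>v. \<theta> v i)) u * F a (Vertex \<beta>) u) * F b (Vertex \<alpha>) u) +
     (\<Sum>b<?m. (\<Sum>a<?m. partial_deriv a (\<lambda>v. \<theta> v i) u * partial_deriv b (F a (Vertex \<beta>)) u) * F b (Vertex \<alpha>) u)"
    unfolding sum.distrib[symmetric] by (intro sum.cong refl) (simp add: deriv distrib_right)
  also have "(\<Sum>b<?m. (\<Sum>a<?m. partial_deriv b (partial_deriv a (\<lambda>v. \<theta> v i)) u * F a (Vertex \<beta>) u) * F b (Vertex \<alpha>) u) =
     (\<Sum>b<?m. \<Sum>a<?m. partial_deriv b (partial_deriv a (\<lambda>v. \<theta> v i)) u * F b (Vertex \<alpha>) u * F a (Vertex \<beta>) u)"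
    unfolding sum_distrib_right by (intro sum.cong refl) simp
  also have "(\<Sum>b<?m. (\<Sum>a<?m. partial_deriv a (\<lambda>v. \<theta> v i) u * partial_deriv b (F a (Vertex \<beta>)) u) * F b (Vertex \<alpha>) u) =
     (\<Sum>a<?m. partial_deriv a (\<lambda>v. \<theta> v i) u * (\<Sum>b<?m. partial_deriv b (F a (Vertex \<beta>)) u * F b (Vertex \<alpha>) u))"
    by (rule sum_mult_sum_swap[symmetric])
  also have "\<dots> = (\<Sum>a<?m. partial_deriv a (\<lambda>v. \<theta> v i) u * F a (Two (Upair \<alpha> \<beta>)) u) +
      (\<Sum>a<?m. partial_deriv a (\<lambda>v. \<theta> v i) u * F a (Ladder \<alpha> \<beta>) u)"
  proof -
    have "(\<Sum>b<?m. partial_deriv b (F a (Vertex \<beta>)) u * F b (Vertex \<alpha>) u) = F a (Two (Upair \<alpha> \<beta>)) u + F a (Ladder \<alpha> \<beta>) u"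
      if "a < ?m" for a
      using adm[rule_format, OF that \<alpha> \<beta>] chart_inv_into[OF M c] by (simp add: F_def[abs_def] u_def)
    then show ?thesis unfolding sum.distrib[symmetric] by (intro sum.cong refl) (simp add: distrib_left)
  qed
  also have "(\<Sum>b<?m. \<Sum>a<?m. partial_deriv b (partial_deriv a (\<lambda>v. \<theta> v i)) u * F b (Vertex \<alpha>) u * F a (Vertex \<beta>) u) +
      ((\<Sum>a<?m. partial_deriv a (\<lambda>v. \<theta> v i) u * F a (Two (Upair \<alpha> \<beta>)) u) +
      (\<Sum>a<?m. partial_deriv a (\<lambda>v. \<theta> v i) u * F a (Ladder \<alpha> \<beta>) u)) =
    G i (Two (Upair \<alpha> \<beta>)) (\<theta> u) + G i (Ladder \<alpha> \<beta>) (\<theta> u)"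
    by (simp add: jet_push_Two[OF J[OF u] i \<alpha> \<beta>] jet_push_Ladder[OF J[OF u] i \<alpha> \<beta>])
  finally show ?thesis using chart_inv_into[OF M d q] by (simp add: G_def[abs_def] \<theta>u)
qed

section \<open>Estimates for functions vanishing on a coordinate slice\<close>

text \<open>Bounds that persist for smaller radii and larger constants can be met simultaneously, by
  the least radius and the largest constant.\<close>

lemma finite_common_bound:
  fixes P :: "'k \<Rightarrow> real \<Rightarrow> real \<Rightarrow> bool"
  assumes "finite A" "\<And>k. k \<in> A \<Longrightarrow> \<exists>r>0. \<exists>C\<ge>0. P k r C"
    and mono: "\<And>k r C r' C'. P k r C \<Longrightarrow> 0 < r' \<Longrightarrow> r' \<le> r \<Longrightarrow> C \<le> C' \<Longrightarrow> P k r' C'"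
  obtains r C where "r > 0" "C \<ge> 0" "\<forall>k\<in>A. P k r C"
proof -
  have "\<exists>r>0. \<exists>C\<ge>0. \<forall>k\<in>A. P k r C"
    using assms(1,2)
  proof (induction A)
    case empty
    then show ?case by (auto intro: exI[of _ 1])
  next
    case (insert a A)
    have "\<exists>r>0. \<exists>C\<ge>0. \<forall>k\<in>A. P k r C" using insert.prems by (intro insert.IH) simp
    then obtain r C where 1: "r > 0" "C \<ge> 0" "\<forall>k\<in>A. P k r C" by blast
    have "\<exists>r>0. \<exists>C\<ge>0. P a r C" using insert.prems by simp
    then obtain r' C' where 2: "r' > 0" "C' \<ge> 0" "P a r' C'" by blast
    have "\<forall>k\<in>insert a A. P k (min r r') (max C C')"
    proof
      fix k assume "k \<in> insert a A"
      then show "P k (min r r') (max C C')"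
        using mono[OF 2(3), of "min r r'" "max C C'"] mono[of k r C "min r r'" "max C C'"] 1 2 by auto
    qed
    moreover have "min r r' > 0" "max C C' \<ge> 0" using 1 2 by auto
    ultimately show ?case by blast
  qed
  then show ?thesis using that by blast
qed

text \<open>Over all coordinates the sum measures the full displacement, over the normal ones only
  the displacement transverse to the slice. The estimates below depend on keeping the two
  apart.\<close>

abbreviation l1_dist :: "nat set \<Rightarrow> (nat \<Rightarrow> real) \<Rightarrow> (nat \<Rightarrow> real) \<Rightarrow> real" where
  "l1_dist A u v \<equiv> \<Sum>i\<in>A. \<bar>v i - u i\<bar>"

abbreviation l1_norm :: "nat set \<Rightarrow> (nat \<Rightarrow> real) \<Rightarrow> real" where
  "l1_norm A u \<equiv> \<Sum>i\<in>A. \<bar>u i\<bar>"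

lemma abs_le_sum:
  fixes g :: "nat \<Rightarrow> real"
  assumes "finite A" "i \<in> A"
  shows "\<bar>g i\<bar> \<le> (\<Sum>i\<in>A. \<bar>g i\<bar>)"
  using assms by (intro member_le_sum) auto

lemma bounded_partial_derivs:
  assumes g: "smooth_on m W g" and c: "c \<in> W"
  obtains r C where "r > 0" "C \<ge> 0" "\<forall>j<m. cube m c r \<subseteq> W \<and> (\<forall>u\<in>cube m c r. \<bar>partial_deriv j g u\<bar> \<le> C)"
proof -
  note W = smooth_on_open[OF g]
  have ex: "\<exists>r>0. \<exists>C\<ge>0. cube m c r \<subseteq> W \<and> (\<forall>u\<in>cube m c r. \<bar>partial_deriv j g u\<bar> \<le> C)" if "j \<in> {..<m}" for j
  proof -
    have j: "j < m" using that by simp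
    obtain r C where rC: "r > 0" "cube m c r \<subseteq> W" "\<forall>v\<in>cube m c r. \<bar>partial_deriv j g v\<bar> \<le> C"
      by (rule continuous_on_bounded_cube[OF W smooth_on_continuous[OF smooth_on_partial_deriv[OF g j]] c])
    then have "\<forall>v\<in>cube m c r. \<bar>partial_deriv j g v\<bar> \<le> max C 0" by (meson max.coboundedI1)
    then show ?thesis using rC(1,2) max.cobounded2[of 0 C] by blast
  qed
  obtain r C where "r > 0" "C \<ge> 0" "\<forall>j\<in>{..<m}. cube m c r \<subseteq> W \<and> (\<forall>u\<in>cube m c r. \<bar>partial_deriv j g u\<bar> \<le> C)"
  proof (rule finite_common_bound[OF finite_lessThan ex])
    fix k r C r' C'
    assume "cube m c r \<subseteq> W \<and> (\<forall>u\<in>cube m c r. \<bar>partial_deriv k g u\<bar> \<le> C)" "0 < r'" "r' \<le> r" "C \<le> C'"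
    then show "cube m c r' \<subseteq> W \<and> (\<forall>u\<in>cube m c r'. \<bar>partial_deriv k g u\<bar> \<le> C')"
      using cube_mono[of r' r m c] by (meson order_trans subsetD)
  qed
  then show ?thesis using that by simp
qed

lemma lipschitz_cube:
  assumes g: "smooth_on m W g" and sub: "cube m c r \<subseteq> W"
    and C: "\<forall>j<m. \<forall>u\<in>cube m c r. \<bar>partial_deriv j g u\<bar> \<le> C"
    and u: "u \<in> cube m c r" and v: "v \<in> cube m c r"
  shows "\<bar>g v - g u\<bar> \<le> C * l1_dist {..<m} u v"
proof -
  obtain \<xi> where \<xi>: "\<forall>k<m. \<xi> k \<in> cube m c r" "\<forall>k i. \<bar>\<xi> k i - u i\<bar> \<le> \<bar>v i - u i\<bar>"
    "g v - g u = (\<Sum>k<m. partial_deriv k g (\<xi> k) * (v k - u k))"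
    by (rule mean_value_cube_smooth[OF g sub u v])
  have "\<bar>g v - g u\<bar> \<le> (\<Sum>k<m. \<bar>partial_deriv k g (\<xi> k) * (v k - u k)\<bar>)" unfolding \<xi>(3) by (rule sum_abs)
  also have "\<dots> \<le> (\<Sum>k<m. C * \<bar>v k - u k\<bar>)"
    using C \<xi>(1) by (intro sum_mono) (simp add: abs_mult mult_right_mono)
  finally show ?thesis by (simp add: sum_distrib_left)
qed

lemma lipschitz_locally:
  assumes g: "smooth_on m W g" and c: "c \<in> W"
  shows "\<exists>r>0. \<exists>C\<ge>0. cube m c r \<subseteq> W \<and> (\<forall>u\<in>cube m c r. \<forall>v\<in>cube m c r. \<bar>g v - g u\<bar> \<le> C * l1_dist {..<m} u v)"
\<comment> \<open>In dimension 0 the bound on the derivatives carries no information about the cube,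
  whose inclusion in \<open>W\<close> stands under the quantifier over \<open>j\<close>.\<close>
proof (cases "m = 0")
  case True
  obtain r where r: "r > 0" "cube m c r \<subseteq> W" by (rule openin_imp_cube[OF smooth_on_open[OF g] c])
  have "\<bar>g v - g u\<bar> \<le> 0 * l1_dist {..<m} u v" if "u \<in> cube m c r" "v \<in> cube m c r" for u v
    using lipschitz_cube[OF g r(2) _ that, of 0] True by simp
  then show ?thesis using r by blast
next
  case False
  obtain r C where r: "r > 0" "C \<ge> 0" "\<forall>j<m. cube m c r \<subseteq> W \<and> (\<forall>u\<in>cube m c r. \<bar>partial_deriv j g u\<bar> \<le> C)"
    by (rule bounded_partial_derivs[OF g c])
  then have sub: "cube m c r \<subseteq> W" using False by blast
  have "\<bar>g v - g u\<bar> \<le> C * l1_dist {..<m} u v" if "u \<in> cube m c r" "v \<in> cube m c r" for u v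
    by (rule lipschitz_cube[OF g sub _ that]) (use r(3) in blast)
  then show ?thesis using r(1,2) sub by blast
qed

definition vanishes_on_slice :: "nat set \<Rightarrow> (nat \<Rightarrow> real) set \<Rightarrow> ((nat \<Rightarrow> real) \<Rightarrow> real) \<Rightarrow> bool" where
  "vanishes_on_slice L W g \<longleftrightarrow> (\<forall>u\<in>W. (\<forall>i\<in>L. u i = 0) \<longrightarrow> g u = 0)"

text \<open>A move in a tangential direction stays in the slice, so the function is zero along the
  whole line near the point.\<close>

lemma vanishes_on_slice_partial_deriv:
  assumes W: "openin (Euclidean_space m) W" and g: "vanishes_on_slice L W g" and j: "j < m" "j \<notin> L"
  shows "vanishes_on_slice L W (partial_deriv j g)"
  unfolding vanishes_on_slice_def
proof (intro ballI impI)
  fix u assume u: "u \<in> W" and 0: "\<forall>i\<in>L. u i = 0"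
  have zero: "g (u(j := t)) = 0" if "u(j := t) \<in> W" for t
    using g that 0 j(2) unfolding vanishes_on_slice_def by auto
  have "\<forall>\<^sub>F t in nhds (u j). g (u(j := t)) = 0"
    by (rule eventually_mono[OF eventually_upd_in[OF W u j(1)]]) (rule zero)
  then have "deriv (\<lambda>t. g (u(j := t))) (u j) = deriv (\<lambda>_. 0) (u j)" by (intro deriv_cong_ev) auto
  then show "partial_deriv j g u = 0" by (simp add: partial_deriv_def)
qed

text \<open>Compare \<open>u\<close> with its projection, obtained by setting the normal coordinates
  to zero. The projection stays in the cube because the centre lies on the slice.\<close>

lemma slice_bound:
  assumes g: "smooth_on m W g" and c: "c \<in> W" and L: "L \<subseteq> {..<m}" and cL: "\<forall>i\<in>L. c i = 0" and van: "vanishes_on_slice L W g"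
  shows "\<exists>r>0. \<exists>C\<ge>0. cube m c r \<subseteq> W \<and> (\<forall>u\<in>cube m c r. \<bar>g u\<bar> \<le> C * l1_norm L u)"
proof -
  obtain r C where r: "r > 0" "C \<ge> 0" "cube m c r \<subseteq> W" "\<forall>u\<in>cube m c r. \<forall>v\<in>cube m c r. \<bar>g v - g u\<bar> \<le> C * l1_dist {..<m} u v"
    using lipschitz_locally[OF g c] by blast
  have "\<bar>g u\<bar> \<le> C * l1_norm L u" if u: "u \<in> cube m c r" for u
  proof -
    define w where "w i = (if i \<in> L then 0 else u i)" for i
    have w: "w \<in> cube m c r" using u cL r(1) by (auto simp: cube_def w_def mem_coord_space)
    then have "g w = 0" using van r(3) unfolding vanishes_on_slice_def by (auto simp: w_def)
    then have "\<bar>g u\<bar> \<le> C * l1_dist {..<m} w u" using r(4) u w by fastforce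
    also have "l1_dist {..<m} w u = l1_norm L u"
      using L by (intro sum.mono_neutral_cong_right) (auto simp: w_def)
    finally show ?thesis .
  qed
  then show ?thesis using r by blast
qed

text \<open>In the mean value expansion the tangential derivatives vanish on the slice and are
  bounded by the normal norm, while the normal derivatives are merely bounded but multiply a normal
  displacement. No term is of the size of the full displacement alone.\<close>

lemma slice_increment:
  assumes g: "smooth_on m W g" and c: "c \<in> W" and L: "L \<subseteq> {..<m}" and cL: "\<forall>i\<in>L. c i = 0" and van: "vanishes_on_slice L W g"
  shows "\<exists>r>0. \<exists>C\<ge>0. cube m c r \<subseteq> W \<and> (\<forall>u\<in>cube m c r. \<forall>v\<in>cube m c r.
    \<bar>g v - g u\<bar> \<le> C * (l1_norm L u * l1_dist {..<m} u v + l1_dist L u v))"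
proof -
  note W = smooth_on_open[OF g]
  define P where "P k r C \<longleftrightarrow> cube m c r \<subseteq> W \<and> (\<forall>u\<in>cube m c r. \<bar>partial_deriv k g u\<bar> \<le> C * l1_norm L u)" for k r C
  have exP: "\<exists>r>0. \<exists>C\<ge>0. P k r C" if "k \<in> {..<m} - L" for k
    unfolding P_def
    using that by (intro slice_bound[OF smooth_on_partial_deriv[OF g] c L cL vanishes_on_slice_partial_deriv[OF W van]]) auto
  obtain r1 C1 where 1: "r1 > 0" "C1 \<ge> 0" "\<forall>k\<in>{..<m} - L. P k r1 C1"
  proof (rule finite_common_bound[OF finite_Diff[OF finite_lessThan] exP])
    fix k r C r' C'
    assume a: "P k r C" "0 < r'" "r' \<le> r" "C \<le> C'"
    have "C * l1_norm L u \<le> C' * l1_norm L u" for u using a(4) by (intro mult_right_mono sum_nonneg) auto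
    then show "P k r' C'"
      unfolding P_def using a cube_mono[OF a(3), of m c] unfolding P_def by (meson order_trans subsetD)
  qed
  obtain r2 C2 where 2: "r2 > 0" "C2 \<ge> 0" "\<forall>j<m. cube m c r2 \<subseteq> W \<and> (\<forall>u\<in>cube m c r2. \<bar>partial_deriv j g u\<bar> \<le> C2)"
    by (rule bounded_partial_derivs[OF g c])
  obtain r3 where 3: "r3 > 0" "cube m c r3 \<subseteq> W" by (rule openin_imp_cube[OF W c])
  define r where "r = min (min r1 r2) r3"
  have r: "r > 0" "cube m c r \<subseteq> cube m c r1" "cube m c r \<subseteq> cube m c r2" "cube m c r \<subseteq> W"
    using 1 2 3 cube_mono[of r r1 m c] cube_mono[of r r2 m c] cube_mono[of r r3 m c] by (auto simp: r_def)
  \<comment> \<open>The part with \<open>2 * r\<close> absorbs products of a normal and a full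
    displacement: inside the cube the latter is at most \<open>real m * (2 * r)\<close>.\<close>
  define C where "C = C1 + (C1 * (real m * (2 * r)) + C2)"
  have C: "C \<ge> 0" using 1 2 r by (simp add: C_def)
  have bound: "\<bar>g v - g u\<bar> \<le> C * (l1_norm L u * l1_dist {..<m} u v + l1_dist L u v)" if u: "u \<in> cube m c r" and v: "v \<in> cube m c r" for u v
  proof -
    let ?N = "l1_norm L u" and ?d = "l1_dist {..<m} u v" and ?dL = "l1_dist L u v"
    have nn: "?N \<ge> 0" "?d \<ge> 0" "?dL \<ge> 0" by (auto intro: sum_nonneg)
    obtain \<xi> where \<xi>: "\<forall>k<m. \<xi> k \<in> cube m c r" "\<forall>k i. \<bar>\<xi> k i - u i\<bar> \<le> \<bar>v i - u i\<bar>"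
      "g v - g u = (\<Sum>k<m. partial_deriv k g (\<xi> k) * (v k - u k))"
      by (rule mean_value_cube_smooth[OF g r(4) u v])
    have N\<xi>: "l1_norm L (\<xi> k) \<le> ?N + ?dL" for k
    proof -
      have "l1_norm L (\<xi> k) \<le> (\<Sum>i\<in>L. \<bar>u i\<bar> + \<bar>v i - u i\<bar>)"
      proof (rule sum_mono)
        fix i show "\<bar>\<xi> k i\<bar> \<le> \<bar>u i\<bar> + \<bar>v i - u i\<bar>" using \<xi>(2)[rule_format, of k i] by linarith
      qed
      then show ?thesis by (simp add: sum.distrib)
    qed
    have "\<bar>g v - g u\<bar> \<le> (\<Sum>k<m. \<bar>partial_deriv k g (\<xi> k)\<bar> * \<bar>v k - u k\<bar>)"
      unfolding \<xi>(3) by (rule order_trans[OF sum_abs]) (simp add: abs_mult)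
    also have "\<dots> = (\<Sum>k\<in>{..<m} - L. \<bar>partial_deriv k g (\<xi> k)\<bar> * \<bar>v k - u k\<bar>) + (\<Sum>k\<in>L. \<bar>partial_deriv k g (\<xi> k)\<bar> * \<bar>v k - u k\<bar>)"
      using sum.subset_diff[OF L finite_lessThan] by simp
    also have "\<dots> \<le> (\<Sum>k\<in>{..<m} - L. C1 * (?N + ?dL) * \<bar>v k - u k\<bar>) + (\<Sum>k\<in>L. C2 * \<bar>v k - u k\<bar>)"
    proof (intro add_mono sum_mono mult_right_mono abs_ge_zero)
      fix k assume k: "k \<in> {..<m} - L"
      then have "\<bar>partial_deriv k g (\<xi> k)\<bar> \<le> C1 * l1_norm L (\<xi> k)"
        using 1(3) \<xi>(1) r(2) unfolding P_def by (meson DiffD1 lessThan_iff subsetD)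
      also have "\<dots> \<le> C1 * (?N + ?dL)" by (rule mult_left_mono[OF N\<xi> 1(2)])
      finally show "\<bar>partial_deriv k g (\<xi> k)\<bar> \<le> C1 * (?N + ?dL)" .
    next
      fix k assume k: "k \<in> L"
      then have "k < m" using L by blast
      then show "\<bar>partial_deriv k g (\<xi> k)\<bar> \<le> C2" using 2(3) \<xi>(1) r(3) by blast
    qed
    also have "\<dots> = C1 * (?N + ?dL) * l1_dist ({..<m} - L) u v + C2 * ?dL" by (simp add: sum_distrib_left)
    also have "\<dots> \<le> C1 * (?N + ?dL) * ?d + C2 * ?dL"
      using 1(2) nn by (intro add_right_mono mult_left_mono sum_mono2) auto
    also have "\<dots> = C1 * ?N * ?d + (C1 * ?d + C2) * ?dL" by (simp add: algebra_simps)
    also have "\<dots> \<le> C1 * ?N * ?d + (C1 * (real m * (2 * r)) + C2) * ?dL"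
    proof (intro add_left_mono mult_right_mono add_right_mono mult_left_mono 1(2) nn(3))
      have "?d \<le> (\<Sum>i<m. 2 * r)"
      proof (rule sum_mono)
        fix i assume "i \<in> {..<m}"
        then have "\<bar>u i - c i\<bar> < r" "\<bar>v i - c i\<bar> < r" using u v by (auto simp: cube_def)
        then show "\<bar>v i - u i\<bar> \<le> 2 * r" by linarith
      qed
      then show "?d \<le> real m * (2 * r)" by simp
    qed
    also have "\<dots> \<le> C * (?N * ?d) + C * ?dL"
    proof (rule add_mono)
      have "C1 \<le> C" "C1 * (real m * (2 * r)) + C2 \<le> C" using 1(2) 2(2) r(1) by (simp_all add: C_def)
      then show "C1 * ?N * ?d \<le> C * (?N * ?d)" "(C1 * (real m * (2 * r)) + C2) * ?dL \<le> C * ?dL"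
        unfolding mult.assoc[of C1] using nn by (simp_all only: mult_right_mono mult_nonneg_nonneg)
    qed
    finally show ?thesis by (simp add: distrib_left)
  qed
  show ?thesis
    by (rule exI[of _ r], rule conjI[OF r(1)], rule exI[of _ C], rule conjI[OF C], rule conjI[OF r(4)], intro ballI, rule bound)
qed

text \<open>The same splitting one derivative later. A tangential derivative again vanishes on the
  slice, so its variation obeys \<open>slice_increment\<close>; a normal derivative is only
  Lipschitz, but it multiplies a normal displacement.\<close>

lemma slice_taylor:
  assumes g: "smooth_on m W g" and c: "c \<in> W" and L: "L \<subseteq> {..<m}" and cL: "\<forall>i\<in>L. c i = 0" and van: "vanishes_on_slice L W g"
  shows "\<exists>r>0. \<exists>C\<ge>0. cube m c r \<subseteq> W \<and> (\<forall>u\<in>cube m c r. \<forall>v\<in>cube m c r.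
    \<bar>g v - g u - (\<Sum>j<m. partial_deriv j g u * (v j - u j))\<bar> \<le>
      C * ((l1_norm L u * l1_dist {..<m} u v + l1_dist L u v) * l1_dist {..<m} u v))"
proof -
  note W = smooth_on_open[OF g]
  define E where "E u v = l1_norm L u * l1_dist {..<m} u v + l1_dist L u v" for u v
  have E0: "E u v \<ge> 0" for u v by (auto simp: E_def intro!: add_nonneg_nonneg mult_nonneg_nonneg sum_nonneg)
  define P where "P k r C \<longleftrightarrow> cube m c r \<subseteq> W \<and> (\<forall>u\<in>cube m c r. \<forall>v\<in>cube m c r.
    \<bar>partial_deriv k g v - partial_deriv k g u\<bar> \<le> C * (if k \<in> L then l1_dist {..<m} u v else E u v))" for k r C
  have exP: "\<exists>r>0. \<exists>C\<ge>0. P k r C" if "k \<in> {..<m}" for k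
  proof (cases "k \<in> L")
    case True
    then show ?thesis unfolding P_def using lipschitz_locally[OF smooth_on_partial_deriv[OF g] c] that by simp
  next
    case False
    then show ?thesis unfolding P_def E_def
      using slice_increment[OF smooth_on_partial_deriv[OF g] c L cL vanishes_on_slice_partial_deriv[OF W van]] that by simp
  qed
  obtain r1 C1 where 1: "r1 > 0" "C1 \<ge> 0" "\<forall>k\<in>{..<m}. P k r1 C1"
  proof (rule finite_common_bound[OF finite_lessThan exP])
    fix k r C r' C'
    assume a: "P k r C" "0 < r'" "r' \<le> r" "C \<le> C'"
    have "C * (if k \<in> L then l1_dist {..<m} u v else E u v) \<le> C' * (if k \<in> L then l1_dist {..<m} u v else E u v)" for u v
      using a(4) E0 by (intro mult_right_mono) (auto intro: sum_nonneg)
    then show "P k r' C'"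
      unfolding P_def using a cube_mono[OF a(3), of m c] unfolding P_def by (meson order_trans subsetD)
  qed
  obtain r3 where 3: "r3 > 0" "cube m c r3 \<subseteq> W" by (rule openin_imp_cube[OF W c])
  define r where "r = min r1 r3"
  have r: "r > 0" "cube m c r \<subseteq> cube m c r1" "cube m c r \<subseteq> W"
    using 1 3 cube_mono[of r r1 m c] cube_mono[of r r3 m c] by (auto simp: r_def)
  have bound: "\<bar>g v - g u - (\<Sum>j<m. partial_deriv j g u * (v j - u j))\<bar> \<le> (2 * C1) * (E u v * l1_dist {..<m} u v)"
    if u: "u \<in> cube m c r" and v: "v \<in> cube m c r" for u v
  proof -
    let ?d = "l1_dist {..<m} u v" and ?dL = "l1_dist L u v"
    have nn: "?d \<ge> 0" "?dL \<ge> 0" by (auto intro: sum_nonneg)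
    obtain \<xi> where \<xi>: "\<forall>k<m. \<xi> k \<in> cube m c r" "\<forall>k i. \<bar>\<xi> k i - u i\<bar> \<le> \<bar>v i - u i\<bar>"
      "g v - g u = (\<Sum>k<m. partial_deriv k g (\<xi> k) * (v k - u k))"
      by (rule mean_value_cube_smooth[OF g r(3) u v])
    have d\<xi>: "l1_dist A u (\<xi> k) \<le> l1_dist A u v" for A k using \<xi>(2) by (intro sum_mono) simp
    have E\<xi>: "E u (\<xi> k) \<le> E u v" for k
      unfolding E_def by (intro add_mono mult_left_mono d\<xi>) (auto intro: sum_nonneg)
    have "\<bar>g v - g u - (\<Sum>j<m. partial_deriv j g u * (v j - u j))\<bar> =
       \<bar>\<Sum>k<m. (partial_deriv k g (\<xi> k) - partial_deriv k g u) * (v k - u k)\<bar>"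
      unfolding \<xi>(3) by (simp add: sum_subtractf left_diff_distrib)
    also have "\<dots> \<le> (\<Sum>k<m. \<bar>partial_deriv k g (\<xi> k) - partial_deriv k g u\<bar> * \<bar>v k - u k\<bar>)"
      by (rule order_trans[OF sum_abs]) (simp add: abs_mult)
    also have "\<dots> = (\<Sum>k\<in>{..<m} - L. \<bar>partial_deriv k g (\<xi> k) - partial_deriv k g u\<bar> * \<bar>v k - u k\<bar>) +
       (\<Sum>k\<in>L. \<bar>partial_deriv k g (\<xi> k) - partial_deriv k g u\<bar> * \<bar>v k - u k\<bar>)"
      using sum.subset_diff[OF L finite_lessThan] by simp
    also have "\<dots> \<le> (\<Sum>k\<in>{..<m} - L. C1 * E u v * \<bar>v k - u k\<bar>) + (\<Sum>k\<in>L. C1 * ?d * \<bar>v k - u k\<bar>)"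
    proof (intro add_mono sum_mono mult_right_mono abs_ge_zero)
      fix k assume k: "k \<in> {..<m} - L"
      then have "P k r1 C1" "\<xi> k \<in> cube m c r1" "u \<in> cube m c r1" using 1(3) \<xi>(1) r(2) u by auto
      then have "\<bar>partial_deriv k g (\<xi> k) - partial_deriv k g u\<bar> \<le> C1 * E u (\<xi> k)" using k unfolding P_def by auto
      also have "\<dots> \<le> C1 * E u v" by (rule mult_left_mono[OF E\<xi> 1(2)])
      finally show "\<bar>partial_deriv k g (\<xi> k) - partial_deriv k g u\<bar> \<le> C1 * E u v" .
    next
      fix k assume k: "k \<in> L"
      then have "P k r1 C1" "\<xi> k \<in> cube m c r1" "u \<in> cube m c r1" using 1(3) \<xi>(1) r(2) u L by auto
      then have "\<bar>partial_deriv k g (\<xi> k) - partial_deriv k g u\<bar> \<le> C1 * l1_dist {..<m} u (\<xi> k)" using k unfolding P_def by auto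
      also have "\<dots> \<le> C1 * ?d" by (rule mult_left_mono[OF d\<xi> 1(2)])
      finally show "\<bar>partial_deriv k g (\<xi> k) - partial_deriv k g u\<bar> \<le> C1 * ?d" .
    qed
    also have "\<dots> = C1 * E u v * l1_dist ({..<m} - L) u v + C1 * ?d * ?dL" by (simp add: sum_distrib_left)
    also have "\<dots> \<le> C1 * E u v * ?d + C1 * ?d * E u v"
    proof (intro add_mono mult_left_mono)
      show "?dL \<le> E u v" by (simp add: E_def sum_nonneg)
    qed (use 1(2) nn E0 in \<open>auto intro: sum_mono2\<close>)
    finally show ?thesis by (simp add: algebra_simps)
  qed
  have "2 * C1 \<ge> 0" using 1(2) by simp
  show ?thesis
    by (rule exI[of _ r], rule conjI[OF r(1)], rule exI[of _ "2 * C1"], rule conjI[OF \<open>2 * C1 \<ge> 0\<close>], rule conjI[OF r(3)],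
      intro ballI, rule bound[unfolded E_def])
qed

section \<open>Sums over forests\<close>

text \<open>Two distinct labels occur in both orders and their product has symmetry factor 1; equal
  labels occur once and have symmetry factor 2. Either way the weight is half the sum over ordered
  pairs.\<close>

lemma sum_forests:
  fixes G :: "forest \<Rightarrow> real"
  shows "(\<Sum>\<tau>\<in>forests n. 1 / symmetry_factor \<tau> * G \<tau>) = (\<Sum>\<alpha>=1..n. G (Vertex \<alpha>)) +
    1/2 * (\<Sum>\<alpha>=1..n. \<Sum>\<beta>=1..n. G (Two (Upair \<alpha> \<beta>))) + (\<Sum>\<alpha>=1..n. \<Sum>\<beta>=1..n. G (Ladder \<alpha> \<beta>))"
proof -
  let ?S = "{1..n} \<times> {1..n}"
  define two where "two = (\<lambda>(\<alpha>, \<beta>). Two (Upair \<alpha> \<beta>))"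
  define lad where "lad = (\<lambda>(\<alpha>, \<beta>). Ladder \<alpha> \<beta>)"
  have eq: "forests n = Vertex ` {1..n} \<union> two ` ?S \<union> lad ` ?S"
  proof (intro subset_antisym subsetI)
    fix \<tau> assume "\<tau> \<in> forests n"
    then show "\<tau> \<in> Vertex ` {1..n} \<union> two ` ?S \<union> lad ` ?S"
    proof (cases rule: forests_cases)
      case (Two \<alpha> \<beta>)
      then have "\<tau> = two (\<alpha>, \<beta>)" "(\<alpha>, \<beta>) \<in> ?S" by (simp_all add: two_def)
      then show ?thesis by blast
    next
      case (Ladder \<alpha> \<beta>)
      then have "\<tau> = lad (\<alpha>, \<beta>)" "(\<alpha>, \<beta>) \<in> ?S" by (simp_all add: lad_def)
      then show ?thesis by blast
    qed simp
  next
    fix \<tau> assume "\<tau> \<in> Vertex ` {1..n} \<union> two ` ?S \<union> lad ` ?S"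
    then show "\<tau> \<in> forests n" by (auto simp: two_def lad_def)
  qed
  have disj: "Vertex ` {1..n} \<inter> two ` ?S = {}" "(Vertex ` {1..n} \<union> two ` ?S) \<inter> lad ` ?S = {}"
    by (auto simp: two_def lad_def)
  have "(\<Sum>\<tau>\<in>forests n. 1 / symmetry_factor \<tau> * G \<tau>) = (\<Sum>\<tau>\<in>Vertex ` {1..n}. 1 / symmetry_factor \<tau> * G \<tau>) +
      (\<Sum>\<tau>\<in>two ` ?S. 1 / symmetry_factor \<tau> * G \<tau>) + (\<Sum>\<tau>\<in>lad ` ?S. 1 / symmetry_factor \<tau> * G \<tau>)"
    unfolding eq by (subst sum.union_disjoint[OF _ _ disj(2)], simp, simp, subst sum.union_disjoint[OF _ _ disj(1)]) simp_all
  moreover have "(\<Sum>\<tau>\<in>Vertex ` {1..n}. 1 / symmetry_factor \<tau> * G \<tau>) = (\<Sum>\<alpha>=1..n. G (Vertex \<alpha>))"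
    by (subst sum.reindex) (auto simp: inj_on_def symmetry_factor_def)
  moreover have "(\<Sum>\<tau>\<in>lad ` ?S. 1 / symmetry_factor \<tau> * G \<tau>) = (\<Sum>\<alpha>=1..n. \<Sum>\<beta>=1..n. G (Ladder \<alpha> \<beta>))"
    unfolding sum.cartesian_product
    by (subst sum.reindex) (auto simp: inj_on_def symmetry_factor_def lad_def intro!: sum.cong)
  moreover have "(\<Sum>\<tau>\<in>two ` ?S. 1 / symmetry_factor \<tau> * G \<tau>) = 1/2 * (\<Sum>\<alpha>=1..n. \<Sum>\<beta>=1..n. G (Two (Upair \<alpha> \<beta>)))"
  proof -
    have "(\<Sum>\<alpha>=1..n. \<Sum>\<beta>=1..n. G (Two (Upair \<alpha> \<beta>))) = (\<Sum>x\<in>?S. G (two x))"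
      unfolding sum.cartesian_product by (intro sum.cong) (auto simp: two_def)
    \<comment> \<open>The ordered pairs are grouped by the unordered pair that they form.\<close>
    also have "\<dots> = (\<Sum>\<tau>\<in>two ` ?S. \<Sum>x\<in>{x \<in> ?S. two x = \<tau>}. G (two x))" by (rule sum.image_gen) simp
    also have "\<dots> = (\<Sum>\<tau>\<in>two ` ?S. 2 * (1 / symmetry_factor \<tau> * G \<tau>))"
    proof (rule sum.cong[OF refl])
      fix \<tau> assume "\<tau> \<in> two ` ?S"
      then obtain \<alpha> \<beta> where ab: "\<alpha> \<in> {1..n}" "\<beta> \<in> {1..n}" "\<tau> = Two (Upair \<alpha> \<beta>)" by (auto simp: two_def)
      have fib: "{x \<in> ?S. two x = \<tau>} = {(\<alpha>, \<beta>), (\<beta>, \<alpha>)}" using ab by (auto simp: two_def Upair_inject)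
      have "(\<Sum>x\<in>{x \<in> ?S. two x = \<tau>}. G (two x)) = real (card {(\<alpha>, \<beta>), (\<beta>, \<alpha>)}) * G \<tau>"
        unfolding fib[symmetric] by simp
      moreover have "real (card {(\<alpha>, \<beta>), (\<beta>, \<alpha>)}) = 2 / symmetry_factor \<tau>"
        using ab(3) by (cases "\<alpha> = \<beta>") (auto simp: symmetry_factor_def Upair_inject)
      ultimately show "(\<Sum>x\<in>{x \<in> ?S. two x = \<tau>}. G (two x)) = 2 * (1 / symmetry_factor \<tau> * G \<tau>)" by simp
    qed
    finally show ?thesis by (simp add: sum_distrib_left)
  qed
  ultimately show ?thesis by simp
qed

text \<open>The local expansion of the equation with all data reduced to numbers: \<open>f1\<close>,
  \<open>f2\<close>, \<open>f3\<close> are the components of the field at vertices, products and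
  ladders, \<open>x\<close> and \<open>l\<close> the vertex and ladder parts of the driver.\<close>

definition germ :: "nat \<Rightarrow> (nat \<Rightarrow> real) \<Rightarrow> (nat \<Rightarrow> nat \<Rightarrow> real) \<Rightarrow> (nat \<Rightarrow> nat \<Rightarrow> real) \<Rightarrow> (nat \<Rightarrow> real) \<Rightarrow> (nat \<Rightarrow> nat \<Rightarrow> real) \<Rightarrow> real" where
  "germ n f1 f2 f3 x l = (\<Sum>\<alpha>=1..n. f1 \<alpha> * x \<alpha>) + 1/2 * (\<Sum>\<alpha>=1..n. \<Sum>\<beta>=1..n. f2 \<alpha> \<beta> * (x \<alpha> * x \<beta>)) +
    (\<Sum>\<alpha>=1..n. \<Sum>\<beta>=1..n. f3 \<alpha> \<beta> * l \<alpha> \<beta>)"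

text \<open>The entries \<open>x + x'\<close> and \<open>l + l' + x * x'\<close> are those of the
  driver over the concatenated interval. Symmetry of \<open>f2\<close> merges the cross terms of the
  product part with that of the ladders, and the bracket in front of \<open>x'\<close> is precisely
  what admissibility compares.\<close>

lemma germ_increment_identity:
  fixes f1 g1 x x' :: "nat \<Rightarrow> real" and f2 g2 f3 g3 l l' :: "nat \<Rightarrow> nat \<Rightarrow> real"
  assumes sym: "\<And>\<alpha> \<beta>. f2 \<alpha> \<beta> = f2 \<beta> \<alpha>"
  shows "germ n f1 f2 f3 x l + germ n g1 g2 g3 x' l' - germ n f1 f2 f3 (\<lambda>\<alpha>. x \<alpha> + x' \<alpha>) (\<lambda>\<alpha> \<beta>. l \<alpha> \<beta> + l' \<alpha> \<beta> + x \<alpha> * x' \<beta>) =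
    (\<Sum>\<beta>=1..n. (g1 \<beta> - f1 \<beta> - (\<Sum>\<alpha>=1..n. (f2 \<alpha> \<beta> + f3 \<alpha> \<beta>) * x \<alpha>)) * x' \<beta>) +
    1/2 * (\<Sum>\<alpha>=1..n. \<Sum>\<beta>=1..n. (g2 \<alpha> \<beta> - f2 \<alpha> \<beta>) * (x' \<alpha> * x' \<beta>)) +
    (\<Sum>\<alpha>=1..n. \<Sum>\<beta>=1..n. (g3 \<alpha> \<beta> - f3 \<alpha> \<beta>) * l' \<alpha> \<beta>)"
proof -
  \<comment> \<open>The two cross terms coincide, which compensates the factor \<open>1/2\<close> of
    the product part.\<close>
  have "(\<Sum>\<alpha>=1..n. \<Sum>\<beta>=1..n. f2 \<alpha> \<beta> * (x' \<alpha> * x \<beta>)) = (\<Sum>\<beta>=1..n. \<Sum>\<alpha>=1..n. f2 \<alpha> \<beta> * (x' \<alpha> * x \<beta>))"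
    by (rule sum.swap)
  also have "\<dots> = (\<Sum>\<alpha>=1..n. \<Sum>\<beta>=1..n. f2 \<alpha> \<beta> * (x \<alpha> * x' \<beta>))"
    by (intro sum.cong refl) (simp add: sym mult_ac)
  finally have cross: "(\<Sum>\<alpha>=1..n. \<Sum>\<beta>=1..n. f2 \<alpha> \<beta> * (x' \<alpha> * x \<beta>)) = (\<Sum>\<alpha>=1..n. \<Sum>\<beta>=1..n. f2 \<alpha> \<beta> * (x \<alpha> * x' \<beta>))" .
  have "(\<Sum>\<beta>=1..n. (\<Sum>\<alpha>=1..n. (f2 \<alpha> \<beta> + f3 \<alpha> \<beta>) * x \<alpha>) * x' \<beta>) = (\<Sum>\<beta>=1..n. \<Sum>\<alpha>=1..n. (f2 \<alpha> \<beta> + f3 \<alpha> \<beta>) * (x \<alpha> * x' \<beta>))"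
    by (simp add: sum_distrib_right mult.assoc)
  also have "\<dots> = (\<Sum>\<alpha>=1..n. \<Sum>\<beta>=1..n. (f2 \<alpha> \<beta> + f3 \<alpha> \<beta>) * (x \<alpha> * x' \<beta>))" by (rule sum.swap)
  finally have mid: "(\<Sum>\<beta>=1..n. (\<Sum>\<alpha>=1..n. (f2 \<alpha> \<beta> + f3 \<alpha> \<beta>) * x \<alpha>) * x' \<beta>) =
     (\<Sum>\<alpha>=1..n. \<Sum>\<beta>=1..n. f2 \<alpha> \<beta> * (x \<alpha> * x' \<beta>)) + (\<Sum>\<alpha>=1..n. \<Sum>\<beta>=1..n. f3 \<alpha> \<beta> * (x \<alpha> * x' \<beta>))"
    by (simp add: distrib_right sum.distrib)
  have lin: "(\<Sum>\<alpha>=1..n. f1 \<alpha> * (x \<alpha> + x' \<alpha>)) = (\<Sum>\<alpha>=1..n. f1 \<alpha> * x \<alpha>) + (\<Sum>\<alpha>=1..n. f1 \<alpha> * x' \<alpha>)"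
    by (simp add: distrib_left sum.distrib)
  have quad: "(\<Sum>\<alpha>=1..n. \<Sum>\<beta>=1..n. f2 \<alpha> \<beta> * ((x \<alpha> + x' \<alpha>) * (x \<beta> + x' \<beta>))) =
      (\<Sum>\<alpha>=1..n. \<Sum>\<beta>=1..n. f2 \<alpha> \<beta> * (x \<alpha> * x \<beta>)) + (\<Sum>\<alpha>=1..n. \<Sum>\<beta>=1..n. f2 \<alpha> \<beta> * (x \<alpha> * x' \<beta>)) +
      (\<Sum>\<alpha>=1..n. \<Sum>\<beta>=1..n. f2 \<alpha> \<beta> * (x' \<alpha> * x \<beta>)) + (\<Sum>\<alpha>=1..n. \<Sum>\<beta>=1..n. f2 \<alpha> \<beta> * (x' \<alpha> * x' \<beta>))"
    unfolding sum.distrib[symmetric] by (intro sum.cong refl) (simp add: algebra_simps)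
  have lad: "(\<Sum>\<alpha>=1..n. \<Sum>\<beta>=1..n. f3 \<alpha> \<beta> * (l \<alpha> \<beta> + l' \<alpha> \<beta> + x \<alpha> * x' \<beta>)) =
      (\<Sum>\<alpha>=1..n. \<Sum>\<beta>=1..n. f3 \<alpha> \<beta> * l \<alpha> \<beta>) + (\<Sum>\<alpha>=1..n. \<Sum>\<beta>=1..n. f3 \<alpha> \<beta> * l' \<alpha> \<beta>) +
      (\<Sum>\<alpha>=1..n. \<Sum>\<beta>=1..n. f3 \<alpha> \<beta> * (x \<alpha> * x' \<beta>))"
    unfolding sum.distrib[symmetric] by (intro sum.cong refl) (simp add: algebra_simps)
  have rhs1: "(\<Sum>\<beta>=1..n. (g1 \<beta> - f1 \<beta> - (\<Sum>\<alpha>=1..n. (f2 \<alpha> \<beta> + f3 \<alpha> \<beta>) * x \<alpha>)) * x' \<beta>) =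
      (\<Sum>\<beta>=1..n. g1 \<beta> * x' \<beta>) - (\<Sum>\<beta>=1..n. f1 \<beta> * x' \<beta>) - (\<Sum>\<beta>=1..n. (\<Sum>\<alpha>=1..n. (f2 \<alpha> \<beta> + f3 \<alpha> \<beta>) * x \<alpha>) * x' \<beta>)"
    by (simp add: left_diff_distrib sum_subtractf)
  have rhs2: "(\<Sum>\<alpha>=1..n. \<Sum>\<beta>=1..n. (g2 \<alpha> \<beta> - f2 \<alpha> \<beta>) * (x' \<alpha> * x' \<beta>)) =
      (\<Sum>\<alpha>=1..n. \<Sum>\<beta>=1..n. g2 \<alpha> \<beta> * (x' \<alpha> * x' \<beta>)) - (\<Sum>\<alpha>=1..n. \<Sum>\<beta>=1..n. f2 \<alpha> \<beta> * (x' \<alpha> * x' \<beta>))"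
    "(\<Sum>\<alpha>=1..n. \<Sum>\<beta>=1..n. (g3 \<alpha> \<beta> - f3 \<alpha> \<beta>) * l' \<alpha> \<beta>) =
      (\<Sum>\<alpha>=1..n. \<Sum>\<beta>=1..n. g3 \<alpha> \<beta> * l' \<alpha> \<beta>) - (\<Sum>\<alpha>=1..n. \<Sum>\<beta>=1..n. f3 \<alpha> \<beta> * l' \<alpha> \<beta>)"
    by (simp_all add: left_diff_distrib sum_subtractf)
  show ?thesis unfolding germ_def lin quad lad rhs1 rhs2 mid cross by (simp add: algebra_simps)
qed

lemma abs_sum_mult_le:
  fixes f x :: "nat \<Rightarrow> real"
  assumes "\<And>\<alpha>. \<alpha> \<in> {1..n} \<Longrightarrow> \<bar>f \<alpha>\<bar> \<le> A" "\<And>\<alpha>. \<alpha> \<in> {1..n} \<Longrightarrow> \<bar>x \<alpha>\<bar> \<le> B" "0 \<le> A"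
  shows "\<bar>\<Sum>\<alpha>=1..n. f \<alpha> * x \<alpha>\<bar> \<le> real n * (A * B)"
proof -
  have "\<bar>\<Sum>\<alpha>=1..n. f \<alpha> * x \<alpha>\<bar> \<le> (\<Sum>\<alpha>=1..n. \<bar>f \<alpha> * x \<alpha>\<bar>)" by (rule sum_abs)
  also have "\<dots> \<le> (\<Sum>\<alpha>=1..n. A * B)"
    unfolding abs_mult using assms by (intro sum_mono mult_mono) auto
  finally show ?thesis by simp
qed

lemma abs_sum2_mult_le:
  fixes f x :: "nat \<Rightarrow> nat \<Rightarrow> real"
  assumes "\<And>\<alpha> \<beta>. \<alpha> \<in> {1..n} \<Longrightarrow> \<beta> \<in> {1..n} \<Longrightarrow> \<bar>f \<alpha> \<beta>\<bar> \<le> A"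
    "\<And>\<alpha> \<beta>. \<alpha> \<in> {1..n} \<Longrightarrow> \<beta> \<in> {1..n} \<Longrightarrow> \<bar>x \<alpha> \<beta>\<bar> \<le> B" "0 \<le> A"
  shows "\<bar>\<Sum>\<alpha>=1..n. \<Sum>\<beta>=1..n. f \<alpha> \<beta> * x \<alpha> \<beta>\<bar> \<le> real n * (real n * (A * B))"
proof -
  have "\<bar>\<Sum>\<alpha>=1..n. \<Sum>\<beta>=1..n. f \<alpha> \<beta> * x \<alpha> \<beta>\<bar> \<le> (\<Sum>\<alpha>=1..n. \<bar>\<Sum>\<beta>=1..n. f \<alpha> \<beta> * x \<alpha> \<beta>\<bar>)" by (rule sum_abs)
  also have "\<dots> \<le> (\<Sum>\<alpha>=1..n. real n * (A * B))"
    using assms by (intro sum_mono abs_sum_mult_le) auto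
  finally show ?thesis by simp
qed

section \<open>Rough curves starting in a slice stay in it\<close>

text \<open>\<open>H\<close> stands for the control to the power \<open>1/p\<close>, so vertices
  have order \<open>H\<close> and the remaining forests order \<open>H^2\<close>. The coefficient
  bound \<open>A\<close> is kept general: it is a constant for arbitrary components and proportional
  to the normal size for normal ones.\<close>

lemma germ_bounds:
  assumes A: "0 \<le> A" and f: "\<forall>\<alpha>\<in>{1..n}. \<forall>\<beta>\<in>{1..n}. \<bar>f1 \<alpha>\<bar> \<le> A \<and> \<bar>f2 \<alpha> \<beta>\<bar> \<le> A \<and> \<bar>f3 \<alpha> \<beta>\<bar> \<le> A"
    and x: "\<forall>\<alpha>\<in>{1..n}. \<forall>\<beta>\<in>{1..n}. \<bar>x \<alpha>\<bar> \<le> c * H \<and> \<bar>x \<alpha> * x \<beta>\<bar> \<le> c * H^2 \<and> \<bar>l \<alpha> \<beta>\<bar> \<le> c * H^2"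
  shows "\<bar>\<Sum>\<alpha>=1..n. f1 \<alpha> * x \<alpha>\<bar> \<le> real n * c * A * H"
    and "\<bar>germ n f1 f2 f3 x l - (\<Sum>\<alpha>=1..n. f1 \<alpha> * x \<alpha>)\<bar> \<le> 2 * real n * real n * c * A * H^2"
proof -
  have "\<bar>\<Sum>\<alpha>=1..n. f1 \<alpha> * x \<alpha>\<bar> \<le> real n * (A * (c * H))"
    by (rule abs_sum_mult_le) (use f x A in blast)+
  then show "\<bar>\<Sum>\<alpha>=1..n. f1 \<alpha> * x \<alpha>\<bar> \<le> real n * c * A * H" by (simp add: mult_ac)
  have 2: "\<bar>\<Sum>\<alpha>=1..n. \<Sum>\<beta>=1..n. f2 \<alpha> \<beta> * (x \<alpha> * x \<beta>)\<bar> \<le> real n * (real n * (A * (c * H^2)))"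
    by (rule abs_sum2_mult_le) (use f x A in blast)+
  have 3: "\<bar>\<Sum>\<alpha>=1..n. \<Sum>\<beta>=1..n. f3 \<alpha> \<beta> * l \<alpha> \<beta>\<bar> \<le> real n * (real n * (A * (c * H^2)))"
    by (rule abs_sum2_mult_le) (use f x A in blast)+
  have eq: "2 * real n * real n * c * A * H^2 = 2 * (real n * (real n * (A * (c * H^2))))" by (simp add: mult_ac)
  show "\<bar>germ n f1 f2 f3 x l - (\<Sum>\<alpha>=1..n. f1 \<alpha> * x \<alpha>)\<bar> \<le> 2 * real n * real n * c * A * H^2"
    unfolding germ_def eq using 2 3 by linarith
qed

text \<open>The expansion of component \<open>i\<close> started at \<open>y s\<close>. Product
  forests of the driver enter as products of vertex entries, as their algebraic relation
  dictates.\<close>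

definition rough_germ :: "nat \<Rightarrow> (nat \<Rightarrow> forest \<Rightarrow> (nat \<Rightarrow> real) \<Rightarrow> real) \<Rightarrow> (forest \<Rightarrow> real \<Rightarrow> real \<Rightarrow> real) \<Rightarrow> (real \<Rightarrow> nat \<Rightarrow> real) \<Rightarrow> nat \<Rightarrow> real \<Rightarrow> real \<Rightarrow> real" where
  "rough_germ n F X y i s t = germ n (\<lambda>\<alpha>. F i (Vertex \<alpha>) (y s)) (\<lambda>\<alpha> \<beta>. F i (Two (Upair \<alpha> \<beta>)) (y s))
     (\<lambda>\<alpha> \<beta>. F i (Ladder \<alpha> \<beta>) (y s)) (\<lambda>\<alpha>. X (Vertex \<alpha>) s t) (\<lambda>\<alpha> \<beta>. X (Ladder \<alpha> \<beta>) s t)"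

text \<open>Accumulates the constants of the next proof: \<open>k\<close> and \<open>k2\<close> for
  the two orders of the germ, \<open>c2\<close> and \<open>c3\<close> for increments of arbitrary
  components, \<open>c4\<close> for the full displacement, \<open>c6\<close> for normal increments,
  \<open>c7\<close> for the slice modulus, \<open>c8\<close> for the bracket. It is explicit so as
  to be visibly independent of \<open>q\<close> and \<open>\<rho>\<close>, which change at every
  stage of the iteration.\<close>

definition defect_const :: "nat \<Rightarrow> nat \<Rightarrow> real \<Rightarrow> real \<Rightarrow> real \<Rightarrow> real" where
  "defect_const m n C0 Cx C1 = (let k = real n * Cx * C0; k2 = 2 * real n * real n * Cx * C0; c2 = C1 + k2; c3 = c2 + k;
     c4 = real m * c3; c6 = k2 + k; c7 = c4 + real m * c6 + real m; c8 = C0 * c4 * c7 + real m * C0 * (c2 + k2 + 1)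
     in real n * Cx * c8 + k2 * c7 + c6 + 1)"

text \<open>Both the normal displacement of the curve and the defect of additivity of its local expansion
  are controlled by the size \<open>q\<close> of the normal component and the normal remainder constant \<open>\<rho>\<close>.
  Admissibility cancels the defect of order two.\<close>

lemma rough_defect_bound:
  fixes F :: "nat \<Rightarrow> forest \<Rightarrow> (nat \<Rightarrow> real) \<Rightarrow> real" and y :: "real \<Rightarrow> nat \<Rightarrow> real" and X :: "forest \<Rightarrow> real \<Rightarrow> real \<Rightarrow> real"
  assumes L: "L \<subseteq> {..<m}" and C0: "0 \<le> C0" and Cx: "0 \<le> Cx" and C1: "0 \<le> C1"
    and F: "\<forall>i<m. \<forall>\<tau>\<in>forests n. \<forall>u\<in>B. \<bar>F i \<tau> u\<bar> \<le> C0"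
    and F0: "\<forall>i\<in>L. \<forall>\<tau>\<in>forests n. \<forall>u\<in>B. \<bar>F i \<tau> u\<bar> \<le> C0 * l1_norm L u"
    and F1: "\<forall>i\<in>L. \<forall>\<tau>\<in>forests n. \<forall>u\<in>B. \<forall>v\<in>B. \<bar>F i \<tau> v - F i \<tau> u\<bar> \<le> C0 * (l1_norm L u * l1_dist {..<m} u v + l1_dist L u v)"
    and F2: "\<forall>i\<in>L. \<forall>\<tau>\<in>forests n. \<forall>u\<in>B. \<forall>v\<in>B. \<bar>F i \<tau> v - F i \<tau> u - (\<Sum>j<m. partial_deriv j (F i \<tau>) u * (v j - u j))\<bar>
        \<le> C0 * ((l1_norm L u * l1_dist {..<m} u v + l1_dist L u v) * l1_dist {..<m} u v)"
    and dF: "\<forall>i\<in>L. \<forall>\<tau>\<in>forests n. \<forall>j<m. \<forall>u\<in>B. \<bar>partial_deriv j (F i \<tau>) u\<bar> \<le> C0 \<and> (j \<notin> L \<longrightarrow> \<bar>partial_deriv j (F i \<tau>) u\<bar> \<le> C0 * l1_norm L u)"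
    and adm: "\<forall>u\<in>B. \<forall>i<m. \<forall>\<alpha>\<in>{1..n}. \<forall>\<beta>\<in>{1..n}. (\<Sum>j<m. partial_deriv j (F i (Vertex \<beta>)) u * F j (Vertex \<alpha>) u) =
        F i (Two (Upair \<alpha> \<beta>)) u + F i (Ladder \<alpha> \<beta>) u"
    and y: "\<forall>t. a \<le> t \<and> t \<le> b \<longrightarrow> y t \<in> B"
    and H: "\<forall>s t. a \<le> s \<and> s \<le> t \<and> t \<le> b \<longrightarrow> 0 \<le> H s t \<and> H s t \<le> 1"
    and Hmono: "\<forall>s u t. a \<le> s \<and> s \<le> u \<and> u \<le> t \<and> t \<le> b \<longrightarrow> H s u \<le> H s t \<and> H u t \<le> H s t"
    and X: "\<forall>\<alpha>\<in>{1..n}. \<forall>\<beta>\<in>{1..n}. \<forall>s t. a \<le> s \<and> s \<le> t \<and> t \<le> b \<longrightarrow>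
        \<bar>X (Vertex \<alpha>) s t\<bar> \<le> Cx * H s t \<and> \<bar>X (Vertex \<alpha>) s t * X (Vertex \<beta>) s t\<bar> \<le> Cx * (H s t)^2 \<and> \<bar>X (Ladder \<alpha> \<beta>) s t\<bar> \<le> Cx * (H s t)^2"
    and chen: "\<forall>\<alpha>\<in>{1..n}. \<forall>\<beta>\<in>{1..n}. \<forall>s u t. a \<le> s \<and> s \<le> u \<and> u \<le> t \<and> t \<le> b \<longrightarrow>
        X (Vertex \<alpha>) s t = X (Vertex \<alpha>) s u + X (Vertex \<alpha>) u t \<and>
        X (Ladder \<alpha> \<beta>) s t = X (Ladder \<alpha> \<beta>) s u + X (Ladder \<alpha> \<beta>) u t + X (Vertex \<alpha>) s u * X (Vertex \<beta>) u t"
    and R: "\<forall>i<m. \<forall>s t. a \<le> s \<and> s \<le> t \<and> t \<le> b \<longrightarrow> \<bar>y t i - y s i - rough_germ n F X y i s t\<bar> \<le> C1 * (H s t)^3"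
    and q: "0 \<le> q" and \<rho>: "0 \<le> \<rho>" and N: "\<forall>s. a \<le> s \<and> s \<le> b \<longrightarrow> l1_norm L (y s) \<le> q"
    and RL: "\<forall>i\<in>L. \<forall>s t. a \<le> s \<and> s \<le> t \<and> t \<le> b \<longrightarrow> \<bar>y t i - y s i - rough_germ n F X y i s t\<bar> \<le> \<rho> * (H s t)^3"
  defines "D \<equiv> defect_const m n C0 Cx C1"
  shows "\<forall>i\<in>L. \<forall>s t. a \<le> s \<and> s \<le> t \<and> t \<le> b \<longrightarrow> \<bar>y t i - y s i\<bar> \<le> D * (q * H s t + \<rho> * (H s t)^2)"
    and "\<forall>i\<in>L. \<forall>s u t. a \<le> s \<and> s \<le> u \<and> u \<le> t \<and> t \<le> b \<longrightarrow>
        \<bar>rough_germ n F X y i s u + rough_germ n F X y i u t - rough_germ n F X y i s t\<bar> \<le> D * (q * (H s t)^3 + \<rho> * (H s t)^4)"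
proof -
  define k where "k = real n * Cx * C0"
  define k2 where "k2 = 2 * real n * real n * Cx * C0"
  define c2 where "c2 = C1 + k2"
  define c3 where "c3 = c2 + k"
  define c4 where "c4 = real m * c3"
  define c6 where "c6 = k2 + k"
  define c7 where "c7 = c4 + real m * c6 + real m"
  define c8 where "c8 = C0 * c4 * c7 + real m * C0 * (c2 + k2 + 1)"
  have D_eq: "D = real n * Cx * c8 + k2 * c7 + c6 + 1"
    unfolding D_def defect_const_def Let_def k_def k2_def c2_def c3_def c4_def c6_def c7_def c8_def ..
  have nn: "0 \<le> k" "0 \<le> k2" "0 \<le> c2" "0 \<le> c3" "0 \<le> c4" "0 \<le> c6" "0 \<le> c7" "0 \<le> c8" "0 \<le> D"
    using C0 Cx C1 by (simp_all add: k_def k2_def c2_def c3_def c4_def c6_def c7_def c8_def D_eq)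
  \<comment> \<open>The first-order part of the germ, the part of the increment to which the
    derivative of the field is applied in the admissibility condition.\<close>
  define A1 where "A1 i s t = (\<Sum>\<alpha>=1..n. F i (Vertex \<alpha>) (y s) * X (Vertex \<alpha>) s t)" for i s t
  have germ_F: "\<bar>A1 i s t\<bar> \<le> real n * Cx * A * H s t"
    "\<bar>rough_germ n F X y i s t - A1 i s t\<bar> \<le> 2 * real n * real n * Cx * A * (H s t)^2"
    if st: "a \<le> s" "s \<le> t" "t \<le> b" and A: "0 \<le> A" and FA: "\<forall>\<tau>\<in>forests n. \<bar>F i \<tau> (y s)\<bar> \<le> A" for i s t A
  proof -
    have fb: "\<forall>\<alpha>\<in>{1..n}. \<forall>\<beta>\<in>{1..n}. \<bar>F i (Vertex \<alpha>) (y s)\<bar> \<le> A \<and> \<bar>F i (Two (Upair \<alpha> \<beta>)) (y s)\<bar> \<le> A \<and> \<bar>F i (Ladder \<alpha> \<beta>) (y s)\<bar> \<le> A"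
      using FA by simp
    have xb: "\<forall>\<alpha>\<in>{1..n}. \<forall>\<beta>\<in>{1..n}. \<bar>X (Vertex \<alpha>) s t\<bar> \<le> Cx * H s t \<and> \<bar>X (Vertex \<alpha>) s t * X (Vertex \<beta>) s t\<bar> \<le> Cx * (H s t)^2 \<and> \<bar>X (Ladder \<alpha> \<beta>) s t\<bar> \<le> Cx * (H s t)^2"
      using X st by blast
    show "\<bar>A1 i s t\<bar> \<le> real n * Cx * A * H s t"
      "\<bar>rough_germ n F X y i s t - A1 i s t\<bar> \<le> 2 * real n * real n * Cx * A * (H s t)^2"
      unfolding A1_def rough_germ_def by (rule germ_bounds[OF A fb xb])+
  qed
  \<comment> \<open>Increments of arbitrary components, with no factor of the normal size; such a
    factor will come from the derivative that multiplies them.\<close>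
  have inc: "\<bar>y t j - y s j - A1 j s t\<bar> \<le> c2 * (H s t)^2" "\<bar>y t j - y s j\<bar> \<le> c3 * H s t"
    if st: "a \<le> s" "s \<le> t" "t \<le> b" and j: "j < m" for j s t
  proof -
    have h: "0 \<le> H s t" "H s t \<le> 1" using H st by blast+
    have ys: "y s \<in> B" using y st by simp
    have FA: "\<forall>\<tau>\<in>forests n. \<bar>F j \<tau> (y s)\<bar> \<le> C0" using F j ys by blast
    have "(H s t)^3 \<le> (H s t)^2" by (rule power_decreasing) (use h in auto)
    then have "C1 * (H s t)^3 \<le> C1 * (H s t)^2" by (rule mult_left_mono[OF _ C1])
    moreover have "\<bar>y t j - y s j - rough_germ n F X y j s t\<bar> \<le> C1 * (H s t)^3" using R j st by blast
    moreover have "\<bar>rough_germ n F X y j s t - A1 j s t\<bar> \<le> k2 * (H s t)^2" using germ_F(2)[OF st C0 FA] by (simp add: k2_def)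
    ultimately show 1: "\<bar>y t j - y s j - A1 j s t\<bar> \<le> c2 * (H s t)^2" unfolding c2_def distrib_right by linarith
    have "(H s t)^2 \<le> H s t" using power_decreasing[of 1 2 "H s t"] h by simp
    then have "c2 * (H s t)^2 \<le> c2 * H s t" by (rule mult_left_mono[OF _ nn(3)])
    moreover have "\<bar>A1 j s t\<bar> \<le> k * H s t" using germ_F(1)[OF st C0 FA] by (simp add: k_def)
    ultimately show "\<bar>y t j - y s j\<bar> \<le> c3 * H s t" using 1 unfolding c3_def distrib_right by linarith
  qed
  have dist: "l1_dist {..<m} (y s) (y t) \<le> c4 * H s t" if st: "a \<le> s" "s \<le> t" "t \<le> b" for s t
  proof -
    have "l1_dist {..<m} (y s) (y t) \<le> (\<Sum>i<m. c3 * H s t)" by (intro sum_mono inc(2)[OF st]) simp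
    then show ?thesis by (simp add: c4_def)
  qed
  have FLq: "\<forall>\<tau>\<in>forests n. \<bar>F i \<tau> (y s)\<bar> \<le> C0 * q" if s: "a \<le> s" "s \<le> b" and i: "i \<in> L" for i s
  proof
    fix \<tau> assume "\<tau> \<in> forests n"
    then have "\<bar>F i \<tau> (y s)\<bar> \<le> C0 * l1_norm L (y s)" using F0 i y s by blast
    also have "\<dots> \<le> C0 * q" using N s by (intro mult_left_mono C0) blast
    finally show "\<bar>F i \<tau> (y s)\<bar> \<le> C0 * q" .
  qed
  \<comment> \<open>For normal components the field has size \<open>C0 * q\<close>, so every term
    acquires a factor \<open>q\<close> or \<open>\<rho>\<close>.\<close>
  have incL: "\<bar>y t i - y s i - A1 i s t\<bar> \<le> k2 * q * (H s t)^2 + \<rho> * (H s t)^3"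
    "\<bar>y t i - y s i\<bar> \<le> c6 * q * H s t + \<rho> * (H s t)^2"
    if st: "a \<le> s" "s \<le> t" "t \<le> b" and i: "i \<in> L" for i s t
  proof -
    have h: "0 \<le> H s t" "H s t \<le> 1" using H st by blast+
    have FA: "\<forall>\<tau>\<in>forests n. \<bar>F i \<tau> (y s)\<bar> \<le> C0 * q" using FLq st i by simp
    have Cq: "0 \<le> C0 * q" using C0 q by simp
    have "\<bar>y t i - y s i - rough_germ n F X y i s t\<bar> \<le> \<rho> * (H s t)^3" using RL i st by blast
    moreover have "\<bar>rough_germ n F X y i s t - A1 i s t\<bar> \<le> k2 * q * (H s t)^2"
      using germ_F(2)[OF st Cq FA] by (simp add: k2_def mult_ac)
    ultimately show 1: "\<bar>y t i - y s i - A1 i s t\<bar> \<le> k2 * q * (H s t)^2 + \<rho> * (H s t)^3" by linarith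
    have "(H s t)^2 \<le> H s t" using power_decreasing[of 1 2 "H s t"] h by simp
    then have "k2 * q * (H s t)^2 \<le> k2 * q * H s t" by (rule mult_left_mono) (use nn q in simp)
    moreover have "(H s t)^3 \<le> (H s t)^2" by (rule power_decreasing) (use h in auto)
    then have "\<rho> * (H s t)^3 \<le> \<rho> * (H s t)^2" by (rule mult_left_mono[OF _ \<rho>])
    moreover have "\<bar>A1 i s t\<bar> \<le> k * q * H s t" using germ_F(1)[OF st Cq FA] by (simp add: k_def mult_ac)
    ultimately show "\<bar>y t i - y s i\<bar> \<le> c6 * q * H s t + \<rho> * (H s t)^2" using 1 unfolding c6_def distrib_right by linarith
  qed
  \<comment> \<open>The common modulus in the increment and Taylor hypotheses \<open>F1\<close> and
    \<open>F2\<close>, evaluated along the curve.\<close>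
  have E: "l1_norm L (y s) * l1_dist {..<m} (y s) (y t) + l1_dist L (y s) (y t) \<le> c7 * (q * H s t + \<rho> * (H s t)^2)"
    if st: "a \<le> s" "s \<le> t" "t \<le> b" for s t
  proof -
    have h: "0 \<le> H s t" "H s t \<le> 1" using H st by blast+
    have "l1_norm L (y s) * l1_dist {..<m} (y s) (y t) \<le> q * (c4 * H s t)"
      using N st q dist[OF st] by (intro mult_mono) (auto intro: sum_nonneg)
    moreover have "l1_dist L (y s) (y t) \<le> (\<Sum>i\<in>L. c6 * q * H s t + \<rho> * (H s t)^2)"
      by (intro sum_mono incL(2)[OF st])
    moreover have "(\<Sum>i\<in>L. c6 * q * H s t + \<rho> * (H s t)^2) \<le> real m * (c6 * q * H s t + \<rho> * (H s t)^2)"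
    proof -
      have "card L \<le> m" using card_mono[OF _ L] by simp
      then show ?thesis using nn(6) q \<rho> h by (simp add: mult_right_mono)
    qed
    moreover have "q * (c4 * H s t) + real m * (c6 * q * H s t + \<rho> * (H s t)^2) \<le> c7 * (q * H s t + \<rho> * (H s t)^2)"
    proof -
      have "c7 * (q * H s t + \<rho> * (H s t)^2) - (q * (c4 * H s t) + real m * (c6 * q * H s t + \<rho> * (H s t)^2))
          = real m * (q * H s t) + (c4 + real m * c6) * (\<rho> * (H s t)^2)"
        by (simp add: c7_def algebra_simps)
      moreover have "0 \<le> real m * (q * H s t) + (c4 + real m * c6) * (\<rho> * (H s t)^2)"
        using nn q \<rho> h by simp
      ultimately show ?thesis by linarith
    qed
    ultimately show ?thesis by linarith
  qed
  have part1: "\<bar>y t i - y s i\<bar> \<le> D * (q * H s t + \<rho> * (H s t)^2)" if st: "a \<le> s" "s \<le> t" "t \<le> b" and i: "i \<in> L" for i s t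
  proof -
    have h: "0 \<le> H s t" "H s t \<le> 1" using H st by blast+
    have "c6 * q * H s t + \<rho> * (H s t)^2 \<le> D * (q * H s t) + D * (\<rho> * (H s t)^2)"
    proof (rule add_mono)
      have "c6 \<le> D" "1 \<le> D" using nn Cx by (simp_all add: D_eq)
      then show "c6 * q * H s t \<le> D * (q * H s t)" "\<rho> * (H s t)^2 \<le> D * (\<rho> * (H s t)^2)"
        unfolding mult.assoc[of c6]
        using q \<rho> h mult_right_mono[of c6 D "q * H s t"] mult_right_mono[of 1 D "\<rho> * (H s t)^2"] by simp_all
    qed
    then show ?thesis using incL(2)[OF st i] by (simp add: distrib_left)
  qed
  have part2: "\<bar>rough_germ n F X y i s u + rough_germ n F X y i u t - rough_germ n F X y i s t\<bar> \<le> D * (q * (H s t)^3 + \<rho> * (H s t)^4)"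
    if su: "a \<le> s" "s \<le> u" "u \<le> t" "t \<le> b" and i: "i \<in> L" for i s u t
  proof -
    define h where "h = H s t"
    have st: "a \<le> s" "s \<le> t" "t \<le> b" and ub: "u \<le> b" and au: "a \<le> u" using su by auto
    have h: "0 \<le> h" "h \<le> 1" using H st by (simp_all add: h_def)
    have hsu: "0 \<le> H s u" "H s u \<le> h" and hut: "0 \<le> H u t" "H u t \<le> h"
      using H[rule_format, of s u] H[rule_format, of u t] Hmono[rule_format, of s u t] su ub au by (simp_all add: h_def)
    have im: "i < m" using i L by blast
    have B: "y s \<in> B" "y u \<in> B" using y su by auto
    have Eu: "l1_norm L (y s) * l1_dist {..<m} (y s) (y u) + l1_dist L (y s) (y u) \<le> c7 * (q * h + \<rho> * h^2)"
    proof -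
      have "q * H s u + \<rho> * (H s u)^2 \<le> q * h + \<rho> * h^2"
        using hsu q \<rho> by (intro add_mono mult_left_mono power_mono) auto
      then have "c7 * (q * H s u + \<rho> * (H s u)^2) \<le> c7 * (q * h + \<rho> * h^2)" by (rule mult_left_mono[OF _ nn(7)])
      then show ?thesis using E[OF su(1,2) ub] by linarith
    qed
    have Xut: "\<bar>X (Vertex \<alpha>) u t\<bar> \<le> Cx * h" "\<bar>X (Vertex \<alpha>) u t * X (Vertex \<beta>) u t\<bar> \<le> Cx * h^2" "\<bar>X (Ladder \<alpha> \<beta>) u t\<bar> \<le> Cx * h^2"
      if "\<alpha> \<in> {1..n}" "\<beta> \<in> {1..n}" for \<alpha> \<beta>
    proof -
      have "Cx * H u t \<le> Cx * h" "Cx * (H u t)^2 \<le> Cx * h^2"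
        using hut Cx by (auto intro!: mult_left_mono power_mono)
      moreover have "\<bar>X (Vertex \<alpha>) u t\<bar> \<le> Cx * H u t \<and> \<bar>X (Vertex \<alpha>) u t * X (Vertex \<beta>) u t\<bar> \<le> Cx * (H u t)^2 \<and> \<bar>X (Ladder \<alpha> \<beta>) u t\<bar> \<le> Cx * (H u t)^2"
        using X that au su by blast
      ultimately show "\<bar>X (Vertex \<alpha>) u t\<bar> \<le> Cx * h" "\<bar>X (Vertex \<alpha>) u t * X (Vertex \<beta>) u t\<bar> \<le> Cx * h^2" "\<bar>X (Ladder \<alpha> \<beta>) u t\<bar> \<le> Cx * h^2"
        by linarith+
    qed
    define F2' where "F2' v \<alpha> \<beta> = F i (Two (Upair \<alpha> \<beta>)) (y v)" for v \<alpha> \<beta>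
    define F3' where "F3' v \<alpha> \<beta> = F i (Ladder \<alpha> \<beta>) (y v)" for v \<alpha> \<beta>
    have sym: "F2' v \<alpha> \<beta> = F2' v \<beta> \<alpha>" for v \<alpha> \<beta>
    proof -
      have "Upair \<alpha> \<beta> = Upair \<beta> \<alpha>" by (simp add: Upair_inject)
      then show ?thesis unfolding F2'_def by (rule arg_cong[where f = "\<lambda>P. F i (Two P) (y v)"])
    qed
    have g3: "rough_germ n F X y i s t = germ n (\<lambda>\<alpha>. F i (Vertex \<alpha>) (y s)) (F2' s) (F3' s)
        (\<lambda>\<alpha>. X (Vertex \<alpha>) s u + X (Vertex \<alpha>) u t)
        (\<lambda>\<alpha> \<beta>. X (Ladder \<alpha> \<beta>) s u + X (Ladder \<alpha> \<beta>) u t + X (Vertex \<alpha>) s u * X (Vertex \<beta>) u t)"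
    proof -
      have V: "X (Vertex \<alpha>) s t = X (Vertex \<alpha>) s u + X (Vertex \<alpha>) u t" if "\<alpha> \<in> {1..n}" for \<alpha>
        using chen that su by blast
      have La: "X (Ladder \<alpha> \<beta>) s t = X (Ladder \<alpha> \<beta>) s u + X (Ladder \<alpha> \<beta>) u t + X (Vertex \<alpha>) s u * X (Vertex \<beta>) u t"
        if "\<alpha> \<in> {1..n}" "\<beta> \<in> {1..n}" for \<alpha> \<beta> using chen that su by blast
      show ?thesis unfolding rough_germ_def germ_def F2'_def F3'_def
        by (intro arg_cong2[where f = "(+)"] arg_cong2[where f = "(*)"] refl sum.cong) (simp_all only: V La)
    qed
    have gv: "rough_germ n F X y i v w = germ n (\<lambda>\<alpha>. F i (Vertex \<alpha>) (y v)) (F2' v) (F3' v) (\<lambda>\<alpha>. X (Vertex \<alpha>) v w) (\<lambda>\<alpha> \<beta>. X (Ladder \<alpha> \<beta>) v w)" for v w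
      by (simp add: rough_germ_def F2'_def[abs_def] F3'_def[abs_def])
    \<comment> \<open>Term by term this bracket is only of first order; admissibility has to raise
      it to second order, since a single factor of the driver multiplies it.\<close>
    define br where "br \<beta> = F i (Vertex \<beta>) (y u) - F i (Vertex \<beta>) (y s) - (\<Sum>\<alpha>=1..n. (F2' s \<alpha> \<beta> + F3' s \<alpha> \<beta>) * X (Vertex \<alpha>) s u)" for \<beta>
    have id: "rough_germ n F X y i s u + rough_germ n F X y i u t - rough_germ n F X y i s t =
        (\<Sum>\<beta>=1..n. br \<beta> * X (Vertex \<beta>) u t) +
        1/2 * (\<Sum>\<alpha>=1..n. \<Sum>\<beta>=1..n. (F2' u \<alpha> \<beta> - F2' s \<alpha> \<beta>) * (X (Vertex \<alpha>) u t * X (Vertex \<beta>) u t)) +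
        (\<Sum>\<alpha>=1..n. \<Sum>\<beta>=1..n. (F3' u \<alpha> \<beta> - F3' s \<alpha> \<beta>) * X (Ladder \<alpha> \<beta>) u t)"
      unfolding g3 gv[of s u] gv[of u t] br_def by (rule germ_increment_identity[OF sym])
    have Fdiff: "\<bar>F i \<tau> (y u) - F i \<tau> (y s)\<bar> \<le> C0 * (c7 * (q * h + \<rho> * h^2))" if "\<tau> \<in> forests n" for \<tau>
    proof -
      have "\<bar>F i \<tau> (y u) - F i \<tau> (y s)\<bar> \<le> C0 * (l1_norm L (y s) * l1_dist {..<m} (y s) (y u) + l1_dist L (y s) (y u))"
        using F1 i that B by blast
      also have "\<dots> \<le> C0 * (c7 * (q * h + \<rho> * h^2))" by (rule mult_left_mono[OF Eu C0])
      finally show ?thesis .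
    qed
    have br: "\<bar>br \<beta>\<bar> \<le> c8 * (q * h^2 + \<rho> * h^3)" if \<beta>: "\<beta> \<in> {1..n}" for \<beta>
    proof -
      let ?dF = "\<lambda>j. partial_deriv j (F i (Vertex \<beta>)) (y s)"
      have V\<beta>: "Vertex \<beta> \<in> forests n" using \<beta> by simp
      have "(\<Sum>\<alpha>=1..n. (F2' s \<alpha> \<beta> + F3' s \<alpha> \<beta>) * X (Vertex \<alpha>) s u) = (\<Sum>\<alpha>=1..n. (\<Sum>j<m. ?dF j * F j (Vertex \<alpha>) (y s)) * X (Vertex \<alpha>) s u)"
      proof (rule sum.cong[OF refl])
        fix \<alpha> assume "\<alpha> \<in> {1..n}"
        then have "(\<Sum>j<m. ?dF j * F j (Vertex \<alpha>) (y s)) = F2' s \<alpha> \<beta> + F3' s \<alpha> \<beta>"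
          unfolding F2'_def F3'_def using adm B(1) im \<beta> by blast
        then show "(F2' s \<alpha> \<beta> + F3' s \<alpha> \<beta>) * X (Vertex \<alpha>) s u = (\<Sum>j<m. ?dF j * F j (Vertex \<alpha>) (y s)) * X (Vertex \<alpha>) s u" by simp
      qed
      also have "\<dots> = (\<Sum>\<alpha>=1..n. \<Sum>j<m. ?dF j * (F j (Vertex \<alpha>) (y s) * X (Vertex \<alpha>) s u))"
        by (simp add: sum_distrib_right mult.assoc)
      also have "\<dots> = (\<Sum>j<m. \<Sum>\<alpha>=1..n. ?dF j * (F j (Vertex \<alpha>) (y s) * X (Vertex \<alpha>) s u))" by (rule sum.swap)
      also have "\<dots> = (\<Sum>j<m. ?dF j * A1 j s u)" by (simp add: A1_def sum_distrib_left)
      \<comment> \<open>After admissibility the sum over labels is the derivative applied to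
        \<open>A1\<close>. What remains is a Taylor remainder and the derivative applied to the
        increment minus \<open>A1\<close>, both of second order.\<close>
      finally have eq: "br \<beta> = (F i (Vertex \<beta>) (y u) - F i (Vertex \<beta>) (y s) - (\<Sum>j<m. ?dF j * (y u j - y s j))) +
          (\<Sum>j<m. ?dF j * (y u j - y s j - A1 j s u))"
        by (simp add: br_def right_diff_distrib sum_subtractf)
      let ?d = "l1_dist {..<m} (y s) (y u)" and ?E = "l1_norm L (y s) * l1_dist {..<m} (y s) (y u) + l1_dist L (y s) (y u)"
      have d: "?d \<le> c4 * h"
      proof -
        have "c4 * H s u \<le> c4 * h" by (rule mult_left_mono[OF hsu(2) nn(5)])
        then show ?thesis using dist[OF su(1,2) ub] by linarith
      qed
      have d0: "0 \<le> ?d" by (simp add: sum_nonneg)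
      have "\<bar>F i (Vertex \<beta>) (y u) - F i (Vertex \<beta>) (y s) - (\<Sum>j<m. ?dF j * (y u j - y s j))\<bar> \<le> C0 * (?E * ?d)"
        using F2 i V\<beta> B by blast
      also have "\<dots> \<le> C0 * (c7 * (q * h + \<rho> * h^2) * (c4 * h))"
        using Eu d d0 nn(7) q \<rho> h by (intro mult_left_mono mult_mono C0) auto
      also have "\<dots> = C0 * c4 * c7 * (q * h^2 + \<rho> * h^3)" by (simp add: algebra_simps power2_eq_square power3_eq_cube)
      finally have b1: "\<bar>F i (Vertex \<beta>) (y u) - F i (Vertex \<beta>) (y s) - (\<Sum>j<m. ?dF j * (y u j - y s j))\<bar> \<le> C0 * c4 * c7 * (q * h^2 + \<rho> * h^3)" .
      have "\<bar>\<Sum>j<m. ?dF j * (y u j - y s j - A1 j s u)\<bar> \<le> (\<Sum>j<m. \<bar>?dF j * (y u j - y s j - A1 j s u)\<bar>)" by (rule sum_abs)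
      also have "\<dots> \<le> (\<Sum>j<m. C0 * (c2 + k2 + 1) * (q * h^2 + \<rho> * h^3))"
      proof (rule sum_mono)
        fix j assume "j \<in> {..<m}"
        then have j: "j < m" by simp
        have dFj: "\<bar>?dF j\<bar> \<le> C0" "j \<notin> L \<Longrightarrow> \<bar>?dF j\<bar> \<le> C0 * l1_norm L (y s)" using dF i V\<beta> j B(1) by blast+
        have h23: "(H s u)^2 \<le> h^2" "(H s u)^3 \<le> h^3" using hsu by (auto intro: power_mono)
        show "\<bar>?dF j * (y u j - y s j - A1 j s u)\<bar> \<le> C0 * (c2 + k2 + 1) * (q * h^2 + \<rho> * h^3)"
        \<comment> \<open>For normal \<open>j\<close> the increment is small, for tangential
          \<open>j\<close> the derivative is; each case supplies the factor \<open>q\<close> or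
          \<open>\<rho>\<close>.\<close>
        proof (cases "j \<in> L")
          case True
          have "\<bar>y u j - y s j - A1 j s u\<bar> \<le> k2 * q * (H s u)^2 + \<rho> * (H s u)^3" by (rule incL(1)[OF su(1,2) ub True])
          also have "\<dots> \<le> k2 * q * h^2 + \<rho> * h^3" using h23 nn(2) q \<rho> by (intro add_mono mult_left_mono) auto
          also have "\<dots> \<le> (c2 + k2 + 1) * (q * h^2 + \<rho> * h^3)"
          proof -
            have "(c2 + k2 + 1) * (q * h^2 + \<rho> * h^3) - (k2 * q * h^2 + \<rho> * h^3) = (c2 + 1) * (q * h^2) + (c2 + k2) * (\<rho> * h^3)"
              by (simp add: algebra_simps)
            moreover have "0 \<le> (c2 + 1) * (q * h^2) + (c2 + k2) * (\<rho> * h^3)" using nn q \<rho> h by simp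
            ultimately show ?thesis by linarith
          qed
          finally have "\<bar>?dF j\<bar> * \<bar>y u j - y s j - A1 j s u\<bar> \<le> C0 * ((c2 + k2 + 1) * (q * h^2 + \<rho> * h^3))"
            using dFj(1) C0 by (intro mult_mono) auto
          then show ?thesis by (simp add: abs_mult mult.assoc)
        next
          case False
          have "\<bar>?dF j\<bar> \<le> C0 * q"
          proof -
            have "C0 * l1_norm L (y s) \<le> C0 * q" using N su by (intro mult_left_mono C0) auto
            then show ?thesis using dFj(2)[OF False] by linarith
          qed
          moreover have "\<bar>y u j - y s j - A1 j s u\<bar> \<le> c2 * h^2"
          proof -
            have "c2 * (H s u)^2 \<le> c2 * h^2" by (rule mult_left_mono[OF h23(1) nn(3)])
            then show ?thesis using inc(1)[OF su(1,2) ub j] by linarith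
          qed
          ultimately have "\<bar>?dF j\<bar> * \<bar>y u j - y s j - A1 j s u\<bar> \<le> (C0 * q) * (c2 * h^2)"
            using C0 q by (intro mult_mono) auto
          also have "\<dots> = C0 * (c2 * (q * h^2))" by (simp add: mult_ac)
          also have "\<dots> \<le> C0 * ((c2 + k2 + 1) * (q * h^2 + \<rho> * h^3))"
            using nn q \<rho> h by (intro mult_left_mono mult_mono C0) auto
          finally show ?thesis by (simp add: abs_mult mult.assoc)
        qed
      qed
      also have "\<dots> = real m * C0 * (c2 + k2 + 1) * (q * h^2 + \<rho> * h^3)" by simp
      finally show ?thesis using b1 unfolding eq c8_def distrib_right[of "C0 * c4 * c7"] by linarith
    qed
    have t1: "\<bar>\<Sum>\<beta>=1..n. br \<beta> * X (Vertex \<beta>) u t\<bar> \<le> real n * (c8 * (q * h^2 + \<rho> * h^3) * (Cx * h))"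
      by (rule abs_sum_mult_le[OF br Xut(1)]) (use nn q \<rho> h in auto)
    have C7: "0 \<le> C0 * (c7 * (q * h + \<rho> * h^2))" using C0 nn q \<rho> h by simp
    have t2: "\<bar>\<Sum>\<alpha>=1..n. \<Sum>\<beta>=1..n. (F2' u \<alpha> \<beta> - F2' s \<alpha> \<beta>) * (X (Vertex \<alpha>) u t * X (Vertex \<beta>) u t)\<bar>
        \<le> real n * (real n * (C0 * (c7 * (q * h + \<rho> * h^2)) * (Cx * h^2)))"
      unfolding F2'_def by (rule abs_sum2_mult_le[OF Fdiff Xut(2) C7]) simp_all
    have t3: "\<bar>\<Sum>\<alpha>=1..n. \<Sum>\<beta>=1..n. (F3' u \<alpha> \<beta> - F3' s \<alpha> \<beta>) * X (Ladder \<alpha> \<beta>) u t\<bar>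
        \<le> real n * (real n * (C0 * (c7 * (q * h + \<rho> * h^2)) * (Cx * h^2)))"
      unfolding F3'_def by (rule abs_sum2_mult_le[OF Fdiff Xut(3) C7]) simp_all
    \<comment> \<open>The second-order bracket meets a vertex entry of order \<open>h\<close>, and
      first-order differences of the field meet entries of order \<open>h^2\<close>: third order
      throughout.\<close>
    have "\<bar>rough_germ n F X y i s u + rough_germ n F X y i u t - rough_germ n F X y i s t\<bar>
        \<le> real n * (c8 * (q * h^2 + \<rho> * h^3) * (Cx * h)) + 2 * (real n * (real n * (C0 * (c7 * (q * h + \<rho> * h^2)) * (Cx * h^2))))"
      unfolding id using t1 t2 t3 by linarith
    also have "\<dots> = (real n * Cx * c8 + k2 * c7) * (q * h^3 + \<rho> * h^4)"
      by (simp add: k2_def algebra_simps power2_eq_square power3_eq_cube power4_eq_xxxx)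
    also have "\<dots> \<le> D * (q * h^3 + \<rho> * h^4)"
      using nn q \<rho> h by (intro mult_right_mono) (simp_all add: D_eq)
    finally show ?thesis by (simp add: h_def)
  qed
  show "\<forall>i\<in>L. \<forall>s t. a \<le> s \<and> s \<le> t \<and> t \<le> b \<longrightarrow> \<bar>y t i - y s i\<bar> \<le> D * (q * H s t + \<rho> * (H s t)^2)"
    using part1 by blast
  show "\<forall>i\<in>L. \<forall>s u t. a \<le> s \<and> s \<le> u \<and> u \<le> t \<and> t \<le> b \<longrightarrow>
      \<bar>rough_germ n F X y i s u + rough_germ n F X y i u t - rough_germ n F X y i s t\<bar> \<le> D * (q * (H s t)^3 + \<rho> * (H s t)^4)"
    using part2 by blast
qed

text \<open>A filter in the radius and the constant: what holds for all small radii and all large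
  constants is closed under finite conjunctions, so the bounds for all components and forests fit
  into one cube with one constant.\<close>

definition small_large :: "(real \<Rightarrow> real \<Rightarrow> bool) \<Rightarrow> bool" where
  "small_large P \<longleftrightarrow> (\<exists>r>0. \<exists>C\<ge>0. \<forall>r' C'. 0 < r' \<and> r' \<le> r \<and> C \<le> C' \<longrightarrow> P r' C')"

lemma small_largeE:
  assumes "small_large P"
  obtains r C where "0 < r" "0 \<le> C" "P r C"
  using assms unfolding small_large_def by blast

lemma small_large_True: "small_large (\<lambda>_ _. True)"
  unfolding small_large_def by (intro exI[of _ 1]) auto

lemma small_large_conj:
  assumes "small_large P" "small_large Q"
  shows "small_large (\<lambda>r C. P r C \<and> Q r C)"
proof -
  obtain r C where 1: "r > 0" "C \<ge> 0" "\<forall>r' C'. 0 < r' \<and> r' \<le> r \<and> C \<le> C' \<longrightarrow> P r' C'"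
    using assms(1) unfolding small_large_def by blast
  obtain r2 C2 where 2: "r2 > 0" "C2 \<ge> 0" "\<forall>r' C'. 0 < r' \<and> r' \<le> r2 \<and> C2 \<le> C' \<longrightarrow> Q r' C'"
    using assms(2) unfolding small_large_def by blast
  have "\<forall>r' C'. 0 < r' \<and> r' \<le> min r r2 \<and> max C C2 \<le> C' \<longrightarrow> P r' C' \<and> Q r' C'" using 1(3) 2(3) by simp
  moreover have "min r r2 > 0" "max C C2 \<ge> 0" using 1 2 by auto
  ultimately show ?thesis unfolding small_large_def by blast
qed

lemma small_large_ball:
  assumes "finite A" "\<And>k. k \<in> A \<Longrightarrow> small_large (P k)"
  shows "small_large (\<lambda>r C. \<forall>k\<in>A. P k r C)"
  using assms
proof (induction A)
  case empty
  then show ?case using small_large_True by simp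
next
  case (insert a A)
  have "small_large (P a)" "small_large (\<lambda>r C. \<forall>k\<in>A. P k r C)" using insert by simp_all
  then show ?case using small_large_conj[of "P a" "\<lambda>r C. \<forall>k\<in>A. P k r C"] by simp
qed

lemma small_large_bound:
  assumes "\<exists>r>0. \<exists>C\<ge>0. cube m c r \<subseteq> W \<and> (\<forall>u\<in>cube m c r. \<forall>v\<in>cube m c r. e u v \<le> C * N u v)" "\<And>u v. 0 \<le> N u v"
  shows "small_large (\<lambda>r C. \<forall>u\<in>cube m c r. \<forall>v\<in>cube m c r. e u v \<le> C * N u v)"
proof -
  obtain r C where 1: "r > 0" "C \<ge> 0" "\<forall>u\<in>cube m c r. \<forall>v\<in>cube m c r. e u v \<le> C * N u v" using assms(1) by blast
  have "\<forall>u\<in>cube m c r'. \<forall>v\<in>cube m c r'. e u v \<le> C' * N u v" if "r' \<le> r" "C \<le> C'" for r' C'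
  proof (intro ballI)
    fix u v assume "u \<in> cube m c r'" "v \<in> cube m c r'"
    then have "e u v \<le> C * N u v" using 1(3) cube_mono[OF that(1)] by blast
    also have "\<dots> \<le> C' * N u v" by (rule mult_right_mono[OF that(2) assms(2)])
    finally show "e u v \<le> C' * N u v" .
  qed
  then show ?thesis unfolding small_large_def using 1(1,2) by blast
qed

lemma small_large_bound1:
  assumes "\<exists>r>0. \<exists>C\<ge>0. cube m c r \<subseteq> W \<and> (\<forall>u\<in>cube m c r. e u \<le> C * N u)" "\<And>u. 0 \<le> N u"
  shows "small_large (\<lambda>r C. \<forall>u\<in>cube m c r. e u \<le> C * N u)"
proof -
  obtain r C where 1: "r > 0" "C \<ge> 0" "\<forall>u\<in>cube m c r. e u \<le> C * N u" using assms(1) by blast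
  have "\<forall>u\<in>cube m c r'. e u \<le> C' * N u" if "r' \<le> r" "C \<le> C'" for r' C'
  proof
    fix u assume "u \<in> cube m c r'"
    then have "e u \<le> C * N u" using 1(3) cube_mono[OF that(1)] by blast
    also have "\<dots> \<le> C' * N u" by (rule mult_right_mono[OF that(2) assms(2)])
    finally show "e u \<le> C' * N u" .
  qed
  then show ?thesis unfolding small_large_def using 1(1,2) by blast
qed

lemma small_large_continuous:
  assumes "smooth_on m W g" "c \<in> W"
  shows "small_large (\<lambda>r C. \<forall>u\<in>cube m c r. \<bar>g u\<bar> \<le> C)"
proof -
  obtain r C where "r > 0" "cube m c r \<subseteq> W" "\<forall>v\<in>cube m c r. \<bar>g v\<bar> \<le> C"
    by (rule continuous_on_bounded_cube[OF smooth_on_open[OF assms(1)] smooth_on_continuous[OF assms(1)] assms(2)])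
  then have "r > 0 \<and> (max C 0 \<ge> 0 \<and> cube m c r \<subseteq> W \<and> (\<forall>v\<in>cube m c r. \<bar>g v\<bar> \<le> max C 0 * 1))"
    by (auto simp: max.coboundedI1)
  then have "\<exists>r>0. \<exists>C\<ge>0. cube m c r \<subseteq> W \<and> (\<forall>v\<in>cube m c r. \<bar>g v\<bar> \<le> C * 1)" by blast
  from small_large_bound1[OF this] show ?thesis by simp
qed

text \<open>Supplies the bounds on the field that \<open>rough_defect_bound\<close> assumes, each
  obtained separately and merged as a conjunction of \<open>small_large\<close> properties.\<close>

lemma slice_estimates:
  assumes W: "openin (Euclidean_space m) W" and smF: "\<And>i \<tau>. i < m \<Longrightarrow> \<tau> \<in> A \<Longrightarrow> smooth_on m W (F i \<tau>)" and A: "finite A"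
    and L: "L \<subseteq> {..<m}" and van: "\<And>i \<tau>. i \<in> L \<Longrightarrow> \<tau> \<in> A \<Longrightarrow> vanishes_on_slice L W (F i \<tau>)"
    and c: "c \<in> W" and cL: "\<forall>i\<in>L. c i = 0"
  obtains r C where "0 < r" "0 \<le> C" "cube m c r \<subseteq> W" "\<forall>i\<in>{..<m}. \<forall>\<tau>\<in>A. \<forall>u\<in>cube m c r. \<bar>F i \<tau> u\<bar> \<le> C"
    "\<forall>i\<in>L. \<forall>\<tau>\<in>A. \<forall>u\<in>cube m c r. \<bar>F i \<tau> u\<bar> \<le> C * l1_norm L u"
    "\<forall>i\<in>L. \<forall>\<tau>\<in>A. \<forall>u\<in>cube m c r. \<forall>v\<in>cube m c r. \<bar>F i \<tau> v - F i \<tau> u\<bar> \<le> C * (l1_norm L u * l1_dist {..<m} u v + l1_dist L u v)"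
    "\<forall>i\<in>L. \<forall>\<tau>\<in>A. \<forall>u\<in>cube m c r. \<forall>v\<in>cube m c r. \<bar>F i \<tau> v - F i \<tau> u - (\<Sum>j<m. partial_deriv j (F i \<tau>) u * (v j - u j))\<bar>
        \<le> C * ((l1_norm L u * l1_dist {..<m} u v + l1_dist L u v) * l1_dist {..<m} u v)"
    "\<forall>i\<in>L. \<forall>\<tau>\<in>A. \<forall>j\<in>{..<m}. \<forall>u\<in>cube m c r. \<bar>partial_deriv j (F i \<tau>) u\<bar> \<le> C"
    "\<forall>i\<in>L. \<forall>\<tau>\<in>A. \<forall>j\<in>{..<m} - L. \<forall>u\<in>cube m c r. \<bar>partial_deriv j (F i \<tau>) u\<bar> \<le> C * l1_norm L u"
proof -
  have finL: "finite L" using L finite_subset by blast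
  have Lm: "i < m" if "i \<in> L" for i using that L by blast
  have nn: "0 \<le> l1_norm B u" "0 \<le> l1_dist B u v" for B u v by (simp_all add: sum_nonneg)
  obtain r0 where r0: "r0 > 0" "cube m c r0 \<subseteq> W" by (rule openin_imp_cube[OF W c])
  have 0: "small_large (\<lambda>r C. cube m c r \<subseteq> W)"
    unfolding small_large_def
    by (rule exI[of _ r0], rule conjI[OF r0(1)], rule exI[of _ 0]) (use r0(2) cube_mono in blast)
  have 1: "small_large (\<lambda>r C. \<forall>i\<in>{..<m}. \<forall>\<tau>\<in>A. \<forall>u\<in>cube m c r. \<bar>F i \<tau> u\<bar> \<le> C)"
    by (intro small_large_ball A finite_lessThan small_large_continuous[OF smF c]) simp_all
  have 2: "small_large (\<lambda>r C. \<forall>i\<in>L. \<forall>\<tau>\<in>A. \<forall>u\<in>cube m c r. \<bar>F i \<tau> u\<bar> \<le> C * l1_norm L u)"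
    by (intro small_large_ball A finL small_large_bound1[OF slice_bound[OF smF c L cL van]] nn) (simp_all add: Lm)
  have 3: "small_large (\<lambda>r C. \<forall>i\<in>L. \<forall>\<tau>\<in>A. \<forall>u\<in>cube m c r. \<forall>v\<in>cube m c r.
      \<bar>F i \<tau> v - F i \<tau> u\<bar> \<le> C * (l1_norm L u * l1_dist {..<m} u v + l1_dist L u v))"
    by (intro small_large_ball A finL small_large_bound[OF slice_increment[OF smF c L cL van]] add_nonneg_nonneg mult_nonneg_nonneg nn) (simp_all add: Lm)
  have 4: "small_large (\<lambda>r C. \<forall>i\<in>L. \<forall>\<tau>\<in>A. \<forall>u\<in>cube m c r. \<forall>v\<in>cube m c r.
      \<bar>F i \<tau> v - F i \<tau> u - (\<Sum>j<m. partial_deriv j (F i \<tau>) u * (v j - u j))\<bar>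
        \<le> C * ((l1_norm L u * l1_dist {..<m} u v + l1_dist L u v) * l1_dist {..<m} u v))"
    by (intro small_large_ball A finL small_large_bound[OF slice_taylor[OF smF c L cL van]] add_nonneg_nonneg mult_nonneg_nonneg nn) (simp_all add: Lm)
  have 5: "small_large (\<lambda>r C. \<forall>i\<in>L. \<forall>\<tau>\<in>A. \<forall>j\<in>{..<m}. \<forall>u\<in>cube m c r. \<bar>partial_deriv j (F i \<tau>) u\<bar> \<le> C)"
    by (intro small_large_ball A finL finite_lessThan small_large_continuous[OF smooth_on_partial_deriv[OF smF] c]) (simp_all add: Lm)
  have 6: "small_large (\<lambda>r C. \<forall>i\<in>L. \<forall>\<tau>\<in>A. \<forall>j\<in>{..<m} - L. \<forall>u\<in>cube m c r. \<bar>partial_deriv j (F i \<tau>) u\<bar> \<le> C * l1_norm L u)"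
    by (intro small_large_ball A finL finite_Diff finite_lessThan nn
        small_large_bound1[OF slice_bound[OF smooth_on_partial_deriv[OF smF] c L cL vanishes_on_slice_partial_deriv[OF W van]]]) (simp_all add: Lm)
  from small_large_conj[OF 0 small_large_conj[OF 1 small_large_conj[OF 2 small_large_conj[OF 3 small_large_conj[OF 4 small_large_conj[OF 5 6]]]]]]
  show ?thesis by (rule small_largeE) (elim conjE, rule that)
qed

section \<open>Control functions\<close>

lemma control_mono:
  assumes "control_function S T \<omega>" "S \<le> s" "s \<le> s'" "s' \<le> t'" "t' \<le> t" "t \<le> T"
  shows "\<omega> s' t' \<le> \<omega> s t"
proof -
  have add: "\<omega> s u + \<omega> u t \<le> \<omega> s t" if "S \<le> s" "s \<le> u" "u \<le> t" "t \<le> T" for s u t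
    using assms(1) that unfolding control_function_def by blast
  have pos: "0 \<le> \<omega> s t" if "S \<le> s" "s \<le> t" "t \<le> T" for s t
    using assms(1) that unfolding control_function_def by blast
  have "\<omega> s s' + \<omega> s' t \<le> \<omega> s t" "\<omega> s' t' + \<omega> t' t \<le> \<omega> s' t" using assms by (auto intro!: add)
  moreover have "0 \<le> \<omega> s s'" "0 \<le> \<omega> t' t" using assms by (auto intro!: pos)
  ultimately show ?thesis by linarith
qed

lemma control_continuous:
  assumes "control_function S T \<omega>" "S \<le> s" "s \<le> T"
  shows "continuous_on {s..T} (\<omega> s)"
proof -
  have c: "continuous_on {(s, t). S \<le> s \<and> s \<le> t \<and> t \<le> T} (\<lambda>(s, t). \<omega> s t)"
    using assms(1) unfolding control_function_def by blast
  have "continuous_on {s..T} (\<lambda>t. (\<lambda>(s, t). \<omega> s t) (s, t))"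
    by (rule continuous_on_compose2[OF c]) (use assms in \<open>auto intro!: continuous_intros\<close>)
  then show ?thesis by simp
qed

text \<open>The intermediate value theorem places exactly half of the control on the left;
  superadditivity leaves at most half of it for the right.\<close>

lemma control_midpoint:
  assumes \<omega>: "control_function S T \<omega>" and st: "S \<le> s" "s \<le> t" "t \<le> T"
  obtains u where "s \<le> u" "u \<le> t" "\<omega> s u = \<omega> s t / 2" "\<omega> u t \<le> \<omega> s t / 2"
proof -
  have 0: "\<omega> s s = 0" and pos: "0 \<le> \<omega> s t" using \<omega> st unfolding control_function_def by auto
  have "continuous_on {s..t} (\<omega> s)"
    by (rule continuous_on_subset[OF control_continuous[OF \<omega> st(1)]]) (use st in auto)
  then obtain u where u: "s \<le> u" "u \<le> t" "\<omega> s u = \<omega> s t / 2"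
    using IVT'[of "\<omega> s" s "\<omega> s t / 2" t] 0 pos st(2) by auto
  have "\<omega> s u + \<omega> u t \<le> \<omega> s t" using \<omega> st u unfolding control_function_def by blast
  then show ?thesis using u by (intro that[of u]) auto
qed

text \<open>Sewing without partitions: halving the control at a midpoint shows that any admissible pair of
  constants for the normal component and for its remainder can be shrunk by the fixed factor \<open>\<kappa> < 1\<close>,
  so both vanish.\<close>

lemma rough_stays_in_slice:
  fixes F :: "nat \<Rightarrow> forest \<Rightarrow> (nat \<Rightarrow> real) \<Rightarrow> real" and y :: "real \<Rightarrow> nat \<Rightarrow> real"
  assumes W: "openin (Euclidean_space m) W" and smF: "\<And>i \<tau>. i < m \<Longrightarrow> \<tau> \<in> forests n \<Longrightarrow> smooth_on m W (F i \<tau>)"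
    and L: "L \<subseteq> {..<m}" and van: "\<And>i \<tau>. i \<in> L \<Longrightarrow> \<tau> \<in> forests n \<Longrightarrow> vanishes_on_slice L W (F i \<tau>)"
    and adm: "\<forall>u\<in>W. \<forall>i<m. \<forall>\<alpha>\<in>{1..n}. \<forall>\<beta>\<in>{1..n}. (\<Sum>j<m. partial_deriv j (F i (Vertex \<beta>)) u * F j (Vertex \<alpha>) u) =
        F i (Two (Upair \<alpha> \<beta>)) u + F i (Ladder \<alpha> \<beta>) u"
    and ab: "a < b" and p: "1 \<le> p" "p < 3" and \<omega>: "control_function a b \<omega>" and X: "branched_rough_path n a b p \<omega> X"
    and yW: "\<forall>t. a \<le> t \<and> t \<le> b \<longrightarrow> y t \<in> W" and ycont: "\<And>i. i < m \<Longrightarrow> continuous_on {a..b} (\<lambda>t. y t i)" and ya: "\<forall>i\<in>L. y a i = 0"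
    and exp: "\<exists>C>0. \<forall>i<m. \<forall>s t. a \<le> s \<and> s \<le> t \<and> t \<le> b \<longrightarrow>
      \<bar>y t i - y s i - (\<Sum>\<tau>\<in>forests n. 1 / symmetry_factor \<tau> * F i \<tau> (y s) * X \<tau> s t)\<bar> \<le> C * \<omega> s t powr (3 / p)"
  obtains b' where "a < b'" "b' \<le> b" "\<forall>t\<in>{a..b'}. \<forall>i\<in>L. y t i = 0"
proof -
  have finL: "finite L" using L finite_subset by blast
  have cW: "y a \<in> W" using yW ab by simp
  obtain r C0 where r: "0 < r" "0 \<le> C0" "cube m (y a) r \<subseteq> W" "\<forall>i\<in>{..<m}. \<forall>\<tau>\<in>forests n. \<forall>u\<in>cube m (y a) r. \<bar>F i \<tau> u\<bar> \<le> C0"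
    "\<forall>i\<in>L. \<forall>\<tau>\<in>forests n. \<forall>u\<in>cube m (y a) r. \<bar>F i \<tau> u\<bar> \<le> C0 * l1_norm L u"
    "\<forall>i\<in>L. \<forall>\<tau>\<in>forests n. \<forall>u\<in>cube m (y a) r. \<forall>v\<in>cube m (y a) r. \<bar>F i \<tau> v - F i \<tau> u\<bar> \<le> C0 * (l1_norm L u * l1_dist {..<m} u v + l1_dist L u v)"
    "\<forall>i\<in>L. \<forall>\<tau>\<in>forests n. \<forall>u\<in>cube m (y a) r. \<forall>v\<in>cube m (y a) r. \<bar>F i \<tau> v - F i \<tau> u - (\<Sum>j<m. partial_deriv j (F i \<tau>) u * (v j - u j))\<bar>
        \<le> C0 * ((l1_norm L u * l1_dist {..<m} u v + l1_dist L u v) * l1_dist {..<m} u v)"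
    "\<forall>i\<in>L. \<forall>\<tau>\<in>forests n. \<forall>j\<in>{..<m}. \<forall>u\<in>cube m (y a) r. \<bar>partial_deriv j (F i \<tau>) u\<bar> \<le> C0"
    "\<forall>i\<in>L. \<forall>\<tau>\<in>forests n. \<forall>j\<in>{..<m} - L. \<forall>u\<in>cube m (y a) r. \<bar>partial_deriv j (F i \<tau>) u\<bar> \<le> C0 * l1_norm L u"
    by (rule slice_estimates[OF W smF finite_forests L van cW ya])
  define B where "B = cube m (y a) r"
  obtain C1 where C1: "C1 > 0" and exp: "\<forall>i<m. \<forall>s t. a \<le> s \<and> s \<le> t \<and> t \<le> b \<longrightarrow>
      \<bar>y t i - y s i - (\<Sum>\<tau>\<in>forests n. 1 / symmetry_factor \<tau> * F i \<tau> (y s) * X \<tau> s t)\<bar> \<le> C1 * \<omega> s t powr (3 / p)"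
    using exp by blast
  obtain Cx where Cx: "Cx > 0" and Xb: "\<forall>\<alpha>\<in>{1..n}. \<forall>\<beta>\<in>{1..n}. \<forall>s t. a \<le> s \<and> s \<le> t \<and> t \<le> b \<longrightarrow>
        \<bar>X (Vertex \<alpha>) s t\<bar> \<le> Cx * \<omega> s t powr (1 / p) \<and>
        \<bar>X (Two (Upair \<alpha> \<beta>)) s t\<bar> \<le> Cx * \<omega> s t powr (2 / p) \<and>
        \<bar>X (Ladder \<alpha> \<beta>) s t\<bar> \<le> Cx * \<omega> s t powr (2 / p)"
    using X unfolding branched_rough_path_def by blast
  have Xc: "X (Vertex \<alpha>) s t = X (Vertex \<alpha>) s u + X (Vertex \<alpha>) u t"
    "X (Two (Upair \<alpha> \<beta>)) s t = X (Vertex \<alpha>) s t * X (Vertex \<beta>) s t"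
    "X (Ladder \<alpha> \<beta>) s t = X (Ladder \<alpha> \<beta>) s u + X (Ladder \<alpha> \<beta>) u t + X (Vertex \<alpha>) s u * X (Vertex \<beta>) u t"
    if "\<alpha> \<in> {1..n}" "\<beta> \<in> {1..n}" "a \<le> s" "s \<le> u" "u \<le> t" "t \<le> b" for \<alpha> \<beta> s u t
    using X that unfolding branched_rough_path_def by blast+
  have \<omega>0: "\<omega> s s = 0" if "a \<le> s" "s \<le> b" for s using \<omega> that unfolding control_function_def by simp
  have \<omega>pos: "0 \<le> \<omega> s t" if "a \<le> s" "s \<le> t" "t \<le> b" for s t using \<omega> that unfolding control_function_def by blast
  \<comment> \<open>The exponents \<open>1/p\<close>, \<open>2/p\<close>, \<open>3/p\<close> become
    the integer powers 1, 2, 3 of \<open>H\<close>.\<close>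
  define H where "H s t = \<omega> s t powr (1 / p)" for s t
  have H2: "\<omega> s t powr (2 / p) = (H s t)^2" and H3: "\<omega> s t powr (3 / p) = (H s t)^3" for s t
    by (simp_all add: H_def power2_eq_square power3_eq_cube powr_add[symmetric])
  have Hpos: "0 \<le> H s t" for s t by (simp add: H_def)
  have Hmono: "H s' t' \<le> H s t" if "a \<le> s" "s \<le> s'" "s' \<le> t'" "t' \<le> t" "t \<le> b" for s s' t' t
    unfolding H_def using that p by (intro powr_mono2 control_mono[OF \<omega>] \<omega>pos) auto
  have germ_eq: "(\<Sum>\<tau>\<in>forests n. 1 / symmetry_factor \<tau> * F i \<tau> (y s) * X \<tau> s t) = rough_germ n F X y i s t"
    if "a \<le> s" "s \<le> t" "t \<le> b" for i s t
  proof -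
    have "(\<Sum>\<tau>\<in>forests n. 1 / symmetry_factor \<tau> * F i \<tau> (y s) * X \<tau> s t) = (\<Sum>\<tau>\<in>forests n. 1 / symmetry_factor \<tau> * (F i \<tau> (y s) * X \<tau> s t))"
      by (simp add: mult.assoc)
    also have "\<dots> = rough_germ n F X y i s t"
      unfolding sum_forests rough_germ_def germ_def
      by (intro arg_cong2[where f = "(+)"] arg_cong2[where f = "(*)"] refl sum.cong) (simp add: Xc(2)[OF _ _ that(1) order_refl that(2,3)])
    finally show ?thesis .
  qed
  define D where "D = defect_const m n C0 Cx C1"
  have D0: "0 \<le> D" using r(2) Cx C1 by (simp add: D_def defect_const_def Let_def)
  \<comment> \<open>Halving the control multiplies \<open>H^3\<close> by
    \<open>2 powr (- 3 / p)\<close>. Two halves together give \<open>lam\<close>, which is below 1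
    because \<open>p < 3\<close>.\<close>
  define lam where "lam = 2 powr (1 - 3 / p)"
  have lam: "0 < lam" "lam < 1" using p by (simp_all add: lam_def powr_less_one)
  \<comment> \<open>Half of the gap \<open>1 - lam\<close> is reserved for the defect of additivity,
    the other half is the gain: \<open>\<kappa> = \<eta> + lam\<close> is the factor of each
    stage.\<close>
  define \<eta> where "\<eta> = (1 - lam) / 2"
  define \<kappa> where "\<kappa> = (1 + lam) / 2"
  have \<eta>: "0 < \<eta>" and \<kappa>: "0 < \<kappa>" "\<kappa> < 1" "1/2 \<le> \<kappa>" "\<eta> + lam = \<kappa>" using lam by (simp_all add: \<eta>_def \<kappa>_def field_simps)
  \<comment> \<open>The remainder constant is kept at \<open>\<Lambda> * q\<close>, with
    \<open>\<Lambda>\<close> so large that the leading part \<open>D * q\<close> of the defect uses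
    at most half of the allowance \<open>\<eta>\<close>.\<close>
  define \<Lambda> where "\<Lambda> = max 1 (2 * D / \<eta>)"
  have \<Lambda>: "1 \<le> \<Lambda>" "D \<le> \<eta> * \<Lambda> / 2"
  proof -
    have "2 * D / \<eta> \<le> \<Lambda>" by (simp add: \<Lambda>_def)
    then show "D \<le> \<eta> * \<Lambda> / 2" using \<eta> by (simp add: field_simps)
  qed (simp add: \<Lambda>_def)
  \<comment> \<open>Bound for \<open>H\<close> on the short interval. The first quotient lets the
    higher-order part of the defect use the other half of \<open>\<eta>\<close>, the second one
    halves the normal size.\<close>
  define \<epsilon> where "\<epsilon> = min 1 (min (\<eta> / (2 * (D + 1))) (1 / (2 * ((real m + 1) * (D + 1) * (1 + \<Lambda>)))))"
  have \<epsilon>: "0 < \<epsilon>" "\<epsilon> \<le> 1" "D * \<epsilon> \<le> \<eta> / 2" "real m * D * (1 + \<Lambda>) * \<epsilon> \<le> 1/2"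
  proof -
    show "0 < \<epsilon>" using \<eta> D0 \<Lambda> by (simp add: \<epsilon>_def)
    show "\<epsilon> \<le> 1" by (simp add: \<epsilon>_def)
    have "\<epsilon> \<le> \<eta> / (2 * (D + 1))" by (simp add: \<epsilon>_def)
    then have "(D + 1) * \<epsilon> \<le> \<eta> / 2" using D0 by (simp add: field_simps)
    then show "D * \<epsilon> \<le> \<eta> / 2" using \<open>0 < \<epsilon>\<close> by (simp add: distrib_right)
    have pos: "0 < 2 * ((real m + 1) * (D + 1) * (1 + \<Lambda>))" using D0 \<Lambda> by simp
    have "\<epsilon> \<le> 1 / (2 * ((real m + 1) * (D + 1) * (1 + \<Lambda>)))" by (simp add: \<epsilon>_def)
    then have "\<epsilon> * (2 * ((real m + 1) * (D + 1) * (1 + \<Lambda>))) \<le> 1" using pos by (simp only: pos_le_divide_eq)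
    then have "2 * ((real m + 1) * (D + 1) * (1 + \<Lambda>) * \<epsilon>) \<le> 1" by (simp only: mult_ac)
    moreover have "real m * D * (1 + \<Lambda>) * \<epsilon> \<le> (real m + 1) * (D + 1) * (1 + \<Lambda>) * \<epsilon>"
      using D0 \<Lambda> \<open>0 < \<epsilon>\<close> by (intro mult_right_mono mult_mono) auto
    ultimately show "real m * D * (1 + \<Lambda>) * \<epsilon> \<le> 1/2" by linarith
  qed
  have "\<forall>\<^sub>F t in at a within {a..b}. \<forall>i<m. \<bar>y t i - y a i\<bar> < r"
  proof (rule eventually_coords_near[OF _ r(1)])
    fix i assume "i < m"
    then show "((\<lambda>t. y t i) \<longlongrightarrow> y a i) (at a within {a..b})"
      using ycont ab unfolding continuous_on_def by simp
  qed
  moreover have "((\<lambda>t. H a t) \<longlongrightarrow> H a a) (at a within {a..b})"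
  proof -
    have "((\<lambda>t. \<omega> a t) \<longlongrightarrow> \<omega> a a) (at a within {a..b})"
      using control_continuous[OF \<omega>, of a] ab unfolding continuous_on_def by simp
    then show ?thesis unfolding H_def
      by (rule tendsto_powr2[OF _ tendsto_const]) (use \<omega>pos p in \<open>auto simp: eventually_at_filter\<close>)
  qed
  then have "\<forall>\<^sub>F t in at a within {a..b}. dist (H a t) (H a a) < \<epsilon>" by (rule tendstoD[OF _ \<epsilon>(1)])
  ultimately have "\<forall>\<^sub>F t in at a within {a..b}. (\<forall>i<m. \<bar>y t i - y a i\<bar> < r) \<and> dist (H a t) (H a a) < \<epsilon>"
    by (rule eventually_conj)
  then obtain d where d: "d > 0" "\<forall>t\<in>{a..b}. t \<noteq> a \<and> dist t a < d \<longrightarrow> (\<forall>i<m. \<bar>y t i - y a i\<bar> < r) \<and> dist (H a t) (H a a) < \<epsilon>"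
    unfolding eventually_at by blast
  define b' where "b' = min b (a + d / 2)"
  have b': "a < b'" "b' \<le> b" using ab d(1) by (auto simp: b'_def)
  have near: "(\<forall>i<m. \<bar>y t i - y a i\<bar> < r) \<and> H a t < \<epsilon>" if t: "a \<le> t" "t \<le> b'" for t
  \<comment> \<open>The filter omits \<open>a\<close> itself, where both quantities are
    zero.\<close>
  proof (cases "t = a")
    case True
    then show ?thesis using r(1) \<epsilon>(1) \<omega>0 ab by (simp add: H_def)
  next
    case False
    have "t \<in> {a..b}" "dist t a < d" using t d(1) b' by (auto simp: b'_def dist_real_def)
    then show ?thesis using d(2) False \<omega>0[of a] ab Hpos by (auto simp: dist_real_def H_def)
  qed
  have yB: "\<forall>t. a \<le> t \<and> t \<le> b' \<longrightarrow> y t \<in> B"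
  proof (intro allI impI)
    fix t assume t: "a \<le> t \<and> t \<le> b'"
    then have "y t \<in> coord_space m" using yW b' openin_subset[OF W] by auto
    then show "y t \<in> B" using near t by (simp add: B_def cube_def)
  qed
  have H\<epsilon>: "H s t \<le> \<epsilon>" if "a \<le> s" "s \<le> t" "t \<le> b'" for s t
    using Hmono[of a s t t] near[of t] that b' by simp
  define R where "R i s t = y t i - y s i - rough_germ n F X y i s t" for i s t
  have R1: "\<bar>R i s t\<bar> \<le> C1 * (H s t)^3" if "i < m" "a \<le> s" "s \<le> t" "t \<le> b'" for i s t
    using exp[rule_format, of i s t] germ_eq[of s t i] that b' H3 by (simp add: R_def)
  \<comment> \<open>One number controls both quantities, so a single recursion improves them
    together.\<close>
  define valid where "valid q \<longleftrightarrow> (\<forall>s. a \<le> s \<and> s \<le> b' \<longrightarrow> l1_norm L (y s) \<le> q) \<and>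
     (\<forall>i\<in>L. \<forall>s t. a \<le> s \<and> s \<le> t \<and> t \<le> b' \<longrightarrow> \<bar>R i s t\<bar> \<le> \<Lambda> * q * (H s t)^3)" for q
  have step: "valid (\<kappa> * q)" if v: "valid q" and q: "0 \<le> q" for q
  proof -
    have \<Lambda>q: "0 \<le> \<Lambda> * q" using \<Lambda> q by simp
    have N: "\<forall>s. a \<le> s \<and> s \<le> b' \<longrightarrow> l1_norm L (y s) \<le> q" and
      RL: "\<forall>i\<in>L. \<forall>s t. a \<le> s \<and> s \<le> t \<and> t \<le> b' \<longrightarrow> \<bar>y t i - y s i - rough_germ n F X y i s t\<bar> \<le> \<Lambda> * q * (H s t)^3"
      using v unfolding valid_def R_def by blast+
    have aF: "\<forall>i<m. \<forall>\<tau>\<in>forests n. \<forall>u\<in>B. \<bar>F i \<tau> u\<bar> \<le> C0" using r(4) by (simp add: B_def)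
    have adF: "\<forall>i\<in>L. \<forall>\<tau>\<in>forests n. \<forall>j<m. \<forall>u\<in>B. \<bar>partial_deriv j (F i \<tau>) u\<bar> \<le> C0 \<and> (j \<notin> L \<longrightarrow> \<bar>partial_deriv j (F i \<tau>) u\<bar> \<le> C0 * l1_norm L u)"
      using r(8,9) by (simp add: B_def)
    have aadm: "\<forall>u\<in>B. \<forall>i<m. \<forall>\<alpha>\<in>{1..n}. \<forall>\<beta>\<in>{1..n}. (\<Sum>j<m. partial_deriv j (F i (Vertex \<beta>)) u * F j (Vertex \<alpha>) u) =
        F i (Two (Upair \<alpha> \<beta>)) u + F i (Ladder \<alpha> \<beta>) u"
      using adm r(3) unfolding B_def by blast
    have aH: "\<forall>s t. a \<le> s \<and> s \<le> t \<and> t \<le> b' \<longrightarrow> 0 \<le> H s t \<and> H s t \<le> 1" using H\<epsilon> \<epsilon>(2) Hpos by (meson order_trans)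
    have aHm: "\<forall>s u t. a \<le> s \<and> s \<le> u \<and> u \<le> t \<and> t \<le> b' \<longrightarrow> H s u \<le> H s t \<and> H u t \<le> H s t" using Hmono b' by simp
    have aX: "\<forall>\<alpha>\<in>{1..n}. \<forall>\<beta>\<in>{1..n}. \<forall>s t. a \<le> s \<and> s \<le> t \<and> t \<le> b' \<longrightarrow>
        \<bar>X (Vertex \<alpha>) s t\<bar> \<le> Cx * H s t \<and> \<bar>X (Vertex \<alpha>) s t * X (Vertex \<beta>) s t\<bar> \<le> Cx * (H s t)^2 \<and> \<bar>X (Ladder \<alpha> \<beta>) s t\<bar> \<le> Cx * (H s t)^2"
    proof (intro ballI allI impI)
      fix \<alpha> \<beta> s t assume 1: "\<alpha> \<in> {1..n}" "\<beta> \<in> {1..n}" and st: "a \<le> s \<and> s \<le> t \<and> t \<le> b'"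
      then have st': "a \<le> s" "s \<le> t" "t \<le> b" using b' by auto
      show "\<bar>X (Vertex \<alpha>) s t\<bar> \<le> Cx * H s t \<and> \<bar>X (Vertex \<alpha>) s t * X (Vertex \<beta>) s t\<bar> \<le> Cx * (H s t)^2 \<and> \<bar>X (Ladder \<alpha> \<beta>) s t\<bar> \<le> Cx * (H s t)^2"
        using bspec[OF bspec[OF Xb 1(1)] 1(2), rule_format, of s t] st' Xc(2)[OF 1 st'(1) order_refl st'(2,3)] H2
        by (simp add: H_def[symmetric])
    qed
    have achen: "\<forall>\<alpha>\<in>{1..n}. \<forall>\<beta>\<in>{1..n}. \<forall>s u t. a \<le> s \<and> s \<le> u \<and> u \<le> t \<and> t \<le> b' \<longrightarrow>
        X (Vertex \<alpha>) s t = X (Vertex \<alpha>) s u + X (Vertex \<alpha>) u t \<and>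
        X (Ladder \<alpha> \<beta>) s t = X (Ladder \<alpha> \<beta>) s u + X (Ladder \<alpha> \<beta>) u t + X (Vertex \<alpha>) s u * X (Vertex \<beta>) u t"
      using Xc(1,3) b'(2) by (meson order_trans)
    have aR: "\<forall>i<m. \<forall>s t. a \<le> s \<and> s \<le> t \<and> t \<le> b' \<longrightarrow> \<bar>y t i - y s i - rough_germ n F X y i s t\<bar> \<le> C1 * (H s t)^3"
      using R1 unfolding R_def by blast
    note bounds = rough_defect_bound[OF L r(2) less_imp_le[OF Cx] less_imp_le[OF C1] aF r(5,6,7)[folded B_def] adF aadm yB aH aHm aX achen aR q \<Lambda>q N RL,
        folded D_def]
    show ?thesis
      unfolding valid_def
    proof (intro conjI allI impI ballI)
      fix s assume s: "a \<le> s \<and> s \<le> b'"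
      have h: "0 \<le> H a s" "H a s \<le> \<epsilon>" using Hpos H\<epsilon>[of a s] s by auto
      have "\<bar>y s i\<bar> \<le> D * (q * (1 + \<Lambda>) * \<epsilon>)" if i: "i \<in> L" for i
      proof -
        \<comment> \<open>The normal coordinates vanish at \<open>a\<close>, so each of them is its
          own increment from \<open>a\<close>.\<close>
        have "\<bar>y s i\<bar> \<le> D * (q * H a s + \<Lambda> * q * (H a s)^2)" using bounds(1) i s ya by force
        also have "\<dots> \<le> D * (q * (1 + \<Lambda>) * \<epsilon>)"
        proof (rule mult_left_mono[OF _ D0])
          have "(H a s)^2 \<le> H a s" using power_decreasing[of 1 2 "H a s"] h \<epsilon>(2) by simp
          then have "(H a s)^2 \<le> \<epsilon>" using h by linarith
          then have "q * H a s + \<Lambda> * q * (H a s)^2 \<le> q * \<epsilon> + \<Lambda> * q * \<epsilon>"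
            using h q \<Lambda>q by (intro add_mono mult_left_mono) auto
          then show "q * H a s + \<Lambda> * q * (H a s)^2 \<le> q * (1 + \<Lambda>) * \<epsilon>" by (simp add: algebra_simps)
        qed
        finally show ?thesis .
      qed
      then have "l1_norm L (y s) \<le> real (card L) * (D * (q * (1 + \<Lambda>) * \<epsilon>))" by (rule sum_bounded_above)
      also have "\<dots> \<le> real m * (D * (q * (1 + \<Lambda>) * \<epsilon>))"
      proof (rule mult_right_mono)
        show "real (card L) \<le> real m" using card_mono[OF finite_lessThan L] by simp
        show "0 \<le> D * (q * (1 + \<Lambda>) * \<epsilon>)" using D0 q \<Lambda> \<epsilon>(1) by simp
      qed
      also have "\<dots> = q * (real m * D * (1 + \<Lambda>) * \<epsilon>)" by (simp add: mult_ac)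
      also have "\<dots> \<le> q * \<kappa>" using \<epsilon>(4) \<kappa>(3) q by (intro mult_left_mono) auto
      finally show "l1_norm L (y s) \<le> \<kappa> * q" by (simp add: mult.commute)
    next
      fix i s t assume i: "i \<in> L" and st: "a \<le> s \<and> s \<le> t \<and> t \<le> b'"
      define h where "h = H s t"
      have h: "0 \<le> h" "h \<le> \<epsilon>" using Hpos H\<epsilon> st by (simp_all add: h_def)
      have st': "a \<le> s" "s \<le> t" "t \<le> b" using st b' by auto
      obtain u where u: "s \<le> u" "u \<le> t" "\<omega> s u = \<omega> s t / 2" "\<omega> u t \<le> \<omega> s t / 2"
        by (rule control_midpoint[OF \<omega> st'])
      have au: "a \<le> u" "u \<le> b" "u \<le> b'" using u st b' by auto
      \<comment> \<open>The factor is \<open>2 powr (- 3 / p)\<close>, written as half of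
        \<open>lam\<close>.\<close>
      have half: "w powr (3 / p) \<le> (1/2 * lam) * h^3" if "0 \<le> w" "w \<le> \<omega> s t / 2" for w
      proof -
        have "w powr (3 / p) \<le> (\<omega> s t / 2) powr (3 / p)" using that p by (intro powr_mono2) auto
        also have "\<dots> = \<omega> s t powr (3 / p) / 2 powr (3 / p)" using \<omega>pos[OF st'] by (simp add: powr_divide)
        also have "\<dots> = (1/2 * lam) * h^3" unfolding H3 h_def lam_def by (simp add: powr_diff field_simps)
        finally show ?thesis .
      qed
      have Hsu: "(H s u)^3 \<le> (1/2 * lam) * h^3" unfolding H3[symmetric] by (rule half) (use \<omega>pos[of s u] u st' au in simp_all)
      have Hut: "(H u t)^3 \<le> (1/2 * lam) * h^3" unfolding H3[symmetric] by (rule half) (use \<omega>pos[of u t] u st' au in simp_all)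
      \<comment> \<open>The remainder over the interval is the defect of additivity plus the
        remainders over the two halves; the increments of \<open>y\<close> cancel.\<close>
      have "R i s t = (rough_germ n F X y i s u + rough_germ n F X y i u t - rough_germ n F X y i s t) + R i s u + R i u t"
        by (simp add: R_def)
      moreover have "\<bar>rough_germ n F X y i s u + rough_germ n F X y i u t - rough_germ n F X y i s t\<bar> \<le> D * (q * h^3 + \<Lambda> * q * h^4)"
        using bounds(2) i u st unfolding h_def by blast
      moreover have "\<bar>R i s u\<bar> \<le> \<Lambda> * q * ((1/2 * lam) * h^3)"
      proof -
        have "\<bar>R i s u\<bar> \<le> \<Lambda> * q * (H s u)^3" using RL i u st au unfolding R_def by blast
        also have "\<dots> \<le> \<Lambda> * q * ((1/2 * lam) * h^3)" by (rule mult_left_mono[OF Hsu \<Lambda>q])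
        finally show ?thesis .
      qed
      moreover have "\<bar>R i u t\<bar> \<le> \<Lambda> * q * ((1/2 * lam) * h^3)"
      proof -
        have "\<bar>R i u t\<bar> \<le> \<Lambda> * q * (H u t)^3" using RL i u st au unfolding R_def by blast
        also have "\<dots> \<le> \<Lambda> * q * ((1/2 * lam) * h^3)" by (rule mult_left_mono[OF Hut \<Lambda>q])
        finally show ?thesis .
      qed
      ultimately have "\<bar>R i s t\<bar> \<le> D * (q * h^3 + \<Lambda> * q * h^4) + \<Lambda> * q * ((1/2 * lam) * h^3) + \<Lambda> * q * ((1/2 * lam) * h^3)" by linarith
      also have "\<dots> = (D + D * h * \<Lambda> + \<Lambda> * lam) * (q * h^3)" by (simp add: algebra_simps power3_eq_cube power4_eq_xxxx)
      also have "\<dots> \<le> (\<Lambda> * \<kappa>) * (q * h^3)"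
      proof (rule mult_right_mono)
        \<comment> \<open>Each of the two terms of the defect costs at most half of
          \<open>\<eta>\<close>, and \<open>\<eta> + lam = \<kappa>\<close>.\<close>
        have "D * h \<le> D * \<epsilon>" by (rule mult_left_mono[OF h(2) D0])
        then have "D * h * \<Lambda> \<le> \<eta> / 2 * \<Lambda>" using \<epsilon>(3) \<Lambda>(1) by (intro mult_right_mono) auto
        then have "D + D * h * \<Lambda> + \<Lambda> * lam \<le> \<eta> * \<Lambda> / 2 + \<eta> / 2 * \<Lambda> + \<Lambda> * lam" using \<Lambda>(2) by linarith
        also have "\<dots> = \<Lambda> * \<kappa>" unfolding \<kappa>(4)[symmetric] by (simp add: algebra_simps)
        finally show "D + D * h * \<Lambda> + \<Lambda> * lam \<le> \<Lambda> * \<kappa>" .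
        show "0 \<le> q * h^3" using q h by simp
      qed
      finally show "\<bar>R i s t\<bar> \<le> \<Lambda> * (\<kappa> * q) * (H s t)^3" by (simp add: h_def mult_ac)
    qed
  qed
  \<comment> \<open>A starting value: in the cube around \<open>y a\<close> the normal coordinates
    are at most \<open>r\<close>, and \<open>C1\<close> bounds the remainders of all
    components.\<close>
  define q0 where "q0 = max (real m * r) C1"
  have q0: "0 \<le> q0" using C1 by (simp add: q0_def max.coboundedI2)
  have "valid q0"
    unfolding valid_def
  proof (intro conjI allI impI ballI)
    fix s assume s: "a \<le> s \<and> s \<le> b'"
    have "\<bar>y s i\<bar> \<le> r" if "i \<in> L" for i
      using near[of s] s ya that L by force
    then have "l1_norm L (y s) \<le> real (card L) * r" by (rule sum_bounded_above)
    also have "\<dots> \<le> real m * r" using card_mono[OF finite_lessThan L] r(1) by simp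
    finally show "l1_norm L (y s) \<le> q0" by (simp add: q0_def)
  next
    fix i s t assume i: "i \<in> L" and st: "a \<le> s \<and> s \<le> t \<and> t \<le> b'"
    have "i < m" using i L by blast
    then have "\<bar>R i s t\<bar> \<le> C1 * (H s t)^3" using R1 st by blast
    also have "\<dots> \<le> \<Lambda> * q0 * (H s t)^3"
    proof (rule mult_right_mono)
      have "1 * C1 \<le> \<Lambda> * q0" using \<Lambda>(1) C1 by (intro mult_mono) (auto simp: q0_def)
      then show "C1 \<le> \<Lambda> * q0" by simp
    qed (simp add: Hpos)
    finally show "\<bar>R i s t\<bar> \<le> \<Lambda> * q0 * (H s t)^3" .
  qed
  then have valid: "valid (\<kappa>^k * q0)" for k
  proof (induction k)
    case (Suc k)
    then show ?case using step[of "\<kappa>^k * q0"] q0 \<kappa>(1) by (simp add: mult.assoc)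
  qed simp
  have "(\<lambda>k. \<kappa>^k * q0) \<longlonglongrightarrow> 0"
    using \<kappa> by (intro tendsto_mult_left_zero LIMSEQ_power_zero) simp
  then have zero: "l1_norm L (y t) \<le> 0" if "a \<le> t" "t \<le> b'" for t
    by (rule LIMSEQ_le_const) (use valid that in \<open>auto simp: valid_def\<close>)
  have "y t i = 0" if "t \<in> {a..b'}" "i \<in> L" for t i
    using zero[of t] abs_le_sum[OF finL that(2), of "y t"] that by auto
  then show ?thesis using b' that by blast
qed

section \<open>Local solutions of ordinary differential equations\<close>

text \<open>Picard iteration, coordinate by coordinate. On a short interval the integral operator
  maps a closed box into itself and contracts by the factor \<open>1/2\<close>, so the iterates
  converge uniformly.\<close>

lemma ode_local_solution:
  assumes W: "openin (Euclidean_space m) W" and g: "\<And>i. i < m \<Longrightarrow> smooth_on m W (g i)" and c: "c \<in> W"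
  obtains \<delta> y where "0 < \<delta>" "\<delta> \<le> 1" "y 0 = c" "\<forall>t\<in>{0..\<delta>}. y t \<in> W"
    "\<forall>i<m. \<forall>t\<in>{0..\<delta>}. ((\<lambda>t. y t i) has_real_derivative g i (y t)) (at t within {0..\<delta>})"
proof -
  have cE: "c \<in> coord_space m" using c openin_subset[OF W] by blast
  obtain r0 where r0: "r0 > 0" "cube m c r0 \<subseteq> W" by (rule openin_imp_cube[OF W c])
  have 0: "small_large (\<lambda>r C. cube m c r \<subseteq> W)"
    unfolding small_large_def
    by (rule exI[of _ r0], rule conjI[OF r0(1)], rule exI[of _ 0]) (use r0(2) cube_mono in blast)
  have 1: "small_large (\<lambda>r C. \<forall>i\<in>{..<m}. \<forall>u\<in>cube m c r. \<bar>g i u\<bar> \<le> C)"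
    by (intro small_large_ball finite_lessThan small_large_continuous[OF g c]) simp
  have 2: "small_large (\<lambda>r C. \<forall>i\<in>{..<m}. \<forall>u\<in>cube m c r. \<forall>v\<in>cube m c r. \<bar>g i v - g i u\<bar> \<le> C * l1_dist {..<m} u v)"
    by (intro small_large_ball finite_lessThan small_large_bound[OF lipschitz_locally[OF g c]]) (simp_all add: sum_nonneg)
  obtain r C where r: "0 < r" and C: "0 \<le> C" and rC: "cube m c r \<subseteq> W \<and> (\<forall>i\<in>{..<m}. \<forall>u\<in>cube m c r. \<bar>g i u\<bar> \<le> C) \<and>
     (\<forall>i\<in>{..<m}. \<forall>u\<in>cube m c r. \<forall>v\<in>cube m c r. \<bar>g i v - g i u\<bar> \<le> C * l1_dist {..<m} u v)"
    by (rule small_largeE[OF small_large_conj[OF 0 small_large_conj[OF 1 2]]])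
  \<comment> \<open>The quotient with \<open>r\<close> keeps the iterates in the cube, the last one
    makes the contraction factor at most \<open>1/2\<close>, and length at most 1 is what the
    regularity of the drivers will ask for.\<close>
  define \<delta> where "\<delta> = min 1 (min (r / (2 * (C + 1))) (1 / (2 * ((C + 1) * (real m + 1)))))"
  have \<delta>: "0 < \<delta>" "\<delta> \<le> 1" "C * \<delta> < r" "C * real m * \<delta> \<le> 1/2"
  proof -
    show pos: "0 < \<delta>" using r C by (simp add: \<delta>_def)
    show "\<delta> \<le> 1" by (simp add: \<delta>_def)
    have "\<delta> \<le> r / (2 * (C + 1))" by (simp add: \<delta>_def)
    then have "\<delta> * (2 * (C + 1)) \<le> r" using C by (simp add: pos_le_divide_eq)
    moreover have "C * \<delta> < \<delta> * (2 * (C + 1))" using pos mult_nonneg_nonneg[OF C less_imp_le[OF pos]] by (simp add: algebra_simps add_nonneg_pos)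
    ultimately show "C * \<delta> < r" by linarith
    have p2: "0 < 2 * ((C + 1) * (real m + 1))" using C by simp
    have "\<delta> \<le> 1 / (2 * ((C + 1) * (real m + 1)))" by (simp add: \<delta>_def)
    then have "\<delta> * (2 * ((C + 1) * (real m + 1))) \<le> 1" using p2 by (simp only: pos_le_divide_eq)
    then have "2 * ((C + 1) * (real m + 1) * \<delta>) \<le> 1" by (simp only: mult_ac)
    moreover have "C * real m * \<delta> \<le> (C + 1) * (real m + 1) * \<delta>" using pos C by (intro mult_right_mono mult_mono) auto
    ultimately show "C * real m * \<delta> \<le> 1/2" by linarith
  qed
  \<comment> \<open>A closed box, so that the limit of the iterates stays in it.\<close>
  define B where "B = {v \<in> coord_space m. \<forall>i<m. \<bar>v i - c i\<bar> \<le> C * \<delta>}"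
  have Bcube: "B \<subseteq> cube m c r" using \<delta>(3) by (force simp: B_def cube_def)
  have BW: "B \<subseteq> W" using Bcube rC by blast
  have gC: "\<bar>g i u\<bar> \<le> C" if "i < m" "u \<in> B" for i u
    using rC that Bcube by (simp add: subset_iff)
  have gL: "\<bar>g i v - g i u\<bar> \<le> C * l1_dist {..<m} u v" if "i < m" "u \<in> B" "v \<in> B" for i u v
    using rC that Bcube by (simp add: subset_iff)
  define I where "I = {0..\<delta>}"
  define Y :: "nat \<Rightarrow> real \<Rightarrow> nat \<Rightarrow> real" where "Y = rec_nat (\<lambda>_. c) (\<lambda>_ Z t i. if i < m then c i + integral {0..t} (\<lambda>s. g i (Z s)) else 0)"
  have Y0: "Y 0 = (\<lambda>_. c)" and YS: "Y (Suc k) = (\<lambda>t i. if i < m then c i + integral {0..t} (\<lambda>s. g i (Y k s)) else 0)" for k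
    unfolding Y_def by simp_all
  define good where "good Z \<longleftrightarrow> (\<forall>t\<in>I. Z t \<in> B) \<and> (\<forall>i. continuous_on I (\<lambda>t. Z t i))" for Z :: "real \<Rightarrow> nat \<Rightarrow> real"
  have gcont: "continuous_on I (\<lambda>s. g i (Z s))" if "good Z" "i < m" for Z i
  proof (rule continuous_on_compose2[OF smooth_on_continuous[OF g[OF that(2)]]])
    show "continuous_on I Z" by (rule continuous_on_coordinatewise_then_product) (use that(1) in \<open>simp add: good_def\<close>)
    show "Z ` I \<subseteq> W" using that(1) BW by (auto simp: good_def)
  qed
  have sub: "{0..t} \<subseteq> I" if "t \<in> I" for t using that by (auto simp: I_def)
  have int_deriv: "((\<lambda>t. integral {0..t} (\<lambda>s. g i (Z s))) has_real_derivative g i (Z t)) (at t within I)"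
    if "good Z" "i < m" "t \<in> I" for Z i t
    unfolding I_def by (rule integral_has_real_derivative) (use gcont[OF that(1,2)] that(3) in \<open>simp_all add: I_def\<close>)
  have next_good: "good (\<lambda>t i. if i < m then c i + integral {0..t} (\<lambda>s. g i (Z s)) else 0)" if Z: "good Z" for Z
    unfolding good_def
  proof (intro conjI ballI allI)
    fix t assume t: "t \<in> I"
    have "\<bar>integral {0..t} (\<lambda>s. g i (Z s))\<bar> \<le> C * \<delta>" if i: "i < m" for i
    proof -
      have "norm (integral {0..t} (\<lambda>s. g i (Z s))) \<le> C * (t - 0)"
      proof (rule integral_bound)
        show "continuous_on {0..t} (\<lambda>s. g i (Z s))" by (rule continuous_on_subset[OF gcont[OF Z i] sub[OF t]])
        show "norm (g i (Z s)) \<le> C" if "s \<in> {0..t}" for s using gC[OF i] Z sub[OF t] that by (auto simp: good_def)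
      qed (use t in \<open>simp add: I_def\<close>)
      also have "\<dots> \<le> C * \<delta>" using t C by (intro mult_left_mono) (auto simp: I_def)
      finally show ?thesis by simp
    qed
    then show "(\<lambda>i. if i < m then c i + integral {0..t} (\<lambda>s. g i (Z s)) else 0) \<in> B"
      by (simp add: B_def mem_coord_space)
  next
    fix i
    show "continuous_on I (\<lambda>t. if i < m then c i + integral {0..t} (\<lambda>s. g i (Z s)) else 0)"
    proof (cases "i < m")
      case True
      have "continuous_on I (\<lambda>t. integral {0..t} (\<lambda>s. g i (Z s)))"
        by (rule DERIV_continuous_on) (rule int_deriv[OF Z True])
      then show ?thesis using True by (simp add: continuous_on_add)
    qed simp
  qed
  have good: "good (Y k)" for k
  proof (induction k)
    case 0
    show ?case unfolding Y0 good_def using cE C \<delta>(1) by (simp add: B_def)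
  next
    case (Suc k)
    show ?case unfolding YS by (rule next_good[OF Suc])
  qed
  \<comment> \<open>The contraction estimate, used for consecutive iterates and again to compare an
    iterate with the limit under the integral.\<close>
  have diff_integral: "\<bar>integral {0..t} (\<lambda>s. g i (Z s)) - integral {0..t} (\<lambda>s. g i (Z' s))\<bar> \<le> C * real m * \<delta> * e"
    if Z: "good Z" "good Z'" and i: "i < m" and t: "t \<in> I" and e: "\<forall>s\<in>I. \<forall>j<m. \<bar>Z s j - Z' s j\<bar> \<le> e" and e0: "0 \<le> e" for Z Z' i t e
  proof -
    have cont: "continuous_on {0..t} (\<lambda>s. g i (Z s))" "continuous_on {0..t} (\<lambda>s. g i (Z' s))"
      by (rule continuous_on_subset[OF gcont[OF _ i] sub[OF t]], fact)+
    have "norm (integral {0..t} (\<lambda>s. g i (Z s) - g i (Z' s))) \<le> (C * (real m * e)) * (t - 0)"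
    proof (rule integral_bound)
      show "continuous_on {0..t} (\<lambda>s. g i (Z s) - g i (Z' s))" using cont by (rule continuous_on_diff)
      show "norm (g i (Z s) - g i (Z' s)) \<le> C * (real m * e)" if "s \<in> {0..t}" for s
      proof -
        have s: "s \<in> I" using that sub[OF t] by blast
        have "\<bar>g i (Z s) - g i (Z' s)\<bar> \<le> C * l1_dist {..<m} (Z' s) (Z s)" using gL[OF i] Z s by (simp add: good_def)
        also have "\<dots> \<le> C * (\<Sum>j<m. e)" using e s by (intro mult_left_mono[OF _ C] sum_mono) simp
        finally show ?thesis by simp
      qed
    qed (use t in \<open>simp add: I_def\<close>)
    also have "\<dots> \<le> (C * (real m * e)) * \<delta>" using t C e0 by (intro mult_left_mono) (auto simp: I_def)
    also have "integral {0..t} (\<lambda>s. g i (Z s) - g i (Z' s)) = integral {0..t} (\<lambda>s. g i (Z s)) - integral {0..t} (\<lambda>s. g i (Z' s))"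
      by (rule Henstock_Kurzweil_Integration.integral_diff) (rule integrable_continuous_real, fact cont)+
    finally show ?thesis by (simp add: mult_ac)
  qed
  have step: "\<forall>s\<in>I. \<forall>j<m. \<bar>Y (Suc k) s j - Y k s j\<bar> \<le> 2 * r * (1/2)^k" for k
  proof (induction k)
    case 0
    show ?case
    proof (intro ballI allI impI)
      fix s j assume s: "s \<in> I" and j: "j < m"
      have "Y (Suc 0) s \<in> B" "Y 0 s \<in> B" using good s unfolding good_def by blast+
      then have "\<bar>Y (Suc 0) s j - c j\<bar> < r" "\<bar>Y 0 s j - c j\<bar> < r" using j Bcube by (auto simp: cube_def)
      then show "\<bar>Y (Suc 0) s j - Y 0 s j\<bar> \<le> 2 * r * (1/2)^0" by simp
    qed
  next
    case (Suc k)
    show ?case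
    proof (intro ballI allI impI)
      fix s j assume s: "s \<in> I" and j: "j < m"
      have "\<bar>Y (Suc (Suc k)) s j - Y (Suc k) s j\<bar> = \<bar>integral {0..s} (\<lambda>s. g j (Y (Suc k) s)) - integral {0..s} (\<lambda>s. g j (Y k s))\<bar>"
        using j by (simp add: YS[of "Suc k"] YS[of k])
      also have "\<dots> \<le> C * real m * \<delta> * (2 * r * (1/2)^k)" by (rule diff_integral[OF good good j s Suc]) (use r in simp)
      also have "\<dots> \<le> 1/2 * (2 * r * (1/2)^k)" by (rule mult_right_mono[OF \<delta>(4)]) (use r in simp)
      finally show "\<bar>Y (Suc (Suc k)) s j - Y (Suc k) s j\<bar> \<le> 2 * r * (1/2)^Suc k" by simp
    qed
  qed
  \<comment> \<open>The limit is a telescoping series, to which the Weierstrass test applies with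
    the geometric bounds of \<open>step\<close>.\<close>
  define y where "y t i = (if i < m then c i + suminf (\<lambda>k. Y (Suc k) t i - Y k t i) else 0)" for t i
  have unif: "uniform_limit I (\<lambda>n t. Y n t i) (\<lambda>t. y t i) sequentially" if i: "i < m" for i
  proof -
    have "uniform_limit I (\<lambda>n t. \<Sum>k<n. Y (Suc k) t i - Y k t i) (\<lambda>t. suminf (\<lambda>k. Y (Suc k) t i - Y k t i)) sequentially"
    proof (rule Weierstrass_m_test)
      show "norm (Y (Suc k) t i - Y k t i) \<le> 2 * r * (1/2)^k" if "t \<in> I" for k t using step that i by simp
      show "summable (\<lambda>k. 2 * r * (1/2)^k)" by (intro summable_mult summable_geometric) simp
    qed
    then have "uniform_limit I (\<lambda>n t. c i + (\<Sum>k<n. Y (Suc k) t i - Y k t i)) (\<lambda>t. c i + suminf (\<lambda>k. Y (Suc k) t i - Y k t i)) sequentially"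
      by (intro uniform_limit_add uniform_limit_const)
    moreover have "c i + (\<Sum>k<n. Y (Suc k) t i - Y k t i) = Y n t i" for n t
      using sum_lessThan_telescope[of "\<lambda>k. Y k t i" n] by (simp add: Y0)
    ultimately show ?thesis using i by (simp add: y_def)
  qed
  have ptw: "(\<lambda>n. Y n t i) \<longlonglongrightarrow> y t i" if "i < m" "t \<in> I" for i t
    by (rule tendsto_uniform_limitI[OF unif[OF that(1)] that(2)])
  have good_y: "good y"
    unfolding good_def
  proof (intro conjI ballI allI)
    fix t assume t: "t \<in> I"
    have "\<bar>y t i - c i\<bar> \<le> C * \<delta>" if i: "i < m" for i
    proof (rule LIMSEQ_le_const2)
      show "(\<lambda>n. \<bar>Y n t i - c i\<bar>) \<longlonglongrightarrow> \<bar>y t i - c i\<bar>"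
        by (intro tendsto_rabs tendsto_diff ptw[OF i t] tendsto_const)
      show "\<exists>N. \<forall>n\<ge>N. \<bar>Y n t i - c i\<bar> \<le> C * \<delta>" using good t i by (auto simp: good_def B_def)
    qed
    then show "y t \<in> B" by (simp add: B_def mem_coord_space y_def)
  next
    fix i
    show "continuous_on I (\<lambda>t. y t i)"
    proof (cases "i < m")
      case True
      have "\<forall>\<^sub>F n in sequentially. continuous_on I (\<lambda>t. Y n t i)" using good by (simp add: good_def)
      then show ?thesis by (rule uniform_limit_theorem[OF _ unif[OF True]]) simp
    qed (simp add: y_def)
  qed
  have eq: "y t i = c i + integral {0..t} (\<lambda>s. g i (y s))" if i: "i < m" and t: "t \<in> I" for i t
  proof (rule LIMSEQ_unique)
    show "(\<lambda>n. Y (Suc n) t i) \<longlonglongrightarrow> y t i" using ptw[OF i t] by (rule LIMSEQ_Suc)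
    have "(\<lambda>n. c i + integral {0..t} (\<lambda>s. g i (Y n s))) \<longlonglongrightarrow> c i + integral {0..t} (\<lambda>s. g i (y s))"
    proof (intro tendsto_add tendsto_const tendstoI)
      fix e :: real assume e: "0 < e"
      have "\<forall>\<^sub>F n in sequentially. \<forall>j\<in>{..<m}. \<forall>s\<in>I. dist (Y n s j) (y s j) < e"
      proof (rule eventually_ball_finite[OF finite_lessThan], rule ballI)
        show "\<forall>\<^sub>F n in sequentially. \<forall>s\<in>I. dist (Y n s j) (y s j) < e" if "j \<in> {..<m}" for j
          using uniform_limitD[OF unif e] that by simp
      qed
      then show "\<forall>\<^sub>F n in sequentially. dist (integral {0..t} (\<lambda>s. g i (Y n s))) (integral {0..t} (\<lambda>s. g i (y s))) < e"
      proof eventually_elim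
        case (elim n)
        then have "\<forall>s\<in>I. \<forall>j<m. \<bar>Y n s j - y s j\<bar> \<le> e" by (auto simp: dist_real_def intro: less_imp_le)
        from diff_integral[OF good good_y i t this] e
        have "\<bar>integral {0..t} (\<lambda>s. g i (Y n s)) - integral {0..t} (\<lambda>s. g i (y s))\<bar> \<le> C * real m * \<delta> * e" by simp
        also have "\<dots> \<le> 1/2 * e" by (rule mult_right_mono[OF \<delta>(4)]) (use e in simp)
        finally show ?case using e by (simp add: dist_real_def)
      qed
    qed
    then show "(\<lambda>n. Y (Suc n) t i) \<longlonglongrightarrow> c i + integral {0..t} (\<lambda>s. g i (y s))" using i by (simp add: YS)
  qed
  show ?thesis
  proof (rule that[OF \<delta>(1,2)])
    have "0 \<in> I" using \<delta>(1) by (simp add: I_def)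
    then show "y 0 = c" using eq[of _ 0] cE by (auto simp: fun_eq_iff y_def mem_coord_space)
    show "\<forall>t\<in>{0..\<delta>}. y t \<in> W" using good_y BW by (auto simp: good_def I_def)
    show "\<forall>i<m. \<forall>t\<in>{0..\<delta>}. ((\<lambda>t. y t i) has_real_derivative g i (y t)) (at t within {0..\<delta>})"
    proof (intro allI impI ballI)
      fix i t assume i: "i < m" and t: "t \<in> {0..\<delta>}"
      then have tI: "t \<in> I" by (simp add: I_def)
      have "((\<lambda>t. c i + integral {0..t} (\<lambda>s. g i (y s))) has_real_derivative g i (y t)) (at t within I)"
        using DERIV_add[OF DERIV_const[of "c i"] int_deriv[OF good_y i tI]] by simp
      then have "((\<lambda>t. y t i) has_real_derivative g i (y t)) (at t within I)"
        by (rule has_field_derivative_transform_within[OF _ zero_less_one tI]) (simp add: eq[OF i])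
      then show "((\<lambda>t. y t i) has_real_derivative g i (y t)) (at t within {0..\<delta>})" by (simp add: I_def)
    qed
  qed
qed

text \<open>Two nested mean values; they give \<open>K\<close> where Taylor's formula would have
  \<open>K / 2\<close>.\<close>

lemma second_order_remainder:
  fixes f :: "real \<Rightarrow> real"
  assumes f: "\<And>t. t \<in> {a..b} \<Longrightarrow> (f has_real_derivative f' t) (at t within {a..b})"
    and f': "\<And>t. t \<in> {a..b} \<Longrightarrow> (f' has_real_derivative f'' t) (at t within {a..b})"
    and K: "\<And>t. t \<in> {a..b} \<Longrightarrow> \<bar>f'' t\<bar> \<le> K" and st: "a \<le> s" "s \<le> t" "t \<le> b"
  shows "\<bar>f t - f s - f' s * (t - s)\<bar> \<le> K * (t - s)^2"
proof -
  have sub: "{s..t'} \<subseteq> {a..b}" if "t' \<le> t" for t' using st that by auto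
  have mvt: "\<exists>x\<in>{s..t'}. h t' - h s = h' x * (t' - s)"
    if "s \<le> t'" "t' \<le> t" and h: "\<And>t. t \<in> {a..b} \<Longrightarrow> (h has_real_derivative h' t) (at t within {a..b})" for h h' t'
  proof -
    have "(h has_derivative (\<lambda>u. h' x * u)) (at x within {s..t'})" if "s \<le> x" "x \<le> t'" for x
    proof -
      have "x \<in> {a..b}" using that \<open>t' \<le> t\<close> st by auto
      from DERIV_subset[OF h[OF this] sub[OF \<open>t' \<le> t\<close>]] show ?thesis by (simp add: has_field_derivative_def)
    qed
    then show ?thesis using mvt_very_simple[of s t' h "\<lambda>x u. h' x * u"] \<open>s \<le> t'\<close> by blast
  qed
  obtain x where x: "x \<in> {s..t}" "f t - f s = f' x * (t - s)" using mvt[OF st(2) order_refl f] by blast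
  have xs: "s \<le> x" "x \<le> t" using x(1) by auto
  obtain z where z: "z \<in> {s..x}" "f' x - f' s = f'' z * (x - s)" using mvt[OF xs f'] by blast
  have "\<bar>f'' z\<bar> \<le> K" using K z(1) xs st by simp
  have "\<bar>f t - f s - f' s * (t - s)\<bar> = \<bar>f'' z\<bar> * (x - s) * (t - s)"
    using x(2) z(2) xs st(2) by (simp add: left_diff_distrib[symmetric] abs_mult)
  also have "\<dots> \<le> K * (t - s) * (t - s)"
    using \<open>\<bar>f'' z\<bar> \<le> K\<close> xs st(2) by (intro mult_mono) auto
  finally show ?thesis by (simp add: power2_eq_square mult.assoc)
qed

section \<open>Curves driven along a single tree\<close>

text \<open>The driver has \<open>X\<^sup>\<tau>\<^sup>0(s,t) = t - s\<close> up to terms of second order, which are dictated by the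
  algebraic relations. For \<open>p = 2\<close> second-order terms are within the error allowed for an integral
  curve, so its integral curves are the solutions of the ordinary differential equation with
  right-hand side \<open>f\<^sub>\<tau>\<^sub>0\<close>.\<close>

definition driver_correction :: "forest \<Rightarrow> forest \<Rightarrow> real" where
  "driver_correction \<tau>0 \<tau> = (case \<tau>0 of Vertex \<alpha> \<Rightarrow> (if \<tau> = Two (Upair \<alpha> \<alpha>) then 1 else if \<tau> = Ladder \<alpha> \<alpha> then 1/2 else 0) | _ \<Rightarrow> 0)"

definition tree_driver :: "forest \<Rightarrow> forest \<Rightarrow> real \<Rightarrow> real \<Rightarrow> real" where
  "tree_driver \<tau>0 \<tau> s t = (if \<tau> = \<tau>0 then t - s else 0) + driver_correction \<tau>0 \<tau> * (t - s)^2"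

text \<open>Separates the forests whose driver component can be prescribed from the products, where
  it is fixed by the components of the two vertices.\<close>

definition is_tree :: "forest \<Rightarrow> bool" where
  "is_tree \<tau> \<longleftrightarrow> (case \<tau> of Two _ \<Rightarrow> False | _ \<Rightarrow> True)"

lemma control_function_length: "control_function S T (\<lambda>s t. t - s)"
  unfolding control_function_def by (auto intro!: continuous_intros simp: case_prod_unfold)

text \<open>For a vertex the corrections are the square of the increment and the iterated integral
  of a linear path. For a ladder the vertex parts vanish, so its component only has to be additive.
  On intervals of length at most 1 a length is bounded by its square root and a square by the
  length, which gives regularity 2.\<close>

lemma tree_driver_rough_path:
  assumes \<tau>0: "is_tree \<tau>0" and ST: "T \<le> S + 1"
  shows "branched_rough_path n S T 2 (\<lambda>s t. t - s) (tree_driver \<tau>0)"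
  unfolding branched_rough_path_def
proof (intro conjI ballI allI impI)
  fix \<alpha> \<beta> s u t
  show "tree_driver \<tau>0 (Vertex \<alpha>) s t = tree_driver \<tau>0 (Vertex \<alpha>) s u + tree_driver \<tau>0 (Vertex \<alpha>) u t"
    using \<tau>0 by (cases \<tau>0) (auto simp: tree_driver_def driver_correction_def)
  show "tree_driver \<tau>0 (Two (Upair \<alpha> \<beta>)) s t = tree_driver \<tau>0 (Vertex \<alpha>) s t * tree_driver \<tau>0 (Vertex \<beta>) s t"
    using \<tau>0 by (cases \<tau>0) (auto simp: tree_driver_def driver_correction_def is_tree_def power2_eq_square Upair_inject)
  show "tree_driver \<tau>0 (Ladder \<alpha> \<beta>) s t = tree_driver \<tau>0 (Ladder \<alpha> \<beta>) s u + tree_driver \<tau>0 (Ladder \<alpha> \<beta>) u t +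
      tree_driver \<tau>0 (Vertex \<alpha>) s u * tree_driver \<tau>0 (Vertex \<beta>) u t"
    using \<tau>0 by (cases \<tau>0) (auto simp: tree_driver_def driver_correction_def is_tree_def power2_eq_square field_simps)
next
  show "\<exists>C>0. \<forall>\<alpha>\<in>{1..n}. \<forall>\<beta>\<in>{1..n}. \<forall>s t. S \<le> s \<and> s \<le> t \<and> t \<le> T \<longrightarrow>
        \<bar>tree_driver \<tau>0 (Vertex \<alpha>) s t\<bar> \<le> C * (t - s) powr (1 / 2) \<and>
        \<bar>tree_driver \<tau>0 (Two (Upair \<alpha> \<beta>)) s t\<bar> \<le> C * (t - s) powr (2 / 2) \<and>
        \<bar>tree_driver \<tau>0 (Ladder \<alpha> \<beta>) s t\<bar> \<le> C * (t - s) powr (2 / 2)"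
  proof (rule exI[of _ 2], intro conjI ballI allI impI)
    fix \<alpha> \<beta> s t assume st: "S \<le> s \<and> s \<le> t \<and> t \<le> T"
    define h where "h = t - s"
    have h: "0 \<le> h" "h \<le> 1" using st ST by (auto simp: h_def)
    have h2: "h^2 \<le> h" using power_decreasing[of 1 2 h] h by simp
    have h1: "h \<le> h powr (1/2)" using powr_mono'[of "1/2" 1 h] h by simp
    have corr: "0 \<le> driver_correction \<tau>0 \<tau>" "driver_correction \<tau>0 \<tau> \<le> 1" "driver_correction \<tau>0 (Vertex \<alpha>) = 0" for \<tau> \<alpha>
      by (auto simp: driver_correction_def split: forest.splits)
    have b: "\<bar>tree_driver \<tau>0 \<tau> s t\<bar> \<le> 2 * h" for \<tau>
    proof -
      have "driver_correction \<tau>0 \<tau> * h^2 \<le> 1 * h" using corr(2)[of \<tau>] h2 h by (intro mult_mono) auto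
      moreover have "0 \<le> driver_correction \<tau>0 \<tau> * h^2" using corr(1)[of \<tau>] by simp
      ultimately show ?thesis using h unfolding tree_driver_def h_def[symmetric] by auto
    qed
    show "\<bar>tree_driver \<tau>0 (Vertex \<alpha>) s t\<bar> \<le> 2 * (t - s) powr (1 / 2)"
      using b[of "Vertex \<alpha>"] h1 unfolding h_def[symmetric] by linarith
    show "\<bar>tree_driver \<tau>0 (Two (Upair \<alpha> \<beta>)) s t\<bar> \<le> 2 * (t - s) powr (2 / 2)"
      "\<bar>tree_driver \<tau>0 (Ladder \<alpha> \<beta>) s t\<bar> \<le> 2 * (t - s) powr (2 / 2)"
      using b h unfolding h_def[symmetric] by simp_all
  qed simp
qed

text \<open>No second derivatives occur at a tree: these components transform like a tangent vector,
  hence define an ordinary vector field.\<close>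

lemma jet_push_tree:
  assumes "jet_push m m' n h u f g" "i < m'" "\<tau> \<in> forests n" "is_tree \<tau>"
  shows "g i \<tau> = (\<Sum>j<m. partial_deriv j (\<lambda>v. h v i) u * f j \<tau>)"
  using assms(3)
proof (cases rule: forests_cases)
  case (Vertex \<alpha>)
  then show ?thesis using jet_push_Vertex[OF assms(1,2)] by simp
next
  case (Two \<alpha> \<beta>)
  then show ?thesis using assms(4) by (simp add: is_tree_def)
next
  case (Ladder \<alpha> \<beta>)
  then show ?thesis using jet_push_Ladder[OF assms(1,2)] by simp
qed

lemma sum_tree_driver:
  assumes "\<tau>0 \<in> forests n" "is_tree \<tau>0"
  shows "(\<Sum>\<tau>\<in>forests n. 1 / symmetry_factor \<tau> * g \<tau> * tree_driver \<tau>0 \<tau> s t) =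
    g \<tau>0 * (t - s) + (\<Sum>\<tau>\<in>forests n. 1 / symmetry_factor \<tau> * driver_correction \<tau>0 \<tau> * g \<tau>) * (t - s)^2"
proof -
  have sf: "symmetry_factor \<tau>0 = 1" using assms(2) by (auto simp: symmetry_factor_def is_tree_def split: forest.splits)
  have "(\<Sum>\<tau>\<in>forests n. 1 / symmetry_factor \<tau> * g \<tau> * tree_driver \<tau>0 \<tau> s t) =
      (\<Sum>\<tau>\<in>forests n. (if \<tau> = \<tau>0 then g \<tau>0 * (t - s) else 0) + 1 / symmetry_factor \<tau> * driver_correction \<tau>0 \<tau> * g \<tau> * (t - s)^2)"
    by (intro sum.cong refl) (auto simp: tree_driver_def sf algebra_simps)
  then show ?thesis using assms(1) finite_forests by (simp add: sum.distrib sum_distrib_right)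
qed

text \<open>The curve is solved for in one chart, but the expansion is demanded in all of them. In
  any other chart it solves the corresponding equation, because the components at a tree form a
  vector field. The deviations from the expansion are then of order \<open>(t - s)^2\<close>, which
  is below \<open>(t - s) powr (3 / 2)\<close> for lengths at most 1.\<close>

lemma tree_driven_curve:
  assumes M: "smooth_manifold M" and f: "rough_velocity_field n M f" and d: "(V, z) \<in> charts M" and q: "q \<in> V"
    and \<tau>0: "\<tau>0 \<in> forests n" "is_tree \<tau>0"
  obtains \<delta> Y where "0 < \<delta>" "\<delta> \<le> 1" "Y 0 = q" "\<forall>t\<in>{0..\<delta>}. Y t \<in> V"
    "integral_curve n M f 0 \<delta> 2 (\<lambda>s t. t - s) (tree_driver \<tau>0) Y"
    "\<forall>i<mdim M. ((\<lambda>t. z (Y t) i) has_real_derivative fiber_coords n M (V, z) (f q) i \<tau>0) (at 0 within {0..\<delta>})"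
proof -
  let ?m = "mdim M"
  define F where "F i u = fiber_coords n M (V, z) (f (inv_into V z u)) i \<tau>0" for i u
  note zV = chart_coordinate_chart(2)[OF M d] and zinv = chart_inv_into[OF M d]
  have F: "smooth_on ?m (z ` V) (F i)" if "i < ?m" for i
    unfolding F_def[abs_def] by (rule field_coords_smooth[OF f d that \<tau>0(1)])
  have zq: "z q \<in> z ` V" using q by blast
  obtain \<delta> y where y: "0 < \<delta>" "\<delta> \<le> 1" "y 0 = z q" "\<forall>t\<in>{0..\<delta>}. y t \<in> z ` V"
    "\<forall>i<?m. \<forall>t\<in>{0..\<delta>}. ((\<lambda>t. y t i) has_real_derivative F i (y t)) (at t within {0..\<delta>})"
    by (rule ode_local_solution[OF zV F zq])
  define Y where "Y t = inv_into V z (y t)" for t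
  have YV: "Y t \<in> V" "z (Y t) = y t" if "t \<in> {0..\<delta>}" for t
    unfolding Y_def using y(4) that by (auto intro: inv_into_into f_inv_into_f)
  have ycont: "continuous_on {0..\<delta>} y"
  proof (rule continuous_on_coordinatewise_then_product)
    fix i
    show "continuous_on {0..\<delta>} (\<lambda>t. y t i)"
    proof (cases "i < ?m")
      case True
      then show ?thesis using y(5) by (intro DERIV_continuous_on) blast
    next
      case False
      then have "y t i = 0" if "t \<in> {0..\<delta>}" for t
        using y(4) that openin_subset[OF zV] by (auto simp: mem_coord_space subset_iff)
      then show ?thesis using continuous_on_cong[OF refl, of "{0..\<delta>}" "\<lambda>t. y t i" "\<lambda>_. 0"] by simp
    qed
  qed
  have Ycont: "continuous_map (top_of_set {0..\<delta>}) (mtop M) Y"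
  proof -
    have "continuous_map (top_of_set {0..\<delta>}) (subtopology (Euclidean_space ?m) (z ` V)) y"
      unfolding Euclidean_space_eq subtopology_subtopology
      using ycont y(4) openin_subset[OF zV] by (auto simp: continuous_map_in_subtopology mem_coord_space subset_iff)
    from continuous_map_compose[OF this chart_inverse_continuous_map[OF M d]]
    show ?thesis by (simp add: Y_def[abs_def] comp_def)
  qed
  have curve: "\<exists>C>0. \<forall>i<?m. \<forall>s t. a \<le> s \<and> s \<le> t \<and> t \<le> b \<longrightarrow>
      \<bar>x (Y t) i - x (Y s) i - (\<Sum>\<tau>\<in>forests n. 1 / symmetry_factor \<tau> * fiber_coords n M (U, x) (f (Y s)) i \<tau> * tree_driver \<tau>0 \<tau> s t)\<bar>
            \<le> C * (t - s) powr (3 / 2)"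
    if ab: "0 \<le> a" "a \<le> b" "b \<le> \<delta>" and c: "(U, x) \<in> charts M" and YU: "Y ` {a..b} \<subseteq> U" for a b U x
  proof -
    have sub: "{a..b} \<subseteq> {0..\<delta>}" using ab by auto
    define G where "G i \<tau> u = fiber_coords n M (U, x) (f (inv_into U x u)) i \<tau>" for i \<tau> u
    note xU = chart_coordinate_chart(2)[OF M c] and xinv = chart_inv_into[OF M c]
    have G: "smooth_on ?m (x ` U) (G i \<tau>)" if "i < ?m" "\<tau> \<in> forests n" for i \<tau>
      unfolding G_def[abs_def] by (rule field_coords_smooth[OF f c that])
    define \<theta> where "\<theta> u = x (inv_into V z u)" for u
    have \<theta>: "smooth_vec ?m ?m (z ` (V \<inter> U)) \<theta>" using chart_transition[OF M d c] by (simp add: \<theta>_def[abs_def])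
    have yW: "y t \<in> z ` (V \<inter> U)" if "t \<in> {a..b}" for t
    proof -
      have t: "t \<in> {0..\<delta>}" using that sub by blast
      then have "Y t \<in> V \<inter> U" "y t = z (Y t)" using YV[OF t] YU that by auto
      then show ?thesis by blast
    qed
    define w where "w t = x (Y t)" for t
    have w\<theta>: "\<theta> (y t) = w t" for t by (simp add: \<theta>_def w_def Y_def)
    have wU: "w t \<in> x ` U" if "t \<in> {a..b}" for t using YU that unfolding w_def by blast
    have ev: "\<forall>\<^sub>F s in at t within {a..b}. P s" if "\<And>s. s \<in> {a..b} \<Longrightarrow> P s" for t P
      using that by (auto simp: eventually_at_filter)
    \<comment> \<open>The chain rule through the transition map, matched with the transformation of
      the field components at the tree.\<close>
    have w': "((\<lambda>t. w t i) has_real_derivative G i \<tau>0 (w t)) (at t within {a..b})" if i: "i < ?m" and t: "t \<in> {a..b}" for i t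
    proof -
      have t': "t \<in> {0..\<delta>}" using t sub by blast
      have "((\<lambda>t. \<theta> (y t) i) has_real_derivative (\<Sum>k<?m. partial_deriv k (\<lambda>u. \<theta> u i) (y t) * F k (y t))) (at t within {a..b})"
      proof (rule smooth_on_along_curve[where \<gamma> = y, OF smooth_vec_coord[OF \<theta> i] yW[OF t]])
        show "\<forall>\<^sub>F s in at t within {a..b}. y s \<in> z ` (V \<inter> U)" by (rule ev) (rule yW)
        show "((\<lambda>t. y t k) has_real_derivative F k (y t)) (at t within {a..b})" if "k < ?m" for k
          using y(5) that t' by (intro DERIV_subset[OF _ sub]) blast
      qed
      moreover have "G i \<tau>0 (w t) = (\<Sum>k<?m. partial_deriv k (\<lambda>u. \<theta> u i) (y t) * F k (y t))"
      proof -
        have YUV: "Y t \<in> V" "Y t \<in> U" "z (Y t) = y t" using YV[OF t'] YU t by auto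
        from jet_push_tree[OF field_coords_transition[OF M f d c YUV(1,2)] i \<tau>0]
        show ?thesis using xinv[OF YUV(2)] by (simp add: G_def F_def \<theta>_def w_def YUV(3) Y_def[symmetric])
      qed
      ultimately show ?thesis by (simp add: w\<theta>)
    qed
    have wcont: "continuous_on {a..b} w"
    proof (rule continuous_on_coordinatewise_then_product)
      fix i
      show "continuous_on {a..b} (\<lambda>t. w t i)"
      proof (cases "i < ?m")
        case True
        then show ?thesis using w' by (intro DERIV_continuous_on) blast
      next
        case False
        then have "w t i = 0" if "t \<in> {a..b}" for t
          using wU[OF that] openin_subset[OF xU] by (auto simp: mem_coord_space subset_iff)
        then show ?thesis using continuous_on_cong[OF refl, of "{a..b}" "\<lambda>t. w t i" "\<lambda>_. 0"] by simp
      qed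
    qed
    have bounded: "\<exists>K\<ge>0. \<forall>t\<in>{a..b}. \<bar>h (w t)\<bar> \<le> K" if "smooth_on ?m (x ` U) h" for h
    proof -
      have "continuous_on {a..b} (\<lambda>t. h (w t))"
        by (rule continuous_on_compose2[OF smooth_on_continuous[OF that] wcont]) (use wU in blast)
      then have "bounded ((\<lambda>t. h (w t)) ` {a..b})" by (intro compact_imp_bounded compact_continuous_image compact_Icc)
      then obtain K where "\<forall>t\<in>{a..b}. \<bar>h (w t)\<bar> \<le> K" by (auto simp: bounded_iff)
      then have "\<forall>t\<in>{a..b}. \<bar>h (w t)\<bar> \<le> max K 0" by (meson max.coboundedI1)
      then show ?thesis by (intro exI[of _ "max K 0"]) simp
    qed
    \<comment> \<open>\<open>E\<close> is the coefficient of \<open>(t - s)^2\<close> in the driven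
      sum, \<open>G'\<close> the second derivative of the curve as a function of its
      position.\<close>
    define E where "E i u = (\<Sum>\<tau>\<in>forests n. 1 / symmetry_factor \<tau> * driver_correction \<tau>0 \<tau> * G i \<tau> u)" for i u
    define G' where "G' i u = (\<Sum>k<?m. partial_deriv k (G i \<tau>0) u * G k \<tau>0 u)" for i u
    have "\<exists>K\<ge>0. \<forall>s t. a \<le> s \<and> s \<le> t \<and> t \<le> b \<longrightarrow> \<bar>w t i - w s i - (G i \<tau>0 (w s) * (t - s) + E i (w s) * (t - s)^2)\<bar> \<le> K * (t - s)^2"
      if i: "i < ?m" for i
    proof -
      have "smooth_on ?m (x ` U) (G' i)"
        unfolding G'_def[abs_def] using i \<tau>0(1)
        by (intro smooth_on_sum xU smooth_on_mult smooth_on_partial_deriv G) simp_all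
      then obtain K1 where K1: "K1 \<ge> 0" "\<forall>t\<in>{a..b}. \<bar>G' i (w t)\<bar> \<le> K1" using bounded by blast
      have "smooth_on ?m (x ` U) (E i)"
        unfolding E_def[abs_def] using i by (intro smooth_on_sum xU smooth_on_mult smooth_on_const G) simp_all
      then obtain K2 where K2: "K2 \<ge> 0" "\<forall>t\<in>{a..b}. \<bar>E i (w t)\<bar> \<le> K2" using bounded by blast
      have G'': "((\<lambda>t. G i \<tau>0 (w t)) has_real_derivative G' i (w t)) (at t within {a..b})" if t: "t \<in> {a..b}" for t
        unfolding G'_def
      proof (rule smooth_on_along_curve[where \<gamma> = w, OF G[OF i \<tau>0(1)] wU[OF t]])
        show "\<forall>\<^sub>F s in at t within {a..b}. w s \<in> x ` U" by (rule ev) (rule wU)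
      qed (rule w'[OF _ t])
      have "\<bar>w t i - w s i - (G i \<tau>0 (w s) * (t - s) + E i (w s) * (t - s)^2)\<bar> \<le> (K1 + K2) * (t - s)^2"
        if st: "a \<le> s" "s \<le> t" "t \<le> b" for s t
      proof -
        have "\<bar>w t i - w s i - G i \<tau>0 (w s) * (t - s)\<bar> \<le> K1 * (t - s)^2"
          by (rule second_order_remainder[OF w'[OF i] G'' _ st]) (use K1(2) in blast)+
        moreover have "\<bar>E i (w s) * (t - s)^2\<bar> \<le> K2 * (t - s)^2"
          unfolding abs_mult using K2 st by (intro mult_mono) auto
        ultimately show ?thesis unfolding distrib_right by linarith
      qed
      moreover have "0 \<le> K1 + K2" using K1 K2 by simp
      ultimately show ?thesis by blast
    qed
    then obtain K where K: "\<forall>i<?m. K i \<ge> 0 \<and> (\<forall>s t. a \<le> s \<and> s \<le> t \<and> t \<le> b \<longrightarrow>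
        \<bar>w t i - w s i - (G i \<tau>0 (w s) * (t - s) + E i (w s) * (t - s)^2)\<bar> \<le> K i * (t - s)^2)"
      by metis
    \<comment> \<open>The sum dominates every \<open>K i\<close>; the summand 1 makes it positive in
      dimension 0 as well.\<close>
    define C where "C = (\<Sum>i<?m. K i) + 1"
    have Kpos: "0 \<le> (\<Sum>i<?m. K i)" using K by (intro sum_nonneg) simp
    show ?thesis
    proof (rule exI[of _ C], intro conjI allI impI)
      show "C > 0" using Kpos by (simp add: C_def)
      fix i s t assume i: "i < ?m" and st: "a \<le> s \<and> s \<le> t \<and> t \<le> b"
      have s: "s \<in> {a..b}" using st by simp
      have Gs: "fiber_coords n M (U, x) (f (Y s)) i \<tau> = G i \<tau> (w s)" for \<tau>
      proof -
        have "Y s \<in> U" using YU s by blast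
        then show ?thesis using xinv[of "Y s"] by (simp add: G_def w_def)
      qed
      have h: "0 \<le> t - s" "t - s \<le> 1" using st ab y(2) by auto
      have "(t - s)^2 \<le> (t - s) powr (3 / 2)"
      proof (cases "t = s")
        case False
        then have "(t - s)^2 = (t - s) powr 2" using h by (simp add: powr_numeral)
        also have "\<dots> \<le> (t - s) powr (3 / 2)" by (rule powr_mono') (use h in auto)
        finally show ?thesis .
      qed simp
      moreover have "K i \<le> C"
      proof -
        have "K i \<le> (\<Sum>i<?m. K i)" using K i by (intro member_le_sum) auto
        then show ?thesis by (simp add: C_def)
      qed
      ultimately have "K i * (t - s)^2 \<le> C * (t - s) powr (3 / 2)" using K i by (intro mult_mono) auto
      moreover have "\<bar>w t i - w s i - (G i \<tau>0 (w s) * (t - s) + E i (w s) * (t - s)^2)\<bar> \<le> K i * (t - s)^2"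
        using K i st by blast
      ultimately show "\<bar>x (Y t) i - x (Y s) i - (\<Sum>\<tau>\<in>forests n. 1 / symmetry_factor \<tau> * fiber_coords n M (U, x) (f (Y s)) i \<tau> * tree_driver \<tau>0 \<tau> s t)\<bar>
            \<le> C * (t - s) powr (3 / 2)"
        unfolding Gs sum_tree_driver[OF \<tau>0] E_def[symmetric] w_def[symmetric] by linarith
    qed
  qed
  show ?thesis
  proof (rule that[OF y(1,2)])
    show "Y 0 = q" using zinv[OF q] by (simp add: Y_def y(3))
    show "\<forall>t\<in>{0..\<delta>}. Y t \<in> V" using YV by blast
    show "integral_curve n M f 0 \<delta> 2 (\<lambda>s t. t - s) (tree_driver \<tau>0) Y"
      unfolding integral_curve_def using Ycont curve by blast
    show "\<forall>i<?m. ((\<lambda>t. z (Y t) i) has_real_derivative fiber_coords n M (V, z) (f q) i \<tau>0) (at 0 within {0..\<delta>})"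
    proof (intro allI impI)
      fix i assume i: "i < ?m"
      have 0: "0 \<in> {0..\<delta>}" using y(1) by simp
      have "((\<lambda>t. y t i) has_real_derivative F i (y 0)) (at 0 within {0..\<delta>})" using y(5) i 0 by blast
      then have "((\<lambda>t. z (Y t) i) has_real_derivative F i (y 0)) (at 0 within {0..\<delta>})"
        by (rule has_field_derivative_transform_within[OF _ zero_less_one 0]) (simp add: YV(2))
      then show "((\<lambda>t. z (Y t) i) has_real_derivative fiber_coords n M (V, z) (f q) i \<tau>0) (at 0 within {0..\<delta>})"
        using zinv[OF q] by (simp add: F_def y(3))
    qed
  qed
qed

section \<open>Invariance of submanifolds\<close>

lemma slice_pairD:
  assumes "slice_pair M M' \<phi> (U, x) (V, z) \<iota>"
  shows "(U, x) \<in> charts M" "(V, z) \<in> charts M'"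
    "q \<in> V \<Longrightarrow> q \<in> \<phi> ` U \<longleftrightarrow> (\<forall>i\<in>{..<mdim M'} - \<iota> ` {..<mdim M}. z q i = 0)"
    "V \<inter> \<phi> ` topspace (mtop M) \<subseteq> \<phi> ` U"
  using assms unfolding slice_pair_def case_prod_conv by blast+

lemma vanishes_on_slice_pair:
  assumes M': "smooth_manifold M'" and S: "slice_pair M M' \<phi> (U, x) (V, z) \<iota>"
    and zero: "\<And>r. r \<in> U \<Longrightarrow> \<phi> r \<in> V \<Longrightarrow> fiber_coords n M' (V, z) (f (\<phi> r)) i \<tau> = 0"
  shows "vanishes_on_slice ({..<mdim M'} - \<iota> ` {..<mdim M}) (z ` V) (\<lambda>u. fiber_coords n M' (V, z) (f (inv_into V z u)) i \<tau>)"
  unfolding vanishes_on_slice_def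
proof (intro ballI impI)
  note S = slice_pairD[OF S]
  fix u assume "u \<in> z ` V" and u0: "\<forall>i\<in>{..<mdim M'} - \<iota> ` {..<mdim M}. u i = 0"
  then obtain q where q: "q \<in> V" "u = z q" by blast
  then have "q \<in> \<phi> ` U" using S(3)[OF q(1)] u0 by simp
  then obtain r where "r \<in> U" "q = \<phi> r" by blast
  then show "fiber_coords n M' (V, z) (f (inv_into V z u)) i \<tau> = 0"
    using zero q chart_inv_into[OF M' S(2) q(1)] by simp
qed

lemma control_function_subinterval:
  assumes "control_function S T \<omega>" "S \<le> a" "b \<le> T"
  shows "control_function a b \<omega>"
proof -
  have "{(s, t). a \<le> s \<and> s \<le> t \<and> t \<le> b} \<subseteq> {(s, t). S \<le> s \<and> s \<le> t \<and> t \<le> T}" using assms(2,3) by auto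
  then show ?thesis
    using assms unfolding control_function_def by (auto intro: continuous_on_subset)
qed

lemma branched_rough_path_subinterval:
  assumes X: "branched_rough_path n S T p \<omega> X" and ab: "S \<le> a" "b \<le> T"
  shows "branched_rough_path n a b p \<omega> X"
proof -
  obtain C where C: "C > 0" "\<forall>\<alpha>\<in>{1..n}. \<forall>\<beta>\<in>{1..n}. \<forall>s t. S \<le> s \<and> s \<le> t \<and> t \<le> T \<longrightarrow>
        \<bar>X (Vertex \<alpha>) s t\<bar> \<le> C * \<omega> s t powr (1 / p) \<and>
        \<bar>X (Two (Upair \<alpha> \<beta>)) s t\<bar> \<le> C * \<omega> s t powr (2 / p) \<and>
        \<bar>X (Ladder \<alpha> \<beta>) s t\<bar> \<le> C * \<omega> s t powr (2 / p)"
    using X unfolding branched_rough_path_def by blast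
  show ?thesis
    unfolding branched_rough_path_def
  proof (rule conjI)
    show "\<forall>\<alpha>\<in>{1..n}. \<forall>\<beta>\<in>{1..n}. \<forall>s u t. a \<le> s \<and> s \<le> u \<and> u \<le> t \<and> t \<le> b \<longrightarrow>
        X (Vertex \<alpha>) s t = X (Vertex \<alpha>) s u + X (Vertex \<alpha>) u t \<and>
        X (Two (Upair \<alpha> \<beta>)) s t = X (Vertex \<alpha>) s t * X (Vertex \<beta>) s t \<and>
        X (Ladder \<alpha> \<beta>) s t =
          X (Ladder \<alpha> \<beta>) s u + X (Ladder \<alpha> \<beta>) u t + X (Vertex \<alpha>) s u * X (Vertex \<beta>) u t"
    proof (intro ballI allI impI)
      fix \<alpha> \<beta> s u t assume "\<alpha> \<in> {1..n}" "\<beta> \<in> {1..n}" and "a \<le> s \<and> s \<le> u \<and> u \<le> t \<and> t \<le> b"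
      moreover from this ab have "S \<le> s \<and> s \<le> u \<and> u \<le> t \<and> t \<le> T" by linarith
      ultimately show "X (Vertex \<alpha>) s t = X (Vertex \<alpha>) s u + X (Vertex \<alpha>) u t \<and>
        X (Two (Upair \<alpha> \<beta>)) s t = X (Vertex \<alpha>) s t * X (Vertex \<beta>) s t \<and>
        X (Ladder \<alpha> \<beta>) s t =
          X (Ladder \<alpha> \<beta>) s u + X (Ladder \<alpha> \<beta>) u t + X (Vertex \<alpha>) s u * X (Vertex \<beta>) u t"
        using X unfolding branched_rough_path_def by blast
    qed
    show "\<exists>C>0. \<forall>\<alpha>\<in>{1..n}. \<forall>\<beta>\<in>{1..n}. \<forall>s t. a \<le> s \<and> s \<le> t \<and> t \<le> b \<longrightarrow>
        \<bar>X (Vertex \<alpha>) s t\<bar> \<le> C * \<omega> s t powr (1 / p) \<and>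
        \<bar>X (Two (Upair \<alpha> \<beta>)) s t\<bar> \<le> C * \<omega> s t powr (2 / p) \<and>
        \<bar>X (Ladder \<alpha> \<beta>) s t\<bar> \<le> C * \<omega> s t powr (2 / p)"
    proof (intro exI[of _ C] conjI[OF C(1)] ballI allI impI)
      fix \<alpha> \<beta> s t assume "\<alpha> \<in> {1..n}" "\<beta> \<in> {1..n}" and "a \<le> s \<and> s \<le> t \<and> t \<le> b"
      moreover from this ab have "S \<le> s \<and> s \<le> t \<and> t \<le> T" by linarith
      ultimately show "\<bar>X (Vertex \<alpha>) s t\<bar> \<le> C * \<omega> s t powr (1 / p) \<and>
        \<bar>X (Two (Upair \<alpha> \<beta>)) s t\<bar> \<le> C * \<omega> s t powr (2 / p) \<and>
        \<bar>X (Ladder \<alpha> \<beta>) s t\<bar> \<le> C * \<omega> s t powr (2 / p)"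
        using C(2) by blast
    qed
  qed
qed

lemma integral_curve_expansion:
  assumes "integral_curve n M' f S T p \<omega> X Y" "(V, z) \<in> charts M'" "S \<le> a" "a \<le> b" "b \<le> T" "Y ` {a..b} \<subseteq> V"
  obtains C where "0 < C" "\<forall>i<mdim M'. \<forall>s t. a \<le> s \<and> s \<le> t \<and> t \<le> b \<longrightarrow>
      \<bar>z (Y t) i - z (Y s) i -
        (\<Sum>\<tau>\<in>forests n. 1 / symmetry_factor \<tau> * fiber_coords n M' (V, z) (f (Y s)) i \<tau> * X \<tau> s t)\<bar>
      \<le> C * \<omega> s t powr (3 / p)"
proof -
  have "\<forall>(U, x)\<in>charts M'. Y ` {a..b} \<subseteq> U \<longrightarrow>
         (\<exists>C>0. \<forall>i<mdim M'. \<forall>s t. a \<le> s \<and> s \<le> t \<and> t \<le> b \<longrightarrow>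
            \<bar>x (Y t) i - x (Y s) i -
              (\<Sum>\<tau>\<in>forests n. 1 / symmetry_factor \<tau> * fiber_coords n M' (U, x) (f (Y s)) i \<tau> * X \<tau> s t)\<bar>
            \<le> C * \<omega> s t powr (3 / p))"
    using assms(1,3,4,5) unfolding integral_curve_def by blast
  from bspec[OF this assms(2)] have "\<exists>C>0. \<forall>i<mdim M'. \<forall>s t. a \<le> s \<and> s \<le> t \<and> t \<le> b \<longrightarrow>
            \<bar>z (Y t) i - z (Y s) i -
              (\<Sum>\<tau>\<in>forests n. 1 / symmetry_factor \<tau> * fiber_coords n M' (V, z) (f (Y s)) i \<tau> * X \<tau> s t)\<bar>
            \<le> C * \<omega> s t powr (3 / p)"
    using assms(6) unfolding case_prod_conv by (rule mp)
  then show ?thesis using that by (elim exE conjE)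
qed

text \<open>Consider the supremum \<open>a\<close> of the times up to which the curve has stayed in
  the image. Closedness of the image gives \<open>Y a\<close> in it, and if \<open>a < T\<close>, a
  slice chart at \<open>Y a\<close> and the local result prolong the stay beyond
  \<open>a\<close>.\<close>

lemma tangent_imp_invariant:
  assumes M': "smooth_manifold M'" and f: "rough_velocity_field n M' f" and adm: "admissible n M' f"
    and M: "smooth_manifold M" and emb: "properly_embedded M M' \<phi>"
    and tan: "(f \<circ> \<phi>) ` topspace (mtop M) \<subseteq> bundle_map n M M' \<phi> ` rough_bundle n M"
    and ST: "S \<le> T" and p: "1 \<le> p" "p < 3" and \<omega>: "control_function S T \<omega>" and X: "branched_rough_path n S T p \<omega> X"
    and Y: "integral_curve n M' f S T p \<omega> X Y" and YS: "Y S \<in> \<phi> ` topspace (mtop M)" and t: "t \<in> {S..T}"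
  shows "Y t \<in> \<phi> ` topspace (mtop M)"
proof -
  let ?m = "mdim M" and ?m' = "mdim M'"
  define K where "K = \<phi> ` topspace (mtop M)"
  have Ycont: "continuous_map (top_of_set {S..T}) (mtop M') Y" using Y by (simp add: integral_curve_def)
  have "closed_map (mtop M) (mtop M') \<phi>" using emb by (simp add: properly_embedded_def proper_map_def)
  then have K: "closedin (mtop M') K" unfolding K_def closed_map_def by blast
  have "closedin (top_of_set {S..T}) {t \<in> {S..T}. Y t \<in> K}"
    using closedin_continuous_map_preimage[OF Ycont K] by simp
  then have closed: "closed {t \<in> {S..T}. Y t \<in> K}" using closedin_closed_trans closed_atLeastAtMost by blast
  \<comment> \<open>Membership asks for the whole initial segment, so that every time before the
    supremum is covered.\<close>
  define E where "E = {t \<in> {S..T}. \<forall>s\<in>{S..t}. Y s \<in> K}"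
  have SE: "S \<in> E" using YS ST by (simp add: E_def K_def)
  have bdd: "bdd_above E" unfolding E_def by (rule bdd_above_mono[of "{S..T}"]) auto
  define a where "a = Sup E"
  have Sa: "S \<le> a" unfolding a_def by (rule cSup_upper[OF SE bdd])
  have aT: "a \<le> T" unfolding a_def by (rule cSup_least) (use SE in \<open>auto simp: E_def\<close>)
  have before: "Y s \<in> K" if s: "S \<le> s" "s < a" for s
  proof -
    obtain t where "t \<in> E" "s < t" using s SE less_cSupE[of s E] unfolding a_def by blast
    then show ?thesis using s by (simp add: E_def)
  qed
  have Ya: "Y a \<in> K"
  proof (cases "a = S")
    case True
    then show ?thesis using YS by (simp add: K_def)
  next
    case False
    then have "S < a" using Sa by simp
    have "{S..<a} \<subseteq> {t \<in> {S..T}. Y t \<in> K}" using before aT by auto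
    then have "closure {S..<a} \<subseteq> {t \<in> {S..T}. Y t \<in> K}" by (rule closure_minimal[OF _ closed])
    then show ?thesis using closure_atLeastLessThan[OF \<open>S < a\<close>] Sa by auto
  qed
  have aE: "a \<in> E"
    unfolding E_def
  proof (intro CollectI conjI ballI)
    show "a \<in> {S..T}" using Sa aT by simp
    fix s assume "s \<in> {S..a}"
    then show "Y s \<in> K" using before[of s] Ya by (cases "s = a") auto
  qed
  have "a = T"
  proof (rule ccontr)
    assume "a \<noteq> T"
    then have aT': "a < T" using aT by simp
    obtain r0 where r0: "r0 \<in> topspace (mtop M)" "Y a = \<phi> r0" using Ya by (auto simp: K_def)
    obtain U x V z \<iota> where S: "slice_pair M M' \<phi> (U, x) (V, z) \<iota>" "r0 \<in> U" "\<phi> r0 \<in> V"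
      by (rule slice_pair_exists[OF M M' emb r0(1)])
    note SD = slice_pairD[OF S(1)]
    note c = SD(1) and d = SD(2)
    define L where "L = {..<?m'} - \<iota> ` {..<?m}"
    have "openin (top_of_set {S..T}) {t \<in> {S..T}. Y t \<in> V}"
      using openin_continuous_map_preimage[OF Ycont chart_coordinate_chart(1)[OF M' d]] by simp
    moreover have "a \<in> {t \<in> {S..T}. Y t \<in> V}" using Sa aT S(3) r0(2) by simp
    ultimately obtain e where e: "e > 0" "\<forall>t\<in>{S..T}. dist t a < e \<longrightarrow> t \<in> {t \<in> {S..T}. Y t \<in> V}"
      unfolding openin_euclidean_subtopology_iff by blast
    define b where "b = min T (a + e / 2)"
    have ab: "a < b" "b \<le> T" using aT' e(1) by (auto simp: b_def)
    have YV: "Y t \<in> V" if "a \<le> t" "t \<le> b" for t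
    proof -
      have "t \<in> {S..T}" "dist t a < e" using that Sa ab(2) e(1) by (auto simp: b_def dist_real_def)
      then show ?thesis using e(2) by blast
    qed
    define F where "F i \<tau> u = fiber_coords n M' (V, z) (f (inv_into V z u)) i \<tau>" for i \<tau> u
    note zinv = chart_inv_into[OF M' d] and zV = chart_coordinate_chart(2)[OF M' d]
    define y where "y t = z (Y t)" for t
    have F: "smooth_on ?m' (z ` V) (F i \<tau>)" if "i < ?m'" "\<tau> \<in> forests n" for i \<tau>
      unfolding F_def[abs_def] by (rule field_coords_smooth[OF f d that])
    have L: "L \<subseteq> {..<?m'}" by (auto simp: L_def)
    have van: "vanishes_on_slice L (z ` V) (F i \<tau>)" if i: "i \<in> L" and \<tau>: "\<tau> \<in> forests n" for i \<tau>
      unfolding L_def F_def[abs_def]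
    proof (rule vanishes_on_slice_pair[OF M' S(1)])
      fix r assume r: "r \<in> U" "\<phi> r \<in> V"
      then have "r \<in> topspace (mtop M)" using chart_subset_topspace[OF M c] by blast
      then have "f (\<phi> r) \<in> bundle_map n M M' \<phi> ` rough_bundle n M" using tan by auto
      then show "fiber_coords n M' (V, z) (f (\<phi> r)) i \<tau> = 0"
        using slice_pair_tangent_iff[OF M M' emb f S(1) r] i \<tau> unfolding L_def by blast
    qed
    have admF: "\<forall>u\<in>z ` V. \<forall>i<?m'. \<forall>\<alpha>\<in>{1..n}. \<forall>\<beta>\<in>{1..n}. (\<Sum>j<?m'. partial_deriv j (F i (Vertex \<beta>)) u * F j (Vertex \<alpha>) u) =
        F i (Two (Upair \<alpha> \<beta>)) u + F i (Ladder \<alpha> \<beta>) u"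
    proof (intro ballI allI impI)
      fix u i \<alpha> \<beta> assume u: "u \<in> z ` V" and i: "i < ?m'" and \<alpha>: "\<alpha> \<in> {1..n}" and \<beta>: "\<beta> \<in> {1..n}"
      obtain q where q: "q \<in> V" "u = z q" using u by blast
      show "(\<Sum>j<?m'. partial_deriv j (F i (Vertex \<beta>)) u * F j (Vertex \<alpha>) u) =
        F i (Two (Upair \<alpha> \<beta>)) u + F i (Ladder \<alpha> \<beta>) u"
        using admissible_in_chart[OF M' f adm d q(1) i \<alpha> \<beta>] zinv[OF q(1)] by (simp add: F_def[abs_def] q(2))
    qed
    have yW: "\<forall>t. a \<le> t \<and> t \<le> b \<longrightarrow> y t \<in> z ` V" using YV by (simp add: y_def)
    have ycont: "continuous_on {a..b} (\<lambda>t. y t i)" for i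
    proof -
      have "continuous_map (top_of_set {a..b}) (mtop M') Y"
        by (rule continuous_map_from_subtopology_mono[OF Ycont]) (use Sa ab in auto)
      then have "continuous_map (top_of_set {a..b}) (subtopology (mtop M') V) Y"
        using YV by (simp add: continuous_map_in_subtopology image_subset_iff Pi_iff)
      from continuous_map_compose[OF this chart_continuous_map[OF M' d]]
      have "continuous_map (top_of_set {a..b}) (top_of_set {x. \<forall>i\<ge>?m'. x i = 0}) y"
        unfolding Euclidean_space_eq by (simp add: y_def[abs_def] comp_def)
      then have "continuous_on {a..b} y" by (simp add: continuous_map_in_subtopology)
      then show ?thesis by (rule continuous_on_product_then_coordinatewise)
    qed
    have ya: "\<forall>i\<in>L. y a i = 0" using SD(3)[OF S(3)] S(2) r0(2) by (auto simp: L_def y_def)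
    have expn: "\<exists>C>0. \<forall>i<?m'. \<forall>s t. a \<le> s \<and> s \<le> t \<and> t \<le> b \<longrightarrow>
      \<bar>y t i - y s i - (\<Sum>\<tau>\<in>forests n. 1 / symmetry_factor \<tau> * F i \<tau> (y s) * X \<tau> s t)\<bar> \<le> C * \<omega> s t powr (3 / p)"
    proof -
      have "Y ` {a..b} \<subseteq> V" using YV by auto
      from integral_curve_expansion[OF Y d Sa less_imp_le[OF ab(1)] ab(2) this]
      obtain C where C: "0 < C" "\<forall>i<?m'. \<forall>s t. a \<le> s \<and> s \<le> t \<and> t \<le> b \<longrightarrow>
            \<bar>z (Y t) i - z (Y s) i -
              (\<Sum>\<tau>\<in>forests n. 1 / symmetry_factor \<tau> * fiber_coords n M' (V, z) (f (Y s)) i \<tau> * X \<tau> s t)\<bar>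
            \<le> C * \<omega> s t powr (3 / p)"
        .
      have "F i \<tau> (y s) = fiber_coords n M' (V, z) (f (Y s)) i \<tau>" if "a \<le> s" "s \<le> b" for i \<tau> s
        using zinv[OF YV[OF that]] by (simp add: F_def y_def)
      then show ?thesis using C by (intro exI[of _ C]) (simp add: y_def)
    qed
    obtain b' where b': "a < b'" "b' \<le> b" "\<forall>t\<in>{a..b'}. \<forall>i\<in>L. y t i = 0"
      by (rule rough_stays_in_slice[OF zV F L van admF ab(1) p control_function_subinterval[OF \<omega> Sa ab(2)]
          branched_rough_path_subinterval[OF X Sa ab(2)] yW ycont ya expn])
    have after: "Y t \<in> K" if "a \<le> t" "t \<le> b'" for t
    proof -
      have "Y t \<in> \<phi> ` U" using SD(3)[OF YV[of t]] b' that by (simp add: L_def y_def)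
      then show ?thesis using chart_subset_topspace[OF M c] by (auto simp: K_def)
    qed
    have "b' \<in> E"
      unfolding E_def
    proof (intro CollectI conjI ballI)
      show "b' \<in> {S..T}" using Sa b' ab by simp
      fix s assume "s \<in> {S..b'}"
      then show "Y s \<in> K" using after[of s] before[of s] by (cases "a \<le> s") auto
    qed
    then have "b' \<le> a" unfolding a_def by (rule cSup_upper[OF _ bdd])
    then show False using b'(1) by simp
  qed
  then show ?thesis using aE t by (simp add: E_def K_def)
qed

lemma not_tree_cases:
  assumes "\<tau> \<in> forests n" "\<not> is_tree \<tau>"
  obtains \<alpha> \<beta> where "\<tau> = Two (Upair \<alpha> \<beta>)" "\<alpha> \<in> {1..n}" "\<beta> \<in> {1..n}"
  using assms(1)
proof (cases rule: forests_cases)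
  case (Two \<alpha> \<beta>)
  then show ?thesis by (rule that)
qed (use assms(2) in \<open>simp_all add: is_tree_def\<close>)

text \<open>At a tree the field component is the initial velocity of a curve confined to the slice.
  At a product, where the driver cannot be prescribed, admissibility expresses the component through
  a derivative of a vertex component and a ladder component.\<close>

lemma invariant_imp_tangent:
  assumes M': "smooth_manifold M'" and f: "rough_velocity_field n M' f" and adm: "admissible n M' f"
    and M: "smooth_manifold M" and emb: "properly_embedded M M' \<phi>"
    and inv: "\<And>S T p \<omega> X Y t. S \<le> T \<Longrightarrow> 1 \<le> p \<Longrightarrow> p < 3 \<Longrightarrow> control_function S T \<omega> \<Longrightarrow> branched_rough_path n S T p \<omega> X \<Longrightarrow>
       integral_curve n M' f S T p \<omega> X Y \<Longrightarrow> Y S \<in> \<phi> ` topspace (mtop M) \<Longrightarrow> t \<in> {S..T} \<Longrightarrow> Y t \<in> \<phi> ` topspace (mtop M)"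
    and r: "r \<in> topspace (mtop M)"
  shows "f (\<phi> r) \<in> bundle_map n M M' \<phi> ` rough_bundle n M"
proof -
  let ?m = "mdim M" and ?m' = "mdim M'"
  obtain U x V z \<iota> where S: "slice_pair M M' \<phi> (U, x) (V, z) \<iota>" "r \<in> U" "\<phi> r \<in> V"
    by (rule slice_pair_exists[OF M M' emb r])
  note SD = slice_pairD[OF S(1)]
  note c = SD(1) and d = SD(2)
  define L where "L = {..<?m'} - \<iota> ` {..<?m}"
  \<comment> \<open>Claimed at all points of the slice in the chart, since the tangential
    derivatives of the vertex components are needed below.\<close>
  have tree: "fiber_coords n M' (V, z) (f (\<phi> r)) i \<tau> = 0"
    if r: "r \<in> U" "\<phi> r \<in> V" and i: "i \<in> L" and \<tau>: "\<tau> \<in> forests n" "is_tree \<tau>" for r i \<tau>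
  proof -
    obtain \<delta> Y where Y: "0 < \<delta>" "\<delta> \<le> 1" "Y 0 = \<phi> r" "\<forall>t\<in>{0..\<delta>}. Y t \<in> V"
      "integral_curve n M' f 0 \<delta> 2 (\<lambda>s t. t - s) (tree_driver \<tau>) Y"
      "\<forall>i<?m'. ((\<lambda>t. z (Y t) i) has_real_derivative fiber_coords n M' (V, z) (f (\<phi> r)) i \<tau>) (at 0 within {0..\<delta>})"
      by (rule tree_driven_curve[OF M' f d r(2) \<tau>])
    have brp: "branched_rough_path n 0 \<delta> 2 (\<lambda>s t. t - s) (tree_driver \<tau>)"
      by (rule tree_driver_rough_path[OF \<tau>(2)]) (use Y(2) in simp)
    have Y0: "Y 0 \<in> \<phi> ` topspace (mtop M)" using Y(3) r(1) chart_subset_topspace[OF M c] by auto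
    have "z (Y t) i = 0" if t: "t \<in> {0..\<delta>}" for t
    proof -
      have "Y t \<in> \<phi> ` topspace (mtop M)"
        by (rule inv[OF _ _ _ control_function_length brp Y(5) Y0 t]) (use Y(1) in auto)
      then have "Y t \<in> \<phi> ` U" using SD(4) Y(4) t by blast
      then show ?thesis using SD(3) Y(4) t i unfolding L_def by blast
    qed
    then have zero: "((\<lambda>t. z (Y t) i) has_real_derivative 0) (at 0 within {0..\<delta>})"
      by (intro has_field_derivative_transform_within[OF DERIV_const[of 0] zero_less_one]) (use Y(1) in auto)
    have "i < ?m'" using i by (simp add: L_def)
    then have deriv: "((\<lambda>t. z (Y t) i) has_real_derivative fiber_coords n M' (V, z) (f (\<phi> r)) i \<tau>) (at 0 within {0..\<delta>})" using Y(6) by blast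
    \<comment> \<open>The interval is non-degenerate, so the one-sided derivative at its left end is
      unique.\<close>
    have "at 0 within {0..\<delta>} \<noteq> bot" using Y(1) by (simp add: at_within_Icc_at_right)
    then show ?thesis
      using deriv zero unfolding has_real_derivative_iff_has_vector_derivative
      by (rule vector_derivative_unique_within)
  qed
  have "fiber_coords n M' (V, z) (f (\<phi> r)) i \<tau> = 0" if i: "i \<in> L" and \<tau>: "\<tau> \<in> forests n" for i \<tau>
  proof (cases "is_tree \<tau>")
    case True
    then show ?thesis by (rule tree[OF S(2,3) i \<tau>])
  next
    case False
    obtain \<alpha> \<beta> where ab: "\<tau> = Two (Upair \<alpha> \<beta>)" "\<alpha> \<in> {1..n}" "\<beta> \<in> {1..n}"
      by (rule not_tree_cases[OF \<tau> False])
    have i': "i < ?m'" using i by (simp add: L_def)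
    define F where "F u = fiber_coords n M' (V, z) (f (inv_into V z u)) i (Vertex \<beta>)" for u
    have trees: "is_tree (Vertex \<gamma>)" "is_tree (Ladder \<gamma> \<beta>)" for \<gamma> by (simp_all add: is_tree_def)
    have "vanishes_on_slice L (z ` V) F"
      unfolding L_def F_def[abs_def]
      by (rule vanishes_on_slice_pair[OF M' S(1)], rule tree) (use i ab trees in \<open>simp_all\<close>)
    then have vd: "vanishes_on_slice L (z ` V) (partial_deriv j F)" if "j < ?m'" "j \<notin> L" for j
      using vanishes_on_slice_partial_deriv[OF chart_coordinate_chart(2)[OF M' d]] that by blast
    have "z (\<phi> r) \<in> z ` V" "\<forall>i\<in>L. z (\<phi> r) i = 0" using SD(3)[OF S(3)] S(2,3) by (auto simp: L_def)
    then have dz: "partial_deriv j F (z (\<phi> r)) = 0" if "j < ?m'" "j \<notin> L" for j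
      using vd[OF that] unfolding vanishes_on_slice_def by blast
    \<comment> \<open>Each summand has a vanishing factor: for tangential \<open>j\<close> the
      derivative of a function that is zero on the slice, for normal \<open>j\<close> the vertex
      component of the field.\<close>
    have "(\<Sum>j<?m'. partial_deriv j F (z (\<phi> r)) * fiber_coords n M' (V, z) (f (\<phi> r)) j (Vertex \<alpha>)) = 0"
    proof (intro sum.neutral ballI)
      fix j assume "j \<in> {..<?m'}"
      then show "partial_deriv j F (z (\<phi> r)) * fiber_coords n M' (V, z) (f (\<phi> r)) j (Vertex \<alpha>) = 0"
        using dz[of j] tree[OF S(2,3), of j "Vertex \<alpha>"] ab(2) trees by (cases "j \<in> L") simp_all
    qed
    moreover have "fiber_coords n M' (V, z) (f (\<phi> r)) i (Ladder \<alpha> \<beta>) = 0"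
      by (rule tree[OF S(2,3) i _ trees(2)]) (use ab in simp)
    ultimately show ?thesis
      using admissible_in_chart[OF M' f adm d S(3) i' ab(2,3)] by (simp add: F_def[abs_def] ab(1))
  qed
  then show ?thesis
    using slice_pair_tangent_iff[OF M M' emb f S(1) S(2,3)] unfolding L_def by blast
qed

theorem theorem5p1:
  fixes n :: nat and M' :: "'b manifold" and f :: "'b \<Rightarrow> 'b bundle_point"
    and M :: "'a manifold" and \<phi> :: "'a \<Rightarrow> 'b"
  assumes "smooth_manifold M'"
    and "rough_velocity_field n M' f" and "admissible n M' f"
    and "smooth_manifold M" and "properly_embedded M M' \<phi>"
  shows "(f \<circ> \<phi>) ` topspace (mtop M) \<subseteq> bundle_map n M M' \<phi> ` rough_bundle n M \<longleftrightarrow>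
    (\<forall>S T p \<omega> X Y.
       S \<le> T \<and> 1 \<le> p \<and> p < 3 \<and> control_function S T \<omega> \<and> branched_rough_path n S T p \<omega> X \<and>
       integral_curve n M' f S T p \<omega> X Y \<and> Y S \<in> \<phi> ` topspace (mtop M) \<longrightarrow>
       (\<forall>t\<in>{S..T}. Y t \<in> \<phi> ` topspace (mtop M)))"
    (is "?tangent \<longleftrightarrow> ?invariant")
proof
  assume tan: ?tangent
  show ?invariant
  proof (intro allI impI ballI, elim conjE)
    fix S T p \<omega> X Y t
    assume "S \<le> T" "1 \<le> p" "p < 3" "control_function S T \<omega>" "branched_rough_path n S T p \<omega> X"
      "integral_curve n M' f S T p \<omega> X Y" "Y S \<in> \<phi> ` topspace (mtop M)" "t \<in> {S..T}"
    then show "Y t \<in> \<phi> ` topspace (mtop M)" by (rule tangent_imp_invariant[OF assms tan])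
  qed
next
  assume inv: ?invariant
  show ?tangent
  proof (intro image_subsetI)
    fix r assume r: "r \<in> topspace (mtop M)"
    have "f (\<phi> r) \<in> bundle_map n M M' \<phi> ` rough_bundle n M"
    proof (rule invariant_imp_tangent[OF assms _ r])
      fix S T p \<omega> X Y t
      assume "S \<le> T" "1 \<le> p" "p < 3" "control_function S T \<omega>" "branched_rough_path n S T p \<omega> X"
        "integral_curve n M' f S T p \<omega> X Y" "Y S \<in> \<phi> ` topspace (mtop M)" and t: "t \<in> {S..T}"
      then have "S \<le> T \<and> 1 \<le> p \<and> p < 3 \<and> control_function S T \<omega> \<and> branched_rough_path n S T p \<omega> X \<and>
         integral_curve n M' f S T p \<omega> X Y \<and> Y S \<in> \<phi> ` topspace (mtop M)"
        by (intro conjI)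
      from inv[rule_format, OF this t] show "Y t \<in> \<phi> ` topspace (mtop M)" .
    qed
    then show "(f \<circ> \<phi>) r \<in> bundle_map n M M' \<phi> ` rough_bundle n M" by simp
  qed
qed

end
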